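(* Let $\Omega\subseteq\mathbb{R}^3$ be a domain, $T>0$, and let $(u,P)$ be a suitable weak solution to the Navier-Stokes equations on $[0,T]\times\Omega$ with $\|u\|_{L^{2,\infty}([0,T];BMO(\Omega))}=M<\infty$. For $z=(t,x)$ and $r>0$ put $$G(r,z)=\sup_{t-r^2\le s<t}\frac1r\int_{B_r(x)}|u(s,y)|^2dy+\frac1r\iint_{Q_r(z)}|\nabla u|^2+\frac1{r^2}\iint_{Q_r(z)}|u|^3+\frac1{r^2}\iint_{Q_r(z)}|P|^{3/2}.$$ Then: (i) $G(r,z)\le C(\rho,M)$ whenever $Q_{2r}(z)\subset Q_\rho(z)\subset(0,T]\times\Omega$, where $C(\rho,M)$ is a positive constant depending on $\rho$ and $M$. (ii) In particular, for fixed $z\in(0,T]\times\Omega$ there exists a constant $r_0>0$ depending on $d_z=\mathrm{dist}(z,\partial([0,T]\times\Omega))$ such that if $r<r_0$ then $G(r,z)\le C(M)$, where $C(M)$ is a positive constant depending on $M$. (iii) Moreover, the energy measure $\mathcal{E}$ of $u$ at time $T$ satisfies $d(x,\mathcal{E})\ge1$ (for $x\in\Omega$) and $D\ge1$.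
   Context: Navier-Stokes equations on a domain $\Omega\subseteq\mathbb{R}^3$: $\partial_tu-\Delta u+u\cdot\nabla u+\nabla P=0$, $\nabla\cdot u=0$, $u|_{\partial\Omega}=0$, $u(0,x)=u_0(x)$. A Leray-Hopf weak solution on $[0,T]\times\Omega$ is $u\in L^\infty(0,T;L^2(\Omega))\cap L^2(0,T;H^1(\Omega))$ such that for some distribution $P$ the pair $(u,P)$ satisfies the equations in the sense of distributions and, for a.e. $t_0\in[0,t]$ including $t_0=0$, $\int_\Omega|u(t,x)|^2dx+2\int_{t_0}^t\int_\Omega|\nabla u|^2dxd\tau\le\int_\Omega|u(t_0,x)|^2dx$. The pair $(u,P)$ is a suitable weak solution if in addition $u\in L^3([0,T];L^3(\Omega))$, $P\in L^{3/2}([0,T]\times\Omega)$ and $$\int_\Omega|u(t,x)|^2\phi\,dx+2\int_0^t\int_\Omega|\nabla u|^2\phi\,dxd\tau\le\int_0^t\int_\Omega|u|^2(\partial_t\phi+\Delta\phi)+(|u|^2+2P)u\cdot\nabla\phi\,dxd\tau$$ for every nonnegative $\phi\in C_0^\infty((0,T]\times\Omega)$. $B_r(x)$ is the open ball; for $z=(t,x)$, $Q_r(z)=\{(s,y):t-r^2<s<t,\ |y-x|<r\}$. $\|f\|_{BMO(\Omega)}$ is the supremum over balls $B\subset\Omega$ of $\frac1{|B|}\int_B|f-[f]_B|dx$, $[f]_B$ being the average of $f$ over $B$. $\|u\|_{L^{2,\infty}([0,T];BMO(\Omega))}=\sup_{\sigma>0}\sigma|\{t\in[0,T]:\|u(t,\cdot)\|_{BMO(\Omega)}>\sigma\}|^{1/2}$.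 Energy measure: $\mathcal{E}$ is a Radon measure on $\Omega$ which is the weak-$*$ limit of $|u(t_k)|^2dx$ for some sequence $t_k\to T^-$. Lower local dimension: $d(x,\mathcal{E})=\liminf_{r\to0^+}\frac{\ln\mathcal{E}(B_r(x))}{\ln r}$. Concentration dimension: $D=\inf\{\dim_{\mathcal H}(S):S\subset\Omega\text{ compact},\ \mathcal{E}(S)>0\}$, with $D=3$ if this collection is empty.
   Formalization: C in (i) and r_0 in (ii) may also depend on the initial energy plus the integral of |P|^{3/2} (r_0 also on M): u=0 with a large constant P refutes constants in rho, M, d_z alone. In d_z the final-time face {T} x Omega is not counted as boundary. *)

theory Defs
  imports "HOL-Analysis.Analysis"
begin

section \<open>Smooth functions, test functions and distributions\<close>

definition partial :: "'a::euclidean_space \<Rightarrow> ('a \<Rightarrow> real) \<Rightarrow> 'a \<Rightarrow> real" where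
  "partial v f x = frechet_derivative f (at x) v"

primrec iter_partial :: "'a::euclidean_space list \<Rightarrow> ('a \<Rightarrow> real) \<Rightarrow> 'a \<Rightarrow> real" where
  "iter_partial [] f = f"
| "iter_partial (v # vs) f = partial v (iter_partial vs f)"

definition smooth :: "('a::euclidean_space \<Rightarrow> real) \<Rightarrow> bool" where
  "smooth f \<longleftrightarrow> (\<forall>vs. set vs \<subseteq> Basis \<longrightarrow> (\<forall>x. iter_partial vs f differentiable (at x)))"

definition support :: "('a::topological_space \<Rightarrow> real) \<Rightarrow> 'a set" where
  "support f = closure {x. f x \<noteq> 0}"

text \<open>\<open>C_c\<^sup>\<infinity>(U)\<close> for open \<open>U\<close>; the functions are extended by zero to the whole space.\<close>

definition test_fun :: "'a::euclidean_space set \<Rightarrow> ('a \<Rightarrow> real) set" where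
  "test_fun U = {\<phi>. smooth \<phi> \<and> compact (support \<phi>) \<and> support \<phi> \<subseteq> U}"

text \<open>Continuity is expressed by the usual seminorm estimate on each compact set: \<open>B\<close> ranges
  over the bounds for the derivatives of order at most \<open>N\<close>.\<close>

definition distribution_on :: "'a::euclidean_space set \<Rightarrow> (('a \<Rightarrow> real) \<Rightarrow> real) \<Rightarrow> bool" where
  "distribution_on U \<Lambda> \<longleftrightarrow>
     (\<forall>\<phi>\<in>test_fun U. \<forall>\<psi>\<in>test_fun U. \<forall>a b.
        \<Lambda> (\<lambda>z. a * \<phi> z + b * \<psi> z) = a * \<Lambda> \<phi> + b * \<Lambda> \<psi>) \<and>
     (\<forall>K. compact K \<and> K \<subseteq> U \<longrightarrow>
        (\<exists>C N. \<forall>\<phi>\<in>test_fun U. support \<phi> \<subseteq> K \<longrightarrow>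
           (\<forall>B. (\<forall>vs z. set vs \<subseteq> Basis \<and> length vs \<le> N \<longrightarrow> \<bar>iter_partial vs \<phi> z\<bar> \<le> B)
                  \<longrightarrow> \<bar>\<Lambda> \<phi>\<bar> \<le> C * B)))"

abbreviation dt :: "(real \<times> (real^3) \<Rightarrow> real) \<Rightarrow> real \<times> (real^3) \<Rightarrow> real" where
  "dt \<equiv> partial (1, 0)"

abbreviation dx :: "3 \<Rightarrow> (real \<times> (real^3) \<Rightarrow> real) \<Rightarrow> real \<times> (real^3) \<Rightarrow> real" where
  "dx j \<equiv> partial (0, axis j 1)"

definition laplace :: "(real \<times> (real^3) \<Rightarrow> real) \<Rightarrow> real \<times> (real^3) \<Rightarrow> real" where
  "laplace \<phi> z = (\<Sum>j\<in>UNIV. dx j (dx j \<phi>) z)"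


section \<open>Weak gradients and Sobolev spaces\<close>

definition domain3 :: "(real^3) set \<Rightarrow> bool" where
  "domain3 \<Omega> \<longleftrightarrow> open \<Omega> \<and> connected \<Omega> \<and> \<Omega> \<noteq> {}"

definition locally_integrable ::
    "(real^3) set \<Rightarrow> (real^3 \<Rightarrow> 'b::{banach, second_countable_topology}) \<Rightarrow> bool" where
  "locally_integrable \<Omega> f \<longleftrightarrow> (\<forall>K. compact K \<and> K \<subseteq> \<Omega> \<longrightarrow> set_integrable lebesgue K f)"

text \<open>\<open>g x $ i $ j\<close> is the weak derivative of \<open>f\<^sub>i\<close> in direction \<open>j\<close>; the norm of \<open>real^3^3\<close> is the
  Frobenius norm.\<close>

definition weak_gradient ::
    "(real^3) set \<Rightarrow> (real^3 \<Rightarrow> real^3) \<Rightarrow> (real^3 \<Rightarrow> real^3^3) \<Rightarrow> bool" where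
  "weak_gradient \<Omega> f g \<longleftrightarrow> locally_integrable \<Omega> f \<and> locally_integrable \<Omega> g \<and>
     (\<forall>\<phi>\<in>test_fun \<Omega>. \<forall>i j.
        (LINT x:\<Omega>|lebesgue. f x $ i * partial (axis j 1) \<phi> x) =
        - (LINT x:\<Omega>|lebesgue. g x $ i $ j * \<phi> x))"

definition sq_norm :: "'a::euclidean_space set \<Rightarrow> ('a \<Rightarrow> 'b::real_normed_vector) \<Rightarrow> ennreal" where
  "sq_norm A f = (\<integral>\<^sup>+x\<in>A. ennreal ((norm (f x))\<^sup>2) \<partial>lebesgue)"

text \<open>\<open>H\<^sub>0\<^sup>1(\<Omega>)\<close>, the closure of the test fields in the \<open>H\<^sup>1\<close> norm.\<close>

definition H10 :: "(real^3) set \<Rightarrow> (real^3 \<Rightarrow> real^3) \<Rightarrow> bool" where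
  "H10 \<Omega> f \<longleftrightarrow> (\<exists>g. weak_gradient \<Omega> f g \<and>
     (\<exists>w :: nat \<Rightarrow> real^3 \<Rightarrow> real^3.
        (\<forall>k i. (\<lambda>x. w k x $ i) \<in> test_fun \<Omega>) \<and>
        (\<lambda>k. sq_norm \<Omega> (\<lambda>x. f x - w k x)) \<longlonglongrightarrow> 0 \<and>
        (\<lambda>k. sq_norm \<Omega>
           (\<lambda>x. g x - (\<chi> i j. partial (axis j 1) (\<lambda>y. w k y $ i) x))) \<longlonglongrightarrow> 0))"

definition spatial_gradient ::
    "real \<Rightarrow> (real^3) set \<Rightarrow> (real \<Rightarrow> real^3 \<Rightarrow> real^3) \<Rightarrow> (real \<Rightarrow> real^3 \<Rightarrow> real^3^3) \<Rightarrow> bool" where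
  "spatial_gradient T \<Omega> u g \<longleftrightarrow>
     (\<lambda>z. g (fst z) (snd z)) \<in> borel_measurable (lebesgue_on ({0..T} \<times> \<Omega>)) \<and>
     (AE t in lebesgue_on {0..T}. weak_gradient \<Omega> (u t) (g t))"

text \<open>A version of \<open>\<nabla>u\<close>; it is determined up to null sets.\<close>

definition grad :: "real \<Rightarrow> (real^3) set \<Rightarrow> (real \<Rightarrow> real^3 \<Rightarrow> real^3) \<Rightarrow> real \<Rightarrow> real^3 \<Rightarrow> real^3^3" where
  "grad T \<Omega> u = (SOME g. spatial_gradient T \<Omega> u g)"


section \<open>Leray-Hopf and suitable weak solutions\<close>

text \<open>The energy inequality, the energy measure and the supremum over times below all refer to
  \<open>u(t,\<cdot>)\<close> at individual times, so \<open>u\<close> is a function with \<open>u(t,\<cdot>) \<in> L\<^sup>2(\<Omega>)\<close> for every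
  \<open>t \<in> [0,T]\<close>, not a class modulo null sets of times.\<close>

definition energy_class :: "real \<Rightarrow> (real^3) set \<Rightarrow> (real \<Rightarrow> real^3 \<Rightarrow> real^3) \<Rightarrow> bool" where
  "energy_class T \<Omega> u \<longleftrightarrow>
     (\<lambda>z. u (fst z) (snd z)) \<in> borel_measurable (lebesgue_on ({0..T} \<times> \<Omega>)) \<and>
     (\<forall>t\<in>{0..T}. u t \<in> borel_measurable (lebesgue_on \<Omega>) \<and> sq_norm \<Omega> (u t) < \<infinity>) \<and>
     (\<exists>K. AE t in lebesgue_on {0..T}. sq_norm \<Omega> (u t) \<le> ennreal K) \<and>
     (\<exists>g. spatial_gradient T \<Omega> u g) \<and>
     sq_norm ({0..T} \<times> \<Omega>) (\<lambda>z. u (fst z) (snd z)) < \<infinity> \<and>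
     sq_norm ({0..T} \<times> \<Omega>) (\<lambda>z. grad T \<Omega> u (fst z) (snd z)) < \<infinity>"

text \<open>The integrand of the velocity terms of the \<open>i\<close>-th momentum equation, tested against \<open>\<phi>\<close>.
  As \<open>div u = 0\<close>, the nonlinearity is \<open>div (u \<otimes> u)\<close>.\<close>

definition momentum_integrand ::
    "(real \<Rightarrow> real^3 \<Rightarrow> real^3) \<Rightarrow> 3 \<Rightarrow> (real \<times> (real^3) \<Rightarrow> real) \<Rightarrow> real \<times> (real^3) \<Rightarrow> real" where
  "momentum_integrand u i \<phi> z =
     (let v = u (fst z) (snd z)
      in v $ i * dt \<phi> z + v $ i * laplace \<phi> z + (\<Sum>j\<in>UNIV. v $ i * v $ j * dx j \<phi> z))"

text \<open>The equations in the sense of distributions, with pressure the distribution \<open>\<Lambda>\<close>. The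
  boundary condition says that \<open>u(t) \<in> H\<^sub>0\<^sup>1(\<Omega>)\<close> for almost all \<open>t\<close>. The initial condition is the
  weak formulation with datum \<open>u(0,\<cdot>)\<close>; since \<open>\<Lambda>\<close> only acts on functions supported in positive
  times, the test fields that may be nonzero at time 0 are divergence free.\<close>

definition solves_NSE ::
    "real \<Rightarrow> (real^3) set \<Rightarrow> (real \<Rightarrow> real^3 \<Rightarrow> real^3) \<Rightarrow> ((real \<times> (real^3) \<Rightarrow> real) \<Rightarrow> real) \<Rightarrow> bool" where
  "solves_NSE T \<Omega> u \<Lambda> \<longleftrightarrow>
     (\<forall>\<phi>\<in>test_fun ({0<..<T} \<times> \<Omega>). \<forall>i.
        (LINT z:{0..T}\<times>\<Omega>|lebesgue. momentum_integrand u i \<phi> z) + \<Lambda> (dx i \<phi>) = 0) \<and>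
     (\<forall>\<phi>\<in>test_fun ({0<..<T} \<times> \<Omega>).
        (LINT z:{0..T}\<times>\<Omega>|lebesgue. (\<Sum>j\<in>UNIV. u (fst z) (snd z) $ j * dx j \<phi> z)) = 0) \<and>
     (AE t in lebesgue_on {0..T}. H10 \<Omega> (u t)) \<and>
     (\<forall>\<Phi> :: 3 \<Rightarrow> real \<times> (real^3) \<Rightarrow> real.
        (\<forall>i. \<Phi> i \<in> test_fun ({..<T} \<times> \<Omega>)) \<and> (\<forall>z. (\<Sum>i\<in>UNIV. dx i (\<Phi> i) z) = 0) \<longrightarrow>
        (LINT z:{0..T}\<times>\<Omega>|lebesgue. (\<Sum>i\<in>UNIV. momentum_integrand u i (\<Phi> i) z)) +
        (LINT x:\<Omega>|lebesgue. (\<Sum>i\<in>UNIV. u 0 x $ i * \<Phi> i (0, x))) = 0)"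

definition energy_inequality ::
    "real \<Rightarrow> (real^3) set \<Rightarrow> (real \<Rightarrow> real^3 \<Rightarrow> real^3) \<Rightarrow> real \<Rightarrow> real \<Rightarrow> bool" where
  "energy_inequality T \<Omega> u t0 t \<longleftrightarrow>
     sq_norm \<Omega> (u t) + 2 * sq_norm ({t0..t} \<times> \<Omega>) (\<lambda>z. grad T \<Omega> u (fst z) (snd z))
       \<le> sq_norm \<Omega> (u t0)"

definition leray_hopf ::
    "real \<Rightarrow> (real^3) set \<Rightarrow> (real \<Rightarrow> real^3 \<Rightarrow> real^3) \<Rightarrow> ((real \<times> (real^3) \<Rightarrow> real) \<Rightarrow> real) \<Rightarrow> bool" where
  "leray_hopf T \<Omega> u \<Lambda> \<longleftrightarrow>
     energy_class T \<Omega> u \<and> distribution_on ({0<..<T} \<times> \<Omega>) \<Lambda> \<and> solves_NSE T \<Omega> u \<Lambda> \<and>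
     (\<forall>t\<in>{0..T}. energy_inequality T \<Omega> u 0 t \<and>
        (AE t0 in lebesgue_on {0..t}. energy_inequality T \<Omega> u t0 t))"

text \<open>\<open>C_c\<^sup>\<infinity>((0,T] \<times> \<Omega>)\<close> consists of the restrictions of the test functions on \<open>(0,\<infinity>) \<times> \<Omega>\<close>.\<close>

definition local_energy_inequality ::
    "real \<Rightarrow> (real^3) set \<Rightarrow> (real \<Rightarrow> real^3 \<Rightarrow> real^3) \<Rightarrow> (real \<Rightarrow> real^3 \<Rightarrow> real) \<Rightarrow> bool" where
  "local_energy_inequality T \<Omega> u P \<longleftrightarrow>
     (\<forall>\<phi>\<in>test_fun ({0<..} \<times> \<Omega>). (\<forall>z. 0 \<le> \<phi> z) \<longrightarrow>
        (\<forall>t\<in>{0..T}.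
           (LINT x:\<Omega>|lebesgue. (norm (u t x))\<^sup>2 * \<phi> (t, x)) +
           2 * (LINT z:{0..t}\<times>\<Omega>|lebesgue. (norm (grad T \<Omega> u (fst z) (snd z)))\<^sup>2 * \<phi> z)
           \<le> (LINT z:{0..t}\<times>\<Omega>|lebesgue.
                (norm (u (fst z) (snd z)))\<^sup>2 * (dt \<phi> z + laplace \<phi> z) +
                ((norm (u (fst z) (snd z)))\<^sup>2 + 2 * P (fst z) (snd z)) *
                  (\<Sum>j\<in>UNIV. u (fst z) (snd z) $ j * dx j \<phi> z))))"

definition suitable_weak_solution ::
    "real \<Rightarrow> (real^3) set \<Rightarrow> (real \<Rightarrow> real^3 \<Rightarrow> real^3) \<Rightarrow> (real \<Rightarrow> real^3 \<Rightarrow> real) \<Rightarrow> bool" where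
  "suitable_weak_solution T \<Omega> u P \<longleftrightarrow>
     leray_hopf T \<Omega> u (\<lambda>\<phi>. LINT z:{0..T}\<times>\<Omega>|lebesgue. P (fst z) (snd z) * \<phi> z) \<and>
     (\<integral>\<^sup>+z\<in>{0..T}\<times>\<Omega>. ennreal (norm (u (fst z) (snd z)) ^ 3) \<partial>lebesgue) < \<infinity> \<and>
     (\<lambda>z. P (fst z) (snd z)) \<in> borel_measurable (lebesgue_on ({0..T} \<times> \<Omega>)) \<and>
     (\<integral>\<^sup>+z\<in>{0..T}\<times>\<Omega>. ennreal (\<bar>P (fst z) (snd z)\<bar> powr (3/2)) \<partial>lebesgue) < \<infinity> \<and>
     local_energy_inequality T \<Omega> u P"


section \<open>BMO and weak \<open>L\<^sup>2\<close> in time\<close>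

definition average :: "(real^3) set \<Rightarrow> (real^3 \<Rightarrow> real^3) \<Rightarrow> real^3" where
  "average B f = (LINT x:B|lebesgue. f x) /\<^sub>R measure lebesgue B"

definition bmo_norm :: "(real^3) set \<Rightarrow> (real^3 \<Rightarrow> real^3) \<Rightarrow> ennreal" where
  "bmo_norm \<Omega> f = (SUP B\<in>{ball a r |a r. 0 < r \<and> ball a r \<subseteq> \<Omega>}.
     (\<integral>\<^sup>+x\<in>B. ennreal (norm (f x - average B f)) \<partial>lebesgue) / emeasure lebesgue B)"

definition weakL2_bmo_norm :: "real \<Rightarrow> (real^3) set \<Rightarrow> (real \<Rightarrow> real^3 \<Rightarrow> real^3) \<Rightarrow> ennreal" where
  "weakL2_bmo_norm T \<Omega> u = (SUP \<sigma>\<in>{0<..}.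
     ennreal (\<sigma> * sqrt (measure lebesgue {t\<in>{0..T}. bmo_norm \<Omega> (u t) > ennreal \<sigma>})))"


section \<open>Scale-invariant quantities\<close>

definition pcyl :: "real \<Rightarrow> real \<times> (real^3) \<Rightarrow> (real \<times> (real^3)) set" where
  "pcyl r z = {fst z - r\<^sup>2<..<fst z} \<times> ball (snd z) r"

definition G_quant ::
    "real \<Rightarrow> (real^3) set \<Rightarrow> (real \<Rightarrow> real^3 \<Rightarrow> real^3) \<Rightarrow> (real \<Rightarrow> real^3 \<Rightarrow> real) \<Rightarrow>
     real \<Rightarrow> real \<times> (real^3) \<Rightarrow> ennreal" where
  "G_quant T \<Omega> u P r z =
     (SUP s\<in>{fst z - r\<^sup>2..<fst z}. ennreal (1 / r) * sq_norm (ball (snd z) r) (u s)) +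
     ennreal (1 / r) * sq_norm (pcyl r z) (\<lambda>w. grad T \<Omega> u (fst w) (snd w)) +
     ennreal (1 / r\<^sup>2) * (\<integral>\<^sup>+w\<in>pcyl r z. ennreal (norm (u (fst w) (snd w)) ^ 3) \<partial>lebesgue) +
     ennreal (1 / r\<^sup>2) * (\<integral>\<^sup>+w\<in>pcyl r z. ennreal (\<bar>P (fst w) (snd w)\<bar> powr (3/2)) \<partial>lebesgue)"

text \<open>The size of the data of a suitable weak solution: its initial energy plus
  \<open>\<integral>\<integral> |P|\<^sup>3\<^sup>/\<^sup>2\<close>. Constants for \<open>G\<close> at a given positive scale must depend on it: if \<open>\<Omega>\<close> is bounded,
  \<open>u = 0\<close> with constant \<open>P\<close> is a suitable weak solution with vanishing BMO norm, but \<open>G\<close> grows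
  with \<open>P\<close>.\<close>

definition data_size ::
    "real \<Rightarrow> (real^3) set \<Rightarrow> (real \<Rightarrow> real^3 \<Rightarrow> real^3) \<Rightarrow> (real \<Rightarrow> real^3 \<Rightarrow> real) \<Rightarrow> real" where
  "data_size T \<Omega> u P = enn2real (sq_norm \<Omega> (u 0) +
     (\<integral>\<^sup>+z\<in>{0..T}\<times>\<Omega>. ennreal (\<bar>P (fst z) (snd z)\<bar> powr (3/2)) \<partial>lebesgue))"

text \<open>The distance of \<open>z\<close> to \<open>\<partial>([0,T] \<times> \<Omega>)\<close>. The boundary is taken relative to
  \<open>(-\<infinity>,T] \<times> \<real>\<^sup>3\<close>: points \<open>(T,x)\<close> with \<open>x \<in> \<Omega>\<close> count as interior, as they do in
  \<open>C_c\<^sup>\<infinity>((0,T] \<times> \<Omega>)\<close>.\<close>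

definition bdist :: "real \<Rightarrow> (real^3) set \<Rightarrow> real \<times> (real^3) \<Rightarrow> real" where
  "bdist T \<Omega> z = infdist z (top_of_set ({..T} \<times> UNIV) frontier_of ({0..T} \<times> \<Omega>))"


section \<open>Energy measures and dimensions\<close>

text \<open>On an open subset of \<open>\<real>\<^sup>3\<close> every Borel measure that is finite on compact sets is regular,
  hence Radon.\<close>

definition radon_measure_on :: "(real^3) set \<Rightarrow> (real^3) measure \<Rightarrow> bool" where
  "radon_measure_on \<Omega> \<E> \<longleftrightarrow> space \<E> = \<Omega> \<and> sets \<E> = sets (restrict_space borel \<Omega>) \<and>
     (\<forall>K. compact K \<and> K \<subseteq> \<Omega> \<longrightarrow> emeasure \<E> K < \<infinity>)"

definition energy_measure ::
    "real \<Rightarrow> (real^3) set \<Rightarrow> (real \<Rightarrow> real^3 \<Rightarrow> real^3) \<Rightarrow> (real^3) measure \<Rightarrow> bool" where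
  "energy_measure T \<Omega> u \<E> \<longleftrightarrow> radon_measure_on \<Omega> \<E> \<and>
     (\<exists>t :: nat \<Rightarrow> real. (\<forall>k. t k \<in> {0..<T}) \<and> t \<longlonglongrightarrow> T \<and>
        (\<forall>f :: real^3 \<Rightarrow> real. continuous_on UNIV f \<and> compact (support f) \<and> support f \<subseteq> \<Omega> \<longrightarrow>
           (\<lambda>k. LINT x:\<Omega>|lebesgue. f x * (norm (u (t k) x))\<^sup>2) \<longlonglongrightarrow> (LINT x|\<E>. f x)))"

text \<open>The logarithm with \<open>ln 0 = -\<infinity>\<close>, so that the lower local dimension is \<open>\<infinity>\<close> off the support
  of the measure.\<close>

definition eln :: "ennreal \<Rightarrow> ereal" where
  "eln a = (if a = 0 then -\<infinity> else if a = \<infinity> then \<infinity> else ereal (ln (enn2real a)))"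

definition lower_local_dim :: "(real^3) measure \<Rightarrow> real^3 \<Rightarrow> ereal" where
  "lower_local_dim \<E> x = Liminf (at_right 0) (\<lambda>r. eln (emeasure \<E> (ball x r)) / ereal (ln r))"

definition hausdorff_premeasure :: "real \<Rightarrow> real \<Rightarrow> 'a::metric_space set \<Rightarrow> ennreal" where
  "hausdorff_premeasure s \<delta> S =
     (INF U\<in>{U :: nat \<Rightarrow> 'a set. S \<subseteq> (\<Union>i. U i) \<and> (\<forall>i. bounded (U i) \<and> diameter (U i) \<le> \<delta>)}.
        (\<Sum>i. ennreal (diameter (U i) powr s)))"

definition hausdorff_measure :: "real \<Rightarrow> 'a::metric_space set \<Rightarrow> ennreal" where
  "hausdorff_measure s S = (SUP \<delta>\<in>{0<..}. hausdorff_premeasure s \<delta> S)"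

text \<open>Restricting to \<open>s > 0\<close> does not change the infimum and avoids the convention for \<open>0\<^sup>0\<close>.\<close>

definition hausdorff_dim :: "'a::metric_space set \<Rightarrow> ereal" where
  "hausdorff_dim S = (INF s\<in>{s. 0 < s \<and> hausdorff_measure s S = 0}. ereal s)"

definition concentration_dim :: "(real^3) set \<Rightarrow> (real^3) measure \<Rightarrow> ereal" where
  "concentration_dim \<Omega> \<E> =
     (let \<S> = {S. compact S \<and> S \<subseteq> \<Omega> \<and> 0 < emeasure \<E> S}
      in if \<S> = {} then 3 else (INF S\<in>\<S>. hausdorff_dim S))"

end

theory Submission
 imports Defs
begin

text \<open>
The hypothesis controls the BMO norm \<open>b(t)\<close> of the velocity only in weak \<open>L\<^sup>2\<close> in time, but this norm is
scale invariant, and it controls every moment of \<open>f = u - a(t)\<close>, where \<open>a(t)\<close> is the mean of \<open>u(t)\<close> over a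
cube of size \<open>r\<close> (\<open>John_Nirenberg\<close>). Interpolating between the energy and the tenth moment gives
\<open>\<integral> |f|\<^sup>4 <= C \<alpha>\<^sup>3\<^sup>/\<^sup>4 (1 + r b(t))\<^sup>5\<^sup>/\<^sup>2 / r\<close>, where \<open>\<alpha>\<close> is the scale-invariant energy. The power \<open>3/4\<close> of this
bound dominates \<open>\<integral> |f|\<^sup>3\<close>, and it contains \<open>b\<close> with an exponent below 2. So its integral over a time
interval of length \<open>r\<^sup>2\<close> is finite, and it is at most \<open>C (1 + M\<^sup>2) \<alpha>\<^sup>9\<^sup>/\<^sup>1\<^sup>6 r\<^sup>2\<close> (\<open>fourth_moment\<close>, \<open>Nu_integral\<close>). The point is that the energy enters
sublinearly.

Let \<open>Y(R)\<close> be \<open>R\<^sup>-\<^sup>2\<close> times the integral of \<open>|u|\<^sup>3 + |P|\<^sup>3\<^sup>/\<^sup>2\<close> over a cylinder of size \<open>R\<close>. On a cylinder smaller by the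
factor \<open>\<theta>\<close> the velocity is \<open>a(t)\<close>, whose cubic integral gains \<open>\<theta>\<^sup>3\<close> from the volume, plus \<open>f\<close>. For the
pressure, the divergence of the momentum equation is \<open>\<Delta>P = - \<partial>\<^sub>i\<partial>\<^sub>j(f\<^sub>i f\<^sub>j)\<close>, because subtracting a function of
time from a divergence free field does not change the right hand side. Pairing \<open>P\<close> with a test function \<open>h\<close>,
and inverting the Laplacian on \<open>h\<close> by a compactly supported parametrix, one meets the average of \<open>h\<close> at the
larger scale, which is small, and the Hessian of the potential in \<open>L\<^sup>2\<close>, which has the norm of the Laplacian
(\<open>laplace_parametrix\<close>, \<open>hessian_L2\<close>, \<open>pressure_dual\<close>). Integration by parts is thus all that is needed of
elliptic theory. Together (\<open>cylinder_decay\<close>): \<open>Y(\<theta>r) <= C \<theta> Y(2r) + C(\<theta>) (1 + M\<^sup>2) \<alpha>\<^sup>9\<^sup>/\<^sup>1\<^sup>6\<close>.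

The local energy inequality gives \<open>\<alpha> <= C (1 + Y)\<close> at twice the scale (\<open>local_energy\<close>). As \<open>9/16 < 1\<close>, Young's
inequality turns the two estimates into \<open>Y(\<theta>'R) <= Y(R)/2 + C(M)\<close> for a fixed \<open>\<theta>'\<close> (\<open>scale_step\<close>). Starting from a
crude bound by the data at the scale \<open>\<rho>/2\<close> (\<open>initial_scale\<close>), the iteration bounds \<open>Y\<close> at all smaller scales,
which is (i); after sufficiently many steps the data are forgotten, which is (ii). For (iii), part (i) at
the points \<open>(T, x)\<close> yields \<open>\<E>(B\<^sub>r(x)) <= C r\<close> locally uniformly in \<open>x\<close> (\<open>energy_measure_ball\<close>), from which both
dimension bounds follow, the second by the mass distribution principle (\<open>hausdorff_measure_pos\<close>).

A measure-theoretic preparation replaces the solution by Borel functions, and shows that \<open>b\<close> is measurable, by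
restricting the balls in the BMO norm to a countable family (\<open>bmo_norm_countable\<close>, \<open>flow_exists\<close>).
\<close>

section \<open>Calculus of smooth functions\<close>

lemma frechet_eqI: "(f has_derivative D) (at x) ==> partial v f x = D v"
 unfolding partial_def using frechet_derivative_at by metis

lemma differentiable_has_partial:
 "f differentiable (at x) ==> (f has_derivative (%v. partial v f x)) (at x)"
 unfolding partial_def using frechet_derivative_works[of f "at x"] by (simp add: eta_contract_eq)

lemma iter_partial_append: "iter_partial (vs @ ws) f = iter_partial vs (iter_partial ws f)"
 by (induction vs) auto

lemma smooth_differentiable: "smooth f ==> f differentiable (at x)"
 unfolding smooth_def by (metis empty_subsetI iter_partial.simps(1) list.set(1))

lemma smooth_has_partial: "smooth f ==> (f has_derivative (%v. partial v f x)) (at x)"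
 by (simp add: differentiable_has_partial smooth_differentiable)

lemma smooth_partial: "smooth f ==> b \<in> Basis ==> smooth (partial b f)"
 unfolding smooth_def
proof (intro allI impI)
 fix vs :: "'a list" and x
 assume *: "\<forall>vs. set vs \<subseteq> Basis --> (\<forall>x. iter_partial vs f differentiable at x)"
  and "b \<in> Basis" "set vs \<subseteq> Basis"
 then have "iter_partial (vs @ [b]) f differentiable at x"
  by auto
 then show "iter_partial vs (partial b f) differentiable at x"
  by (simp add: iter_partial_append)
qed

text \<open>Iterated derivatives are awkward to compute; exhibiting a class that is closed under partial
 derivatives avoids them in all the closure properties below.\<close>

lemma smooth_coinduct:
 assumes "f \<in> S" "!!f x. f \<in> S ==> f differentiable (at x)"
  "!!f b. f \<in> S ==> b \<in> Basis ==> partial b f \<in> S"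
 shows "smooth f"
proof -
 have "set vs \<subseteq> Basis ==> iter_partial vs f \<in> S" for vs
  by (induction vs) (auto simp: assms)
 then show ?thesis
  unfolding smooth_def using assms(2) by blast
qed

lemma smooth_continuous: "smooth f ==> continuous_on A f"
 by (meson continuous_at_imp_continuous_on differentiable_imp_continuous_within smooth_differentiable)

lemma smooth_borel: "smooth f ==> f \<in> borel_measurable borel"
 by (simp add: borel_measurable_continuous_onI smooth_continuous)

lemma partial_const [simp]: "partial v (%x. c) = (%x. 0)"
 by (rule ext, rule frechet_eqI[THEN trans]) (auto intro!: derivative_eq_intros)

lemma smooth_const [simp, intro]: "smooth (%x. c)"
 by (rule smooth_coinduct[of _ "range (%c. (%x. c))"]) auto

lemma partial_add:
 "f differentiable (at x) ==> g differentiable (at x) ==>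
   partial v (%x. f x + g x) x = partial v f x + partial v g x"
 by (rule frechet_eqI[THEN trans], rule has_derivative_add)
  (auto intro: differentiable_has_partial)

lemma partial_mult:
 "f differentiable (at x) ==> g differentiable (at x) ==>
   partial v (%x. f x * g x) x = f x * partial v g x + partial v f x * g x"
 by (rule frechet_eqI[THEN trans], rule has_derivative_mult)
  (auto intro: differentiable_has_partial)

lemma partial_cmult:
 "f differentiable (at x) ==> partial v (%x. c * f x) x = c * partial v f x"
 using partial_mult[of "%x. c" x f v] by simp

lemma partial_compose:
 fixes g :: "real => real"
 assumes "g differentiable (at (f x))" "f differentiable (at x)"
 shows "partial v (%x. g (f x)) x = partial 1 g (f x) * partial v f x"
proof -
 have "(g has_derivative (%v. partial v g (f x))) (at (f x))"
  using assms by (simp add: differentiable_has_partial)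
 then have "((%x. g (f x)) has_derivative (%v. partial (partial v f x) g (f x))) (at x)"
  using diff_chain_at[OF differentiable_has_partial[OF assms(2)]] by (simp add: o_def)
 then have "partial v (%x. g (f x)) x = partial (partial v f x) g (f x)"
  by (rule frechet_eqI)
 also have "... = partial v f x * partial 1 g (f x)"
 proof -
  have "linear (%v. partial v g (f x))"
   using differentiable_has_partial[OF assms(1)] has_derivative_linear by blast
  from linear_cmul[OF this, of "partial v f x" 1] show ?thesis by simp
 qed
 finally show ?thesis by simp
qed

lemma sum_split_nat: "(\<Sum>k<n+(m::nat). h k) = (\<Sum>k<n. h k) + (\<Sum>k<m. h (n + k) :: real)"
 by (induction m) auto

text \<open>Products of smooth functions form, together with their finite sums, a class that is closed
 under partial derivatives; the same device handles compositions below.\<close>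

lemma smooth_mult [intro]:
 fixes f g :: "'a::euclidean_space => real"
 assumes f: "smooth f" and g: "smooth g"
 shows "smooth (%x. f x * g x)"
proof -
 define S :: "('a => real) set" where "S = {(%x. \<Sum>k<(n::nat). F k x * G k x) | n F G. (\<forall>k. smooth (F k)) \<and> (\<forall>k. smooth (G k))}"
 show ?thesis
 proof (rule smooth_coinduct[of _ S])
  show "(%x. f x * g x) \<in> S" unfolding S_def mem_Collect_eq
   using f g by (intro exI[of _ 1] exI[of _ "%_. f"] exI[of _ "%_. g"]) auto
 next
  fix h x assume "h \<in> S"
  then show "h differentiable (at x)"
   by (auto simp: S_def intro!: differentiable_sum differentiable_mult simp: smooth_differentiable)
 next
  fix h and b :: 'a assume "h \<in> S" and b: "b \<in> Basis"
  then obtain n F G where h: "h = (%x. \<Sum>k<(n::nat). F k x * G k x)"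
   and F: "!!k. smooth (F k)" and G: "!!k. smooth (G k)" unfolding S_def by blast
  let ?F = "%k. if k < n then F k else partial b (F (k - n))"
  let ?G = "%k. if k < n then partial b (G k) else G (k - n)"
  have "partial b h x = (\<Sum>k<n+n. ?F k x * ?G k x)" for x
  proof -
   have "partial b h x = (\<Sum>k<n. F k x * partial b (G k) x + partial b (F k) x * G k x)"
    unfolding h
    by (rule frechet_eqI[THEN trans], rule has_derivative_sum, rule has_derivative_mult)
     (auto intro: smooth_has_partial F G)
   also have "... = (\<Sum>k<n. ?F k x * ?G k x) + (\<Sum>k<n. ?F (n+k) x * ?G (n+k) x)"
    by (simp add: sum.distrib)
   also have "... = (\<Sum>k<n+n. ?F k x * ?G k x)"
    by (rule sum_split_nat[symmetric])
   finally show ?thesis .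
  qed
  moreover have "smooth (?F k)" "smooth (?G k)" for k
   using F G b by (auto simp: smooth_partial)
  ultimately show "partial b h \<in> S"
   unfolding S_def mem_Collect_eq
   by (intro exI[of _ "n+n"] exI[of _ ?F] exI[of _ ?G] conjI allI ext)
 qed
qed

lemma smooth_add [intro]:
 fixes f g :: "'a::euclidean_space => real"
 assumes f: "smooth f" and g: "smooth g"
 shows "smooth (%x. f x + g x)"
proof -
 define S :: "('a => real) set" where "S = {%x. f x + g x | f g. smooth f \<and> smooth g}"
 show ?thesis
 proof (rule smooth_coinduct[of _ S])
  show "(%x. f x + g x) \<in> S" unfolding S_def using f g by blast
  fix h and b :: 'a assume "h \<in> S"
  then obtain f g where h: "h = (%x. f x + g x)" "smooth f" "smooth g" unfolding S_def by blast
  then show "h differentiable (at x)" for x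
   by (auto intro!: differentiable_add simp: smooth_differentiable)
  assume b: "b \<in> Basis"
  from h have "partial b h = (%x. partial b f x + partial b g x)"
   unfolding h(1) by (intro ext partial_add smooth_differentiable) (use h in auto)
  then show "partial b h \<in> S"
   unfolding S_def using smooth_partial[OF h(2) b] smooth_partial[OF h(3) b] by blast
 qed
qed

lemma smooth_cmult [intro]: "smooth f ==> smooth (%x. c * f x)"
 by auto

lemma smooth_minus [intro]: "smooth f ==> smooth (%x. - f x)"
 using smooth_cmult[of f "-1"] by simp

lemma smooth_diff [intro]: "smooth f ==> smooth g ==> smooth (%x. f x - g x)"
 using smooth_add[of f "%x. - g x"] by auto

lemma smooth_sum [intro]: "(!!i. i \<in> I ==> smooth (f i)) ==> smooth (%x. \<Sum>i\<in>I. f i x)"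
 by (induction I rule: infinite_finite_induct) auto

lemma smooth_power [intro]: "smooth f ==> smooth (%x. f x ^ n)"
 by (induction n) auto

lemma partial_sum:
 "(!!i. i \<in> I ==> f i differentiable (at x)) ==>
   partial v (%x. \<Sum>i\<in>I. f i x) x = (\<Sum>i\<in>I. partial v (f i) x)"
 by (rule frechet_eqI[THEN trans], rule has_derivative_sum)
  (auto intro: differentiable_has_partial)

lemma partial_linear: "bounded_linear f ==> partial v f x = f v"
 by (rule frechet_eqI) (rule bounded_linear_imp_has_derivative)

lemma smooth_linear [intro]:
 assumes "bounded_linear f" shows "smooth f"
proof (rule smooth_coinduct[of _ "insert f (range (%c. (%x. c)))"])
 fix h b assume "h \<in> insert f (range (%c. (%x. c)))"
 then show "partial b h \<in> insert f (range (%c. (%x. c)))"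
  using partial_linear[OF assms, of b] by auto
qed (use assms in \<open>auto simp: bounded_linear_imp_differentiable\<close>)

lemma smooth_compose [intro]:
 assumes g: "smooth (g :: real => real)" and f: "smooth (f :: 'a::euclidean_space => real)"
 shows "smooth (%x. g (f x))"
proof -
 define S :: "('a => real) set" where "S = {(%x. \<Sum>k<(n::nat). F k (f x) * G k x) | n F G. (\<forall>k. smooth (F k)) \<and> (\<forall>k. smooth (G k))}"
 have dc: "(%x. F (f x)) differentiable (at x)" if "smooth F" for F x
  using differentiable_chain_at[of f x F] that f by (simp add: smooth_differentiable o_def)
 show ?thesis
 proof (rule smooth_coinduct[of _ S])
  show "(%x. g (f x)) \<in> S" unfolding S_def mem_Collect_eq
   using g by (intro exI[of _ 1] exI[of _ "%_. g"] exI[of _ "%_ _. 1"]) auto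
 next
  fix h x assume "h \<in> S"
  then show "h differentiable (at x)"
   by (auto simp: S_def intro!: differentiable_sum differentiable_mult dc simp: smooth_differentiable)
 next
  fix h and b :: 'a assume "h \<in> S" and b: "b \<in> Basis"
  then obtain n F G where h: "h = (%x. \<Sum>k<(n::nat). F k (f x) * G k x)"
   and F: "!!k. smooth (F k)" and G: "!!k. smooth (G k)" unfolding S_def by blast
  let ?F = "%k. if k < n then F k else partial 1 (F (k - n))"
  let ?G = "%k. if k < n then partial b (G k) else (%x. partial b f x * G (k - n) x)"
  have "partial b h x = (\<Sum>k<n+n. ?F k (f x) * ?G k x)" for x
  proof -
   have "partial b h x = (\<Sum>k<n. F k (f x) * partial b (G k) x + partial b (%x. F k (f x)) x * G k x)"
    unfolding h
    by (rule frechet_eqI[THEN trans], rule has_derivative_sum, rule has_derivative_mult)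
     (auto intro: smooth_has_partial G differentiable_has_partial dc F)
   also have "... = (\<Sum>k<n. ?F k (f x) * ?G k x) + (\<Sum>k<n. ?F (n+k) (f x) * ?G (n+k) x)"
    by (simp add: sum.distrib partial_compose smooth_differentiable F f mult.assoc)
   also have "... = (\<Sum>k<n+n. ?F k (f x) * ?G k x)"
    by (rule sum_split_nat[symmetric])
   finally show ?thesis .
  qed
  moreover have "smooth (?F k)" "smooth (?G k)" for k
   using F G b f by (auto simp: smooth_partial)
  ultimately show "partial b h \<in> S"
   unfolding S_def mem_Collect_eq
   by (intro exI[of _ "n+n"] exI[of _ ?F] exI[of _ ?G] conjI allI ext)
 qed
qed

lemma smooth_polynomial: "real_polynomial_function p ==> smooth p"
 by (induction rule: real_polynomial_function.induct) auto

lemma partial_eq_deriv: "(g has_real_derivative d) (at x) ==> partial 1 g x = d"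
 using frechet_eqI[of g "(*) d" x 1] by (simp add: has_field_derivative_def)

lemma smooth_exp: "smooth (exp :: real => real)"
proof (rule smooth_coinduct[of _ "{exp}"])
 have "partial 1 exp x = exp x" for x :: real
  by (intro partial_eq_deriv) (auto intro!: derivative_eq_intros)
 then show "partial b f \<in> {exp}" if "f \<in> {exp}" "b \<in> Basis" for f and b :: real
  using that by auto
qed (use field_differentiable_imp_differentiable field_differentiable_within_exp in blast)+

text \<open>The function \<open>q(1/t) exp(-1/t)\<close> for \<open>t > 0\<close>, extended by zero, has a derivative of the same form,
 because the exponential beats every power at the origin.\<close>

definition flat :: "real poly => real => real" where
 "flat q t = (if 0 < t then poly q (1 / t) * exp (- 1 / t) else 0)"

lemma poly_times_exp_neg_tendsto:
 fixes q :: "real poly"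
 shows "((%s. poly q s * exp (- s)) \<longlongrightarrow> 0) at_top"
proof -
 have "((%s. \<Sum>i\<le>degree q. coeff q i * (s ^ i / exp s)) \<longlongrightarrow> (\<Sum>i\<le>degree q. coeff q i * 0)) at_top"
  by (intro tendsto_sum tendsto_mult tendsto_const tendsto_power_div_exp_0)
 moreover have "(\<Sum>i\<le>degree q. coeff q i * (s ^ i / exp s)) = poly q s * exp (- s)" for s
  by (simp add: poly_altdef sum_distrib_right exp_minus divide_inverse mult.assoc)
 ultimately show ?thesis by simp
qed

lemma flat_has_derivative:
 "(flat q has_real_derivative flat ([:0, 0, 1:] * (q - pderiv q)) t) (at t)"
proof (cases t "0::real" rule: linorder_cases)
 case less
 have "(flat q has_real_derivative 0) (at t)"
  by (rule has_field_derivative_transform_within_open[of "%_. 0" _ _ "{..<0}"])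
   (use less in \<open>auto simp: flat_def\<close>)
 then show ?thesis using less by (simp add: flat_def)
next
 case greater
 have "((%t. poly q (1 / t) * exp (- 1 / t)) has_real_derivative
   flat ([:0, 0, 1:] * (q - pderiv q)) t) (at t)"
  using greater
  by (auto intro!: derivative_eq_intros poly_DERIV[THEN DERIV_chain2] simp: flat_def)
   (simp add: field_simps power2_eq_square)
 then show ?thesis
  by (rule has_field_derivative_transform_within_open[of _ _ _ "{0<..}"])
   (use greater in \<open>auto simp: flat_def\<close>)
next
 case equal
 have "((%h. flat q h / h) \<longlongrightarrow> 0) (at_right 0)"
 proof -
  have "((%h::real. poly ([:0,1:] * q) (inverse h) * exp (- inverse h)) \<longlongrightarrow> 0) (at_right 0)"
   by (rule filterlim_compose[OF poly_times_exp_neg_tendsto filterlim_inverse_at_top_right])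
  then show ?thesis
   by (rule Lim_transform_eventually)
    (auto simp: eventually_at_filter flat_def field_simps)
 qed
 moreover have "((%h. flat q h / h) \<longlongrightarrow> 0) (at_left 0)"
  by (rule Lim_transform_eventually[OF tendsto_const])
   (auto simp: eventually_at_filter flat_def)
 ultimately have "((%h. flat q h / h) \<longlongrightarrow> 0) (at 0)"
  by (simp add: filterlim_at_split)
 then show ?thesis using equal by (simp add: DERIV_def flat_def)
qed

lemma smooth_flat: "smooth (flat q)"
proof (rule smooth_coinduct[of _ "range flat"])
 fix f and b :: real assume "f \<in> range flat" "b \<in> Basis"
 then show "partial b f \<in> range flat"
  using ext[OF partial_eq_deriv[OF flat_has_derivative], of "%_. q" "%t. t" for q] by auto
next
 fix f x assume "f \<in> range flat"
 then show "f differentiable (at x)"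
  using flat_has_derivative has_field_derivative_imp_has_derivative differentiable_def by blast
qed auto

definition bump :: "real => real" where
 "bump = flat 1"

lemma smooth_bump: "smooth bump" by (simp add: bump_def smooth_flat)

lemma bump_eq: "bump t = (if 0 < t then exp (- 1 / t) else 0)"
 by (simp add: bump_def flat_def)

lemma bump_mono: "s <= t ==> bump s <= bump t"
 by (auto simp: bump_eq field_simps)

lemma bump_nonneg [simp]: "0 <= bump t" and bump_le_1: "bump t <= 1"
 and bump_pos_iff [simp]: "0 < bump t \<longleftrightarrow> 0 < t" and bump_eq_0: "t <= 0 ==> bump t = 0"
 by (auto simp: bump_eq)


text \<open>The symmetry of second derivatives: twice the mean value theorem writes the second difference
 \<open>f(x+sv+sw) - f(x+sv) - f(x+sw) + f(x)\<close> as \<open>s\<^sup>2\<close> times either mixed derivative at a nearby point.\<close>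

lemma has_derivative_line: "((%s. x + s *\<^sub>R v) has_derivative (%t. t *\<^sub>R v)) (at s)"
 by (auto intro!: derivative_eq_intros)

lemma smooth_line_derivative:
 assumes "smooth f"
 shows "((%s. f (x + s *\<^sub>R v)) has_real_derivative partial v f (x + s *\<^sub>R v)) (at s)"
proof -
 have "((%s. f (x + s *\<^sub>R v)) has_derivative (%t. partial (t *\<^sub>R v) f (x + s *\<^sub>R v))) (at s)"
  using diff_chain_at[of "%s. x + s *\<^sub>R v" "%t. t *\<^sub>R v" s f, OF has_derivative_line
   smooth_has_partial[OF assms]]
  by (simp add: o_def)
 moreover have "partial (t *\<^sub>R v) f y = t * partial v f y" for t y
  using linear_cmul[OF has_derivative_linear[OF smooth_has_partial[OF assms]], of t v y] by simp
 ultimately show ?thesis by (simp add: has_field_derivative_def mult_commute_abs)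
qed

lemma second_difference_eq:
 assumes f: "smooth f" and v: "v \<in> Basis" and w: "w \<in> Basis" and "0 < s"
 obtains a b where "0 <= a" "a <= s" "0 <= b" "b <= s"
  "f (x + s *\<^sub>R v + s *\<^sub>R w) - f (x + s *\<^sub>R v) - f (x + s *\<^sub>R w) + f x =
    s\<^sup>2 * partial w (partial v f) (x + a *\<^sub>R v + b *\<^sub>R w)"
proof -
 define g where "g = (%a. f (x + s *\<^sub>R w + a *\<^sub>R v) - f (x + a *\<^sub>R v))"
 have "(g has_real_derivative partial v f (x + s *\<^sub>R w + a *\<^sub>R v) - partial v f (x + a *\<^sub>R v)) (at a)" for a
  unfolding g_def by (intro DERIV_diff smooth_line_derivative f)
 from MVT2[OF \<open>0 < s\<close> this] obtain a where a: "0 < a" "a < s"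
  "g s - g 0 = s * (partial v f (x + s *\<^sub>R w + a *\<^sub>R v) - partial v f (x + a *\<^sub>R v))" by auto
 have "((%b. partial v f (x + a *\<^sub>R v + b *\<^sub>R w)) has_real_derivative
   partial w (partial v f) (x + a *\<^sub>R v + b *\<^sub>R w)) (at b)" for b
  by (intro smooth_line_derivative smooth_partial f v)
 from MVT2[OF \<open>0 < s\<close> this] obtain b where b: "0 < b" "b < s"
  "partial v f (x + a *\<^sub>R v + s *\<^sub>R w) - partial v f (x + a *\<^sub>R v)
   = s * partial w (partial v f) (x + a *\<^sub>R v + b *\<^sub>R w)" by auto
 have 1: "f (x + s *\<^sub>R v + s *\<^sub>R w) - f (x + s *\<^sub>R v) - f (x + s *\<^sub>R w) + f x = g s - g 0"
  by (simp add: g_def add_ac)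
 have 2: "x + s *\<^sub>R w + a *\<^sub>R v = x + a *\<^sub>R v + s *\<^sub>R w"
  by (simp add: add_ac)
 show ?thesis
  by (rule that[of a b]) (use a b in \<open>simp_all add: 1 2 power2_eq_square\<close>)
qed

lemma partial_commute:
 assumes f: "smooth f" and v: "v \<in> Basis" and w: "w \<in> Basis"
 shows "partial w (partial v f) x = partial v (partial w f) x"
proof -
 have lim: "(%n. F (x + a n *\<^sub>R v + b n *\<^sub>R w)) \<longlonglongrightarrow> F x"
  if "smooth F" "!!n. 0 <= a n \<and> a n <= inverse (real (Suc n)) \<and> 0 <= b n \<and> b n <= inverse (real (Suc n))"
  for F :: "'a => real" and a b v w
 proof -
  have sq: "c \<longlonglongrightarrow> 0" if "!!n. 0 <= c n" "!!n. c n <= inverse (real (Suc n))" for c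
   by (rule tendsto_sandwich[OF _ _ tendsto_const LIMSEQ_inverse_real_of_nat])
    (simp_all only: that eventually_True)
  have "a \<longlonglongrightarrow> 0" "b \<longlonglongrightarrow> 0"
   by (rule sq, use that(2) in blast, use that(2) in blast)+
  then have "(%n. x + a n *\<^sub>R v + b n *\<^sub>R w) \<longlonglongrightarrow> x + 0 *\<^sub>R v + 0 *\<^sub>R w"
   by (intro tendsto_intros)
  moreover have "isCont F x"
   using smooth_continuous[OF that(1), of UNIV] by (simp add: continuous_on_eq_continuous_at)
  ultimately show ?thesis using isCont_tendsto_compose[of x F] by simp
 qed
 define D where "D n = (let s = inverse (real (Suc n)) in
   f (x + s *\<^sub>R v + s *\<^sub>R w) - f (x + s *\<^sub>R v) - f (x + s *\<^sub>R w) + f x)" for n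
 have *: "(%n. D n / (inverse (real (Suc n)))^2) \<longlonglongrightarrow> partial w (partial v f) x"
  if v: "v \<in> Basis" and w: "w \<in> Basis" and D: "D = (%n. let s = inverse (real (Suc n)) in
   f (x + s *\<^sub>R v + s *\<^sub>R w) - f (x + s *\<^sub>R v) - f (x + s *\<^sub>R w) + f x)" for v w D
 proof -
  have "\<exists>a b. 0 <= a \<and> a <= inverse (real (Suc n)) \<and> 0 <= b \<and> b <= inverse (real (Suc n)) \<and>
    D n / (inverse (real (Suc n)))^2 = partial w (partial v f) (x + a *\<^sub>R v + b *\<^sub>R w)" for n
  proof -
   have "0 < inverse (real (Suc n))" by simp
   from second_difference_eq[OF f v w this, of x] obtain a b where
    ab: "0 <= a" "a <= inverse (real (Suc n))" "0 <= b" "b <= inverse (real (Suc n))" and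
    eq: "f (x + inverse (real (Suc n)) *\<^sub>R v + inverse (real (Suc n)) *\<^sub>R w) -
     f (x + inverse (real (Suc n)) *\<^sub>R v) - f (x + inverse (real (Suc n)) *\<^sub>R w) + f x =
     (inverse (real (Suc n)))\<^sup>2 * partial w (partial v f) (x + a *\<^sub>R v + b *\<^sub>R w)" .
   have "D n = (inverse (real (Suc n)))^2 * partial w (partial v f) (x + a *\<^sub>R v + b *\<^sub>R w)"
    using eq by (simp only: D Let_def)
   with ab show ?thesis by (intro exI[of _ a] exI[of _ b]) simp
  qed
  then obtain a b where ab: "!!n. 0 <= a n \<and> a n <= inverse (real (Suc n)) \<and> 0 <= b n \<and>
    b n <= inverse (real (Suc n)) \<and>
    D n / (inverse (real (Suc n)))^2 = partial w (partial v f) (x + a n *\<^sub>R v + b n *\<^sub>R w)" by metis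
  have eq: "(%n. D n / (inverse (real (Suc n)))^2) =
    (%n. partial w (partial v f) (x + a n *\<^sub>R v + b n *\<^sub>R w))"
   using ab by blast
  show ?thesis
   unfolding eq
  proof (rule lim[OF smooth_partial[OF smooth_partial[OF f v] w]])
   show "0 <= a n \<and> a n <= inverse (real (Suc n)) \<and> 0 <= b n \<and> b n <= inverse (real (Suc n))" for n
    using ab[of n] by blast
  qed
 qed
 have "(%n. D n / (inverse (real (Suc n)))^2) \<longlonglongrightarrow> partial w (partial v f) x"
  by (rule *[OF v w]) (simp add: D_def fun_eq_iff)
 moreover have "(%n. D n / (inverse (real (Suc n)))^2) \<longlonglongrightarrow> partial v (partial w f) x"
 proof (rule *[OF w v], rule ext)
  fix n
  define s where "s = inverse (real (Suc n))"
  have "x + s *\<^sub>R v + s *\<^sub>R w = x + s *\<^sub>R w + s *\<^sub>R v" by (simp add: add_ac)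
  from arg_cong[OF this, of f] show "D n = (let s = inverse (real (Suc n)) in
   f (x + s *\<^sub>R w + s *\<^sub>R v) - f (x + s *\<^sub>R w) - f (x + s *\<^sub>R v) + f x)"
   unfolding D_def Let_def s_def[symmetric] by simp
 qed
 ultimately show ?thesis by (rule LIMSEQ_unique)
qed


subsection \<open>Test functions\<close>

lemma test_funI:
 assumes "smooth f" "compact K" "K \<subseteq> U" "!!x. x \<notin> K ==> f x = 0"
 shows "f \<in> test_fun U" "support f \<subseteq> K"
proof -
 show s: "support f \<subseteq> K"
  unfolding support_def using assms by (intro closure_minimal) (auto simp: compact_imp_closed)
 have "compact (K \<inter> support f)"
  using assms by (intro compact_Int_closed) (auto simp: support_def)
 then show "f \<in> test_fun U"
  using assms s unfolding test_fun_def by (auto simp: Int_absorb1)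
qed

lemma not_in_support: "x \<notin> support f ==> f x = 0"
 unfolding support_def using closure_subset[of "{x. f x ~= 0}"] by auto

lemma test_funD:
 assumes "f \<in> test_fun U"
 shows "smooth f" "compact (support f)" "support f \<subseteq> U" "!!x. x \<notin> U ==> f x = 0"
 using assms not_in_support[of _ f] unfolding test_fun_def by blast+

lemma partial_zero_open:
 assumes "open S" "x \<in> S" "!!y. y \<in> S ==> f y = 0"
 shows "partial v f x = 0"
 by (rule frechet_eqI[THEN trans], rule has_derivative_transform_within_open[of "%_. 0" "%_. 0" _ _ S])
  (use assms in auto)

lemma partial_outside_support:
 assumes "x \<notin> support f" shows "partial v f x = 0"
proof (rule partial_zero_open)
 show "open (- support f)" by (simp add: support_def open_Compl)
 show "x \<in> - support f" using assms by simp
 show "f y = 0" if "y \<in> - support f" for y using that not_in_support[of y f] by simp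
qed

lemma test_fun_partial:
 assumes "f \<in> test_fun U" "b \<in> Basis"
 shows "partial b f \<in> test_fun U" "support (partial b f) \<subseteq> support f"
 using test_funI[OF smooth_partial[OF test_funD(1)[OF assms(1)] assms(2)] test_funD(2,3)[OF assms(1)]
  partial_outside_support] by auto

lemma test_fun_mono: "f \<in> test_fun U ==> U \<subseteq> V ==> f \<in> test_fun V"
 by (auto simp: test_fun_def)

lemma test_fun_mult:
 assumes "f \<in> test_fun U" "smooth g"
 shows "(%x. g x * f x) \<in> test_fun U"
proof (rule test_funI(1))
 show "smooth (%x. g x * f x)" using test_funD(1)[OF assms(1)] assms(2) by (rule smooth_mult[rotated])
 show "g x * f x = 0" if "x \<notin> support f" for x using that not_in_support[of x f] by simp
qed (use test_funD(2,3)[OF assms(1)] in auto)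

lemma test_fun_bounded:
 assumes "f \<in> test_fun U"
 obtains B where "0 <= B" "!!x. \<bar>f x\<bar> <= B"
proof -
 have "bounded (f ` support f)"
  by (intro compact_imp_bounded compact_continuous_image smooth_continuous test_funD(1)[OF assms]
   test_funD(2)[OF assms])
 then obtain B where "!!x. x \<in> support f ==> \<bar>f x\<bar> <= B"
  by (auto simp: bounded_iff)
 with not_in_support[of _ f] have "\<bar>f x\<bar> <= max B 0" for x
  by (metis abs_zero max.cobounded2 max.coboundedI1)
 then show ?thesis using that[of "max B 0"] by simp
qed

lemma test_fun_integrable:
 assumes "f \<in> test_fun U"
 shows "integrable lborel f"
proof -
 have "set_integrable lborel (support f) f"
  unfolding set_integrable_def
  by (intro borel_integrable_compact smooth_continuous test_funD(1)[OF assms]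
   test_funD(2)[OF assms])
 moreover have "(%x. indicator (support f) x *\<^sub>R f x) = f"
 proof
  show "indicator (support f) x *\<^sub>R f x = f x" for x
   using not_in_support[of x f] by (cases "x \<in> support f") simp_all
 qed
 ultimately show ?thesis by (simp add: set_integrable_def)
qed

section \<open>Integration by parts and a compactly supported parametrix\<close>

lemma partial_chain:
 assumes g: "(g has_derivative g') (at x)" and f: "f differentiable (at (g x))"
 shows "(%x. f (g x)) differentiable (at x)" "partial v (%x. f (g x)) x = partial (g' v) f (g x)"
proof -
 have "((%x. f (g x)) has_derivative (%v. partial (g' v) f (g x))) (at x)"
  using diff_chain_at[OF g differentiable_has_partial[OF f]] by (simp add: o_def)
 then show "(%x. f (g x)) differentiable (at x)" "partial v (%x. f (g x)) x = partial (g' v) f (g x)"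
  using frechet_eqI by (auto simp: differentiable_def)
qed

lemma partial_scaleR: "f differentiable (at x) ==> partial (c *\<^sub>R v) f x = c * partial v f x"
 using linear_cmul[OF has_derivative_linear[OF differentiable_has_partial], of f x c v] by simp

lemma lborel_integral_cbox:
 fixes f :: "'a::euclidean_space => real"
 assumes "continuous_on UNIV f" "!!x. x \<notin> cbox a b ==> f x = 0"
 shows "integrable lborel f" "integral\<^sup>L lborel f = integral (cbox a b) f"
proof -
 have eq: "(%x. indicator (cbox a b) x * f x) = f"
 proof
  show "indicator (cbox a b) x * f x = f x" for x
   using assms(2)[of x] by (cases "x \<in> cbox a b") simp_all
 qed
 have *: "integrable lborel (%x. indicator (cbox a b) x *\<^sub>R f x)"
  by (intro borel_integrable_compact compact_cbox continuous_on_subset[OF assms(1)]) simp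
 then show "integrable lborel f" by (simp add: eq)
 show "integral\<^sup>L lborel f = integral (cbox a b) f"
  using set_borel_integral_eq_integral(2)[of "cbox a b" f] * eq
  by (simp add: set_integrable_def set_lebesgue_integral_def)
qed

lemma lborel_integral_affine:
 fixes f :: "'a::euclidean_space => real"
 assumes c: "c ~= 0"
 shows "integrable lborel (%x. f (t + c *\<^sub>R x)) \<longleftrightarrow> integrable lborel f"
  "(LINT x|lborel. f x) = \<bar>c\<bar> ^ DIM('a) * (LINT x|lborel. f (t + c *\<^sub>R x))"
proof -
 have *: "integrable lborel (%x. f (t + c *\<^sub>R x))" if f: "integrable lborel f" and c: "c ~= 0" for f :: "'a => real" and c t
 proof -
  have [measurable]: "f \<in> borel_measurable borel" using f by auto
  have "integrable (density (distr lborel borel (%x. t + c *\<^sub>R x)) (%_. \<bar>c\<bar> ^ DIM('a))) f"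
   using f lborel_affine[OF c, of t] by simp
  then have "integrable (distr lborel borel (%x. t + c *\<^sub>R x)) (%x. \<bar>c\<bar> ^ DIM('a) * f x)"
   by (subst (asm) integrable_density) auto
  then have "integrable (distr lborel borel (%x. t + c *\<^sub>R x)) f"
   using c by simp
  then show ?thesis by (subst (asm) integrable_distr_eq) auto
 qed
 have "(%x. f (t + c *\<^sub>R (- t /\<^sub>R c + (1/c) *\<^sub>R x))) = f"
  using c by (simp add: algebra_simps)
 then show iff: "integrable lborel (%x. f (t + c *\<^sub>R x)) \<longleftrightarrow> integrable lborel f"
  using *[of f c t] *[of "%x. f (t + c *\<^sub>R x)" "1/c" "- t /\<^sub>R c"] c by auto
 show "(LINT x|lborel. f x) = \<bar>c\<bar> ^ DIM('a) * (LINT x|lborel. f (t + c *\<^sub>R x))"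
 proof (cases "integrable lborel f")
  case True
  then have [measurable]: "f \<in> borel_measurable borel" by auto
  show ?thesis
   by (subst lborel_affine[OF c, of t], subst integral_density)
    (simp_all add: integral_distr)
 qed (simp add: iff not_integrable_integral_eq)
qed

lemma line_derivative:
 assumes "f differentiable (at (x + s *\<^sub>R v))"
 shows "((%s. f (x + s *\<^sub>R v)) has_real_derivative partial v f (x + s *\<^sub>R v)) (at s)"
 using diff_chain_at[OF has_derivative_line differentiable_has_partial[OF assms]]
 by (simp add: has_field_derivative_def o_def partial_scaleR[OF assms] mult_commute_abs)

text \<open>The integral of a directional derivative of a compactly supported function vanishes: averaging
 the fundamental theorem of calculus along the segments from \<open>x\<close> to \<open>x + v\<close> over all \<open>x\<close> gives the
 integral of the derivative on one side, and on the other side the difference of the integrals of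
 two translates.\<close>

lemma integral_partial_zero:
 fixes f :: "'a::euclidean_space => real"
 assumes f: "!!x. f differentiable (at x)" and c: "continuous_on UNIV (partial v f)"
  and z: "!!x. x \<notin> cball 0 r ==> f x = 0"
 shows "integrable lborel (partial v f)" "(LINT x|lborel. partial v f x) = 0"
proof -
 define g where "g = partial v f"
 have cf: "continuous_on UNIV f"
  using f by (simp add: continuous_at_imp_continuous_on differentiable_imp_continuous_within)
 have gz: "g x = 0" if "x \<notin> cball 0 r" for x
  unfolding g_def by (rule partial_zero_open[of "- cball 0 r"]) (use that z in \<open>auto simp: open_Compl\<close>)
 obtain a where a: "cball 0 (r + norm v) \<subseteq> cbox (- a) (a::'a)"
  using bounded_subset_cbox_symmetric[OF bounded_cball] by metis
 have outside: "x + s *\<^sub>R v \<notin> cball 0 r" if "x \<notin> cbox (-a) a" "s \<in> {0..1}" for x s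
 proof
  assume "x + s *\<^sub>R v \<in> cball 0 r"
  then have "norm (x + s *\<^sub>R v) <= r" by simp
  moreover have "norm x <= norm (x + s *\<^sub>R v) + norm (s *\<^sub>R v)"
   using norm_triangle_ineq4[of "x + s *\<^sub>R v" "s *\<^sub>R v"] by simp
  moreover have "norm (s *\<^sub>R v) <= norm v" using that(2) by (simp add: mult_left_le_one_le)
  ultimately have "x \<in> cball 0 (r + norm v)" by simp
  then show False using that a by blast
 qed
 have cg: "continuous_on A (%x. g (h x))" if "continuous_on A h" for A and h :: "'b::topological_space => 'a"
  using continuous_on_compose2[OF c that] by (auto simp: g_def)
 have sh: "(LINT x|lborel. F (x + s *\<^sub>R v)) = (LINT x|lborel. F x)" for F :: "'a => real" and s
  using lborel_integral_affine(2)[of 1 F "s *\<^sub>R v"] by (simp add: add.commute)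
 have J: "integral (cbox (-a) a) (%x. g (x + s *\<^sub>R v)) = (LINT x|lborel. g x)" if "s \<in> {0..1}" for s
  using lborel_integral_cbox(2)[of "%x. g (x + s *\<^sub>R v)" "-a" a] sh[of g s] outside[OF _ that] gz
  by (simp add: cg continuous_intros)
 have ftc: "integral (cbox 0 1) (%s. g (x + s *\<^sub>R v)) = f (x + v) - f x" for x
 proof -
  have "((%s. g (x + s *\<^sub>R v)) has_integral (f (x + 1 *\<^sub>R v) - f (x + 0 *\<^sub>R v))) {0..1}"
   using f by (intro fundamental_theorem_of_calculus)
    (auto simp: g_def has_real_derivative_iff_has_vector_derivative[symmetric]
     intro: line_derivative has_field_derivative_at_within)
  then show ?thesis by (simp add: integral_unique)
 qed
 have "integral (cbox 0 1) (%s. integral (cbox (-a) a) (%x. g (x + s *\<^sub>R v))) =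
   integral (cbox (-a) a) (%x. integral (cbox 0 1) (%s. g (x + s *\<^sub>R v)))"
  by (rule integral_swap_continuous)
   (auto simp: split_beta intro!: cg continuous_intros)
 also have "integral (cbox 0 1) (%s. integral (cbox (-a) a) (%x. g (x + s *\<^sub>R v))) = integral (cbox (0::real) 1) (%s. (LINT x|lborel. g x))"
  by (rule integral_cong) (use J in auto)
 also have "... = (LINT x|lborel. g x)" by simp
 also have "integral (cbox (-a) a) (%x. integral (cbox 0 1) (%s. g (x + s *\<^sub>R v))) = integral (cbox (-a) a) (%x. f (x + v) - f x)"
  by (simp only: ftc)
 also have "... = (LINT x|lborel. f (x + v) - f x)"
  by (rule lborel_integral_cbox(2)[symmetric])
   (use outside[of _ 0] outside[of _ 1] z in \<open>auto intro!: continuous_intros continuous_on_compose2[OF cf]\<close>)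
 also have "... = 0"
 proof -
  have "integrable lborel f" "integrable lborel (%x. f (x + v))"
   by (rule lborel_integral_cbox(1)[of _ "-a" a];
    use outside[of _ 0] outside[of _ 1] z in \<open>auto intro!: continuous_intros continuous_on_compose2[OF cf]\<close>)+
  then show ?thesis using sh[of f 1] by simp
 qed
 finally show "(LINT x|lborel. partial v f x) = 0" by (simp add: g_def)
 show "integrable lborel (partial v f)"
  by (rule lborel_integral_cbox(1)[of _ "-a" a])
   (use outside[of _ 0] gz c in \<open>auto simp: g_def\<close>)
qed

lemma integral_by_parts:
 fixes f g :: "'a::euclidean_space => real"
 assumes f: "!!x. f differentiable (at x)" "continuous_on UNIV (partial v f)"
  and g: "!!x. g differentiable (at x)" "continuous_on UNIV (partial v g)"
  and z: "!!x. x \<notin> cball 0 r ==> f x = 0"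
 shows "(LINT x|lborel. f x * partial v g x) = - (LINT x|lborel. partial v f x * g x)"
  "integrable lborel (%x. f x * partial v g x)" "integrable lborel (%x. partial v f x * g x)"
proof -
 have cf: "continuous_on UNIV f" "continuous_on UNIV g"
  using f g by (simp_all add: continuous_at_imp_continuous_on differentiable_imp_continuous_within)
 have pz: "partial v f x = 0" if "x \<notin> cball 0 r" for x
  by (rule partial_zero_open[of "- cball 0 r"]) (use that z in \<open>auto simp: open_Compl\<close>)
 obtain a where a: "cball 0 r \<subseteq> cbox (- a) (a::'a)"
  using bounded_subset_cbox_symmetric[OF bounded_cball] by metis
 show i: "integrable lborel (%x. f x * partial v g x)" "integrable lborel (%x. partial v f x * g x)"
  by (rule lborel_integral_cbox(1)[of _ "-a" a]; use a z pz f g cf in \<open>force intro!: continuous_intros\<close>)+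
 have p: "partial v (%x. f x * g x) = (%x. f x * partial v g x + partial v f x * g x)"
  using f g by (auto simp: partial_mult)
 have "(LINT x|lborel. partial v (%x. f x * g x) x) = 0"
  by (rule integral_partial_zero(2)[of _ _ r])
   (use f g z cf in \<open>auto simp: p intro!: continuous_intros differentiable_mult\<close>)
 then show "(LINT x|lborel. f x * partial v g x) = - (LINT x|lborel. partial v f x * g x)"
  using i by (simp add: p)
qed

subsection \<open>Spatial slices of functions on space-time\<close>

lemma slice_has_derivative: "((%y. (t, x + c *\<^sub>R y)) has_derivative (%v. (0, c *\<^sub>R v))) (at y)"
 by (auto intro!: derivative_eq_intros)

lemma slice_partial:
 fixes F :: "real \<times> (real^3) => real"
 assumes "smooth F"
 shows "(%y. F (t, x + c *\<^sub>R y)) differentiable (at y)"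
  "partial v (%y. F (t, x + c *\<^sub>R y)) y = c * partial (0, v) F (t, x + c *\<^sub>R y)"
proof -
 note d = smooth_differentiable[OF assms, of "(t, x + c *\<^sub>R y)"]
 show "(%y. F (t, x + c *\<^sub>R y)) differentiable (at y)"
  using partial_chain(1)[OF slice_has_derivative d] .
 show "partial v (%y. F (t, x + c *\<^sub>R y)) y = c * partial (0, v) F (t, x + c *\<^sub>R y)"
  using partial_chain(2)[OF slice_has_derivative d, of v] partial_scaleR[OF d, of c "(0, v)"] by simp
qed

lemma slice_support:
 fixes F :: "real \<times> (real^3) => real"
 assumes "F \<in> test_fun U"
 obtains r where "0 < r" "!!t x. r <= norm x ==> F (t, x) = 0"
proof -
 have "bounded (support F)" using test_funD(2)[OF assms] compact_imp_bounded by blast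
 then obtain b where b: "!!z. z \<in> support F ==> norm z <= b" by (auto simp: bounded_iff)
 have "F (t, x) = 0" if "max b 0 + 1 <= norm x" for t x
 proof (rule not_in_support[of "(t, x)" F], rule notI)
  assume "(t, x) \<in> support F"
  then show False using b[of "(t, x)"] norm_snd_le[of x t] that by auto
 qed
 then show ?thesis using that[of "max b 0 + 1"] by auto
qed

lemma dx_Basis [simp, intro]: "(0, axis j 1) \<in> (Basis :: (real \<times> (real^3)) set)"
 and dt_Basis [simp, intro]: "(1, 0) \<in> (Basis :: (real \<times> (real^3)) set)"
 by (auto simp: Basis_prod_def)

lemma continuous_slice:
 fixes F :: "real \<times> (real^3) => real"
 assumes "smooth F" shows "continuous_on A (%y. F (t, x + c *\<^sub>R y))"
 by (rule continuous_on_compose2[OF smooth_continuous[OF assms, of UNIV]])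
  (auto intro!: continuous_intros)

lemma slice_integrable:
 fixes F :: "real \<times> (real^3) => real"
 assumes "F \<in> test_fun U"
 shows "integrable lborel (%x. F (t, x))"
proof -
 obtain r where r: "!!x. r <= norm x ==> F (t, x) = 0" using slice_support[OF assms] by metis
 obtain a where "cball 0 r \<subseteq> cbox (- a) (a::real^3)"
  using bounded_subset_cbox_symmetric[OF bounded_cball] by metis
 then show ?thesis
  using continuous_slice[OF test_funD(1)[OF assms], where t=t and x=0 and c=1 and A=UNIV] r
  by (intro lborel_integral_cbox(1)[of _ "-a" a]) force+
qed

lemma slice_by_parts:
 fixes F :: "real \<times> (real^3) => real"
 assumes F: "F \<in> test_fun U" and G: "smooth G"
 shows "(LINT x|lborel. F (t, x) * dx j G (t, x)) = - (LINT x|lborel. dx j F (t, x) * G (t, x))"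
proof -
 obtain r where r: "!!x. r <= norm x ==> F (t, x) = 0" using slice_support[OF F] by metis
 note s = slice_partial[where t=t and x=0 and c=1, simplified]
  and c = continuous_slice[where t=t and x=0 and c=1 and A=UNIV, simplified]
 note sF = test_funD(1)[OF F]
 have p: "partial (axis j 1) (%x. F (t, x)) = (%x. dx j F (t, x))"
  "partial (axis j 1) (%x. G (t, x)) = (%x. dx j G (t, x))"
  using s(2) sF G by auto
 show ?thesis
  using integral_by_parts(1)[of "%x. F (t, x)" "axis j 1" "%x. G (t, x)" r] r s(1) c sF G
  by (simp add: p smooth_partial)
qed

lemma slice_integral_dx_zero:
 assumes F: "F \<in> test_fun U"
 shows "(LINT x|lborel. dx j F (t, x)) = 0"
 using slice_by_parts[OF F, of "%z. 1" t j] by simp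

lemma smooth_laplace: "smooth \<phi> ==> smooth (laplace \<phi>)"
 unfolding laplace_def[abs_def] by (intro smooth_sum smooth_partial dx_Basis)

lemma laplace_outside_support: "z \<notin> support \<phi> ==> laplace \<phi> z = 0"
proof -
 assume z: "z \<notin> support \<phi>"
 have "dx j (dx j \<phi>) z = 0" for j
 proof (rule partial_zero_open[of "- support \<phi>"])
  show "open (- support \<phi>)" by (simp add: support_def open_Compl)
 qed (use z partial_outside_support in auto)
 then show ?thesis by (simp add: laplace_def)
qed

lemma test_fun_laplace: "\<phi> \<in> test_fun U ==> laplace \<phi> \<in> test_fun U"
 using test_funI(1)[of "laplace \<phi>" "support \<phi>" U, OF smooth_laplace _ _ laplace_outside_support] test_funD
 by blast

text \<open>Two integrations by parts move both derivatives from one factor to the other, so that the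
 Hessian and the Laplacian of a test function have the same norm in \<open>L\<^sup>2\<close>.\<close>

lemma hessian_L2:
 assumes F: "F \<in> test_fun U"
 shows "(LINT x|lborel. (\<Sum>i\<in>UNIV. \<Sum>j\<in>UNIV. (dx i (dx j F) (t, x))^2)) = (LINT x|lborel. (laplace F (t, x))^2)"
proof -
 have sm: "smooth F" by (rule test_funD(1)[OF F])
 have D: "dx i F \<in> test_fun U" "dx i (dx j F) \<in> test_fun U" "dx i (dx j (dx k F)) \<in> test_fun U" for i j k
  by (intro test_fun_partial(1) F dx_Basis)+
 have comm: "dx i (dx j G) = dx j (dx i G)" if "smooth G" for i j G
  using partial_commute[OF that] by auto
 have 1: "(LINT x|lborel. dx i (dx j F) (t, x) * dx i (dx j F) (t, x)) =
   (LINT x|lborel. dx i (dx i F) (t, x) * dx j (dx j F) (t, x))" for i j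
 proof -
  have "(LINT x|lborel. dx i (dx j F) (t, x) * dx i (dx j F) (t, x)) =
    - (LINT x|lborel. dx i (dx i (dx j F)) (t, x) * dx j F (t, x))"
   by (rule slice_by_parts[OF D(2) test_funD(1)[OF D(1)]])
  also have "dx i (dx i (dx j F)) = dx j (dx i (dx i F))"
   using comm[OF sm, of i j] comm[OF test_funD(1)[OF D(1)], of i j i] by simp
  also have "- (LINT x|lborel. dx j (dx i (dx i F)) (t, x) * dx j F (t, x)) =
    (LINT x|lborel. dx i (dx i F) (t, x) * dx j (dx j F) (t, x))"
   using slice_by_parts[OF D(2) test_funD(1)[OF D(1)], of i i t j j] by simp
  finally show ?thesis .
 qed
 have int: "integrable lborel (%x. G (t, x) * H (t, x))" if "G \<in> test_fun U" "H \<in> test_fun U" for G H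
  using slice_integrable[OF test_fun_mult[OF that(2) test_funD(1)[OF that(1)]]] by simp
 have "(LINT x|lborel. (\<Sum>i\<in>UNIV. \<Sum>j\<in>UNIV. (dx i (dx j F) (t, x))^2)) =
  (\<Sum>i\<in>UNIV. \<Sum>j\<in>UNIV. (LINT x|lborel. dx i (dx j F) (t, x) * dx i (dx j F) (t, x)))"
  by (simp add: power2_eq_square int D)
 also have "... = (\<Sum>i\<in>UNIV. \<Sum>j\<in>UNIV. (LINT x|lborel. dx i (dx i F) (t, x) * dx j (dx j F) (t, x)))"
  by (simp only: 1)
 also have "... = (LINT x|lborel. (\<Sum>i\<in>UNIV. \<Sum>j\<in>UNIV. dx i (dx i F) (t, x) * dx j (dx j F) (t, x)))"
  by (simp add: int D)
 also have "... = (LINT x|lborel. (laplace F (t, x))^2)"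
  by (simp add: laplace_def power2_eq_square sum_product)
 finally show ?thesis .
qed

subsection \<open>The parametrix\<close>

text \<open>The cube makes \<open>\<kappa>\<close> continuously differentiable, and \<open>\<eta>\<close> is the radial profile with
 \<open>\<nabla>\<kappa> = - y \<eta>\<close>.\<close>

definition kappa :: "real^3 => real" where
 "kappa y = (max 0 (1 - y \<bullet> y)) ^ 3"

definition eta :: "real^3 => real" where
 "eta y = 6 * (max 0 (1 - y \<bullet> y))^2"

lemma max_cube_derivative: "((%t::real. (max 0 t) ^ 3) has_real_derivative 3 * (max 0 t)^2) (at t)"
proof (cases t "0::real" rule: linorder_cases)
 case less
 have "((%t::real. (max 0 t) ^ 3) has_real_derivative 0) (at t)"
  by (rule has_field_derivative_transform_within_open[of "%_. 0" _ _ "{..<0}"]) (use less in auto)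
 then show ?thesis using less by simp
next
 case greater
 have "((%t::real. t ^ 3) has_real_derivative 3 * t^2) (at t)"
  by (auto intro!: derivative_eq_intros simp: power2_eq_square)
 then have "((%t::real. (max 0 t) ^ 3) has_real_derivative 3 * t^2) (at t)"
  by (rule has_field_derivative_transform_within_open[of _ _ _ "{0<..}"]) (use greater in auto)
 then show ?thesis using greater by simp
next
 case equal
 have "((%h::real. (max 0 h) ^ 3 / h) \<longlongrightarrow> 0) (at 0)"
 proof (rule Lim_null_comparison)
  show "\<forall>\<^sub>F h::real in at 0. norm ((max 0 h) ^ 3 / h) <= h^2"
   by (auto simp: eventually_at_filter power3_eq_cube power2_eq_square max_def abs_mult)
  show "((%h::real. h^2) \<longlongrightarrow> 0) (at 0)"
   by (auto intro!: tendsto_eq_intros)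
 qed
 then show ?thesis using equal by (simp add: DERIV_def)
qed

lemma kappa_differentiable: "kappa differentiable (at y)"
 and partial_kappa: "partial v kappa y = - eta y * (y \<bullet> v)"
proof -
 have "((%y::real^3. 1 - y \<bullet> y) has_derivative (%v. - 2 * (y \<bullet> v))) (at y)"
  by (auto intro!: derivative_eq_intros simp: inner_commute)
 then have "(kappa has_derivative (%v. (- 2 * (y \<bullet> v)) * (3 * (max 0 (1 - y \<bullet> y))^2))) (at y)"
  unfolding kappa_def[abs_def]
  using max_cube_derivative[THEN DERIV_compose_FDERIV, of "%y::real^3. 1 - y \<bullet> y"] by blast
 then have *: "(kappa has_derivative (%v. - eta y * (y \<bullet> v))) (at y)"
  by (simp add: eta_def mult.commute mult.left_commute)
 then show "kappa differentiable (at y)" by (auto simp: differentiable_def)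
 show "partial v kappa y = - eta y * (y \<bullet> v)" by (rule frechet_eqI[OF *])
qed

lemma continuous_kappa: "continuous_on A kappa" and continuous_eta: "continuous_on A eta"
 by (auto simp: kappa_def[abs_def] eta_def[abs_def] intro!: continuous_intros)

lemma kappa_eq_0: "1 <= norm y ==> kappa y = 0" and eta_eq_0: "1 <= norm y ==> eta y = 0"
 by (auto simp: kappa_def eta_def dot_square_norm max_def power_mono_iff abs_square_le_1 one_le_power)

lemma eta_bounds: "0 <= eta y" "eta y <= 6"
 by (auto simp: eta_def max_def power_le_one)

abbreviation unit_box :: "(real^3) set" where
 "unit_box \<equiv> cbox (- One) One"

lemma not_unit_box: "y \<notin> unit_box ==> 1 <= norm y"
proof (rule ccontr)
 assume "y \<notin> unit_box" "\<not> 1 <= norm y"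
 then have "\<bar>y \<bullet> i\<bar> <= 1" if "i \<in> Basis" for i using Basis_le_norm[OF that, of y] by simp
 then have "y \<in> unit_box" by (simp add: mem_box abs_le_iff minus_le_iff)
 then show False using \<open>y \<notin> unit_box\<close> by simp
qed

lemma lborel_integral_unit_box:
 fixes f :: "real^3 => real"
 assumes "continuous_on UNIV f" "!!y. 1 <= norm y ==> f y = 0"
 shows "integrable lborel f" "integral\<^sup>L lborel f = integral unit_box f"
 using lborel_integral_cbox[OF assms(1), of "- One" One] assms(2) not_unit_box by blast+

definition eta_mass :: real where
 "eta_mass = (LINT y|lborel. eta y)"

lemma eta_mass_pos: "0 < eta_mass"
proof -
 have i: "integrable lborel eta"
  by (intro lborel_integral_unit_box continuous_eta eta_eq_0)
 have "eta_mass ~= 0"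
 proof
  assume "eta_mass = 0"
  then have "AE y in lborel. eta y = 0"
   unfolding eta_mass_def using integral_nonneg_eq_0_iff_AE[OF i] eta_bounds by auto
  then have "AE y in lborel. y \<notin> ball (0::real^3) 1"
  proof eventually_elim
   case (elim y)
   then have "1 - y \<bullet> y <= 0" by (auto simp: eta_def max_def split: if_splits)
   then have "1 <= (norm y)^2" by (simp add: dot_square_norm)
   then show ?case using abs_square_less_1[of "norm y"] by (auto simp: dist_norm)
  qed
  then have "emeasure lborel (ball (0::real^3) 1) = 0"
   by (subst (asm) AE_iff_measurable[OF _ refl]) (auto simp: ball_def)
  then have "unit_ball_vol 3 <= 0" by (simp add: emeasure_ball ennreal_eq_0_iff)
  moreover have "0 < unit_ball_vol (3::real)" by (rule unit_ball_vol_pos) simp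
  ultimately show False by linarith
 qed
 moreover have "0 <= eta_mass" unfolding eta_mass_def by (simp add: eta_bounds)
 ultimately show ?thesis by simp
qed

text \<open>The parametrix averages \<open>s \<kappa>(y) h(t, x - s y)\<close>. With \<open>\<nabla>\<kappa> = - y \<eta>\<close> its Laplacian telescopes:
 an integration by parts in \<open>y\<close> turns the integrand into the \<open>s\<close>-derivative of
 \<open>\<integral> \<eta>(y) h(t, x - s y) dy\<close>. So it inverts the Laplacian up to an average of \<open>h\<close> at scale \<open>R\<close>, and it
 preserves compact supports, in contrast to the Newtonian potential.\<close>

definition parametrix :: "real => (real \<times> (real^3) => real) => real \<times> (real^3) => real" where
 "parametrix R h z = integral (cbox (0, - One) (R, One))
   (%w. fst w * kappa (snd w) * h (z - (0, fst w *\<^sub>R snd w)))"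

lemma smooth_blinfun:
 fixes f :: "'a::euclidean_space => real"
 assumes "smooth f"
 shows "(f has_derivative blinfun_apply (\<Sum>b\<in>Basis. partial b f x *\<^sub>R blinfun_inner_right b)) (at x)"
proof -
 note l = has_derivative_linear[OF smooth_has_partial[OF assms]]
 have eq: "partial v f x = (\<Sum>b\<in>Basis. partial b f x * (b \<bullet> v))" for v
 proof -
  have "partial (\<Sum>b\<in>Basis. (v \<bullet> b) *\<^sub>R b) f x = (\<Sum>b\<in>Basis. partial ((v \<bullet> b) *\<^sub>R b) f x)"
   using linear_sum[OF l[of x], of "%b. (v \<bullet> b) *\<^sub>R b" Basis] by simp
  then have "partial v f x = (\<Sum>b\<in>Basis. (v \<bullet> b) * partial b f x)"
   by (simp add: euclidean_representation partial_scaleR smooth_differentiable assms)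
  then show ?thesis
   by (simp add: mult.commute inner_commute)
 qed
 have "blinfun_apply (\<Sum>b\<in>Basis. partial b f x *\<^sub>R blinfun_inner_right b) v = partial v f x" for v
  unfolding eq[of v] by (simp add: blinfun.sum_left blinfun.scaleR_left)
 then have "blinfun_apply (\<Sum>b\<in>Basis. partial b f x *\<^sub>R blinfun_inner_right b) = (%v. partial v f x)"
  by (rule ext)
 then show ?thesis
  using smooth_has_partial[OF assms, of x] by simp
qed

lemma continuous_kernel:
 fixes h :: "real \<times> (real^3) => real"
 assumes "continuous_on UNIV h"
 shows "continuous_on A (%w. fst w * kappa (snd w) * h (z - (0, fst w *\<^sub>R snd w)))"
 by (intro continuous_on_mult continuous_on_compose2[OF continuous_kappa[of UNIV]]
   continuous_on_compose2[OF assms]) (auto intro!: continuous_intros)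

text \<open>The derivatives under the integral fall on \<open>h\<close> alone, so the kernel need not be smooth.\<close>

lemma parametrix_derivative:
 fixes h :: "real \<times> (real^3) => real"
 assumes h: "smooth h"
 shows "parametrix R h differentiable (at z)"
  "b \<in> Basis ==> partial b (parametrix R h) z = parametrix R (partial b h) z"
proof -
 define D where "D = (%z. \<Sum>b\<in>Basis. partial b h z *\<^sub>R blinfun_inner_right b)"
 define fx where "fx = (%z w. (fst w * kappa (snd w)) *\<^sub>R D (z - (0, fst w *\<^sub>R snd w)))"
 have D: "(h has_derivative blinfun_apply (D z)) (at z)" for z
  unfolding D_def by (rule smooth_blinfun[OF h])
 have cD: "continuous_on UNIV D"
  unfolding D_def by (intro continuous_intros smooth_continuous smooth_partial h)
 have cfx: "continuous_on A (%(z, w). fx z w)" for A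
  unfolding fx_def split_beta
  by (intro continuous_on_scaleR continuous_on_mult continuous_on_compose2[OF continuous_kappa[of UNIV]]
   continuous_on_compose2[OF cD]) (auto intro!: continuous_intros)
 have der: "((%z. parametrix R h z) has_derivative integral (cbox (0, - One) (R, One)) (fx z)) (at z within UNIV)"
  unfolding parametrix_def
 proof (rule leibniz_rule)
  fix z w
  have "((%z. h (z - (0, fst w *\<^sub>R snd w))) has_derivative blinfun_apply (D (z - (0, fst w *\<^sub>R snd w)))) (at z)"
   using diff_chain_at[OF has_derivative_diff[OF has_derivative_ident has_derivative_const] D]
   by (simp add: o_def)
  then show "((%z. fst w * kappa (snd w) * h (z - (0, fst w *\<^sub>R snd w))) has_derivative
    blinfun_apply (fx z w)) (at z within UNIV)"
   unfolding fx_def by (auto intro!: derivative_eq_intros simp: blinfun.scaleR_left)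
 next
  show "(%w. fst w * kappa (snd w) * h (z - (0, fst w *\<^sub>R snd w))) integrable_on cbox (0, - One) (R, One)" for z
   by (intro integrable_continuous continuous_kernel smooth_continuous h)
 qed (use cfx in auto)
 then show "parametrix R h differentiable (at z)"
  by (auto simp: differentiable_def)
 assume b: "b \<in> Basis"
 have "blinfun_apply (D y) b = partial b h y" for y
  using b by (simp add: D_def blinfun.sum_left blinfun.scaleR_left inner_Basis if_distrib[of "%x. _ * x"] cong: if_cong)
 then have e: "blinfun_apply (fx z w) b = fst w * kappa (snd w) * partial b h (z - (0, fst w *\<^sub>R snd w))" for w
  by (simp add: fx_def blinfun.scaleR_left)
 have "fx z integrable_on cbox (0, - One) (R, One)"
  by (intro integrable_continuous continuous_on_compose2[OF cfx[of UNIV], of _ "%w. (z, w)", simplified])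
   (auto intro!: continuous_intros)
 from integral_linear[OF this blinfun.bounded_linear_left[of b]]
 have "integral (cbox (0, - One) (R, One)) (fx z) b = parametrix R (partial b h) z"
  by (simp add: o_def e parametrix_def)
 then show "partial b (parametrix R h) z = parametrix R (partial b h) z"
  using frechet_eqI[of "parametrix R h" _ z b] der by simp
qed

lemma smooth_parametrix:
 assumes "smooth h" shows "smooth (parametrix R h)"
proof (rule smooth_coinduct[of _ "parametrix R ` Collect smooth"])
 fix f and b :: "real \<times> (real^3)" assume "f \<in> parametrix R ` Collect smooth" and b: "b \<in> Basis"
 then obtain h where h: "smooth h" "f = parametrix R h" by auto
 then have "partial b f = parametrix R (partial b h)"
  using parametrix_derivative(2)[OF h(1) b] by auto
 then show "partial b f \<in> parametrix R ` Collect smooth"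
  using smooth_partial[OF h(1) b] by auto
qed (use assms parametrix_derivative(1) in auto)

lemma parametrix_eq_0:
 assumes "!!y. norm y <= R ==> h (z - (0, y)) = 0"
 shows "parametrix R h z = 0"
proof -
 have "fst w * kappa (snd w) * h (z - (0, fst w *\<^sub>R snd w)) = 0" if "w \<in> cbox (0, - One) (R, One)" for w
 proof (cases "norm (snd w) < 1")
  case True
  have "0 <= fst w" "fst w <= R"
   using that by (cases w, auto simp: mem_box Basis_prod_def ball_Un)+
  then have "fst w * norm (snd w) <= R * 1"
   using True by (intro mult_mono) auto
  with \<open>0 <= fst w\<close> show ?thesis using assms[of "fst w *\<^sub>R snd w"] by simp
 qed (simp add: kappa_eq_0)
 then have "integral (cbox (0, - One) (R, One)) (%w. fst w * kappa (snd w) * h (z - (0, fst w *\<^sub>R snd w))) =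
   integral (cbox (0, - One) (R, One)) (%w::real \<times> (real^3). 0::real)"
  by (rule integral_cong)
 then show ?thesis
  unfolding parametrix_def by simp
qed

lemma test_fun_parametrix:
 assumes h: "h \<in> test_fun V" and VU: "!!t x y. (t, x) \<in> V ==> norm y <= R ==> (t, x + y) \<in> U"
 shows "parametrix R h \<in> test_fun U"
proof (rule test_funI(1))
 let ?K = "{a + b | a b. a \<in> support h \<and> b \<in> {0} \<times> cball 0 R}"
 show "compact ?K"
  by (intro compact_sums test_funD(2)[OF h] compact_Times) auto
 show "?K \<subseteq> U"
 proof
  fix z assume "z \<in> ?K"
  then obtain t x y where "z = (t, x + y)" "(t, x) \<in> support h" "norm y <= R" by auto
  then show "z \<in> U" using VU[of t x y] test_funD(3)[OF h] by auto
 qed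
 show "parametrix R h z = 0" if z: "z \<notin> ?K" for z
 proof (rule parametrix_eq_0)
  fix y :: "real^3" assume y: "norm y <= R"
  have "z - (0, y) \<notin> support h"
  proof
   assume "z - (0, y) \<in> support h"
   then have "z \<in> ?K" using y by (intro CollectI exI[of _ "z - (0, y)"] exI[of _ "(0, y)"]) auto
   then show False using z by simp
  qed
  then show "h (z - (0, y)) = 0" by (rule not_in_support[of "z - (0, y)" h])
 qed
 show "smooth (parametrix R h)" by (rule smooth_parametrix[OF test_funD(1)[OF h]])
qed

lemma parametrix_sum:
 assumes "!!i. i \<in> I ==> continuous_on UNIV (H i)"
 shows "parametrix R (%z. \<Sum>i\<in>I. H i z) z = (\<Sum>i\<in>I. parametrix R (H i) z)"
proof (cases "finite I")
 case True
 then show ?thesis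
  unfolding parametrix_def sum_distrib_left
  by (intro integral_sum integrable_continuous continuous_kernel assms)
qed (simp add: parametrix_def)

lemma laplace_parametrix_commute:
 assumes h: "smooth h"
 shows "laplace (parametrix R h) z = parametrix R (laplace h) z"
proof -
 have "dx j (dx j (parametrix R h)) z = parametrix R (dx j (dx j h)) z" for j
 proof -
  have "dx j (parametrix R h) = parametrix R (dx j h)"
   using parametrix_derivative(2)[OF h dx_Basis] by auto
  then show ?thesis using parametrix_derivative(2)[OF smooth_partial[OF h dx_Basis] dx_Basis] by simp
 qed
 then show ?thesis
  using parametrix_sum[of UNIV "%j. dx j (dx j h)" R z] h
  by (simp add: laplace_def[abs_def] smooth_continuous smooth_partial)
qed

lemma laplace_parametrix:
 assumes h: "h \<in> test_fun V" and R: "0 <= R"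
 shows "laplace (parametrix R h) (t, x) =
  (LINT y|lborel. eta y * h (t, x - R *\<^sub>R y)) - eta_mass * h (t, x)"
proof -
 have sm: "smooth h" by (rule test_funD(1)[OF h])
 note sl = slice_partial[where t=t and x=x and c="- s" for s, simplified]
 have cs: "continuous_on UNIV (%y. F (t, x - s *\<^sub>R y))" if "smooth F" for F s
  using continuous_slice[OF that, where t=t and x=x and c="-s" and A=UNIV] by simp
 define q where "q = (%s y. - eta y * (\<Sum>j\<in>UNIV. y $ j * dx j h (t, x - s *\<^sub>R y)))"
 have cq: "continuous_on A (%(s, y). q s y)" for A
  unfolding q_def split_beta
  by (intro continuous_intros continuous_on_compose2[OF continuous_eta[of UNIV]]
   continuous_on_compose2[OF smooth_continuous[OF smooth_partial[OF sm dx_Basis], of UNIV]]) auto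
 have "laplace (parametrix R h) (t, x) = parametrix R (laplace h) (t, x)"
  by (rule laplace_parametrix_commute[OF sm])
 also have "... = integral (cbox 0 R) (%s. integral unit_box (%y. s * kappa y * laplace h (t, x - s *\<^sub>R y)))"
  unfolding parametrix_def
  by (subst integral_prod_continuous)
   (use continuous_kernel[OF smooth_continuous[OF smooth_laplace[OF sm]], where z="(t, x)"] in simp_all)
 also have "... = integral (cbox 0 R) (%s. integral unit_box (q s))"
 proof (rule integral_cong)
  fix s assume "s \<in> cbox 0 R"
  \<comment> \<open>integration by parts in \<open>y\<close>, one coordinate at a time\<close>
  have j: "(LINT y|lborel. s * kappa y * dx j (dx j h) (t, x - s *\<^sub>R y)) =
    (LINT y|lborel. - eta y * y $ j * dx j h (t, x - s *\<^sub>R y))"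
   and int: "integrable lborel (%y. s * kappa y * dx j (dx j h) (t, x - s *\<^sub>R y))"
    "integrable lborel (%y. - eta y * y $ j * dx j h (t, x - s *\<^sub>R y))" for j
  proof -
   have sj: "smooth (dx j h)" by (intro smooth_partial sm dx_Basis)
   have pk: "partial (axis j 1) kappa = (%y. - eta y * y $ j)"
    by (simp add: partial_kappa inner_axis fun_eq_iff)
   have pg: "partial (axis j 1) (%y. dx j h (t, x - s *\<^sub>R y)) = (%y. - s * dx j (dx j h) (t, x - s *\<^sub>R y))"
    by (rule ext) (simp add: sl(2)[OF sj])
   have ce: "continuous_on UNIV (%y. - eta y * y $ j)"
    by (intro continuous_intros continuous_eta)
   note ibp = integral_by_parts[of kappa "axis j 1" "%y. dx j h (t, x - s *\<^sub>R y)" 1, unfolded pk pg,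
     OF kappa_differentiable ce sl(1)[OF sj] continuous_on_mult_left[OF cs[OF smooth_partial[OF sj dx_Basis]]]]
   have k0: "kappa y = 0" if "y \<notin> cball 0 1" for y using that by (simp add: kappa_eq_0)
   show "(LINT y|lborel. s * kappa y * dx j (dx j h) (t, x - s *\<^sub>R y)) =
    (LINT y|lborel. - eta y * y $ j * dx j h (t, x - s *\<^sub>R y))"
    using ibp(1)[OF k0] by (simp add: mult.left_commute mult.assoc)
   show "integrable lborel (%y. s * kappa y * dx j (dx j h) (t, x - s *\<^sub>R y))"
    using integrable_minus[OF ibp(2)[OF k0]] by (simp add: mult.left_commute mult.assoc)
   show "integrable lborel (%y. - eta y * y $ j * dx j h (t, x - s *\<^sub>R y))"
    by (rule ibp(3)[OF k0])
  qed
  have "integral unit_box (%y. s * kappa y * laplace h (t, x - s *\<^sub>R y)) =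
    (LINT y|lborel. s * kappa y * laplace h (t, x - s *\<^sub>R y))"
   by (rule lborel_integral_unit_box(2)[symmetric])
    (auto simp: kappa_eq_0 intro!: continuous_intros continuous_kappa cs smooth_laplace sm)
  also have "... = (\<Sum>j\<in>UNIV. (LINT y|lborel. s * kappa y * dx j (dx j h) (t, x - s *\<^sub>R y)))"
   unfolding laplace_def sum_distrib_left by (rule Bochner_Integration.integral_sum) (rule int)
  also have "... = (\<Sum>j\<in>UNIV. (LINT y|lborel. - eta y * y $ j * dx j h (t, x - s *\<^sub>R y)))"
   by (simp only: j)
  also have "... = (LINT y|lborel. q s y)"
   unfolding q_def sum_distrib_left
   by (subst Bochner_Integration.integral_sum[symmetric]) (use int(2) in \<open>simp_all add: mult.assoc\<close>)
  also have "... = integral unit_box (q s)"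
   by (rule lborel_integral_unit_box(2))
    (auto simp: q_def eta_eq_0 intro!: continuous_intros continuous_eta cs smooth_partial sm)
  finally show "integral unit_box (%y. s * kappa y * laplace h (t, x - s *\<^sub>R y)) = integral unit_box (q s)" .
 qed
 also have "... = integral unit_box (%y. integral (cbox 0 R) (%s. q s y))"
  by (rule integral_swap_continuous[OF cq])
 also have "... = integral unit_box (%y. eta y * h (t, x - R *\<^sub>R y) - eta y * h (t, x))"
 proof (rule integral_cong)
  fix y
  have d: "((%s. h (t, x - s *\<^sub>R y)) has_real_derivative - (\<Sum>j\<in>UNIV. y $ j * dx j h (t, x - s *\<^sub>R y))) (at s)" for s
  proof -
   have "((%s. h ((t, x) + s *\<^sub>R (0, - y))) has_real_derivative partial (0, - y) h ((t, x) + s *\<^sub>R (0, - y))) (at s)"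
    by (rule smooth_line_derivative[OF sm])
   moreover have "partial (0, - y) h z = - (\<Sum>j\<in>UNIV. y $ j * dx j h z)" for z
   proof -
    note l = has_derivative_linear[OF smooth_has_partial[OF sm, of z]]
    have "(0, - y) = (\<Sum>j\<in>UNIV. (- y $ j) *\<^sub>R ((0::real), axis j (1::real)))"
     by (simp add: prod_eq_iff fst_sum snd_sum vec_eq_iff axis_def if_distrib cong: if_cong)
    then have "partial (0, - y) h z = (\<Sum>j\<in>UNIV. partial ((- y $ j) *\<^sub>R (0, axis j 1)) h z)"
     using linear_sum[OF l, of "%j. (- y $ j) *\<^sub>R (0, axis j 1)" UNIV] by simp
    also have "... = (\<Sum>j\<in>UNIV. - y $ j * dx j h z)"
     by (simp only: partial_scaleR[OF smooth_differentiable[OF sm]])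
    finally show ?thesis by (simp add: sum_negf)
   qed
   ultimately show ?thesis by (simp add: )
  qed
  have "((%s. q s y) has_integral (eta y * h (t, x - R *\<^sub>R y) - eta y * h (t, x - 0 *\<^sub>R y))) {0..R}"
  proof (rule fundamental_theorem_of_calculus[OF R])
   fix s
   have "((%s. eta y * h (t, x - s *\<^sub>R y)) has_real_derivative q s y) (at s within {0..R})"
    using DERIV_cmult[OF d, of "eta y" s] unfolding q_def by (simp add: has_field_derivative_at_within)
   then show "((%s. eta y * h (t, x - s *\<^sub>R y)) has_vector_derivative q s y) (at s within {0..R})"
    by (simp add: has_real_derivative_iff_has_vector_derivative)
  qed
  then show "integral (cbox 0 R) (%s. q s y) = eta y * h (t, x - R *\<^sub>R y) - eta y * h (t, x)"
   by (simp add: integral_unique)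
 qed
 also have "... = (LINT y|lborel. eta y * h (t, x - R *\<^sub>R y) - eta y * h (t, x))"
  by (rule lborel_integral_unit_box(2)[symmetric])
   (auto simp: eta_eq_0 intro!: continuous_intros continuous_eta cs sm)
 also have "... = (LINT y|lborel. eta y * h (t, x - R *\<^sub>R y)) - eta_mass * h (t, x)"
 proof -
  have "integrable lborel (%y. eta y * h (t, x - R *\<^sub>R y))" "integrable lborel eta"
   by (rule lborel_integral_unit_box(1);
    auto simp: eta_eq_0 intro!: continuous_intros continuous_eta cs sm)+
  then show ?thesis by (simp add: eta_mass_def)
 qed
 finally show ?thesis .
qed

text \<open>The substitution \<open>y \<mapsto> (x - y) / R\<close> and \<open>\<eta> <= 6\<close>.\<close>

lemma eta_average_bound:
 fixes h :: "real \<times> (real^3) => real"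
 assumes h: "h \<in> test_fun V" and R: "0 < R"
 shows "\<bar>LINT y|lborel. eta y * h (t, x - R *\<^sub>R y)\<bar> <= 6 / R ^ 3 * (LINT y|lborel. \<bar>h (t, y)\<bar>)"
proof -
 have i: "integrable lborel (%y. \<bar>h (t, y)\<bar>)"
  using slice_integrable[OF h] by auto
 have a: "integrable lborel (%y. \<bar>h (t, x - R *\<^sub>R y)\<bar>)"
  "(LINT y|lborel. \<bar>h (t, y)\<bar>) = R ^ 3 * (LINT y|lborel. \<bar>h (t, x - R *\<^sub>R y)\<bar>)"
  using lborel_integral_affine[of "- R" "%y. \<bar>h (t, y)\<bar>" x] R i by simp_all
 have "\<bar>LINT y|lborel. eta y * h (t, x - R *\<^sub>R y)\<bar> <= (LINT y|lborel. 6 * \<bar>h (t, x - R *\<^sub>R y)\<bar>)"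
 proof (rule integral_abs_bound_integral)
  show "integrable lborel (%y. eta y * h (t, x - R *\<^sub>R y))"
   using continuous_slice[OF test_funD(1)[OF h], where t=t and x=x and c="-R" and A=UNIV]
   by (intro lborel_integral_unit_box(1)) (auto simp: eta_eq_0 intro!: continuous_intros continuous_eta)
  show "integrable lborel (%y. 6 * \<bar>h (t, x - R *\<^sub>R y)\<bar>)" using a(1) by simp
  show "\<bar>eta y * h (t, x - R *\<^sub>R y)\<bar> <= 6 * \<bar>h (t, x - R *\<^sub>R y)\<bar>" for y
   using eta_bounds[of y] by (simp add: abs_mult mult_right_mono)
 qed
 also have "... = 6 / R ^ 3 * (LINT y|lborel. \<bar>h (t, y)\<bar>)"
  using R by (simp add: a(2))
 finally show ?thesis .
qed

section \<open>Approximation of bounded measurable functions by test functions\<close>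

text \<open>The level sets of two smooth functions exhaust the region where both are positive. The factor
 \<open>1 - exp(- n bump(n w - 1))\<close> vanishes for \<open>w <= 1/n\<close> and tends to 1 wherever \<open>w > 0\<close>.\<close>

lemma cutoff_sequence:
 fixes w1 w2 :: "'a::euclidean_space => real"
 assumes w1: "smooth w1" and w2: "smooth w2"
  and cpt: "!!\<epsilon>. 0 < \<epsilon> ==> compact {z. \<epsilon> <= w1 z \<and> \<epsilon> <= w2 z}"
 obtains ct :: "nat => 'a => real"
 where "!!n. ct n \<in> test_fun {z. 0 < w1 z \<and> 0 < w2 z}" "!!n z. 0 <= ct n z" "!!n z. ct n z <= 1"
  "!!z. 0 < w1 z ==> 0 < w2 z ==> (%n. ct n z) \<longlonglongrightarrow> 1"
proof -
 define G where "G n s = 1 - exp (- (real n * bump (real n * s - 1)))" for n s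
 have G0: "G n s = 0" if "real n * s <= 1" for n s using that by (simp add: G_def bump_eq_0)
 have G01: "0 <= G n s" "G n s <= 1" for n s by (auto simp: G_def)
 have G1: "(%n. G n s) \<longlonglongrightarrow> 1" if "0 < s" for s
 proof -
  have "(%n. exp (- (real n * bump (real n * s - 1)))) \<longlonglongrightarrow> 0"
  proof (rule tendsto_sandwich[of "%n. 0" _ _ "%n. exp (- (real n * bump 1))"])
   have "\<forall>\<^sub>F n in sequentially. 2 / s <= real n"
    using filterlim_real_sequentially by (auto simp: filterlim_at_top)
   then show "\<forall>\<^sub>F n in sequentially. exp (- (real n * bump (real n * s - 1))) <= exp (- (real n * bump 1))"
   proof eventually_elim
    case (elim n)
    then have "1 <= real n * s - 1" using that by (simp add: field_simps)
    then show ?case using bump_mono by (simp add: mult_left_mono)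
   qed
   have "(%n. exp (- bump 1) ^ n) \<longlonglongrightarrow> 0" by (rule LIMSEQ_power_zero) simp
   then show "(%n. exp (- (real n * bump 1))) \<longlonglongrightarrow> 0"
    by (simp add: exp_of_nat_mult[symmetric])
  qed auto
  from tendsto_diff[OF tendsto_const this, of 1] show ?thesis by (simp add: G_def)
 qed
 have sG: "smooth (%z. G n (w z))" if "smooth w" for n and w :: "'a => real"
 proof -
  have "smooth (%z. bump (real n * w z - 1))"
   by (rule smooth_compose[OF smooth_bump, of "%z. real n * w z - 1"])
    (intro smooth_diff smooth_cmult smooth_const that)
  then have "smooth (%z. - (real n * bump (real n * w z - 1)))"
   by (intro smooth_minus smooth_cmult)
  from smooth_compose[OF smooth_exp this] show ?thesis
   unfolding G_def by (intro smooth_diff smooth_const)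
 qed
 show ?thesis
 proof (rule that[of "%n z. G n (w1 z) * G n (w2 z)"])
  fix n
  show "(%z. G n (w1 z) * G n (w2 z)) \<in> test_fun {z. 0 < w1 z \<and> 0 < w2 z}"
  proof (rule test_funI(1)[OF smooth_mult[OF sG[OF w1] sG[OF w2]]])
   have pos: "0 < 1 / real (max 1 n)" by simp
   show "compact {z. 1 / real (max 1 n) <= w1 z \<and> 1 / real (max 1 n) <= w2 z}"
    by (rule cpt[OF pos])
   show "{z. 1 / real (max 1 n) <= w1 z \<and> 1 / real (max 1 n) <= w2 z} \<subseteq> {z. 0 < w1 z \<and> 0 < w2 z}"
    using less_le_trans[OF pos] by blast
   show "G n (w1 z) * G n (w2 z) = 0" if "z \<notin> {z. 1 / real (max 1 n) <= w1 z \<and> 1 / real (max 1 n) <= w2 z}" for z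
   proof -
    have "real n * s <= 1" if "\<not> 1 / real (max 1 n) <= s" for s
    proof (cases "n = 0")
     case False
     then have "real (max 1 n) = real n" by simp
     then show ?thesis using that False by (simp add: field_simps not_le)
    qed simp
    then show ?thesis using that G0 by auto
   qed
  qed
  show "0 <= G n (w1 z) * G n (w2 z)" "G n (w1 z) * G n (w2 z) <= 1" for z
   using G01 by (auto intro: mult_le_one)
 next
  fix z assume "0 < w1 z" "0 < w2 z"
  from tendsto_mult[OF G1[OF this(1)] G1[OF this(2)]]
  show "(%n. G n (w1 z) * G n (w2 z)) \<longlonglongrightarrow> 1" by simp
 qed
qed

lemma approx_continuous:
 fixes f :: "'a::euclidean_space => real"
 assumes f: "f \<in> borel_measurable borel" and L: "!!z. \<bar>f z\<bar> <= L"
 obtains g where "!!n::nat. continuous_on UNIV (g n)" "!!n z. \<bar>g n z\<bar> <= L"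
  "AE z in lborel. (%n. g n z) \<longlonglongrightarrow> f z"
proof -
 have "f measurable_on UNIV"
  using f by (intro lebesgue_measurable_imp_measurable_on) (auto intro: measurable_completion)
 then obtain N g where N: "negligible N" and g: "!!n::nat. continuous_on UNIV (g n)"
  and lim: "!!x. x \<notin> N ==> (%n. g n x) \<longlonglongrightarrow> f x"
  unfolding measurable_on_def by auto
 have L0: "0 <= L" using L[of undefined] by linarith
 have "AE z in lebesgue. z \<notin> N"
  using N by (intro AE_not_in) (simp add: negligible_iff_null_sets)
 then have N: "AE z in lborel. z \<notin> N" by (simp add: AE_completion_iff)
 show ?thesis
 proof (rule that[of "%n x. max (- L) (min L (g n x))"])
  show "continuous_on UNIV (%x. max (- L) (min L (g n x)))" for n
   by (intro continuous_intros g)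
  show "\<bar>max (- L) (min L (g n z))\<bar> <= L" for n z using L0 by auto
  show "AE z in lborel. (%n. max (- L) (min L (g n z))) \<longlonglongrightarrow> f z"
   using N
  proof eventually_elim
   case (elim z)
   have "(%n. max (- L) (min L (g n z))) \<longlonglongrightarrow> max (- L) (min L (f z))"
    by (intro tendsto_intros lim elim)
   also have "max (- L) (min L (f z)) = f z" using L[of z] by (auto simp: abs_le_iff)
   finally show ?case .
  qed
 qed
qed

text \<open>Polynomials are smooth, so Stone-Weierstrass replaces mollification: multiply by a cutoff a
 polynomial that is uniformly close, on the support of the cutoff, to a continuous approximation.\<close>

lemma approx_test_functions:
 fixes f :: "'a::euclidean_space => real"
 assumes chi: "!!n. ct n \<in> test_fun U" "!!n z. 0 <= ct n z" "!!n z. ct n z <= 1"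
   "!!z. z \<in> U ==> (%n::nat. ct n z) \<longlonglongrightarrow> 1"
  and f: "f \<in> borel_measurable borel" and L: "!!z. \<bar>f z\<bar> <= L"
 obtains h where "!!n::nat. h n \<in> test_fun U" "!!n z. \<bar>h n z\<bar> <= L + 1"
  "AE z in lborel. z \<in> U --> (%n. h n z) \<longlonglongrightarrow> f z"
proof (rule approx_continuous[OF f L])
 fix g' :: "nat => 'a => real"
 assume g': "!!n. continuous_on UNIV (g' n)" "!!n z. \<bar>g' n z\<bar> <= L"
  "AE z in lborel. (%n. g' n z) \<longlonglongrightarrow> f z"
 have L0: "0 <= L" using L[of undefined] by linarith
 have "\<exists>p. real_polynomial_function p \<and> (\<forall>x\<in>support (ct n). \<bar>g' n x - p x\<bar> < inverse (real (Suc n)))" for n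
 proof -
  have "continuous_on (support (ct n)) (g' n)"
   by (rule continuous_on_subset[OF g'(1)]) simp
  moreover have "0 < inverse (real (Suc n))" by simp
  ultimately obtain q where "real_polynomial_function q"
    "!!x. x \<in> support (ct n) ==> \<bar>g' n x - q x\<bar> < inverse (real (Suc n))"
   using Stone_Weierstrass_real_polynomial_function[OF test_funD(2)[OF chi(1)]] by metis
  then show ?thesis by blast
 qed
 then obtain p where p: "!!n. real_polynomial_function (p n)"
  "!!n x. x \<in> support (ct n) ==> \<bar>g' n x - p n x\<bar> < inverse (real (Suc n))" by metis
 define h where "h n x = p n x * ct n x" for n x
 have close: "\<bar>h n x - g' n x * ct n x\<bar> <= inverse (real (Suc n))" for n x
 proof (cases "x \<in> support (ct n)")
  case True
  have "\<bar>h n x - g' n x * ct n x\<bar> = \<bar>g' n x - p n x\<bar> * ct n x"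
   using chi(2)[of n x] by (simp add: h_def abs_mult left_diff_distrib[symmetric] abs_minus_commute)
  also have "... <= \<bar>g' n x - p n x\<bar> * 1" by (intro mult_left_mono chi) simp
  finally show ?thesis using p(2)[OF True] by simp
 next
  case False
  then have "ct n x = 0" by (rule not_in_support[of x "ct n"])
  then show ?thesis by (simp add: h_def)
 qed
 show ?thesis
 proof (rule that[of h])
  show "h n \<in> test_fun U" for n
   unfolding h_def[abs_def] by (rule test_fun_mult[OF chi(1) smooth_polynomial[OF p(1)]])
  show "\<bar>h n z\<bar> <= L + 1" for n z
  proof -
   have "\<bar>g' n z * ct n z\<bar> <= L * 1"
    unfolding abs_mult by (rule mult_mono) (use L0 chi(2,3)[of n z] g'(2) in auto)
   moreover have "inverse (real (Suc n)) <= 1" by (simp add: field_simps)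
   ultimately show ?thesis using close[of n z] by linarith
  qed
  from g'(3)
  show "AE z in lborel. z \<in> U --> (%n. h n z) \<longlonglongrightarrow> f z"
  proof eventually_elim
   case (elim z)
   show ?case
   proof
    assume "z \<in> U"
    have "(%n. g' n z * ct n z) \<longlonglongrightarrow> f z * 1"
     using elim chi(4)[OF \<open>z \<in> U\<close>] by (rule tendsto_mult)
    moreover have "(%n. h n z - g' n z * ct n z) \<longlonglongrightarrow> 0"
     by (rule Lim_null_comparison[OF _ LIMSEQ_inverse_real_of_nat]) (use close in auto)
    ultimately have "(%n. g' n z * ct n z + (h n z - g' n z * ct n z)) \<longlonglongrightarrow> f z * 1 + 0"
     by (rule tendsto_add)
    then show "(%n. h n z) \<longlonglongrightarrow> f z" by simp
   qed
  qed
 qed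
qed

lemma quadratic_pos_iff: "0 < (t - t1) * (t2 - t) \<longleftrightarrow> t1 < t \<and> t < (t2::real)" if "t1 < t2"
 using that by (auto simp: zero_less_mult_iff)

lemma quadratic_nonneg_iff: "0 <= (t - t1) * (t2 - t) \<longleftrightarrow> t1 <= t \<and> t <= (t2::real)" if "t1 < t2"
 using that by (auto simp: zero_le_mult_iff)

lemma approx_interval:
 fixes f :: "real => real"
 assumes "t1 < t2" and f: "f \<in> borel_measurable borel" "!!z. \<bar>f z\<bar> <= L"
 obtains h where "!!n::nat. h n \<in> test_fun {t1<..<t2}" "!!n z. \<bar>h n z\<bar> <= L + 1"
  "AE z in lborel. z \<in> {t1<..<t2} --> (%n. h n z) \<longlonglongrightarrow> f z"
proof -
 let ?w = "%t. (t - t1) * (t2 - t)"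
 have sm: "smooth ?w"
  by (intro smooth_mult smooth_diff smooth_const smooth_linear bounded_linear_ident)
 have cpt: "compact {z. \<epsilon> <= ?w z \<and> \<epsilon> <= ?w z}" if "0 < \<epsilon>" for \<epsilon>
 proof -
  have "closed {z. \<epsilon> <= ?w z \<and> \<epsilon> <= ?w z}"
   by (intro closed_Collect_conj closed_Collect_le continuous_intros)
  moreover have "{z. \<epsilon> <= ?w z \<and> \<epsilon> <= ?w z} \<subseteq> {t1..t2}"
   using quadratic_nonneg_iff[OF assms(1)] that by (smt (verit) atLeastAtMost_iff mem_Collect_eq subsetI)
  ultimately show ?thesis
   using bounded_closed_interval bounded_subset compact_eq_bounded_closed by blast
 qed
 have U: "{z. 0 < ?w z \<and> 0 < ?w z} = {t1<..<t2}"
  by (simp add: quadratic_pos_iff[OF assms(1)] set_eq_iff)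
 show ?thesis
 proof (rule cutoff_sequence[OF sm sm cpt])
  fix ct :: "nat => real => real"
  assume ct: "!!n. ct n \<in> test_fun {z. 0 < ?w z \<and> 0 < ?w z}" "!!n z. 0 <= ct n z" "!!n z. ct n z <= 1"
   "!!z. 0 < ?w z ==> 0 < ?w z ==> (%n. ct n z) \<longlonglongrightarrow> 1"
  show ?thesis
  proof (rule approx_test_functions[OF ct(1)[unfolded U] ct(2,3) _ f that])
   fix z assume "z \<in> {t1<..<t2}"
   then have "0 < ?w z" using quadratic_pos_iff[OF assms(1), of z] by simp
   then show "(%n. ct n z) \<longlonglongrightarrow> 1" using ct(4) by blast
  qed
 qed
qed

lemma approx_cylinder:
 fixes f :: "real \<times> (real^3) => real"
 assumes "t1 < t2" "0 < \<rho>" and f: "f \<in> borel_measurable borel" "!!z. \<bar>f z\<bar> <= L"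
 obtains h where "!!n::nat. h n \<in> test_fun ({t1<..<t2} \<times> ball x0 \<rho>)" "!!n z. \<bar>h n z\<bar> <= L + 1"
  "AE z in lborel. z \<in> {t1<..<t2} \<times> ball x0 \<rho> --> (%n. h n z) \<longlonglongrightarrow> f z"
proof -
 let ?w = "%z::real \<times> (real^3). (fst z - t1) * (t2 - fst z)"
 let ?v = "%z::real \<times> (real^3). \<rho>^2 - (\<Sum>j\<in>UNIV. (snd z $ j - x0 $ j)^2)"
 have ve: "?v z = \<rho>^2 - (dist x0 (snd z))^2" for z
  by (simp add: dist_vec_def L2_set_def dist_norm power2_commute sum_nonneg)
 have vpos: "0 < ?v z \<longleftrightarrow> snd z \<in> ball x0 \<rho>" for z
  unfolding ve using power2_less_imp_less[of "dist x0 (snd z)" \<rho>]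
   power_strict_mono[of "dist x0 (snd z)" \<rho> 2] assms(2) by auto
 have vnn: "0 <= ?v z \<longleftrightarrow> snd z \<in> cball x0 \<rho>" for z
  unfolding ve using power2_le_imp_le[of "dist x0 (snd z)" \<rho>]
   power_mono[of "dist x0 (snd z)" \<rho> 2] assms(2) by auto
 have sm: "smooth ?w" "smooth ?v"
 proof -
  show "smooth ?w"
   by (intro smooth_mult smooth_diff smooth_const smooth_linear bounded_linear_fst)
  show "smooth ?v"
   by (intro smooth_diff smooth_const smooth_sum smooth_power smooth_linear
    bounded_linear_compose[OF bounded_linear_vec_nth bounded_linear_snd])
 qed
 have cpt: "compact {z. \<epsilon> <= ?w z \<and> \<epsilon> <= ?v z}" if "0 < \<epsilon>" for \<epsilon>
 proof -
  have "closed {z. \<epsilon> <= ?w z \<and> \<epsilon> <= ?v z}"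
   by (intro closed_Collect_conj closed_Collect_le continuous_intros)
  moreover have "{z. \<epsilon> <= ?w z \<and> \<epsilon> <= ?v z} \<subseteq> {t1..t2} \<times> cball x0 \<rho>"
  proof
   fix z assume "z \<in> {z. \<epsilon> <= ?w z \<and> \<epsilon> <= ?v z}"
   then have "0 <= ?w z" "0 <= ?v z" using that by auto
   then show "z \<in> {t1..t2} \<times> cball x0 \<rho>"
    using quadratic_nonneg_iff[OF assms(1), of "fst z"] vnn[of z] by (cases z) simp
  qed
  ultimately show ?thesis
   using bounded_Times[OF bounded_closed_interval[of t1 t2] bounded_cball[of x0 \<rho>]]
    bounded_subset compact_eq_bounded_closed by blast
 qed
 have U: "{z. 0 < ?w z \<and> 0 < ?v z} = {t1<..<t2} \<times> ball x0 \<rho>"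
  using quadratic_pos_iff[OF assms(1)] vpos by (simp add: set_eq_iff)
 show ?thesis
 proof (rule cutoff_sequence[OF sm cpt])
  fix ct :: "nat => real \<times> (real^3) => real"
  assume ct: "!!n. ct n \<in> test_fun {z. 0 < ?w z \<and> 0 < ?v z}" "!!n z. 0 <= ct n z" "!!n z. ct n z <= 1"
   "!!z. 0 < ?w z ==> 0 < ?v z ==> (%n. ct n z) \<longlonglongrightarrow> 1"
  show ?thesis
  proof (rule approx_test_functions[OF ct(1)[unfolded U] ct(2,3) _ f that])
   fix z assume "z \<in> {t1<..<t2} \<times> ball x0 \<rho>"
   then have "0 < ?w z" "0 < ?v z" unfolding U[symmetric] by simp_all
   then show "(%n. ct n z) \<longlonglongrightarrow> 1" by (rule ct(4))
  qed
 qed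
qed

section \<open>The John-Nirenberg inequality on dyadic cubes\<close>

text \<open>Half-open cubes, given by center and half side, so that the eight children partition their parent.\<close>

definition cube :: "real^3 => real => (real^3) set" where
 "cube c s = {x. \<forall>i. c $ i - s <= x $ i \<and> x $ i < c $ i + s}"

definition corners :: "(real^3) set" where
 "corners = {e. \<forall>i. e $ i = 1 \<or> e $ i = - 1}"

abbreviation child :: "real^3 => real => real^3 => real^3" where
 "child c s e \<equiv> c + (s / 2) *\<^sub>R e"

lemma corners_card: "finite corners" "card corners = 8"
proof -
 have "bij_betw (%A. (\<chi> i. if i \<in> A then 1 else (- 1 :: real))) (Pow (UNIV :: 3 set)) corners"
 proof (rule bij_betw_byWitness[where f' = "%e. {i. e $ i = 1}"])
  show "\<forall>e\<in>corners. (\<chi> i. if i \<in> {i. e $ i = 1} then 1 else - 1) = e"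
   by (auto simp: corners_def vec_eq_iff)
 qed (auto simp: corners_def split: if_splits)
 then show "finite corners" "card corners = 8"
  using bij_betw_finite bij_betw_same_card by (fastforce simp: card_Pow)+
qed

lemma cube_measurable [measurable]: "cube c s \<in> sets borel"
 unfolding cube_def by measurable

lemma cube_subset_cbox: "cube c s \<subseteq> cbox (c - (\<chi> i. s)) (c + (\<chi> i. s))"
 by (auto simp: cube_def mem_box_cart less_imp_le)

lemma cube_measure:
 assumes "0 < s"
 shows "emeasure lborel (cube c s) = ennreal (8 * s ^ 3)" "measure lborel (cube c s) = 8 * s ^ 3"
proof -
 let ?a = "c - (\<chi> i. s)" and ?b = "c + (\<chi> i. s)"
 have ne: "cbox ?a ?b ~= {}" using assms by (simp add: interval_ne_empty_cart)
 have m: "measure lborel (cbox ?a ?b) = 8 * s ^ 3"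
  using content_cbox_cart[OF ne] by (simp add: power_mult_distrib)
 have eq: "emeasure lborel (box ?a ?b) = emeasure lborel (cbox ?a ?b)"
  by (simp add: emeasure_lborel_box_eq emeasure_lborel_cbox_eq)
 have e: "emeasure lborel (cbox ?a ?b) = ennreal (8 * s ^ 3)"
  using m emeasure_lborel_cbox_finite[of ?a ?b]
  by (subst emeasure_eq_ennreal_measure) (auto simp: less_top)
 have "box ?a ?b \<subseteq> cube c s" by (auto simp: cube_def mem_box_cart less_imp_le)
 then have "emeasure lborel (box ?a ?b) <= emeasure lborel (cube c s)"
  by (intro emeasure_mono) auto
 moreover have "emeasure lborel (cube c s) <= emeasure lborel (cbox ?a ?b)"
  by (intro emeasure_mono cube_subset_cbox) auto
 ultimately show *: "emeasure lborel (cube c s) = ennreal (8 * s ^ 3)"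
  using eq e by simp
 show "measure lborel (cube c s) = 8 * s ^ 3"
  using * assms by (simp add: measure_def)
qed

lemma cube_children: "cube c s = (\<Union>e\<in>corners. cube (child c s e) (s / 2))"
proof (intro set_eqI iffI)
 fix x assume x: "x \<in> cube c s"
 define e where "e = (\<chi> i. if c $ i <= x $ i then 1 else (- 1 :: real))"
 have "e \<in> corners" by (simp add: e_def corners_def)
 moreover have "x \<in> cube (child c s e) (s / 2)"
 proof -
  have "c $ i + s / 2 * e $ i - s / 2 <= x $ i \<and> x $ i < c $ i + s / 2 * e $ i + s / 2" for i
  proof -
   have "c $ i - s <= x $ i" "x $ i < c $ i + s" using x by (auto simp: cube_def)
   then show ?thesis by (auto simp: e_def)
  qed
  then show ?thesis by (simp add: cube_def)
 qed
 ultimately show "x \<in> (\<Union>e\<in>corners. cube (child c s e) (s / 2))" by blast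
next
 fix x assume "x \<in> (\<Union>e\<in>corners. cube (child c s e) (s / 2))"
 then obtain e where e: "e \<in> corners" "x \<in> cube (child c s e) (s / 2)" by blast
 have "c $ i - s <= x $ i \<and> x $ i < c $ i + s" for i
 proof -
  have "c $ i + s / 2 * e $ i - s / 2 <= x $ i" "x $ i < c $ i + s / 2 * e $ i + s / 2"
   using e(2) by (auto simp: cube_def)
  moreover have "e $ i = 1 \<or> e $ i = -1" using e(1) by (simp add: corners_def)
  ultimately show ?thesis by auto
 qed
 then show "x \<in> cube c s" by (simp add: cube_def)
qed

lemma children_disjoint: "disjoint_family_on (%e. cube (child c s e) (s / 2)) corners"
 unfolding disjoint_family_on_def
proof (intro ballI impI)
 fix e e' assume e: "e \<in> corners" "e' \<in> corners" "e ~= e'"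
 then obtain i where "e $ i ~= e' $ i" by (auto simp: vec_eq_iff)
 then consider "e $ i = 1" "e' $ i = - 1" | "e $ i = - 1" "e' $ i = 1"
  proof -
   have "e $ i = 1 \<or> e $ i = - 1" "e' $ i = 1 \<or> e' $ i = - 1"
    using e(1,2) by (simp_all add: corners_def)
   then show ?thesis using that \<open>e $ i ~= e' $ i\<close> by metis
  qed
 then show "cube (child c s e) (s / 2) \<inter> cube (child c s e') (s / 2) = {}"
 proof cases
  case 1
  have "False" if "x \<in> cube (child c s e) (s / 2)" "x \<in> cube (child c s e') (s / 2)" for x
  proof -
   have "c $ i + s / 2 * e $ i - s / 2 <= x $ i" "x $ i < c $ i + s / 2 * e' $ i + s / 2"
    using that by (auto simp: cube_def)
   then show False using 1 by simp
  qed
  then show ?thesis by blast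
 next
  case 2
  have "False" if "x \<in> cube (child c s e) (s / 2)" "x \<in> cube (child c s e') (s / 2)" for x
  proof -
   have "c $ i + s / 2 * e' $ i - s / 2 <= x $ i" "x $ i < c $ i + s / 2 * e $ i + s / 2"
    using that by (auto simp: cube_def)
   then show False using 2 by simp
  qed
  then show ?thesis by blast
 qed
qed

lemma child_subset: "e \<in> corners ==> cube (child c s e) (s / 2) \<subseteq> cube c s"
 using cube_children[of c s] by blast

definition cube_mean :: "(real^3 => real) => real^3 => real => real" where
 "cube_mean f c s = (LINT x:cube c s|lborel. f x) / (8 * s ^ 3)"

lemma set_integrable_child:
 assumes "set_integrable lborel (cube c s) (f :: real^3 => real)" "e \<in> corners"
 shows "set_integrable lborel (cube (child c s e) (s / 2)) f"
 by (rule set_integrable_subset[OF assms(1) _ child_subset[OF assms(2)]]) simp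

lemma cube_mean_children:
 assumes "set_integrable lborel (cube c s) f" "0 < s"
 shows "cube_mean f c s = (\<Sum>e\<in>corners. cube_mean f (child c s e) (s / 2)) / 8"
proof -
 have "(LINT x:cube c s|lborel. f x) = (\<Sum>e\<in>corners. (LINT x:cube (child c s e) (s / 2)|lborel. f x))"
  by (subst cube_children, rule set_integral_finite_Union)
   (use corners_card children_disjoint set_integrable_child[OF assms(1)] in auto)
 moreover have "8 * s ^ 3 = 8 * (8 * (s / 2) ^ 3)" by (simp add: field_simps power3_eq_cube)
 ultimately show ?thesis
  using assms(2) by (simp add: cube_mean_def sum_divide_distrib field_simps)
qed

lemma set_integrable_cube_const: "0 < s ==> set_integrable lborel (cube c s) (%x. k::real)"
 unfolding set_integrable_def by (simp add: cube_measure)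

lemma cube_mean_const: "0 < s ==> cube_mean (%x. k) c s = k"
 by (simp add: cube_mean_def cube_measure set_integral_const)

lemma cube_mean_mono:
 assumes "set_integrable lborel (cube c s) f" "set_integrable lborel (cube c s) g" "0 < s"
  "!!x. x \<in> cube c s ==> f x <= g x"
 shows "cube_mean f c s <= cube_mean g c s"
 unfolding cube_mean_def
 by (intro divide_right_mono set_integral_mono assms) (use assms(3) in auto)

lemma cube_mean_add:
 assumes "set_integrable lborel (cube c s) f" "set_integrable lborel (cube c s) g"
 shows "cube_mean (%x. f x + g x) c s = cube_mean f c s + cube_mean g c s"
 using assms by (simp add: cube_mean_def set_integral_add add_divide_distrib)

lemma cube_mean_cmult: "cube_mean (%x. k * f x) c s = k * cube_mean f c s"
 by (simp add: cube_mean_def)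

lemma set_integrable_dev:
 assumes "set_integrable lborel (cube c s) f" "0 < s"
 shows "set_integrable lborel (cube c s) (%x. \<bar>f x - k\<bar> :: real)"
 using set_integral_diff(1)[OF assms(1) set_integrable_cube_const[OF assms(2)]]
 by (rule set_integrable_abs)

lemma cube_mean_dev:
 assumes "set_integrable lborel (cube c s) f" "0 < s"
 shows "\<bar>cube_mean f c s - k\<bar> <= cube_mean (%x. \<bar>f x - k\<bar>) c s"
proof -
 have "cube_mean f c s - k = cube_mean (%x. f x - k) c s"
  using cube_mean_add[of c s f "%x. - k"] cube_mean_const[OF assms(2), of "- k" c] assms
   set_integrable_cube_const[OF assms(2), of c "- k"] by simp
 moreover have "cube_mean (%x. f x - k) c s <= cube_mean (%x. \<bar>f x - k\<bar>) c s"
  by (intro cube_mean_mono set_integrable_dev set_integral_diff(1) set_integrable_cube_const assms) auto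
 moreover have "cube_mean (%x. - 1 * \<bar>f x - k\<bar>) c s <= cube_mean (%x. f x - k) c s"
  by (intro cube_mean_mono set_integrable_mult_right set_integrable_dev set_integral_diff(1) set_integrable_cube_const assms) auto
 ultimately show ?thesis using cube_mean_cmult[of "-1" "%x. \<bar>f x - k\<bar>" c s] by linarith
qed

lemma cube_osc_le_dev:
 assumes i: "set_integrable lborel (cube c s) f" and s: "0 < s"
 shows "cube_mean (%x. \<bar>f x - cube_mean f c s\<bar>) c s <= 2 * cube_mean (%x. \<bar>f x - k\<bar>) c s"
proof -
 let ?m = "cube_mean f c s"
 have "cube_mean (%x. \<bar>f x - ?m\<bar>) c s <= cube_mean (%x. \<bar>f x - k\<bar> + \<bar>?m - k\<bar>) c s"
  by (intro cube_mean_mono set_integrable_dev set_integral_add(1) set_integrable_cube_const i s) auto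
 also have "... = cube_mean (%x. \<bar>f x - k\<bar>) c s + \<bar>?m - k\<bar>"
  using s by (simp add: cube_mean_add set_integrable_dev[OF i s] set_integrable_cube_const cube_mean_const)
 also have "... <= 2 * cube_mean (%x. \<bar>f x - k\<bar>) c s"
  using cube_mean_dev[OF i s, of k] by simp
 finally show ?thesis .
qed

text \<open>The average of a function of cubes over the \<open>8\<^sup>k\<close> descendants of generation \<open>k\<close>.\<close>

primrec dyadic_mean :: "nat => (real^3 => real => real) => real^3 => real => real" where
 "dyadic_mean 0 \<phi> c s = \<phi> c s"
| "dyadic_mean (Suc k) \<phi> c s = (\<Sum>e\<in>corners. dyadic_mean k \<phi> (child c s e) (s / 2)) / 8"

text \<open>The fixed point of \<open>x \<mapsto> (x + K\<^sup>p) / 2 + \<Lambda>\<^sup>p\<close> with \<open>\<Lambda> = 2\<^sup>p\<^sup>+\<^sup>1\<close> and \<open>K = \<Lambda> + 8\<close>: \<open>\<Lambda> b\<close> is the threshold of the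
 stopping argument, and on a stopped cube the mean has moved by at most \<open>K b\<close>.\<close>

definition JN :: "nat => real" where
 "JN p = (2 ^ (p + 1) + 8) ^ p + 2 * (2 ^ (p + 1)) ^ p"

lemma power_add_bound: "0 <= x ==> 0 <= y ==> (x + y) ^ p <= 2 ^ p * (x ^ p + y ^ p :: real)"
proof -
 assume xy: "0 <= x" "0 <= y"
 have "(x + y) ^ p <= (2 * max x y) ^ p" using xy by (intro power_mono) auto
 also have "... = 2 ^ p * (max x y) ^ p" by (simp add: power_mult_distrib)
 also have "(max x y) ^ p <= x ^ p + y ^ p" using xy by (auto simp: max_def)
 finally show ?thesis by simp
qed

text \<open>In the application \<open>G\<close> selects the cubes whose circumscribed balls lie in a given ball, since only those are
 controlled by the BMO norm of a domain.\<close>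

locale bmo_cubes =
 fixes G :: "real^3 => real => bool" and f :: "real^3 => real" and b :: real
 assumes f_borel [measurable]: "f \<in> borel_measurable borel"
  and G_pos: "!!c s. G c s ==> 0 < s"
  and G_child: "!!c s e. G c s ==> e \<in> corners ==> G (child c s e) (s / 2)"
  and G_int: "!!c s. G c s ==> set_integrable lborel (cube c s) f"
  and G_osc: "!!c s. G c s ==> cube_mean (%x. \<bar>f x - cube_mean f c s\<bar>) c s <= b"
  and b_pos: "0 < b"
begin

abbreviation "m \<equiv> cube_mean f"

lemma dyadic_mean_mono:
 assumes "!!c s. G c s ==> \<phi> c s <= \<psi> c s" "G c s"
 shows "dyadic_mean k \<phi> c s <= dyadic_mean k \<psi> c s"
 using assms(2)
proof (induction k arbitrary: c s)
 case (Suc k)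
 then show ?case by (auto intro!: divide_right_mono sum_mono G_child)
qed (simp add: assms)

lemma dyadic_mean_linear:
 "dyadic_mean k (%c s. x * \<phi> c s + y) c s = x * dyadic_mean k \<phi> c s + y"
proof (induction k arbitrary: c s)
 case (Suc k)
 then show ?case
  by (simp add: sum.distrib corners_card sum_distrib_left add_divide_distrib)
qed simp

lemma child_jump:
 assumes G: "G c s" and e: "e \<in> corners"
 shows "\<bar>m (child c s e) (s / 2) - m c s\<bar> <= 8 * b"
proof -
 note s = G_pos[OF G] and i = G_int[OF G]
 let ?g = "%x. \<bar>f x - m c s\<bar>"
 have gi: "set_integrable lborel (cube c s) ?g" by (rule set_integrable_dev[OF i s])
 have nn: "0 <= cube_mean ?g c' s'" if "0 < s'" for c' s'
  using that by (simp add: cube_mean_def set_lebesgue_integral_def)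
 have "\<bar>m (child c s e) (s / 2) - m c s\<bar> <= cube_mean ?g (child c s e) (s / 2)"
  by (rule cube_mean_dev[OF set_integrable_child[OF i e]]) (use s in simp)
 also have "... <= (\<Sum>e\<in>corners. cube_mean ?g (child c s e) (s / 2))"
  using nn[of "s/2"] s by (intro member_le_sum[OF e]) (auto simp: corners_card)
 also have "... = 8 * cube_mean ?g c s"
  using cube_mean_children[OF gi s] by simp
 also have "... <= 8 * b" using G_osc[OF G] by simp
 finally show ?thesis .
qed

text \<open>The stopping time argument: descend from a cube, and stop at the first subcubes whose mean differs
 from the initial mean by more than \<open>2\<^sup>p\<^sup>+\<^sup>1 b\<close>. The stopped cubes cover at most the fraction
 \<open>2\<^sup>-\<^sup>p\<^sup>-\<^sup>1\<close> of the initial cube, which pays for the factor \<open>2\<^sup>p\<close> in \<open>(x + y)\<^sup>p <= 2\<^sup>p (x\<^sup>p + y\<^sup>p)\<close>, and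
 inside them fewer subdivisions remain, so that induction on their number applies.\<close>

lemma dyadic_JN:
 assumes "G c s"
 shows "dyadic_mean N (%c' s'. \<bar>m c' s' - m c s\<bar> ^ p) c s <= JN p * b ^ p"
 using assms
proof (induction N arbitrary: c s rule: less_induct)
 case (less N)
 define l where "l = m c s"
 define \<Lambda> :: real where "\<Lambda> = 2 ^ (p + 1)"
 define K where "K = \<Lambda> + 8"
 define Z where "Z = 2 ^ p * (JN p * b ^ p + (K * b) ^ p)"
 have \<Lambda>: "0 < \<Lambda>" and K: "0 < K" by (auto simp: \<Lambda>_def K_def add_pos_pos)
 have Z: "0 <= Z" using b_pos K by (auto simp: Z_def JN_def)
 let ?A = "%k c s. dyadic_mean k (%c' s'. \<bar>m c' s' - l\<bar> ^ p) c s"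
 let ?h = "%c s. cube_mean (%x. \<bar>f x - l\<bar>) c s"
 have inner: "?A k c' s' <= ?h c' s' / (\<Lambda> * b) * Z + (\<Lambda> * b) ^ p"
  if "G c' s'" "\<bar>m c' s' - l\<bar> <= K * b" "k <= N" "k < N \<or> \<bar>m c' s' - l\<bar> <= \<Lambda> * b" for k c' s'
  using that
 proof (induction k arbitrary: c' s')
  case 0
  have h: "\<bar>m c' s' - l\<bar> <= ?h c' s'"
   by (rule cube_mean_dev[OF G_int G_pos]; rule 0)
  then have h0: "0 <= ?h c' s'" by linarith
  show ?case
  proof (cases "\<bar>m c' s' - l\<bar> <= \<Lambda> * b")
   case True
   then have "?A 0 c' s' <= (\<Lambda> * b) ^ p" by (simp add: power_mono)
   moreover have "0 <= ?h c' s' / (\<Lambda> * b) * Z" using h0 \<Lambda> b_pos Z by simp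
   ultimately show ?thesis by linarith
  next
   case False
   have "?A 0 c' s' <= (K * b) ^ p" using 0 by (simp add: power_mono)
   also have "... <= 1 * Z"
   proof -
    have "1 * (K * b) ^ p <= 2 ^ p * (K * b) ^ p" using b_pos K by (intro mult_right_mono) auto
    also have "... <= Z" using b_pos by (auto simp: Z_def JN_def intro!: mult_left_mono)
    finally show ?thesis by simp
   qed
   also have "... <= ?h c' s' / (\<Lambda> * b) * Z"
    using False h \<Lambda> b_pos by (intro mult_right_mono[OF _ Z]) (simp add: field_simps)
   also have "... <= ?h c' s' / (\<Lambda> * b) * Z + (\<Lambda> * b) ^ p" using \<Lambda> b_pos by simp
   finally show ?thesis .
  qed
 next
  case (Suc k)
  note i = G_int[OF Suc.prems(1)] and s = G_pos[OF Suc.prems(1)]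
  have h: "\<bar>m c' s' - l\<bar> <= ?h c' s'"
   by (rule cube_mean_dev[OF i s])
  show ?case
  proof (cases "\<bar>m c' s' - l\<bar> <= \<Lambda> * b")
   case True
   have "?A k (child c' s' e) (s' / 2) <= ?h (child c' s' e) (s' / 2) / (\<Lambda> * b) * Z + (\<Lambda> * b) ^ p"
    if e: "e \<in> corners" for e
   proof (rule Suc.IH)
    show "G (child c' s' e) (s' / 2)" by (rule G_child[OF Suc.prems(1) e])
    show "\<bar>m (child c' s' e) (s' / 2) - l\<bar> <= K * b"
     using child_jump[OF Suc.prems(1) e] True by (simp add: K_def algebra_simps)
   qed (use Suc.prems in auto)
   then have "?A (Suc k) c' s' <= (\<Sum>e\<in>corners. ?h (child c' s' e) (s' / 2) / (\<Lambda> * b) * Z + (\<Lambda> * b) ^ p) / 8"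
    by (auto intro!: divide_right_mono sum_mono)
   also have "... = ((\<Sum>e\<in>corners. ?h (child c' s' e) (s' / 2)) / 8) / (\<Lambda> * b) * Z + (\<Lambda> * b) ^ p"
   proof -
    have "(\<Sum>e\<in>corners. ?h (child c' s' e) (s' / 2) / (\<Lambda> * b) * Z) =
      (\<Sum>e\<in>corners. ?h (child c' s' e) (s' / 2)) / (\<Lambda> * b) * Z"
     by (simp only: sum_divide_distrib sum_distrib_right)
    then show ?thesis by (simp add: sum.distrib corners_card add_divide_distrib)
   qed
   also have "(\<Sum>e\<in>corners. ?h (child c' s' e) (s' / 2)) / 8 = ?h c' s'"
    by (rule cube_mean_children[OF set_integrable_dev[OF i s] s, symmetric])
   finally show ?thesis .
  next
   case False
   then have kN: "Suc k < N" using Suc.prems by auto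
   have "?A (Suc k) c' s' <= dyadic_mean (Suc k) (%c'' s''. 2 ^ p * \<bar>m c'' s'' - m c' s'\<bar> ^ p + 2 ^ p * (K * b) ^ p) c' s'"
   proof (rule dyadic_mean_mono[OF _ Suc.prems(1)])
    fix c'' s''
    have "\<bar>m c'' s'' - l\<bar> ^ p <= (\<bar>m c'' s'' - m c' s'\<bar> + K * b) ^ p"
     using Suc.prems(2) by (intro power_mono) auto
    also have "... <= 2 ^ p * (\<bar>m c'' s'' - m c' s'\<bar> ^ p + (K * b) ^ p)"
     by (rule power_add_bound) (use K b_pos in auto)
    finally show "\<bar>m c'' s'' - l\<bar> ^ p <= 2 ^ p * \<bar>m c'' s'' - m c' s'\<bar> ^ p + 2 ^ p * (K * b) ^ p"
     by (simp add: algebra_simps)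
   qed
   also have "... = 2 ^ p * dyadic_mean (Suc k) (%c'' s''. \<bar>m c'' s'' - m c' s'\<bar> ^ p) c' s' + 2 ^ p * (K * b) ^ p"
    by (rule dyadic_mean_linear)
   also have "... <= 2 ^ p * (JN p * b ^ p) + 2 ^ p * (K * b) ^ p"
    using less.IH[OF kN Suc.prems(1)] by simp
   also have "... = 1 * Z" by (simp add: Z_def algebra_simps)
   also have "... <= ?h c' s' / (\<Lambda> * b) * Z"
    using False h \<Lambda> b_pos by (intro mult_right_mono[OF _ Z]) (simp add: field_simps)
   also have "... <= ?h c' s' / (\<Lambda> * b) * Z + (\<Lambda> * b) ^ p" using \<Lambda> b_pos by simp
   finally show ?thesis .
  qed
 qed
 have "?A N c s <= ?h c s / (\<Lambda> * b) * Z + (\<Lambda> * b) ^ p"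
  by (rule inner[OF less.prems]) (use \<Lambda> K b_pos in \<open>auto simp: l_def\<close>)
 also have "... <= 1 / \<Lambda> * Z + (\<Lambda> * b) ^ p"
  using G_osc[OF less.prems] b_pos \<Lambda> by (intro add_right_mono mult_right_mono[OF _ Z]) (simp add: l_def field_simps)
 also have "1 / \<Lambda> * Z = (JN p * b ^ p + (K * b) ^ p) / 2"
  by (simp add: \<Lambda>_def Z_def)
 also have "(JN p * b ^ p + (K * b) ^ p) / 2 + (\<Lambda> * b) ^ p = JN p * b ^ p"
  unfolding power_mult_distrib JN_def K_def[symmetric] \<Lambda>_def[symmetric] by (simp add: algebra_simps)
 finally show ?case by (simp add: l_def)
qed

abbreviation "osc \<equiv> %c s. cube_mean (%x. \<bar>f x - m c s\<bar>) c s"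

lemma L1_approx:
 assumes G: "G c s" and e: "0 < \<epsilon>"
 obtains g where "continuous_on UNIV g" "set_integrable lborel (cube c s) g"
  "cube_mean (%x. \<bar>f x - g x\<bar>) c s <= \<epsilon>"
proof -
 note i = G_int[OF G] and s = G_pos[OF G]
 define V where "V = 8 * s ^ 3"
 have V: "0 < V" using s by (simp add: V_def)
 define tr where "tr n x = max (- real n) (min (real n) (f x))" for n x
 have trb: "\<bar>tr n x\<bar> <= real n" for n x by (auto simp: tr_def)
 have trm [measurable]: "tr n \<in> borel_measurable borel" for n unfolding tr_def by measurable
 have si: "set_integrable lborel (cube c s) h" if "h \<in> borel_measurable borel" "!!x. \<bar>h x\<bar> <= B" for h :: "real^3 => real" and B
  unfolding set_integrable_def
  by (rule Bochner_Integration.integrable_bound[OF set_integrable_cube_const[OF s, of c B, unfolded set_integrable_def]])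
   (use that in \<open>auto simp: indicator_def intro!: AE_I2 order_trans[OF that(2) abs_ge_self]\<close>)
 have fi: "integrable lborel (%x. indicator (cube c s) x *\<^sub>R f x)" using i by (simp add: set_integrable_def)
 have "(%n. LINT x:cube c s|lborel. \<bar>f x - tr n x\<bar>) \<longlonglongrightarrow> (LINT x:cube c s|lborel. 0)"
  unfolding set_lebesgue_integral_def
 proof (rule integral_dominated_convergence[where w="%x. 2 * \<bar>indicator (cube c s) x *\<^sub>R f x\<bar>"])
  show "AE x in lborel. (%n. indicat_real (cube c s) x *\<^sub>R \<bar>f x - tr n x\<bar>) \<longlonglongrightarrow> indicat_real (cube c s) x *\<^sub>R 0"
  proof (rule AE_I2, rule tendsto_eventually)
   fix x
   obtain N where N: "\<bar>f x\<bar> <= real N" using real_arch_simple by blast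
   show "\<forall>\<^sub>F n in sequentially. indicat_real (cube c s) x *\<^sub>R \<bar>f x - tr n x\<bar> = indicat_real (cube c s) x *\<^sub>R 0"
    using eventually_ge_at_top[of N]
   proof eventually_elim
    case (elim n)
    then have "\<bar>f x\<bar> <= real n" using N by simp
    then show ?case by (auto simp: tr_def)
   qed
  qed
  show "AE x in lborel. norm (indicat_real (cube c s) x *\<^sub>R \<bar>f x - tr n x\<bar>) <= 2 * \<bar>indicat_real (cube c s) x *\<^sub>R f x\<bar>" for n
   by (rule AE_I2) (auto simp: tr_def indicator_def)
  show "integrable lborel (%x. 2 * \<bar>indicat_real (cube c s) x *\<^sub>R f x\<bar>)"
   by (intro integrable_mult_right integrable_abs fi)
 qed auto
 then have "\<forall>\<^sub>F n in sequentially. (LINT x:cube c s|lborel. \<bar>f x - tr n x\<bar>) < V * (\<epsilon> / 2)"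
  using V e by (intro order_tendstoD(2)) (auto simp: set_lebesgue_integral_def)
 then obtain n where n: "(LINT x:cube c s|lborel. \<bar>f x - tr n x\<bar>) < V * (\<epsilon> / 2)"
  using eventually_happens by fastforce
 show ?thesis
 proof (rule approx_continuous[OF trm trb])
  fix g :: "nat => real^3 => real"
  assume g: "!!k. continuous_on UNIV (g k)" "!!k z. \<bar>g k z\<bar> <= real n"
   "AE z in lborel. (%k. g k z) \<longlonglongrightarrow> tr n z"
  have [measurable]: "g k \<in> borel_measurable borel" for k
   by (rule borel_measurable_continuous_onI[OF g(1)])
  have "(%k. LINT x:cube c s|lborel. \<bar>tr n x - g k x\<bar>) \<longlonglongrightarrow> (LINT x:cube c s|lborel. 0)"
   unfolding set_lebesgue_integral_def
  proof (rule integral_dominated_convergence[where w="%x. indicator (cube c s) x *\<^sub>R (2 * real n)"])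
   show "AE x in lborel. (%k. indicat_real (cube c s) x *\<^sub>R \<bar>tr n x - g k x\<bar>) \<longlonglongrightarrow> indicat_real (cube c s) x *\<^sub>R 0"
    using g(3)
   proof eventually_elim
    case (elim x)
    have "(%k. indicat_real (cube c s) x *\<^sub>R \<bar>tr n x - g k x\<bar>) \<longlonglongrightarrow> indicat_real (cube c s) x *\<^sub>R \<bar>tr n x - tr n x\<bar>"
     by (intro tendsto_intros elim)
    then show ?case by simp
   qed
   show "AE x in lborel. norm (indicat_real (cube c s) x *\<^sub>R \<bar>tr n x - g k x\<bar>) <= indicat_real (cube c s) x *\<^sub>R (2 * real n)" for k
   proof (rule AE_I2)
    fix x show "norm (indicat_real (cube c s) x *\<^sub>R \<bar>tr n x - g k x\<bar>) <= indicat_real (cube c s) x *\<^sub>R (2 * real n)"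
     using trb[of n x] g(2)[of k x] by (auto simp: indicator_def)
   qed
   show "integrable lborel (%x. indicat_real (cube c s) x *\<^sub>R (2 * real n))"
    using set_integrable_cube_const[OF s, of c "2 * real n"] unfolding set_integrable_def .
  qed auto
  then have "\<forall>\<^sub>F k in sequentially. (LINT x:cube c s|lborel. \<bar>tr n x - g k x\<bar>) < V * (\<epsilon> / 2)"
   using V e by (intro order_tendstoD(2)) (auto simp: set_lebesgue_integral_def)
  then obtain k where k: "(LINT x:cube c s|lborel. \<bar>tr n x - g k x\<bar>) < V * (\<epsilon> / 2)"
   using eventually_happens by fastforce
  have gi: "set_integrable lborel (cube c s) (g k)" by (rule si[OF _ g(2)]) simp
  have ti: "set_integrable lborel (cube c s) (tr n)" by (rule si[OF _ trb]) simp
  note d = set_integral_diff(1)[THEN set_integrable_abs]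
  have "(LINT x:cube c s|lborel. \<bar>f x - g k x\<bar>) <= (LINT x:cube c s|lborel. \<bar>f x - tr n x\<bar> + \<bar>tr n x - g k x\<bar>)"
   by (intro set_integral_mono d set_integral_add(1) i ti gi) auto
  also have "... = (LINT x:cube c s|lborel. \<bar>f x - tr n x\<bar>) + (LINT x:cube c s|lborel. \<bar>tr n x - g k x\<bar>)"
   by (intro set_integral_add(2) d i ti gi)
  also have "... <= V * \<epsilon>" using n k by simp
  finally have "cube_mean (%x. \<bar>f x - g k x\<bar>) c s <= \<epsilon>"
   using V by (simp add: cube_mean_def V_def[symmetric] field_simps)
  then show ?thesis using that g(1) gi by blast
 qed
qed

text \<open>A function close to \<open>f\<close> in \<open>L\<^sup>1\<close> and uniformly continuous hardly oscillates on small cubes.\<close>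

lemma osc_small:
 assumes G: "G c s" and e: "0 < \<epsilon>"
 obtains N where "dyadic_mean N osc c s <= \<epsilon>"
proof (rule L1_approx[OF G, of "\<epsilon> / 4"])
 fix g assume g: "continuous_on UNIV g" "set_integrable lborel (cube c s) g"
  "cube_mean (%x. \<bar>f x - g x\<bar>) c s <= \<epsilon> / 4"
 define D where "D = cbox (c - (\<chi> i. s)) (c + (\<chi> i. s))"
 have "uniformly_continuous_on D g"
  unfolding D_def by (intro compact_uniformly_continuous continuous_on_subset[OF g(1)]) auto
 then obtain \<delta> where d: "0 < \<delta>" "!!x y. x \<in> D ==> y \<in> D ==> dist y x < \<delta> ==> \<bar>g y - g x\<bar> < \<epsilon> / 4"
  using e unfolding uniformly_continuous_on_def dist_real_def by (metis zero_less_divide_iff zero_less_numeral)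
 have *: "dyadic_mean N osc c' s' <= 2 * (cube_mean (%x. \<bar>f x - g x\<bar>) c' s' + \<epsilon> / 4)"
  if "G c' s'" "cube c' s' \<subseteq> cube c s" "3 * s' / 2 ^ N < \<delta>" for N c' s'
  using that
 proof (induction N arbitrary: c' s')
  case 0
  note i = G_int[OF 0(1)] and s = G_pos[OF 0(1)]
  have gi: "set_integrable lborel (cube c' s') g"
   by (rule set_integrable_subset[OF g(2) _ 0(2)]) simp
  note d' = set_integral_diff(1)[OF i gi, THEN set_integrable_abs]
  have c': "c' \<in> cube c' s'" using s by (simp add: cube_def)
  have "osc c' s' <= 2 * cube_mean (%x. \<bar>f x - g c'\<bar>) c' s'" by (rule cube_osc_le_dev[OF i s])
  also have "cube_mean (%x. \<bar>f x - g c'\<bar>) c' s' <= cube_mean (%x. \<bar>f x - g x\<bar> + \<epsilon> / 4) c' s'"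
  proof (intro cube_mean_mono set_integrable_dev i s set_integral_add(1) d' set_integrable_cube_const)
   fix x assume x: "x \<in> cube c' s'"
   have "dist x c' <= (\<Sum>i\<in>UNIV. \<bar>x $ i - c' $ i\<bar>)"
    using norm_le_l1_cart[of "x - c'"] by (simp add: dist_norm)
   also have "... <= (\<Sum>i\<in>(UNIV::3 set). s')"
   proof (rule sum_mono)
    fix i :: 3
    have "c' $ i - s' <= x $ i" "x $ i < c' $ i + s'" using x by (auto simp: cube_def)
    then show "\<bar>x $ i - c' $ i\<bar> <= s'" by simp
   qed
   also have "... < \<delta>" using 0(3) by simp
   finally have "\<bar>g x - g c'\<bar> < \<epsilon> / 4"
    using x c' 0(2) cube_subset_cbox[of c s] by (intro d(2)) (auto simp: D_def)
   then show "\<bar>f x - g c'\<bar> <= \<bar>f x - g x\<bar> + \<epsilon> / 4"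
    using abs_triangle_ineq[of "f x - g x" "g x - g c'"] by simp
  qed
  also have "cube_mean (%x. \<bar>f x - g x\<bar> + \<epsilon> / 4) c' s' = cube_mean (%x. \<bar>f x - g x\<bar>) c' s' + \<epsilon> / 4"
   using s by (simp add: cube_mean_add d' set_integrable_cube_const cube_mean_const)
  finally show ?case by simp
 next
  case (Suc N)
  note i = G_int[OF Suc.prems(1)] and s = G_pos[OF Suc.prems(1)]
  have gi: "set_integrable lborel (cube c' s') g"
   by (rule set_integrable_subset[OF g(2) _ Suc.prems(2)]) simp
  note d' = set_integral_diff(1)[OF i gi, THEN set_integrable_abs]
  have "dyadic_mean (Suc N) osc c' s' <=
    (\<Sum>e\<in>corners. 2 * (cube_mean (%x. \<bar>f x - g x\<bar>) (child c' s' e) (s' / 2) + \<epsilon> / 4)) / 8"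
   unfolding dyadic_mean.simps
  proof (intro divide_right_mono sum_mono Suc.IH)
   fix e assume e: "e \<in> corners"
   show "G (child c' s' e) (s' / 2)" by (rule G_child[OF Suc.prems(1) e])
   show "cube (child c' s' e) (s' / 2) \<subseteq> cube c s" using child_subset[OF e] Suc.prems(2) by blast
   show "3 * (s' / 2) / 2 ^ N < \<delta>" using Suc.prems(3) by simp
  qed simp
  also have "... = 2 * ((\<Sum>e\<in>corners. cube_mean (%x. \<bar>f x - g x\<bar>) (child c' s' e) (s' / 2)) / 8 + \<epsilon> / 4)"
   by (simp add: sum.distrib sum_distrib_left[symmetric] corners_card add_divide_distrib)
  also have "... = 2 * (cube_mean (%x. \<bar>f x - g x\<bar>) c' s' + \<epsilon> / 4)"
   using cube_mean_children[OF d' s] by simp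
  finally show ?case .
 qed
 have "(%N. 3 * s * (1 / 2) ^ N) \<longlonglongrightarrow> 3 * s * 0"
  by (intro tendsto_intros LIMSEQ_power_zero) simp
 then have "\<forall>\<^sub>F N in sequentially. 3 * s * (1 / 2) ^ N < \<delta>"
  using d(1) by (intro order_tendstoD(2)) auto
 then obtain N where "3 * s * (1 / 2) ^ N < \<delta>" using eventually_happens by fastforce
 then have "3 * s / 2 ^ N < \<delta>" by (simp add: power_one_over field_simps)
 from *[OF G _ this] g(3) have "dyadic_mean N osc c s <= \<epsilon>" by auto
 then show ?thesis by (rule that)
qed (use e in simp)

lemma mean_le_dyadic_mean:
 fixes \<phi> :: "real => real"
 assumes lip: "!!x y. \<bar>\<phi> x - \<phi> y\<bar> <= L * \<bar>x - y\<bar>" and bnd: "!!x. \<bar>\<phi> x\<bar> <= B"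
  and [measurable]: "\<phi> \<in> borel_measurable borel" and G: "G c s"
 shows "cube_mean (%x. \<phi> (f x)) c s <= dyadic_mean N (%c s. \<phi> (m c s)) c s + L * dyadic_mean N osc c s"
 using G
proof (induction N arbitrary: c s)
 have si: "set_integrable lborel (cube c s) (%x. \<phi> (f x))" if "G c s" for c s
  unfolding set_integrable_def
  by (rule Bochner_Integration.integrable_bound[OF set_integrable_cube_const[OF G_pos[OF that], of c B, unfolded set_integrable_def]])
   (use bnd in \<open>auto simp: indicator_def intro!: AE_I2 order_trans[OF bnd abs_ge_self]\<close>)
 {
  case 0
  note i = G_int[OF 0] and s = G_pos[OF 0]
  have "cube_mean (%x. \<phi> (f x)) c s <= cube_mean (%x. \<phi> (m c s) + L * \<bar>f x - m c s\<bar>) c s"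
  proof (intro cube_mean_mono si 0 s set_integral_add(1) set_integrable_cube_const set_integrable_mult_right set_integrable_dev i)
   fix x show "\<phi> (f x) <= \<phi> (m c s) + L * \<bar>f x - m c s\<bar>" using lip[of "f x" "m c s"] by linarith
  qed
  also have "... = \<phi> (m c s) + L * osc c s"
   using s by (simp add: cube_mean_add set_integrable_cube_const cube_mean_const set_integrable_dev[OF i s] cube_mean_cmult)
  finally show ?case by simp
 next
  case (Suc N)
  have "cube_mean (%x. \<phi> (f x)) c s = (\<Sum>e\<in>corners. cube_mean (%x. \<phi> (f x)) (child c s e) (s / 2)) / 8"
   by (rule cube_mean_children[OF si[OF Suc.prems] G_pos[OF Suc.prems]])
  also have "... <= (\<Sum>e\<in>corners. dyadic_mean N (%c s. \<phi> (m c s)) (child c s e) (s / 2)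
    + L * dyadic_mean N osc (child c s e) (s / 2)) / 8"
   by (intro divide_right_mono sum_mono Suc.IH G_child Suc.prems) simp_all
  also have "... = dyadic_mean (Suc N) (%c s. \<phi> (m c s)) c s + L * dyadic_mean (Suc N) osc c s"
   by (simp add: sum.distrib sum_distrib_left add_divide_distrib)
  finally show ?case .
 }
qed

text \<open>The dyadic bound is uniform in the generation, and for Lipschitz functions of \<open>f\<close> the dyadic means
 approach the true mean. It therefore holds for truncated powers, and then by monotone convergence.\<close>

theorem John_Nirenberg:
 assumes G: "G c s"
 shows "(\<integral>\<^sup>+x\<in>cube c s. ennreal (\<bar>f x - m c s\<bar> ^ p) \<partial>lborel) <= ennreal (8 * s ^ 3 * (JN p * b ^ p))"
proof -
 note s = G_pos[OF G]
 define l where "l = m c s"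
 have trunc: "(\<integral>\<^sup>+x\<in>cube c s. ennreal ((min \<bar>f x - l\<bar> (real M)) ^ p) \<partial>lborel) <= ennreal (8 * s ^ 3 * (JN p * b ^ p))"
  if M: "0 < M" for M :: nat
 proof -
  define \<phi> where "\<phi> y = (min (\<bar>y - l\<bar> / real M) 1) ^ p" for y
  have lip: "\<bar>\<phi> x - \<phi> y\<bar> <= (real p / real M) * \<bar>x - y\<bar>" for x y
  proof -
   let ?a = "min (\<bar>x - l\<bar> / real M) 1" and ?b = "min (\<bar>y - l\<bar> / real M) 1"
   have "\<bar>?a ^ p - ?b ^ p\<bar> <= real p * \<bar>?a - ?b\<bar>"
    using norm_power_diff[of ?a ?b p] by simp
   also have "\<bar>?a - ?b\<bar> <= \<bar>x - y\<bar> / real M"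
   proof -
    have "\<bar>min u 1 - min v 1\<bar> <= \<bar>u - v\<bar>" for u v :: real by linarith
    then have "\<bar>?a - ?b\<bar> <= \<bar>\<bar>x - l\<bar> / real M - \<bar>y - l\<bar> / real M\<bar>" .
    also have "... = \<bar>\<bar>x - l\<bar> - \<bar>y - l\<bar>\<bar> / real M" by (simp add: diff_divide_distrib[symmetric])
    also have "... <= \<bar>x - y\<bar> / real M" by (intro divide_right_mono) auto
    finally show ?thesis .
   qed
   finally show ?thesis by (simp add: \<phi>_def mult_left_mono)
  qed
  have bnd: "\<bar>\<phi> x\<bar> <= 1" for x by (auto simp: \<phi>_def power_le_one)
  have \<phi>0: "0 <= \<phi> x" for x by (simp add: \<phi>_def)
  have meas [measurable]: "\<phi> \<in> borel_measurable borel" unfolding \<phi>_def by measurable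
  have main: "cube_mean (%x. \<phi> (f x)) c s <= JN p * b ^ p / real M ^ p"
  proof (rule field_le_epsilon)
   fix e :: real assume e: "0 < e"
   obtain N where N: "dyadic_mean N osc c s <= e * real M / (real p + 1)"
    using osc_small[OF G, of "e * real M / (real p + 1)"] e M by auto
   have "dyadic_mean N (%c s. \<phi> (m c s)) c s <= dyadic_mean N (%c' s'. (1 / real M ^ p) * \<bar>m c' s' - l\<bar> ^ p + 0) c s"
   proof (rule dyadic_mean_mono[OF _ G])
    fix c' s'
    have "\<phi> (m c' s') <= (\<bar>m c' s' - l\<bar> / real M) ^ p"
     unfolding \<phi>_def by (rule power_mono) auto
    then show "\<phi> (m c' s') <= (1 / real M ^ p) * \<bar>m c' s' - l\<bar> ^ p + 0"
     by (simp add: power_divide)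
   qed
   also have "... = (1 / real M ^ p) * dyadic_mean N (%c' s'. \<bar>m c' s' - l\<bar> ^ p) c s + 0"
    by (rule dyadic_mean_linear)
   also have "... <= JN p * b ^ p / real M ^ p"
    using mult_left_mono[OF dyadic_JN[OF G, of N p], of "1 / real M ^ p"] by (simp add: l_def)
   finally have 1: "dyadic_mean N (%c s. \<phi> (m c s)) c s <= JN p * b ^ p / real M ^ p" .
   have "(real p / real M) * dyadic_mean N osc c s <= (real p / real M) * (e * real M / (real p + 1))"
    by (intro mult_left_mono N) auto
   also have "... = e * (real p / (real p + 1))" using M by simp
   also have "... <= e * 1" using e by (intro mult_left_mono) auto
   finally show "cube_mean (%x. \<phi> (f x)) c s <= JN p * b ^ p / real M ^ p + e"
    using mean_le_dyadic_mean[OF lip bnd meas G, of N] 1 by linarith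
  qed
  have eq: "(min \<bar>f x - l\<bar> (real M)) ^ p = real M ^ p * \<phi> (f x)" for x
  proof -
   have "min \<bar>f x - l\<bar> (real M) = real M * min (\<bar>f x - l\<bar> / real M) 1"
    using M by (simp add: min_mult_distrib_left)
   then show ?thesis by (simp add: \<phi>_def power_mult_distrib)
  qed
  have si: "integrable lborel (%x. indicator (cube c s) x * \<phi> (f x))"
   by (rule Bochner_Integration.integrable_bound[OF set_integrable_cube_const[OF s, of c 1, unfolded set_integrable_def]])
    (use bnd in \<open>auto simp: indicator_def intro!: AE_I2 order_trans[OF bnd abs_ge_self]\<close>)
  have "(\<integral>\<^sup>+x\<in>cube c s. ennreal ((min \<bar>f x - l\<bar> (real M)) ^ p) \<partial>lborel) =
    (\<integral>\<^sup>+x. ennreal (real M ^ p * (indicator (cube c s) x * \<phi> (f x))) \<partial>lborel)"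
   unfolding eq by (intro nn_integral_cong) (auto simp: indicator_def)
  also have "... = ennreal (LINT x|lborel. real M ^ p * (indicator (cube c s) x * \<phi> (f x)))"
   by (rule nn_integral_eq_integral) (use si \<phi>0 in auto)
  also have "(LINT x|lborel. real M ^ p * (indicator (cube c s) x * \<phi> (f x))) = real M ^ p * (8 * s ^ 3 * cube_mean (%x. \<phi> (f x)) c s)"
   using s by (simp add: cube_mean_def set_lebesgue_integral_def)
  also have "... <= real M ^ p * (8 * s ^ 3 * (JN p * b ^ p / real M ^ p))"
   using s by (intro mult_left_mono main) auto
  also have "... = 8 * s ^ 3 * (JN p * b ^ p)" using M by simp
  finally show ?thesis by (simp add: ennreal_leI)
 qed
 have "(\<integral>\<^sup>+x\<in>cube c s. ennreal (\<bar>f x - l\<bar> ^ p) \<partial>lborel) =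
   (\<integral>\<^sup>+x. (SUP M. ennreal ((min \<bar>f x - l\<bar> (real (Suc M))) ^ p) * indicator (cube c s) x) \<partial>lborel)"
 proof (rule nn_integral_cong)
  fix x
  have "(SUP M. ennreal ((min \<bar>f x - l\<bar> (real (Suc M))) ^ p) * indicator (cube c s) x)
    = ennreal (\<bar>f x - l\<bar> ^ p) * indicator (cube c s) x"
  proof (rule antisym)
   show "(SUP M. ennreal ((min \<bar>f x - l\<bar> (real (Suc M))) ^ p) * indicator (cube c s) x) <=
     ennreal (\<bar>f x - l\<bar> ^ p) * indicator (cube c s) x"
    by (intro SUP_least mult_right_mono ennreal_leI power_mono) auto
   obtain N where N: "\<bar>f x - l\<bar> <= real N" using real_arch_simple by blast
   show "ennreal (\<bar>f x - l\<bar> ^ p) * indicator (cube c s) x <=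
     (SUP M. ennreal ((min \<bar>f x - l\<bar> (real (Suc M))) ^ p) * indicator (cube c s) x)"
    by (rule SUP_upper2[of N]) (use N in auto)
  qed
  then show "ennreal (\<bar>f x - l\<bar> ^ p) * indicator (cube c s) x =
    (SUP M. ennreal ((min \<bar>f x - l\<bar> (real (Suc M))) ^ p) * indicator (cube c s) x)" by simp
 qed
 also have "... = (SUP M. \<integral>\<^sup>+x. ennreal ((min \<bar>f x - l\<bar> (real (Suc M))) ^ p) * indicator (cube c s) x \<partial>lborel)"
 proof (rule nn_integral_monotone_convergence_SUP)
  show "incseq (%M x. ennreal ((min \<bar>f x - l\<bar> (real (Suc M))) ^ p) * indicator (cube c s) x)"
   by (intro monoI le_funI mult_right_mono ennreal_leI power_mono) auto
 qed measurable
 also have "... <= ennreal (8 * s ^ 3 * (JN p * b ^ p))"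
  by (intro SUP_least trunc) simp
 finally show ?thesis by (simp add: l_def)
qed

end

section \<open>Measures on space-time\<close>

lemma borel_measurable_component [measurable (raw)]:
 fixes f :: "'a => real^3"
 assumes "f \<in> borel_measurable N" shows "(%x. f x $ i) \<in> borel_measurable N"
 by (rule borel_measurable_continuous_on[OF _ assms]) (intro continuous_intros)

type_synonym spacetime = "real \<times> (real^3)"

lemma ball_borel_measurable [measurable]: "ball (c :: real^3) r \<in> sets borel"
 by simp

lemma fst_borel_measurable [measurable]: "(fst :: spacetime => real) \<in> borel \<rightarrow>\<^sub>M borel"
 and snd_borel_measurable [measurable]: "(snd :: spacetime => real^3) \<in> borel \<rightarrow>\<^sub>M borel"
 by (rule borel_measurable_continuous_onI, intro continuous_intros)+

lemma nn_integral_lincomb: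
 assumes "F \<in> borel_measurable N" "G \<in> borel_measurable N"
 shows "(\<integral>\<^sup>+x. c * F x + d * G x \<partial>N) = c * (\<integral>\<^sup>+x. F x \<partial>N) + d * (\<integral>\<^sup>+x. G x \<partial>N)"
 using assms by (simp add: nn_integral_add nn_integral_cmult)

lemma nn_integral_lincomb_indicator:
 assumes "F \<in> borel_measurable N" "A \<in> sets N"
 shows "(\<integral>\<^sup>+x. c * F x + d * indicator A x \<partial>N) = c * (\<integral>\<^sup>+x. F x \<partial>N) + d * emeasure N A"
 using nn_integral_lincomb[OF assms(1) borel_measurable_indicator[OF assms(2)]] assms(2) by simp

lemma tonelli:
 fixes F :: "spacetime => ennreal"
 assumes "F \<in> borel_measurable borel"
 shows "(\<integral>\<^sup>+z. F z \<partial>lborel) = (\<integral>\<^sup>+t. (\<integral>\<^sup>+x. F (t, x) \<partial>lborel) \<partial>lborel)"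
proof -
 have m: "F \<in> borel_measurable (lborel \<Otimes>\<^sub>M lborel)"
  using assms by (simp add: lborel_prod)
 show ?thesis
  using lborel.nn_integral_fst[OF m] by (simp add: lborel_prod)
qed

lemma fubini_slices:
 fixes F :: "spacetime => real"
 assumes "integrable lborel F"
 shows "(LINT z|lborel. F z) = (LINT t|lborel. (LINT x|lborel. F (t, x)))"
proof -
 have m: "integrable (lborel \<Otimes>\<^sub>M lborel) F"
  using assms by (simp add: lborel_prod)
 show ?thesis
  using lborel_pair.integral_fst'[OF m] by (simp add: lborel_prod)
qed

lemma AE_fst:
 assumes "AE t in lborel. P t"
 shows "AE z in (lborel :: spacetime measure). P (fst z)"
proof -
 obtain N where N: "N \<in> null_sets lborel" "{t. \<not> P t} \<subseteq> N"
  using assms by (auto elim!: AE_E simp: null_sets_def)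
 have "emeasure (lborel \<Otimes>\<^sub>M lborel) (N \<times> (UNIV :: (real^3) set)) = emeasure lborel N * emeasure lborel (UNIV :: (real^3) set)"
  using N(1) by (intro lborel.emeasure_pair_measure_Times) auto
 also have "... = 0" using N(1) by (simp add: null_setsD1)
 finally have "N \<times> UNIV \<in> null_sets (lborel :: spacetime measure)"
  using N(1) by (auto simp: lborel_prod null_sets_def simp del: sets_lborel intro!: pair_measureI)
   (metis lborel_prod pair_measureI sets_lborel space_borel space_lborel sets.top)
 then show ?thesis
  using N(2) by (intro AE_I'[of "N \<times> UNIV"]) auto
qed

lemma AE_slices:
 assumes "AE z in (lborel :: spacetime measure). P z"
 shows "AE t in lborel. AE x in lborel. P (t, x)"
proof -
 have "AE z in (lborel \<Otimes>\<^sub>M lborel). P z"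
  using assms by (simp only: lborel_prod)
 then show ?thesis by (rule lborel_pair.AE_pair)
qed

lemma slice_measurable:
 "F \<in> borel_measurable borel ==> (%x. F (t::real, x::real^3)) \<in> borel_measurable borel"
 by (rule measurable_compose[of "%x. (t, x)" borel borel]) (auto simp: borel_prod[symmetric])

lemma slice_integral_measurable:
 fixes F :: "spacetime => 'b::{banach, second_countable_topology}"
 assumes "F \<in> borel_measurable borel"
 shows "(%t. LINT x|lborel. F (t, x)) \<in> borel_measurable borel"
proof -
 have "F \<in> borel_measurable (borel \<Otimes>\<^sub>M lborel)"
  using assms by (simp add: borel_prod[symmetric] cong: measurable_cong_sets)
 then have "(%(t, x). F (t, x)) \<in> borel_measurable (borel \<Otimes>\<^sub>M lborel)" by simp
 then show ?thesis by (rule lborel.borel_measurable_lebesgue_integral)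
qed

lemma slice_nn_integral_measurable:
 fixes F :: "spacetime => ennreal"
 assumes "F \<in> borel_measurable borel"
 shows "(%t. \<integral>\<^sup>+x. F (t, x) \<partial>lborel) \<in> borel_measurable borel"
proof -
 have "F \<in> borel_measurable (borel \<Otimes>\<^sub>M lborel)"
  using assms by (simp add: borel_prod[symmetric] cong: measurable_cong_sets)
 then have "(%(t, x). F (t, x)) \<in> borel_measurable (borel \<Otimes>\<^sub>M lborel)" by simp
 then show ?thesis by (rule lborel.borel_measurable_nn_integral)
qed

section \<open>Oscillation of the velocity on a cube\<close>

text \<open>What the decay estimates use of a solution, for Borel functions on all of space-time. The pressure
 equation is the divergence of the momentum equation. The BMO bound holds at every time: \<open>U\<close> has been
 set to zero at the times of a null set where it fails. Any constant \<open>k\<close> may replace the average, at the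
 price of a factor 2.\<close>

locale flow_base =
 fixes E0 :: real and U :: "spacetime => real^3" and p :: "spacetime => real"
 assumes E0: "0 <= E0"
  and U_borel [measurable]: "U \<in> borel_measurable borel"
  and p_borel [measurable]: "p \<in> borel_measurable borel"
  and energy: "!!t. (\<integral>\<^sup>+x. ennreal ((norm (U (t, x)))^2) \<partial>lborel) <= ennreal E0"
  and p_int: "(\<integral>\<^sup>+z. ennreal (\<bar>p z\<bar> powr (3/2)) \<partial>lborel) < \<infinity>"

locale flow = flow_base +
 fixes T M :: real and \<Omega> :: "(real^3) set" and b :: "real => real"
 assumes b_borel [measurable]: "b \<in> borel_measurable borel"
  and pressure_eq: "!!\<psi>. \<psi> \<in> test_fun ({0<..<T} \<times> \<Omega>) ==>
   (LINT z|lborel. (\<Sum>i\<in>UNIV. \<Sum>j\<in>UNIV. U z $ i * U z $ j * dx j (dx i \<psi>) z) + p z * laplace \<psi> z) = 0"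
  and div_free: "!!\<psi>. \<psi> \<in> test_fun ({0<..<T} \<times> \<Omega>) ==>
   (LINT z|lborel. (\<Sum>j\<in>UNIV. U z $ j * dx j \<psi> z)) = 0"
  and b_nonneg: "!!t. 0 <= b t"
  and bmo: "!!t c s. 0 < t ==> t < T ==> 0 < s ==> ball c s \<subseteq> \<Omega> ==>
   \<exists>k. (\<integral>\<^sup>+x\<in>ball c s. ennreal (norm (U (t, x) - k)) \<partial>lborel) <= ennreal (b t * (unit_ball_vol 3 * s ^ 3))"
  and weakL2: "!!\<sigma>. 0 < \<sigma> ==> emeasure lborel {t. 0 < t \<and> t < T \<and> \<sigma> < b t} <= ennreal (M^2 / \<sigma>^2)"

lemma cube_subset_ball: assumes "0 < s" shows "cube c s \<subseteq> ball c (2 * s)"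
proof
 fix x assume x: "x \<in> cube c s"
 have "(norm (x - c))^2 = (\<Sum>i\<in>UNIV. (x $ i - c $ i)^2)"
  by (simp add: norm_vec_def L2_set_def sum_nonneg)
 also have "... <= (\<Sum>i\<in>(UNIV::3 set). s^2)"
 proof (rule sum_mono)
  fix i :: 3
  have "c $ i - s <= x $ i" "x $ i < c $ i + s" using x by (auto simp: cube_def)
  then have "\<bar>x $ i - c $ i\<bar> <= \<bar>s\<bar>" using assms by simp
  then show "(x $ i - c $ i)^2 <= s^2" by (simp only: abs_le_square_iff)
 qed
 also have "... < (2 * s)^2" using assms by (simp add: power2_eq_square)
 finally have "norm (x - c) < 2 * s" by (rule power2_less_imp_less) (use assms in simp)
 then show "x \<in> ball c (2 * s)" by (simp add: dist_norm norm_minus_commute)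
qed

lemma ball_subset_cube: "ball c s \<subseteq> cube c s"
proof
 fix x assume "x \<in> ball c s"
 then have "\<bar>(x - c) $ i\<bar> < s" for i
  using component_le_norm_cart[of "x - c" i] by (auto simp: dist_norm norm_minus_commute)
 then have "c $ i - s <= x $ i \<and> x $ i < c $ i + s" for i
  by (simp add: abs_less_iff) (smt (verit))
 then show "x \<in> cube c s" by (simp add: cube_def)
qed

lemma child_ball_subset:
 assumes "e \<in> corners" "0 < s"
 shows "ball (child c s e) (2 * (s / 2)) \<subseteq> ball c (2 * s)"
proof -
 have "(norm e)^2 = (\<Sum>i\<in>UNIV. (e $ i)^2)"
  by (simp add: norm_vec_def L2_set_def sum_nonneg)
 also have "... = (\<Sum>i\<in>(UNIV :: 3 set). 1)"
  using assms(1) by (intro sum.cong) (auto simp: corners_def power2_eq_1_iff)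
 finally have "(norm e)^2 <= 2^2" by simp
 then have "norm e <= 2" by (rule power2_le_imp_le) simp
 then have "dist (child c s e) c <= s" using assms(2) by (simp add: dist_norm)
 then show ?thesis
 proof (intro subsetI)
  fix x assume "dist (child c s e) c <= s" "x \<in> ball (child c s e) (2 * (s / 2))"
  then have "dist c x < 2 * s"
   using dist_triangle[of c x "child c s e"] by (simp add: dist_commute)
  then show "x \<in> ball c (2 * s)" by simp
 qed
qed

lemma set_integrable_of_square:
 fixes f :: "real^3 => real"
 assumes [measurable]: "f \<in> borel_measurable borel" and s: "0 < s"
  and fin: "(\<integral>\<^sup>+x\<in>cube c s. ennreal ((f x)^2) \<partial>lborel) < \<infinity>"
 shows "set_integrable lborel (cube c s) f" "set_integrable lborel (cube c s) (%x. (f x)^2)"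
proof -
 show 2: "set_integrable lborel (cube c s) (%x. (f x)^2)"
  unfolding set_integrable_def
 proof (rule integrableI_bounded)
  have "(\<integral>\<^sup>+ x. ennreal (norm (indicator (cube c s) x *\<^sub>R (f x)\<^sup>2)) \<partial>lborel) =
    (\<integral>\<^sup>+x\<in>cube c s. ennreal ((f x)^2) \<partial>lborel)"
   by (intro nn_integral_cong) (auto simp: indicator_def)
  then show "(\<integral>\<^sup>+ x. ennreal (norm (indicator (cube c s) x *\<^sub>R (f x)\<^sup>2)) \<partial>lborel) < \<infinity>"
   using fin by simp
 qed measurable
 have bound: "\<bar>y\<bar> <= 1 + y^2" for y :: real
 proof (cases "\<bar>y\<bar> <= 1")
  case False
  then have "\<bar>y\<bar> * 1 <= \<bar>y\<bar> * \<bar>y\<bar>" by (intro mult_left_mono) auto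
  then show ?thesis by (simp add: power2_eq_square)
 qed (simp add: add_increasing2)
 have "integrable lborel (%x. indicator (cube c s) x *\<^sub>R (1 + (f x)^2))"
  using set_integral_add(1)[OF set_integrable_cube_const[OF s, of c 1] 2] by (simp add: set_integrable_def)
 then show "set_integrable lborel (cube c s) f"
  unfolding set_integrable_def
  by (rule Bochner_Integration.integrable_bound) (use bound in \<open>auto simp: indicator_def intro!: AE_I2 order_trans[OF bound]\<close>)
qed

lemma set_nn_integral_eq_set_integral':
 fixes g :: "real^3 => real"
 assumes "set_integrable lborel A g" "!!x. 0 <= g x"
 shows "(\<integral>\<^sup>+x\<in>A. ennreal (g x) \<partial>lborel) = ennreal (LINT x:A|lborel. g x)"
proof -
 have "(\<integral>\<^sup>+x\<in>A. ennreal (g x) \<partial>lborel) = (\<integral>\<^sup>+x. ennreal (indicator A x *\<^sub>R g x) \<partial>lborel)"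
  by (intro nn_integral_cong) (auto simp: indicator_def)
 also have "... = ennreal (LINT x|lborel. indicator A x *\<^sub>R g x)"
  using assms by (intro nn_integral_eq_integral) (auto simp: set_integrable_def)
 finally show ?thesis by (simp add: set_lebesgue_integral_def)
qed

lemma variance_le:
 fixes f :: "real^3 => real"
 assumes [measurable]: "f \<in> borel_measurable borel" and s: "0 < s"
  and fin: "(\<integral>\<^sup>+x\<in>cube c s. ennreal ((f x)^2) \<partial>lborel) < \<infinity>"
 shows "(\<integral>\<^sup>+x\<in>cube c s. ennreal ((f x - cube_mean f c s)^2) \<partial>lborel) <= (\<integral>\<^sup>+x\<in>cube c s. ennreal ((f x)^2) \<partial>lborel)"
proof -
 note i = set_integrable_of_square[OF assms]
 define m where "m = cube_mean f c s"
 have V: "0 < 8 * s ^ 3" using s by simp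
 have mI: "(LINT x:cube c s|lborel. f x) = m * (8 * s ^ 3)"
  using V by (simp add: m_def cube_mean_def)
 have eq: "(f x - m)^2 = (f x)^2 + ((- 2 * m) * f x + m^2)" for x by (simp add: power2_eq_square algebra_simps)
 note c = set_integrable_cube_const[OF s]
 have i2: "set_integrable lborel (cube c s) (%x. (- 2 * m) * f x + m^2)"
  by (intro set_integral_add(1) set_integrable_mult_right i c)
 have i3: "set_integrable lborel (cube c s) (%x. (f x - m)^2)"
  unfolding eq by (intro set_integral_add(1) i i2)
 have "(LINT x:cube c s|lborel. (f x - m)^2) = (LINT x:cube c s|lborel. (f x)^2) + ((- 2 * m) * (m * (8 * s ^ 3)) + m^2 * (8 * s ^ 3))"
  unfolding eq using i i2 c set_integrable_mult_right[OF i(1), of "- 2 * m"] s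
  by (simp add: set_integral_add(2) mI set_integral_const cube_measure)
 also have "... <= (LINT x:cube c s|lborel. (f x)^2)"
 proof -
  have "(- 2 * m) * (m * (8 * s ^ 3)) + m^2 * (8 * s ^ 3) = - (m^2 * (8 * s ^ 3))"
   by (simp add: power2_eq_square algebra_simps)
  moreover have "0 <= m^2 * (8 * s ^ 3)" using s by simp
  ultimately show ?thesis by linarith
 qed
 finally show ?thesis
  unfolding m_def[symmetric] using i i3 by (simp add: set_nn_integral_eq_set_integral' ennreal_leI)
qed

lemma power10_sum3: "(norm (v :: real^3)) ^ 10 <= 243 * (\<Sum>i\<in>UNIV. \<bar>v $ i\<bar> ^ 10)"
proof -
 define m where "m = Max (range (%i. \<bar>v $ i\<bar>))"
 have m: "\<bar>v $ i\<bar> <= m" for i unfolding m_def by (rule Max_ge) auto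
 have m0: "0 <= m" using m[of 1] by linarith
 have "m \<in> range (%i. \<bar>v $ i\<bar>)" unfolding m_def by (rule Max_in) auto
 then obtain k where k: "m = \<bar>v $ k\<bar>" by blast
 have "(norm v)^2 = (\<Sum>i\<in>UNIV. (v $ i)^2)" by (simp add: norm_vec_def L2_set_def sum_nonneg)
 also have "... <= (\<Sum>i\<in>(UNIV :: 3 set). m^2)"
  using m m0 by (intro sum_mono) (simp add: abs_le_square_iff[symmetric])
 finally have "(norm v)^2 <= 3 * m^2" by simp
 then have "((norm v)^2) ^ 5 <= (3 * m^2) ^ 5" by (intro power_mono) auto
 then have "(norm v) ^ 10 <= 243 * m ^ 10" by (simp add: power_mult_distrib flip: power_mult)
 also have "m ^ 10 <= (\<Sum>i\<in>UNIV. \<bar>v $ i\<bar> ^ 10)"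
  unfolding k by (rule member_le_sum) auto
 finally show ?thesis by simp
qed

text \<open>The parameter \<open>l\<close> is chosen later to balance the energy with the tenth moment.\<close>

lemma quartic_interpolation:
 assumes "0 < l" "0 <= (f::real)"
 shows "f ^ 4 <= l * f^2 + f ^ 10 / l ^ 3"
proof (cases "f^2 <= l")
 case True
 then have "f^2 * f^2 <= l * f^2" by (intro mult_right_mono) auto
 moreover have "f ^ 4 = f^2 * f^2" by (simp add: power_add[symmetric])
 moreover have "0 <= f ^ 10 / l ^ 3" using assms by simp
 ultimately show ?thesis by linarith
next
 case False
 then have "l ^ 3 <= (f^2) ^ 3" using assms by (intro power_mono) auto
 then have "f ^ 4 * l ^ 3 <= f ^ 4 * (f^2) ^ 3" by (intro mult_left_mono) auto
 also have "... = f ^ 10" by (simp add: power_mult[symmetric] power_add[symmetric])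
 finally have "f ^ 4 <= f ^ 10 / l ^ 3" using assms by (simp add: field_simps)
 moreover have "0 <= l * f^2" using assms by simp
 ultimately show ?thesis by linarith
qed

context flow
begin

definition mean :: "real^3 => real => real => real^3" where
 "mean c r t = (\<chi> i. cube_mean (%x. U (t, x) $ i) c r)"

lemma mean_measurable [measurable]: "mean c r \<in> borel_measurable borel"
proof -
 have "(%t. mean c r t $ i) \<in> borel_measurable borel" for i
 proof -
  have [measurable]: "(%z::spacetime. indicator (cube c r) (snd z) *\<^sub>R (U z $ i)) \<in> borel_measurable borel"
   by measurable
  have "(%t. LINT x|lborel. indicator (cube c r) x *\<^sub>R (U (t, x) $ i)) \<in> borel_measurable borel"
   using slice_integral_measurable[of "%z. indicator (cube c r) (snd z) *\<^sub>R (U z $ i)"] by simp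
  then show ?thesis
   unfolding mean_def cube_mean_def set_lebesgue_integral_def by simp
 qed
 then show ?thesis by (subst borel_measurable_euclidean_space) (auto simp: Basis_vec_def inner_axis)
qed

lemma comp_measurable [measurable]: "(%z. U z $ i) \<in> borel_measurable borel"
 by measurable

lemma comp_square_finite: "(\<integral>\<^sup>+x\<in>A. ennreal ((U (t, x) $ i)^2) \<partial>lborel) < \<infinity>"
proof -
 have "(\<integral>\<^sup>+x\<in>A. ennreal ((U (t, x) $ i)^2) \<partial>lborel) <= (\<integral>\<^sup>+x. ennreal ((norm (U (t, x)))^2) \<partial>lborel)"
 proof (rule nn_integral_mono)
  fix x
  have "(U (t, x) $ i)^2 <= (norm (U (t, x)))^2"
   using component_le_norm_cart[of "U (t, x)" i] by (metis abs_le_square_iff abs_norm_cancel)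
  then show "ennreal ((U (t, x) $ i)^2) * indicator A x <= ennreal ((norm (U (t, x)))^2)"
   by (auto simp: indicator_def ennreal_leI)
 qed
 also have "... <= ennreal E0" by (rule energy)
 finally show ?thesis by (simp add: le_less_trans less_top)
qed

text \<open>The summand \<open>1 / r\<close> only makes the bound for the oscillation positive. Every cube of half side \<open>s\<close>
 lies in a ball of radius \<open>2 s\<close>, which is why the ball of radius \<open>2 r\<close> has to be in the domain.\<close>

lemma tenth_moment:
 assumes r: "0 < r" and B: "ball x0 (2 * r) \<subseteq> \<Omega>" and t: "0 < t" "t < T"
 shows "(\<integral>\<^sup>+x\<in>cube x0 r. ennreal (\<bar>U (t, x) $ i - mean x0 r t $ i\<bar> ^ 10) \<partial>lborel)
  <= ennreal (8 * r ^ 3 * (JN 10 * (2 * unit_ball_vol 3 * (b t + 1 / r)) ^ 10))"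
proof -
 let ?G = "%c s. 0 < s \<and> ball c (2 * s) \<subseteq> ball x0 (2 * r)"
 let ?f = "%x. U (t, x) $ i"
 have si: "set_integrable lborel (cube c s) ?f" if "0 < s" for c s
  by (rule set_integrable_of_square(1)[OF _ that comp_square_finite]) measurable
 interpret bmo_cubes ?G ?f "2 * unit_ball_vol 3 * (b t + 1 / r)"
 proof
  show "?f \<in> borel_measurable borel" by measurable
  fix c s assume G: "?G c s"
  show "0 < s" using G by simp
  then show "set_integrable lborel (cube c s) ?f" by (rule si)
  show "?G (child c s e) (s / 2)" if "e \<in> corners" for e
   using child_ball_subset[OF that, of s c] G by auto
  have "ball c (2 * s) \<subseteq> \<Omega>" using G B by blast
  then obtain k where k: "(\<integral>\<^sup>+x\<in>ball c (2 * s). ennreal (norm (U (t, x) - k)) \<partial>lborel) <= ennreal (b t * (unit_ball_vol 3 * (2 * s) ^ 3))"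
   using bmo[OF t, of "2 * s" c] G by auto
  have "ennreal (LINT x:cube c s|lborel. \<bar>?f x - k $ i\<bar>) = (\<integral>\<^sup>+x\<in>cube c s. ennreal \<bar>?f x - k $ i\<bar> \<partial>lborel)"
   using G by (intro set_nn_integral_eq_set_integral'[symmetric] set_integrable_dev si) auto
  also have "... <= (\<integral>\<^sup>+x\<in>ball c (2 * s). ennreal (norm (U (t, x) - k)) \<partial>lborel)"
  proof (rule nn_integral_mono)
   fix x
   have "\<bar>?f x - k $ i\<bar> <= norm (U (t, x) - k)"
    using component_le_norm_cart[of "U (t, x) - k" i] by simp
   then show "ennreal \<bar>?f x - k $ i\<bar> * indicator (cube c s) x <= ennreal (norm (U (t, x) - k)) * indicator (ball c (2 * s)) x"
    using cube_subset_ball[of s c] G by (auto simp: indicator_def intro!: ennreal_leI)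
  qed
  also note k
  finally have "(LINT x:cube c s|lborel. \<bar>?f x - k $ i\<bar>) <= b t * (unit_ball_vol 3 * (2 * s) ^ 3)"
   using b_nonneg[of t] G by (subst (asm) ennreal_le_iff) auto
  then have "cube_mean (%x. \<bar>?f x - k $ i\<bar>) c s <= b t * unit_ball_vol 3"
   using G by (simp add: cube_mean_def field_simps power_mult_distrib)
  then have "cube_mean (%x. \<bar>?f x - cube_mean ?f c s\<bar>) c s <= 2 * (b t * unit_ball_vol 3)"
   using cube_osc_le_dev[OF si, of s c "k $ i"] G by simp
  also have "... <= 2 * unit_ball_vol 3 * (b t + 1 / r)"
   using r unit_ball_vol_nonneg[of 3] by (simp add: algebra_simps)
  finally show "cube_mean (%x. \<bar>?f x - cube_mean ?f c s\<bar>) c s <= 2 * unit_ball_vol 3 * (b t + 1 / r)" .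
 next
  show "0 < 2 * unit_ball_vol 3 * (b t + 1 / r)"
   using r b_nonneg[of t] unit_ball_vol_pos[of 3] by (intro mult_pos_pos add_nonneg_pos) auto
 qed
 show ?thesis
  using John_Nirenberg[of r x0 10] r by (simp add: mean_def)
qed

definition KPhi :: real where
 "KPhi = 2 + 5832 * JN 10 * (2 * unit_ball_vol 3) ^ 10"

text \<open>A dimensionless bound for the fourth moment; \<open>\<alpha>\<close> stands for the scale-invariant energy.\<close>

definition Phi :: "real => real => real => real" where
 "Phi r \<alpha> t = KPhi * (\<alpha> powr (3/4)) * (1 + r * b t) powr (5/2)"

lemma KPhi_ge: "2 <= KPhi"
 by (auto simp: KPhi_def JN_def)

lemma Phi_ge_1:
 assumes "0 < r" "1 <= \<alpha>" shows "1 <= Phi r \<alpha> t"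
proof -
 have "1 <= \<alpha> powr (3/4)" "1 <= (1 + r * b t) powr (5/2)"
  using assms b_nonneg[of t] by (auto intro!: ge_one_powr_ge_zero)
 then have "1 * 1 * 1 <= KPhi * \<alpha> powr (3/4) * (1 + r * b t) powr (5/2)"
  using KPhi_ge by (intro mult_mono) auto
 then show ?thesis by (simp add: Phi_def)
qed

text \<open>Interpolation between the energy and the \<open>q\<close>-th moment gives the power \<open>2q/(q-2)\<close> of the BMO norm, of
 which the cubic moment takes the power \<open>3/4\<close>. The result has to stay below 2, the exponent of weak
 integrability in time, which holds for \<open>q > 8\<close>: here \<open>q = 10\<close> yields \<open>5/2\<close> and \<open>15/8\<close>.\<close>

lemma fourth_moment:
 assumes r: "0 < r" and B: "ball x0 (2 * r) \<subseteq> \<Omega>" and t: "0 < t" "t < T" and \<alpha>: "1 <= \<alpha>"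
  and A: "(\<integral>\<^sup>+x\<in>ball x0 (2 * r). ennreal ((norm (U (t, x)))^2) \<partial>lborel) <= ennreal (2 * r * \<alpha>)"
 shows "(\<integral>\<^sup>+x\<in>cube x0 r. ennreal ((norm (U (t, x) - mean x0 r t)) ^ 4) \<partial>lborel) <= ennreal (Phi r \<alpha> t / r)"
proof -
 define g where "g = 1 + r * b t"
 have g: "1 <= g" using r b_nonneg[of t] by (simp add: g_def)
 \<comment> \<open>The value at which both terms of the interpolation scale like \<open>\<alpha>\<^sup>3\<^sup>/\<^sup>4 g\<^sup>5\<^sup>/\<^sup>2 / r\<close>.\<close>
 define l where "l = g powr (5/2) * \<alpha> powr (-1/4) / r^2"
 have l: "0 < l" using g \<alpha> r by (simp add: l_def)
 define d where "d x = U (t, x) - mean x0 r t" for x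
 have [measurable]: "d \<in> borel_measurable borel" unfolding d_def by measurable
 define K where "K = 8 * r ^ 3 * (JN 10 * (2 * unit_ball_vol 3 * (b t + 1 / r)) ^ 10)"
 have K0: "0 <= K" using r by (auto simp: K_def JN_def)
 have sq: "(\<integral>\<^sup>+x\<in>cube x0 r. ennreal ((norm (d x))^2) \<partial>lborel) <= ennreal (2 * r * \<alpha>)"
 proof -
  have n2: "ennreal ((norm v)^2) = (\<Sum>i\<in>UNIV. ennreal ((v $ i)^2))" for v :: "real^3"
   by (subst sum_ennreal) (auto simp: norm_vec_def L2_set_def sum_nonneg)
  have "(\<integral>\<^sup>+x\<in>cube x0 r. ennreal ((norm (d x))^2) \<partial>lborel) = (\<Sum>i\<in>UNIV. \<integral>\<^sup>+x\<in>cube x0 r. ennreal ((d x $ i)^2) \<partial>lborel)"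
   unfolding n2 sum_distrib_right by (rule nn_integral_sum) measurable
  also have "... <= (\<Sum>i\<in>UNIV. \<integral>\<^sup>+x\<in>cube x0 r. ennreal ((U (t, x) $ i)^2) \<partial>lborel)"
   unfolding d_def mean_def vector_minus_component vec_lambda_beta
   by (intro sum_mono variance_le comp_square_finite r) measurable
  also have "... = (\<integral>\<^sup>+x\<in>cube x0 r. ennreal ((norm (U (t, x)))^2) \<partial>lborel)"
   unfolding n2 sum_distrib_right by (rule nn_integral_sum[symmetric]) measurable
  also have "... <= (\<integral>\<^sup>+x\<in>ball x0 (2 * r). ennreal ((norm (U (t, x)))^2) \<partial>lborel)"
   using cube_subset_ball[OF r, of x0] by (intro nn_integral_mono) (auto simp: indicator_def)
  finally show ?thesis using A by simp
 qed
 have ten: "(\<integral>\<^sup>+x\<in>cube x0 r. ennreal ((norm (d x)) ^ 10) \<partial>lborel) <= ennreal (729 * K)"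
 proof -
  have "(\<integral>\<^sup>+x\<in>cube x0 r. ennreal ((norm (d x)) ^ 10) \<partial>lborel) <=
    (\<integral>\<^sup>+x. (\<Sum>i\<in>UNIV. 243 * (ennreal (\<bar>d x $ i\<bar> ^ 10) * indicator (cube x0 r) x)) \<partial>lborel)"
  proof (rule nn_integral_mono)
   fix x
   have "ennreal ((norm (d x)) ^ 10) <= ennreal (243 * (\<Sum>i\<in>UNIV. \<bar>d x $ i\<bar> ^ 10))"
    by (intro ennreal_leI power10_sum3)
   also have "... = (\<Sum>i\<in>UNIV. 243 * ennreal (\<bar>d x $ i\<bar> ^ 10))"
    by (subst ennreal_mult) (auto simp: sum_nonneg sum_distrib_left[symmetric] sum_ennreal)
   finally show "ennreal ((norm (d x)) ^ 10) * indicator (cube x0 r) x <= (\<Sum>i\<in>UNIV. 243 * (ennreal (\<bar>d x $ i\<bar> ^ 10) * indicator (cube x0 r) x))"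
    by (auto simp: indicator_def)
  qed
  also have "... = (\<Sum>i\<in>UNIV. 243 * (\<integral>\<^sup>+x\<in>cube x0 r. ennreal (\<bar>d x $ i\<bar> ^ 10) \<partial>lborel))"
   by (simp add: nn_integral_sum nn_integral_cmult)
  also have "... <= (\<Sum>i\<in>(UNIV :: 3 set). 243 * ennreal K)"
   using tenth_moment[OF r B t] by (intro sum_mono mult_left_mono) (auto simp: d_def K_def)
  also have "... = ennreal (729 * K)"
   using K0 by (simp add: ennreal_mult flip: mult.assoc)
  finally show ?thesis .
 qed
 have "(\<integral>\<^sup>+x\<in>cube x0 r. ennreal ((norm (d x)) ^ 4) \<partial>lborel) <=
   (\<integral>\<^sup>+x. ennreal l * (ennreal ((norm (d x))^2) * indicator (cube x0 r) x) + ennreal (1 / l ^ 3) * (ennreal ((norm (d x)) ^ 10) * indicator (cube x0 r) x) \<partial>lborel)"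
 proof (rule nn_integral_mono)
  fix x
  have "ennreal ((norm (d x)) ^ 4) <= ennreal (l * (norm (d x))^2 + (norm (d x)) ^ 10 / l ^ 3)"
   by (intro ennreal_leI quartic_interpolation l) simp
  also have "... = ennreal l * ennreal ((norm (d x))^2) + ennreal (1 / l ^ 3) * ennreal ((norm (d x)) ^ 10)"
   using l by (simp add: ennreal_plus ennreal_mult[symmetric])
  finally show "ennreal ((norm (d x)) ^ 4) * indicator (cube x0 r) x <= ennreal l * (ennreal ((norm (d x))^2) * indicator (cube x0 r) x) + ennreal (1 / l ^ 3) * (ennreal ((norm (d x)) ^ 10) * indicator (cube x0 r) x)"
   by (auto simp: indicator_def)
 qed
 also have "... = ennreal l * (\<integral>\<^sup>+x\<in>cube x0 r. ennreal ((norm (d x))^2) \<partial>lborel) + ennreal (1 / l ^ 3) * (\<integral>\<^sup>+x\<in>cube x0 r. ennreal ((norm (d x)) ^ 10) \<partial>lborel)"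
  by (simp add: nn_integral_add nn_integral_cmult)
 also have "... <= ennreal l * ennreal (2 * r * \<alpha>) + ennreal (1 / l ^ 3) * ennreal (729 * K)"
  by (intro add_mono mult_left_mono sq ten) auto
 also have "... = ennreal (l * (2 * r * \<alpha>) + 1 / l ^ 3 * (729 * K))"
  using l r \<alpha> K0 by (simp add: ennreal_plus ennreal_mult[symmetric])
 also have "l * (2 * r * \<alpha>) + 1 / l ^ 3 * (729 * K) = Phi r \<alpha> t / r"
 proof -
  have a1: "\<alpha> powr (-1/4) * \<alpha> = \<alpha> powr (3/4)"
   using \<alpha> powr_add[of \<alpha> "-1/4" 1] by simp
  have l3: "l ^ 3 = g powr (15/2) * \<alpha> powr (-3/4) / r ^ 6"
   using g \<alpha> by (simp add: l_def power_divide power_mult_distrib powr_power flip: power_mult)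
  have inv: "1 / l ^ 3 = r ^ 6 * (\<alpha> powr (3/4) / g powr (15/2))"
   unfolding l3 using \<alpha> by (simp add: powr_minus_divide)
  have g10: "g ^ 10 / g powr (15/2) = g powr (5/2)"
   using g powr_diff[of g 10 "15/2"] by (simp add: powr_numeral)
  have br: "b t + 1 / r = g / r" using r by (simp add: g_def field_simps)
  have K': "729 * K = 5832 * JN 10 * (2 * unit_ball_vol 3) ^ 10 * (g ^ 10) / r ^ 7"
   using r by (simp add: K_def br power_mult_distrib power_divide field_simps power_add[symmetric])
  have "1 / l ^ 3 * (729 * K) = (5832 * JN 10 * (2 * unit_ball_vol 3) ^ 10) * \<alpha> powr (3/4) * (g ^ 10 / g powr (15/2)) * (r ^ 6 / r ^ 7)"
   unfolding inv K' by (simp add: field_simps)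
  also have "r ^ 6 / r ^ 7 = 1 / r" using r by (simp add: field_simps power_Suc[symmetric] numeral_eq_Suc)
  finally have 2: "1 / l ^ 3 * (729 * K) = (5832 * JN 10 * (2 * unit_ball_vol 3) ^ 10) * \<alpha> powr (3/4) * g powr (5/2) / r"
   by (simp add: g10)
  have 1: "l * (2 * r * \<alpha>) = 2 * \<alpha> powr (3/4) * g powr (5/2) / r"
   unfolding l_def a1[symmetric] using r by (simp add: field_simps power2_eq_square)
  show ?thesis unfolding 1 2 Phi_def KPhi_def g_def[symmetric]
   by (simp only: distrib_right add_divide_distrib)
 qed
 finally show ?thesis by (simp add: d_def)
qed

end

section \<open>Decay of the cubic quantities\<close>

lemma young_32: "0 <= x ==> 0 <= y ==> x^2 * y <= x ^ 3 + (y::real) ^ 3"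
proof (cases "x <= y")
 case True
 assume "0 <= x" "0 <= y"
 then have "x^2 * y <= y^2 * y" using True by (intro mult_right_mono power_mono) auto
 then show ?thesis using \<open>0 <= x\<close> by (simp add: power3_eq_cube power2_eq_square add_increasing)
next
 case False
 assume "0 <= x" "0 <= y"
 then have "x^2 * y <= x^2 * x" using False by (intro mult_left_mono) auto
 then show ?thesis using \<open>0 <= y\<close> by (simp add: power3_eq_cube power2_eq_square add_increasing2)
qed

lemma sqrt_powr: "\<bar>y\<bar> powr (3/2) = (sqrt \<bar>y\<bar>) ^ 3"
proof (cases "y = 0")
 case False
 then show ?thesis by (simp add: powr_half_sqrt[symmetric] powr_power)
qed simp

lemma abs_le_one_plus_powr: "\<bar>y\<bar> <= 1 + \<bar>y::real\<bar> powr (3/2)"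
proof (cases "\<bar>y\<bar> <= 1")
 case False
 then have "\<bar>y\<bar> powr 1 <= \<bar>y\<bar> powr (3/2)" by (intro powr_mono) auto
 then show ?thesis by simp
qed (simp add: add_increasing2)

text \<open>A power is dominated by a step function with dyadic levels, whose integral only involves the
 measures of the superlevel sets.\<close>

lemma dyadic_majorant:
 assumes "0 <= y"
 shows "ennreal ((1 + y) powr (15/8)) <=
  4 + (\<Sum>k. ennreal (16 * (2 powr (15/8)) ^ k) * (if 2 ^ k < y then 1 else 0))"
proof (cases "y <= 1")
 case True
 have "(1 + y) powr (15/8) <= 2 powr (15/8)" using assms True by (intro powr_mono2) auto
 also have "... <= 2 powr 2" by (intro powr_mono) auto
 finally have "ennreal ((1 + y) powr (15/8)) <= ennreal 4" by (intro ennreal_leI) simp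
 then show ?thesis by (simp add: add_increasing2)
next
 case False
 have ex: "\<exists>k. y <= 2 ^ k" using real_arch_pow[of 2 y] by (auto intro: less_imp_le)
 define n where "n = (LEAST k. y <= 2 ^ k)"
 have n: "y <= 2 ^ n" unfolding n_def by (rule LeastI_ex[OF ex])
 have "n ~= 0" using n False by (cases n) auto
 then obtain k where k: "n = Suc k" by (cases n) auto
 have lt: "2 ^ k < y"
 proof (rule ccontr)
  assume "\<not> 2 ^ k < y"
  then have "n <= k" unfolding n_def by (intro Least_le) simp
  then show False using k by simp
 qed
 have "(1 + y) powr (15/8) <= (2 ^ (k + 2)) powr (15/8)"
  using n k False by (intro powr_mono2) auto
 also have "... = 2 powr (15/4) * (2 powr (15/8)) ^ k"
 proof -
  have "(2 ^ (k + 2)) powr (15/8) = (2 powr (real k + 2)) powr (15/8)"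
   by (simp add: powr_add powr_realpow mult.commute)
  also have "... = 2 powr (15/4 + (15/8) * real k)" by (simp add: powr_powr algebra_simps add_divide_distrib)
  also have "... = 2 powr (15/4) * (2 powr (15/8)) ^ k" by (simp add: powr_add powr_power mult.commute)
  finally show ?thesis .
 qed
 also have "... <= 16 * (2 powr (15/8)) ^ k"
 proof (rule mult_right_mono)
  have "2 powr (15/4) <= (2::real) powr 4" by (intro powr_mono) auto
  then show "2 powr (15/4) <= (16::real)" by simp
 qed simp
 finally have "ennreal ((1 + y) powr (15/8)) <= ennreal (16 * (2 powr (15/8)) ^ k) * (if 2 ^ k < y then 1 else 0)"
  using lt by (simp add: ennreal_leI)
 also have "... <= (\<Sum>k. ennreal (16 * (2 powr (15/8)) ^ k) * (if 2 ^ k < y then 1 else 0))"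
  using sum_le_suminf[of "%k. ennreal (16 * (2 powr (15/8)) ^ k) * (if 2 ^ k < y then 1 else 0)" "{k}"]
  by (simp add: summableI)
 finally show ?thesis by (simp add: add_increasing)
qed

definition KW :: real where
 "KW = 4 + 16 / (1 - 2 powr (15/8) / 4)"

lemma KW_ratio: "0 < 2 powr (15/8) / (4::real)" "2 powr (15/8) / 4 < (1::real)"
proof -
 have "2 powr (15/8) < (2::real) powr 2" by (intro powr_less_mono) auto
 then show "2 powr (15/8) / 4 < (1::real)" by simp
qed simp

lemma KW_pos: "0 < KW"
 using KW_ratio by (auto simp: KW_def intro!: add_pos_pos)

context flow
begin

text \<open>The weak \<open>L\<^sup>2\<close> bound makes the contribution of the level \<open>2\<^sup>k\<close> proportional to \<open>(2\<^sup>1\<^sup>5\<^sup>/\<^sup>8 / 4)\<^sup>k\<close>, and the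
 geometric series converges because \<open>15/8 < 2\<close>. Scale invariance shows in the factor \<open>r\<^sup>2\<close>.\<close>

lemma weak_integral:
 assumes r: "0 < r" and J: "J \<subseteq> {0<..<T}" "J \<in> sets borel" "emeasure lborel J <= ennreal (r^2)"
 shows "(\<integral>\<^sup>+t\<in>J. ennreal ((1 + r * b t) powr (15/8)) \<partial>lborel) <= ennreal (KW * (1 + M^2) * r^2)"
proof -
 define q :: real where "q = 2 powr (15/8) / 4"
 have q: "0 < q" "q < 1" using KW_ratio by (auto simp: q_def)
 define c where "c k = ennreal (16 * (2 powr (15/8)) ^ k)" for k :: nat
 have J' [measurable]: "J \<in> sets borel" by fact
 have lev: "(\<integral>\<^sup>+t. (if 2 ^ k < r * b t then 1 else 0) * indicator J t \<partial>lborel) <= ennreal (M^2 * r^2 / 4 ^ k)" for k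
 proof -
  have "(\<integral>\<^sup>+t. (if 2 ^ k < r * b t then 1 else 0) * indicator J t \<partial>lborel) <= (\<integral>\<^sup>+t. indicator {t. 0 < t \<and> t < T \<and> 2 ^ k / r < b t} t \<partial>lborel)"
   using J(1) r by (intro nn_integral_mono) (auto simp: indicator_def field_simps)
  also have "... = emeasure lborel {t. 0 < t \<and> t < T \<and> 2 ^ k / r < b t}"
   by (intro nn_integral_indicator) measurable
  also have "... <= ennreal (M^2 / (2 ^ k / r)^2)" by (rule weakL2) (use r in simp)
  also have "M^2 / (2 ^ k / r)^2 = M^2 * r^2 / 4 ^ k"
   by (simp add: power_divide power_mult[symmetric] mult.commute[of k 2] power_mult)
  finally show ?thesis .
 qed
 have "(\<integral>\<^sup>+t\<in>J. ennreal ((1 + r * b t) powr (15/8)) \<partial>lborel) <=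
   (\<integral>\<^sup>+t. 4 * indicator J t + (\<Sum>k. c k * ((if 2 ^ k < r * b t then 1 else 0) * indicator J t)) \<partial>lborel)"
 proof (rule nn_integral_mono)
  fix t
  have "0 <= r * b t" using r b_nonneg by simp
  from dyadic_majorant[OF this]
  show "ennreal ((1 + r * b t) powr (15/8)) * indicator J t <= 4 * indicator J t + (\<Sum>k. c k * ((if 2 ^ k < r * b t then 1 else 0) * indicator J t))"
   by (auto simp: indicator_def c_def)
 qed
 also have "... = 4 * emeasure lborel J + (\<Sum>k. c k * (\<integral>\<^sup>+t. (if 2 ^ k < r * b t then 1 else 0) * indicator J t \<partial>lborel))"
  by (simp add: nn_integral_add nn_integral_suminf nn_integral_cmult)
 also have "... <= 4 * ennreal (r^2) + (\<Sum>k. ennreal (16 * M^2 * r^2 * q ^ k))"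
 proof (intro add_mono mult_left_mono J(3) suminf_le summableI)
  fix k
  have "c k * (\<integral>\<^sup>+t. (if 2 ^ k < r * b t then 1 else 0) * indicator J t \<partial>lborel) <= c k * ennreal (M^2 * r^2 / 4 ^ k)"
   by (intro mult_left_mono lev) simp
  also have "... = ennreal (16 * M^2 * r^2 * q ^ k)"
   by (simp add: c_def ennreal_mult[symmetric] q_def power_divide mult_ac)
  finally show "c k * (\<integral>\<^sup>+t. (if 2 ^ k < r * b t then 1 else 0) * indicator J t \<partial>lborel) <= ennreal (16 * M^2 * r^2 * q ^ k)" .
 qed simp
 also have "(\<Sum>k. ennreal (16 * M^2 * r^2 * q ^ k)) = ennreal (16 * M^2 * r^2 * (1 / (1 - q)))"
  using q by (intro suminf_ennreal_eq sums_mult geometric_sums) auto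
 also have "4 * ennreal (r^2) + ennreal (16 * M^2 * r^2 * (1 / (1 - q))) = ennreal (4 * r^2 + 16 * M^2 * r^2 * (1 / (1 - q)))"
  using q by (simp add: ennreal_plus ennreal_mult)
 also have "... <= ennreal (KW * (1 + M^2) * r^2)"
 proof (rule ennreal_leI)
  have "0 <= 1 / (1 - q)" using q by simp
  then have "0 <= 16 * r^2 * (1 / (1 - q)) + 4 * M^2 * r^2" by simp
  moreover have "KW * (1 + M^2) * r^2 = 4 * r^2 + 16 * M^2 * r^2 * (1 / (1 - q)) + (16 * r^2 * (1 / (1 - q)) + 4 * M^2 * r^2)"
   unfolding KW_def q_def[symmetric] by (simp add: algebra_simps add_divide_distrib)
  ultimately show "4 * r^2 + 16 * M^2 * r^2 * (1 / (1 - q)) <= KW * (1 + M^2) * r^2" by linarith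
 qed
 finally show ?thesis .
qed

text \<open>The source term of all decay estimates. Up to a constant it bounds the cubic moment of the velocity minus
 its mean.\<close>

definition Nu :: "real => real => real => real" where
 "Nu r \<alpha> t = Phi r \<alpha> t powr (3/4)"

lemma Phi_measurable [measurable]: "Phi r \<alpha> \<in> borel_measurable borel"
 unfolding Phi_def[abs_def] by measurable

lemma Nu_measurable [measurable]: "Nu r \<alpha> \<in> borel_measurable borel"
 unfolding Nu_def[abs_def] by measurable

lemma Nu_nonneg: "0 <= Nu r \<alpha> t" by (simp add: Nu_def)

definition KN :: real where "KN = KPhi powr (3/4) * KW"

text \<open>The energy enters with the power \<open>9/16 < 1\<close>. This sublinearity is what closes the iteration.\<close>

lemma Nu_integral:
 assumes r: "0 < r" and \<alpha>: "1 <= \<alpha>" and J: "J \<subseteq> {0<..<T}" "J \<in> sets borel" "emeasure lborel J <= ennreal (r^2)"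
 shows "(\<integral>\<^sup>+t\<in>J. ennreal (Nu r \<alpha> t) \<partial>lborel) <= ennreal (KN * (1 + M^2) * \<alpha> powr (9/16) * r^2)"
proof -
 define c where "c = KPhi powr (3/4) * \<alpha> powr (9/16)"
 have eq: "Nu r \<alpha> t = c * (1 + r * b t) powr (15/8)" for t
  using KPhi_ge \<alpha> r b_nonneg[of t] by (simp add: Nu_def Phi_def c_def powr_mult powr_powr)
 have "(\<integral>\<^sup>+t\<in>J. ennreal (Nu r \<alpha> t) \<partial>lborel) = ennreal c * (\<integral>\<^sup>+t\<in>J. ennreal ((1 + r * b t) powr (15/8)) \<partial>lborel)"
  unfolding eq using J(2)
  by (subst nn_integral_cmult[symmetric]) (auto simp: c_def ennreal_mult mult.assoc)
 also have "... <= ennreal c * ennreal (KW * (1 + M^2) * r^2)"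
  by (intro mult_left_mono weak_integral r J) simp
 also have "... = ennreal (KN * (1 + M^2) * \<alpha> powr (9/16) * r^2)"
  using KW_pos by (simp add: ennreal_mult[symmetric] c_def KN_def mult_ac)
 finally show ?thesis .
qed

lemma third_moment:
 assumes r: "0 < r" and \<alpha>: "1 <= \<alpha>"
  and F: "(\<integral>\<^sup>+x\<in>cube x0 r. ennreal ((norm (U (t, x) - mean x0 r t)) ^ 4) \<partial>lborel) <= ennreal (Phi r \<alpha> t / r)"
 shows "(\<integral>\<^sup>+x\<in>cube x0 r. ennreal ((norm (U (t, x) - mean x0 r t)) ^ 3) \<partial>lborel) <= ennreal (9 * Nu r \<alpha> t)"
proof -
 define P where "P = Phi r \<alpha> t"
 have P: "1 <= P" unfolding P_def by (rule Phi_ge_1[OF r \<alpha>])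
 \<comment> \<open>Both terms of the interpolation then have the size \<open>P\<^sup>3\<^sup>/\<^sup>4\<close>.\<close>
 define m where "m = r * P powr (-1/4)"
 have m: "0 < m" using r P by (simp add: m_def)
 define d where "d x = norm (U (t, x) - mean x0 r t)" for x
 have [measurable]: "d \<in> borel_measurable borel" unfolding d_def by measurable
 have d0: "0 <= d x" for x by (simp add: d_def)
 have ptw: "y ^ 3 <= m * y ^ 4 + 1 / m ^ 3" if "0 <= y" for y :: real
 proof (cases "1 <= m * y")
  case True
  then have "y ^ 3 * 1 <= y ^ 3 * (m * y)" using that by (intro mult_left_mono) auto
  moreover have "y ^ 3 * (m * y) = m * y ^ 4" by (simp add: power_Suc numeral_eq_Suc)
  moreover have "0 <= 1 / m ^ 3" using m by simp
  ultimately show ?thesis by linarith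
 next
  case False
  then have "y ^ 3 <= (1 / m) ^ 3" using that m by (intro power_mono) (auto simp: field_simps)
  moreover have "0 <= m * y ^ 4" using m that by simp
  ultimately show ?thesis by (simp add: power_divide)
 qed
 have "(\<integral>\<^sup>+x\<in>cube x0 r. ennreal (d x ^ 3) \<partial>lborel) <= (\<integral>\<^sup>+x. ennreal m * (ennreal (d x ^ 4) * indicator (cube x0 r) x) + ennreal (1 / m ^ 3) * indicator (cube x0 r) x \<partial>lborel)"
 proof (rule nn_integral_mono)
  fix x
  have "ennreal (d x ^ 3) <= ennreal m * ennreal (d x ^ 4) + ennreal (1 / m ^ 3)"
   using ennreal_leI[OF ptw[OF d0]] m d0 by (simp add: ennreal_plus ennreal_mult)
  then show "ennreal (d x ^ 3) * indicator (cube x0 r) x <= ennreal m * (ennreal (d x ^ 4) * indicator (cube x0 r) x) + ennreal (1 / m ^ 3) * indicator (cube x0 r) x"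
   by (auto simp: indicator_def)
 qed
 also have "... = ennreal m * (\<integral>\<^sup>+x\<in>cube x0 r. ennreal (d x ^ 4) \<partial>lborel) + ennreal (1 / m ^ 3) * ennreal (8 * r ^ 3)"
  using r by (simp add: nn_integral_add nn_integral_cmult cube_measure)
 also have "... <= ennreal m * ennreal (P / r) + ennreal (1 / m ^ 3) * ennreal (8 * r ^ 3)"
  using F by (intro add_right_mono mult_left_mono) (auto simp: d_def P_def)
 also have "... = ennreal (m * (P / r) + 1 / m ^ 3 * (8 * r ^ 3))"
  using m P r by (simp add: ennreal_plus ennreal_mult[symmetric])
 also have "m * (P / r) + 1 / m ^ 3 * (8 * r ^ 3) = 9 * Nu r \<alpha> t"
 proof -
  have "P powr (-1/4) * P = P powr (3/4)" using P powr_add[of P "-1/4" 1] by simp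
  then have 1: "m * (P / r) = P powr (3/4)" using r by (simp add: m_def)
  have "m ^ 3 = r ^ 3 * P powr (-3/4)" using P by (simp add: m_def power_mult_distrib powr_power)
  then have 2: "1 / m ^ 3 * (8 * r ^ 3) = 8 * P powr (3/4)" using r P by (simp add: powr_minus_divide)
  show ?thesis unfolding 1 2 by (simp add: Nu_def P_def)
 qed
 finally show ?thesis by (simp add: d_def)
qed

definition KC :: real where "KC = 72 + 72 * unit_ball_vol 3"

lemma KC_pos: "0 < KC" using unit_ball_vol_pos[of 3] by (simp add: KC_def add_pos_pos)

text \<open>On a smaller ball the velocity is its mean over the cube plus the oscillation; the mean contributes a
 small multiple of the cubic integral because the volume of the smaller ball is small.\<close>

lemma cubic_decay:
 assumes r: "0 < r" and \<alpha>: "1 <= \<alpha>" and \<theta>: "0 < \<theta>" "\<theta> <= 1"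
  and F: "(\<integral>\<^sup>+x\<in>cube x0 r. ennreal ((norm (U (t, x) - mean x0 r t)) ^ 4) \<partial>lborel) <= ennreal (Phi r \<alpha> t / r)"
 shows "(\<integral>\<^sup>+x\<in>ball x0 (\<theta> * r). ennreal (norm (U (t, x)) ^ 3) \<partial>lborel) <=
  ennreal (KC * \<theta> ^ 3) * (\<integral>\<^sup>+x\<in>ball x0 (2 * r). ennreal (norm (U (t, x)) ^ 3) \<partial>lborel) + ennreal KC * ennreal (Nu r \<alpha> t)"
proof -
 define u where "u x = U (t, x)" for x
 have [measurable]: "u \<in> borel_measurable borel" unfolding u_def by measurable
 define a where "a = norm (mean x0 r t)"
 define d where "d x = norm (u x - mean x0 r t)" for x
 define n where "n = Nu r \<alpha> t"
 define ub :: real where "ub = unit_ball_vol 3"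
 define X where "X = (\<integral>\<^sup>+x\<in>ball x0 (2 * r). ennreal (norm (u x) ^ 3) \<partial>lborel)"
 have ub: "0 <= ub" by (simp add: ub_def)
 have n: "0 <= n" by (simp add: n_def Nu_nonneg)
 have a: "0 <= a" by (simp add: a_def)
 have [measurable]: "d \<in> borel_measurable borel" unfolding d_def by measurable
 have d0: "0 <= d x" for x by (simp add: d_def)
 have d3: "(\<integral>\<^sup>+x\<in>cube x0 r. ennreal (d x ^ 3) \<partial>lborel) <= ennreal (9 * n)"
  using third_moment[OF r \<alpha> F] by (simp add: d_def n_def u_def)
 have p1: "norm (u x) ^ 3 <= 8 * d x ^ 3 + 8 * a ^ 3" for x
 proof -
  have "norm (u x) ^ 3 <= (d x + a) ^ 3"
   using norm_triangle_ineq[of "u x - mean x0 r t" "mean x0 r t"] by (intro power_mono) (auto simp: d_def a_def)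
  also have "... <= 8 * (d x ^ 3 + a ^ 3)" using power_add_bound[OF d0 a, of x 3] by simp
  finally show ?thesis by simp
 qed
 have p2: "a ^ 3 <= 8 * norm (u x) ^ 3 + 8 * d x ^ 3" for x
 proof -
  have "a ^ 3 <= (norm (u x) + d x) ^ 3"
   using norm_triangle_ineq4[of "u x" "u x - mean x0 r t"] by (intro power_mono) (auto simp: d_def a_def)
  also have "... <= 8 * (norm (u x) ^ 3 + d x ^ 3)" using power_add_bound[OF _ d0, of "norm (u x)" x 3] by simp
  finally show ?thesis by simp
 qed
 have e8: "ennreal (8 * x + 8 * y) = 8 * ennreal x + 8 * ennreal y" if "0 <= x" "0 <= y" for x y
  using that by (simp add: ennreal_plus ennreal_mult)
 have A: "ennreal (8 * r ^ 3 * a ^ 3) <= 8 * X + ennreal (72 * n)"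
 proof -
  have "ennreal (8 * r ^ 3 * a ^ 3) = (\<integral>\<^sup>+x\<in>cube x0 r. ennreal (a ^ 3) \<partial>lborel)"
  proof -
   have "(\<integral>\<^sup>+x\<in>cube x0 r. ennreal (a ^ 3) \<partial>lborel) = ennreal (a ^ 3) * emeasure lborel (cube x0 r)"
    by (rule nn_integral_cmult_indicator) simp
   then show ?thesis using r a by (simp add: cube_measure ennreal_mult[symmetric] mult_ac)
  qed
  also have "... <= (\<integral>\<^sup>+x. 8 * (ennreal (norm (u x) ^ 3) * indicator (ball x0 (2 * r)) x) + 8 * (ennreal (d x ^ 3) * indicator (cube x0 r) x) \<partial>lborel)"
  proof (rule nn_integral_mono)
   fix x
   have "ennreal (a ^ 3) <= 8 * ennreal (norm (u x) ^ 3) + 8 * ennreal (d x ^ 3)"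
    using ennreal_leI[OF p2[of x]] e8[of "norm (u x) ^ 3" "d x ^ 3"] d0[of x] by simp
   then show "ennreal (a ^ 3) * indicator (cube x0 r) x <= 8 * (ennreal (norm (u x) ^ 3) * indicator (ball x0 (2 * r)) x) + 8 * (ennreal (d x ^ 3) * indicator (cube x0 r) x)"
    using subsetD[OF cube_subset_ball[OF r, of x0], of x] by (cases "x \<in> cube x0 r") simp_all
  qed
  also have "... = 8 * X + 8 * (\<integral>\<^sup>+x\<in>cube x0 r. ennreal (d x ^ 3) \<partial>lborel)"
   unfolding X_def by (rule nn_integral_lincomb) measurable
  also have "... <= 8 * X + 8 * ennreal (9 * n)" by (intro add_left_mono mult_left_mono d3) simp
  also have "8 * ennreal (9 * n) = ennreal (72 * n)" using n by (simp add: ennreal_mult flip: mult.assoc)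
  finally show ?thesis .
 qed
 have sub: "ball x0 (\<theta> * r) \<subseteq> cube x0 r"
 proof -
  have "\<theta> * r <= 1 * r" using \<theta> r by (intro mult_right_mono) auto
  then have "ball x0 (\<theta> * r) \<subseteq> ball x0 r" by auto
  then show ?thesis using ball_subset_cube by blast
 qed
 have "(\<integral>\<^sup>+x\<in>ball x0 (\<theta> * r). ennreal (norm (u x) ^ 3) \<partial>lborel) <=
   (\<integral>\<^sup>+x. 8 * (ennreal (d x ^ 3) * indicator (cube x0 r) x) + ennreal (8 * a ^ 3) * indicator (ball x0 (\<theta> * r)) x \<partial>lborel)"
 proof (rule nn_integral_mono)
  fix x
  have "ennreal (norm (u x) ^ 3) <= 8 * ennreal (d x ^ 3) + ennreal (8 * a ^ 3)"
   using ennreal_leI[OF p1[of x]] e8[of "d x ^ 3" "a ^ 3"] d0[of x] a by (simp add: ennreal_mult)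
  then show "ennreal (norm (u x) ^ 3) * indicator (ball x0 (\<theta> * r)) x <= 8 * (ennreal (d x ^ 3) * indicator (cube x0 r) x) + ennreal (8 * a ^ 3) * indicator (ball x0 (\<theta> * r)) x"
   using subsetD[OF sub, of x] by (cases "x \<in> ball x0 (\<theta> * r)") simp_all
 qed
 also have "... = 8 * (\<integral>\<^sup>+x\<in>cube x0 r. ennreal (d x ^ 3) \<partial>lborel) + ennreal (8 * a ^ 3) * emeasure lborel (ball x0 (\<theta> * r))"
  by (rule nn_integral_lincomb_indicator) measurable
 also have "emeasure lborel (ball x0 (\<theta> * r)) = ennreal (ub * \<theta> ^ 3 * r ^ 3)"
  using \<theta> r by (simp add: emeasure_ball ub_def power_mult_distrib mult_ac)
 also have "8 * (\<integral>\<^sup>+x\<in>cube x0 r. ennreal (d x ^ 3) \<partial>lborel) + ennreal (8 * a ^ 3) * ennreal (ub * \<theta> ^ 3 * r ^ 3)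
   <= 8 * ennreal (9 * n) + ennreal (ub * \<theta> ^ 3) * (8 * X + ennreal (72 * n))"
 proof (intro add_mono mult_left_mono d3)
  have "ennreal (8 * a ^ 3) * ennreal (ub * \<theta> ^ 3 * r ^ 3) = ennreal (ub * \<theta> ^ 3) * ennreal (8 * r ^ 3 * a ^ 3)"
   using a ub \<theta> r by (simp add: ennreal_mult[symmetric] mult_ac)
  also have "... <= ennreal (ub * \<theta> ^ 3) * (8 * X + ennreal (72 * n))"
   by (intro mult_left_mono A) simp
  finally show "ennreal (8 * a ^ 3) * ennreal (ub * \<theta> ^ 3 * r ^ 3) <= ennreal (ub * \<theta> ^ 3) * (8 * X + ennreal (72 * n))" .
 qed simp
 also have "... = ennreal (8 * ub * \<theta> ^ 3) * X + ennreal (72 * n + ub * \<theta> ^ 3 * (72 * n))"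
  using n ub \<theta> by (simp add: distrib_left ennreal_plus ennreal_mult flip: mult.assoc) (simp add: mult_ac add_ac)
 also have "... <= ennreal (KC * \<theta> ^ 3) * X + ennreal (KC * n)"
 proof (rule add_mono[OF mult_right_mono[OF ennreal_leI] ennreal_leI])
  show "8 * ub * \<theta> ^ 3 <= KC * \<theta> ^ 3"
   using ub \<theta> by (intro mult_right_mono) (auto simp: KC_def ub_def)
  have "ub * \<theta> ^ 3 * (72 * n) <= ub * 1 * (72 * n)"
   using \<theta> ub n by (intro mult_right_mono mult_left_mono power_le_one) auto
  then show "72 * n + ub * \<theta> ^ 3 * (72 * n) <= KC * n"
   by (simp add: KC_def ub_def[symmetric] algebra_simps)
 qed simp
 finally show ?thesis
  using KC_pos n by (simp add: X_def n_def u_def ennreal_mult)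
qed

end

section \<open>Decay of the pressure\<close>

lemma integral_le_of_nn:
 fixes f :: "'a => real"
 assumes "(\<integral>\<^sup>+x. ennreal \<bar>f x\<bar> \<partial>N) <= ennreal X" "0 <= X"
 shows "(LINT x|N. f x) <= X"
proof (cases "integrable N f")
 case True
 have "(LINT x|N. f x) <= (LINT x|N. \<bar>f x\<bar>)" using True by (intro integral_mono) auto
 moreover have "ennreal (LINT x|N. \<bar>f x\<bar>) = (\<integral>\<^sup>+x. ennreal \<bar>f x\<bar> \<partial>N)"
  using True by (intro nn_integral_eq_integral[symmetric]) auto
 then have "ennreal (LINT x|N. \<bar>f x\<bar>) <= ennreal X" using assms(1) by (simp only:)
 then have "(LINT x|N. \<bar>f x\<bar>) <= X" using assms(2) by (simp only: ennreal_le_iff)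
 ultimately show ?thesis by (rule order_trans)
qed (use assms in \<open>simp add: not_integrable_integral_eq\<close>)

text \<open>Integrability on bounded sets is all that pairing with a test function needs.\<close>

definition locally_finite_int :: "(spacetime => real) => bool" where
 "locally_finite_int F \<longleftrightarrow> F \<in> borel_measurable borel \<and>
   (\<forall>K. compact K --> (\<integral>\<^sup>+z\<in>K. ennreal \<bar>F z\<bar> \<partial>lborel) < \<infinity>)"

lemma integrable_test_mult:
 assumes F: "locally_finite_int F" and G: "G \<in> test_fun V"
 shows "integrable lborel (%z. F z * G z)"
proof (rule integrableI_bounded)
 have [measurable]: "F \<in> borel_measurable borel" "G \<in> borel_measurable borel"
  using F smooth_borel[OF test_funD(1)[OF G]] by (auto simp: locally_finite_int_def)
 have [measurable]: "support G \<in> sets borel" by (rule borel_compact[OF test_funD(2)[OF G]])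
 show "(%z. F z * G z) \<in> borel_measurable lborel" by measurable
 obtain B where B: "0 <= B" "!!z. \<bar>G z\<bar> <= B" using test_fun_bounded[OF G] by metis
 have "(\<integral>\<^sup>+z. ennreal (norm (F z * G z)) \<partial>lborel) <= (\<integral>\<^sup>+z. ennreal B * (ennreal \<bar>F z\<bar> * indicator (support G) z) \<partial>lborel)"
 proof (rule nn_integral_mono)
  fix z
  show "ennreal (norm (F z * G z)) <= ennreal B * (ennreal \<bar>F z\<bar> * indicator (support G) z)"
  proof (cases "z \<in> support G")
   case True
   have "\<bar>F z\<bar> * \<bar>G z\<bar> <= B * \<bar>F z\<bar>"
    using mult_left_mono[OF B(2)[of z], of "\<bar>F z\<bar>"] by (simp add: mult.commute)
   then show ?thesis using True B by (simp add: abs_mult ennreal_mult[symmetric] ennreal_leI)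
  qed (use not_in_support[of z G] in simp)
 qed
 also have "... = ennreal B * (\<integral>\<^sup>+z\<in>support G. ennreal \<bar>F z\<bar> \<partial>lborel)"
  by (intro nn_integral_cmult) measurable
 also have "... < \<infinity>"
  using F test_funD(2)[OF G] by (auto simp: locally_finite_int_def ennreal_mult_less_top)
 finally show "(\<integral>\<^sup>+z. ennreal (norm (F z * G z)) \<partial>lborel) < \<infinity>" .
qed

lemma locally_finite_int_mono:
 assumes H: "locally_finite_int H" and F: "F \<in> borel_measurable borel" "!!z. \<bar>F z\<bar> <= H z"
 shows "locally_finite_int F"
 unfolding locally_finite_int_def
proof (intro conjI allI impI F(1))
 fix K :: "spacetime set" assume K: "compact K"
 have "(\<integral>\<^sup>+z\<in>K. ennreal \<bar>F z\<bar> \<partial>lborel) <= (\<integral>\<^sup>+z\<in>K. ennreal \<bar>H z\<bar> \<partial>lborel)"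
  using order_trans[OF F(2) abs_ge_self] by (intro nn_integral_mono mult_right_mono ennreal_leI) auto
 also have "... < \<infinity>" using H K by (simp add: locally_finite_int_def)
 finally show "(\<integral>\<^sup>+z\<in>K. ennreal \<bar>F z\<bar> \<partial>lborel) < \<infinity>" .
qed

lemma locally_finite_int_const: "locally_finite_int (%z. c)"
 unfolding locally_finite_int_def
proof (intro conjI allI impI)
 fix K :: "spacetime set" assume K: "compact K"
 then have "emeasure lborel K < \<infinity>" "K \<in> sets borel"
  using emeasure_compact_finite[OF K] by (auto intro: borel_compact)
 then show "(\<integral>\<^sup>+z\<in>K. ennreal \<bar>c\<bar> \<partial>lborel) < \<infinity>"
  by (simp add: nn_integral_cmult_indicator ennreal_mult_less_top)
qed simp

lemma locally_finite_int_add_mult: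
 assumes F: "locally_finite_int F" and G: "locally_finite_int G"
 shows "locally_finite_int (%z. c * (F z + G z))"
 unfolding locally_finite_int_def
proof (intro conjI allI impI)
 have [measurable]: "F \<in> borel_measurable borel" "G \<in> borel_measurable borel"
  using F G by (auto simp: locally_finite_int_def)
 show "(%z. c * (F z + G z)) \<in> borel_measurable borel" by measurable
 fix K :: "spacetime set" assume K: "compact K"
 have [measurable]: "K \<in> sets borel" by (rule borel_compact[OF K])
 have "(\<integral>\<^sup>+z\<in>K. ennreal \<bar>c * (F z + G z)\<bar> \<partial>lborel) <=
   (\<integral>\<^sup>+z. ennreal \<bar>c\<bar> * (ennreal \<bar>F z\<bar> * indicator K z + ennreal \<bar>G z\<bar> * indicator K z) \<partial>lborel)"
 proof (rule nn_integral_mono)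
  fix z
  have "\<bar>c * (F z + G z)\<bar> <= \<bar>c\<bar> * (\<bar>F z\<bar> + \<bar>G z\<bar>)"
   by (simp add: abs_mult mult_left_mono)
  from ennreal_leI[OF this]
  show "ennreal \<bar>c * (F z + G z)\<bar> * indicator K z <= ennreal \<bar>c\<bar> * (ennreal \<bar>F z\<bar> * indicator K z + ennreal \<bar>G z\<bar> * indicator K z)"
   by (auto simp: indicator_def ennreal_mult ennreal_plus)
 qed
 also have "... = ennreal \<bar>c\<bar> * ((\<integral>\<^sup>+z\<in>K. ennreal \<bar>F z\<bar> \<partial>lborel) + (\<integral>\<^sup>+z\<in>K. ennreal \<bar>G z\<bar> \<partial>lborel))"
  by (simp add: nn_integral_cmult nn_integral_add)
 also have "... < \<infinity>" using F G K by (simp add: locally_finite_int_def ennreal_mult_less_top)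
 finally show "(\<integral>\<^sup>+z\<in>K. ennreal \<bar>c * (F z + G z)\<bar> \<partial>lborel) < \<infinity>" .
qed

text \<open>Integrate the tangent inequality of the cube at the mean.\<close>

lemma jensen_cube:
 fixes g :: "real^3 => real"
 assumes g: "integrable lborel g" "integrable lborel (%x. g x ^ 3)" and nn: "!!x. 0 <= g x"
  and B: "B \<in> sets borel" "emeasure lborel B < \<infinity>" "!!x. x \<notin> B ==> g x = 0" and V: "0 < measure lborel B"
 shows "(LINT x|lborel. g x) ^ 3 <= (measure lborel B)^2 * (LINT x|lborel. g x ^ 3)"
proof -
 define V where "V = measure lborel B"
 have V: "0 < V" using assms by (simp add: V_def)
 define m where "m = (LINT x|lborel. g x) / V"
 have m0: "0 <= m" using V nn by (simp add: m_def)
 have mV: "(LINT x|lborel. g x) = m * V" using V by (simp add: m_def)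
 have tan: "3 * m^2 * y - 2 * m ^ 3 <= y ^ 3" if "0 <= y" for y
 proof -
  have "y ^ 3 - (3 * m^2 * y - 2 * m ^ 3) = (y - m)^2 * (y + 2 * m)"
   by (simp add: power2_eq_square power3_eq_cube algebra_simps)
  moreover have "0 <= (y - m)^2 * (y + 2 * m)" using that m0 by simp
  ultimately show ?thesis by linarith
 qed
 have iB: "integrable lborel (%x. indicator B x :: real)"
  using B by (simp add: integrable_indicator_iff)
 have "(LINT x|lborel. 3 * m^2 * g x - 2 * m ^ 3 * indicator B x) <= (LINT x|lborel. g x ^ 3)"
 proof (rule integral_mono)
  show "integrable lborel (%x. 3 * m^2 * g x - 2 * m ^ 3 * indicator B x)" using g(1) iB by auto
  fix x show "3 * m^2 * g x - 2 * m ^ 3 * indicator B x <= g x ^ 3"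
   using tan[OF nn[of x]] B(3)[of x] by (cases "x \<in> B") auto
 qed (rule g)
 also have "(LINT x|lborel. 3 * m^2 * g x - 2 * m ^ 3 * indicator B x) = m ^ 3 * V"
  using g(1) iB B(1) mV by (simp add: V_def[symmetric] power2_eq_square power3_eq_cube)
 finally have "V^2 * (m ^ 3 * V) <= V^2 * (LINT x|lborel. g x ^ 3)" by (intro mult_left_mono) auto
 moreover have "(LINT x|lborel. g x) ^ 3 = V^2 * (m ^ 3 * V)"
  by (simp add: mV power_mult_distrib power2_eq_square power3_eq_cube)
 ultimately show ?thesis by (simp add: V_def)
qed

lemma test_fun_time_mult:
 fixes G :: "spacetime => real"
 assumes h: "smooth (h :: real => real)" and G: "G \<in> test_fun V"
 shows "(%z. h (fst z) * G z) \<in> test_fun V" "dx j (%z. h (fst z) * G z) z = h (fst z) * dx j G z"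
proof -
 have lf: "bounded_linear (fst :: spacetime => real)" by (rule bounded_linear_fst)
 have sf: "smooth (%z::spacetime. h (fst z))" by (rule smooth_compose[OF h smooth_linear[OF lf]])
 show "(%z. h (fst z) * G z) \<in> test_fun V" by (rule test_fun_mult[OF G sf])
 have "dx j (%z. h (fst z)) z = 0"
  using partial_compose[OF smooth_differentiable[OF h] smooth_differentiable[OF smooth_linear[OF lf]], of "(0, axis j 1)" z]
  by (simp add: partial_linear[OF lf])
 then show "dx j (%z. h (fst z) * G z) z = h (fst z) * dx j G z"
  using partial_mult[OF smooth_differentiable[OF sf] smooth_differentiable[OF test_funD(1)[OF G]], of "(0, axis j 1)" z]
  by simp
qed

context flow_base
begin

lemma lf_square: "locally_finite_int (%z. (norm (U z))^2)"
 unfolding locally_finite_int_def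
proof (intro conjI allI impI)
 show "(%z. (norm (U z))^2) \<in> borel_measurable borel" by measurable
 fix K :: "spacetime set" assume K: "compact K"
 have [measurable]: "K \<in> sets borel" by (rule borel_compact[OF K])
 have "bounded (fst ` K)"
  using K by (intro compact_imp_bounded compact_continuous_image continuous_intros)
 then obtain c where c: "!!z. z \<in> K ==> \<bar>fst z\<bar> <= c" by (auto simp: bounded_iff)
 have "(\<integral>\<^sup>+z\<in>K. ennreal \<bar>(norm (U z))\<^sup>2\<bar> \<partial>lborel) <= (\<integral>\<^sup>+z. ennreal ((norm (U z))^2) * indicator {-c..c} (fst z) \<partial>lborel)"
  using c by (intro nn_integral_mono) (auto simp: indicator_def abs_le_iff minus_le_iff)
 also have "... = (\<integral>\<^sup>+t. (\<integral>\<^sup>+x. ennreal ((norm (U (t, x)))^2) * indicator {-c..c} t \<partial>lborel) \<partial>lborel)"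
  by (subst tonelli) (auto intro!: measurable_compose[OF fst_borel_measurable])
 also have "... = (\<integral>\<^sup>+t. (\<integral>\<^sup>+x. ennreal ((norm (U (t, x)))^2) \<partial>lborel) * indicator {-c..c} t \<partial>lborel)"
  by (intro nn_integral_cong nn_integral_multc) measurable
 also have "... <= (\<integral>\<^sup>+t. ennreal E0 * indicator {-c..c} t \<partial>lborel)"
  by (intro nn_integral_mono mult_right_mono energy) auto
 also have "... < \<infinity>"
  by (simp add: nn_integral_cmult_indicator ennreal_mult_less_top emeasure_lborel_Icc_eq)
 finally show "(\<integral>\<^sup>+z\<in>K. ennreal \<bar>(norm (U z))\<^sup>2\<bar> \<partial>lborel) < \<infinity>" .
qed

lemma lf_p: "locally_finite_int p"
proof (rule locally_finite_int_mono[of "%z. 1 * (1 + \<bar>p z\<bar> powr (3/2))"])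
 have "locally_finite_int (%z. \<bar>p z\<bar> powr (3/2))"
  unfolding locally_finite_int_def
 proof (intro conjI allI impI)
  fix K :: "spacetime set"
  have "(\<integral>\<^sup>+z\<in>K. ennreal \<bar>\<bar>p z\<bar> powr (3/2)\<bar> \<partial>lborel) <= (\<integral>\<^sup>+z. ennreal (\<bar>p z\<bar> powr (3/2)) \<partial>lborel)"
   by (intro nn_integral_mono) (auto simp: indicator_def)
  then show "(\<integral>\<^sup>+z\<in>K. ennreal \<bar>\<bar>p z\<bar> powr (3/2)\<bar> \<partial>lborel) < \<infinity>" using p_int by (rule le_less_trans)
 qed measurable
 then show "locally_finite_int (%z. 1 * (1 + \<bar>p z\<bar> powr (3/2)))"
  by (rule locally_finite_int_add_mult[OF locally_finite_int_const])
 show "\<bar>p z\<bar> <= 1 * (1 + \<bar>p z\<bar> powr (3/2))" for z using abs_le_one_plus_powr[of "p z"] by simp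
qed measurable

lemma comp_le_norm_sq: "\<bar>(v::real^3) $ i * v $ j\<bar> <= (norm v)^2" "\<bar>(v::real^3) $ i\<bar> <= 1 + (norm v)^2"
proof -
 have i: "\<bar>v $ i\<bar> <= norm v" for i by (rule component_le_norm_cart)
 show "\<bar>v $ i * v $ j\<bar> <= (norm v)^2"
  unfolding abs_mult power2_eq_square by (intro mult_mono i) auto
 have "norm v <= 1 + (norm v)^2"
  using sum_squares_bound[of "norm v" 1] by (simp add: power2_eq_square) (use norm_ge_zero[of v] in linarith)
 then show "\<bar>v $ i\<bar> <= 1 + (norm v)^2" using i[of i] by linarith
qed

lemma lf_UU: "locally_finite_int (%z. U z $ i * U z $ j)"
 by (rule locally_finite_int_mono[OF lf_square]) (use comp_le_norm_sq(1) in \<open>auto\<close>)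

lemma lf_aU:
 assumes [measurable]: "c \<in> borel_measurable borel" and c: "!!t. \<bar>c t\<bar> <= L"
 shows "locally_finite_int (%z. c (fst z) * U z $ j)"
proof (rule locally_finite_int_mono[OF locally_finite_int_add_mult[OF locally_finite_int_const[of 1] lf_square, of L]])
 fix z
 have "\<bar>c (fst z)\<bar> * \<bar>U z $ j\<bar> <= L * (1 + (norm (U z))^2)"
  using c[of "fst z"] by (intro mult_mono comp_le_norm_sq(2) c) auto
 then show "\<bar>c (fst z) * U z $ j\<bar> <= L * (1 + (norm (U z))^2)" by (simp add: abs_mult)
qed measurable

end

context flow
begin

text \<open>Because \<open>U\<close> is free of divergence, a velocity that depends only on time may be subtracted from both
 factors of the nonlinearity.\<close>

lemma time_factor_zero:
 assumes \<psi>: "\<psi> \<in> test_fun ({t1<..<t2} \<times> B)" and t: "t1 < t2" and sub: "{t1<..<t2} \<times> B \<subseteq> {0<..<T} \<times> \<Omega>"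
  and c: "c \<in> borel_measurable borel" "!!t. \<bar>c t\<bar> <= L"
 shows "(LINT z|lborel. (\<Sum>j\<in>UNIV. c (fst z) * U z $ j * dx j \<psi> z)) = 0"
proof (rule approx_interval[OF t c])
 fix h :: "nat => real => real"
 assume h: "!!n. h n \<in> test_fun {t1<..<t2}" "!!n z. \<bar>h n z\<bar> <= L + 1"
  "AE z in lborel. z \<in> {t1<..<t2} --> (%n. h n z) \<longlonglongrightarrow> c z"
 have [measurable]: "h n \<in> borel_measurable borel" "c \<in> borel_measurable borel" for n
  using smooth_borel[OF test_funD(1)[OF h(1)]] c by auto
 have D: "dx j \<psi> \<in> test_fun ({t1<..<t2} \<times> B)" for j by (intro test_fun_partial(1) \<psi> dx_Basis)
 have [measurable]: "dx j \<psi> \<in> borel_measurable borel" for j by (rule smooth_borel[OF test_funD(1)[OF D]])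
 have zero: "(LINT z|lborel. (\<Sum>j\<in>UNIV. h n (fst z) * U z $ j * dx j \<psi> z)) = 0" for n
 proof -
  have "(%z. h n (fst z) * \<psi> z) \<in> test_fun ({0<..<T} \<times> \<Omega>)"
   using test_fun_mono[OF test_fun_time_mult(1)[OF test_funD(1)[OF h(1)] \<psi>] sub] .
  from div_free[OF this, unfolded test_fun_time_mult(2)[OF test_funD(1)[OF h(1)] \<psi>]] show ?thesis
   by (simp add: mult.assoc mult.left_commute)
 qed
 have int: "integrable lborel (%z. c' (fst z) * U z $ j * dx j \<psi> z)"
  if "c' \<in> borel_measurable borel" "!!t. \<bar>c' t\<bar> <= L'" for c' L' j
  by (rule integrable_test_mult[OF lf_aU[OF that] D])
 have "(%n. LINT z|lborel. (\<Sum>j\<in>UNIV. h n (fst z) * U z $ j * dx j \<psi> z)) \<longlonglongrightarrow>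
   (LINT z|lborel. (\<Sum>j\<in>UNIV. c (fst z) * U z $ j * dx j \<psi> z))"
 proof (rule integral_dominated_convergence[where w="%z. \<Sum>j\<in>UNIV. \<bar>(L + 1) * U z $ j * dx j \<psi> z\<bar>"])
  show "integrable lborel (%z. \<Sum>j\<in>UNIV. \<bar>(L + 1) * U z $ j * dx j \<psi> z\<bar>)"
   by (intro Bochner_Integration.integrable_sum integrable_abs int[where c'="%_. L + 1"]) auto
  show "AE z in lborel. (%n. \<Sum>j\<in>UNIV. h n (fst z) * U z $ j * dx j \<psi> z) \<longlonglongrightarrow> (\<Sum>j\<in>UNIV. c (fst z) * U z $ j * dx j \<psi> z)"
   using AE_fst[OF h(3)]
  proof eventually_elim
   case (elim z)
   show ?case
   proof (cases "fst z \<in> {t1<..<t2}")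
    case True
    then show ?thesis using elim by (intro tendsto_intros) auto
   next
    case False
    then have "z \<notin> {t1<..<t2} \<times> B" by (cases z) auto
    then have "dx j \<psi> z = 0" for j by (rule test_funD(4)[OF D])
    then show ?thesis by simp
   qed
  qed
  show "AE z in lborel. norm (\<Sum>j\<in>UNIV. h n (fst z) * U z $ j * dx j \<psi> z) <= (\<Sum>j\<in>UNIV. \<bar>(L + 1) * U z $ j * dx j \<psi> z\<bar>)" for n
  proof (rule AE_I2)
   fix z
   have L: "0 <= L + 1" using c(2)[of 0] by linarith
   show "norm (\<Sum>j\<in>UNIV. h n (fst z) * U z $ j * dx j \<psi> z) <= (\<Sum>j\<in>UNIV. \<bar>(L + 1) * U z $ j * dx j \<psi> z\<bar>)"
    unfolding real_norm_def abs_mult abs_of_nonneg[OF L]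
    by (intro order_trans[OF sum_abs] sum_mono) (auto simp: abs_mult intro!: mult_right_mono h(2))
  qed
 qed measurable
 then show ?thesis by (simp add: zero LIMSEQ_const_iff)
qed

lemma pressure_eq_dev:
 assumes \<psi>: "\<psi> \<in> test_fun ({t1<..<t2} \<times> B)" and t: "t1 < t2" and sub: "{t1<..<t2} \<times> B \<subseteq> {0<..<T} \<times> \<Omega>"
  and a: "!!i. (%t. a t $ i) \<in> borel_measurable borel" "!!i t. \<bar>a t $ i\<bar> <= L"
 shows "(LINT z|lborel. (\<Sum>i\<in>UNIV. \<Sum>j\<in>UNIV. (U z - a (fst z)) $ i * (U z - a (fst z)) $ j * dx j (dx i \<psi>) z))
  + (LINT z|lborel. p z * laplace \<psi> z) = 0"
proof -
 note [measurable] = a(1)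
 have sm: "smooth \<psi>" by (rule test_funD(1)[OF \<psi>])
 have D: "dx i \<psi> \<in> test_fun ({t1<..<t2} \<times> B)" for i by (intro test_fun_partial(1) \<psi> dx_Basis)
 have DD: "dx j (dx i \<psi>) \<in> test_fun ({t1<..<t2} \<times> B)" for i j by (intro test_fun_partial(1) \<psi> dx_Basis)
 have comm: "dx j (dx i \<psi>) = dx i (dx j \<psi>)" for i j
  using partial_commute[OF sm] by auto
 have iUU: "integrable lborel (%z. U z $ i * U z $ j * dx j (dx i \<psi>) z)" for i j
  by (rule integrable_test_mult[OF lf_UU DD])
 have iaU: "integrable lborel (%z. a (fst z) $ i * U z $ k * dx j (dx l \<psi>) z)" for i j k l
  using integrable_test_mult[OF lf_aU[OF a(1) a(2)] DD] .
 have lfaa: "locally_finite_int (%z. a (fst z) $ i * a (fst z) $ j)" for i j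
 proof (rule locally_finite_int_mono[OF locally_finite_int_const[of "L * L"]])
  have "0 <= L" using a(2)[of 0 1] by linarith
  then show "\<bar>a (fst z) $ i * a (fst z) $ j\<bar> <= L * L" for z
   unfolding abs_mult by (intro mult_mono a(2)) auto
 qed measurable
 have iaa: "integrable lborel (%z. a (fst z) $ i * a (fst z) $ j * dx j (dx i \<psi>) z)" for i j
  by (rule integrable_test_mult[OF lfaa DD])
 have aU: "(\<Sum>j\<in>UNIV. (LINT z|lborel. a (fst z) $ i * U z $ j * dx j (dx i \<psi>) z)) = 0" for i
  using time_factor_zero[OF D t sub a(1) a(2), of i i] by (simp add: iaU)
 have aa: "(LINT z|lborel. a (fst z) $ i * a (fst z) $ j * dx j (dx i \<psi>) z) = 0" for i j
 proof -
  have "(LINT x|lborel. a t $ i * a t $ j * dx j (dx i \<psi>) (t, x)) = 0" for t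
   using slice_integral_dx_zero[OF D, of j i t] by simp
  then show ?thesis unfolding fubini_slices[OF iaa[of i j]] fst_conv by (simp only:) simp
 qed
 have ip: "integrable lborel (%z. p z * laplace \<psi> z)"
  by (rule integrable_test_mult[OF lf_p test_fun_laplace[OF \<psi>]])
 have UU: "(\<Sum>i\<in>UNIV. \<Sum>j\<in>UNIV. (LINT z|lborel. U z $ i * U z $ j * dx j (dx i \<psi>) z)) + (LINT z|lborel. p z * laplace \<psi> z) = 0"
  using pressure_eq[OF test_fun_mono[OF \<psi> sub]] iUU ip by simp
 have split: "(U z - a (fst z)) $ i * (U z - a (fst z)) $ j * dx j (dx i \<psi>) z =
   U z $ i * U z $ j * dx j (dx i \<psi>) z - a (fst z) $ i * U z $ j * dx j (dx i \<psi>) z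
   - a (fst z) $ j * U z $ i * dx j (dx i \<psi>) z + a (fst z) $ i * a (fst z) $ j * dx j (dx i \<psi>) z" for z i j
  by (simp add: algebra_simps)
 have "(LINT z|lborel. (\<Sum>i\<in>UNIV. \<Sum>j\<in>UNIV. (U z - a (fst z)) $ i * (U z - a (fst z)) $ j * dx j (dx i \<psi>) z)) =
   (\<Sum>i\<in>UNIV. \<Sum>j\<in>UNIV. (LINT z|lborel. U z $ i * U z $ j * dx j (dx i \<psi>) z))
   - (\<Sum>i\<in>UNIV. \<Sum>j\<in>UNIV. (LINT z|lborel. a (fst z) $ i * U z $ j * dx j (dx i \<psi>) z))
   - (\<Sum>i\<in>UNIV. \<Sum>j\<in>UNIV. (LINT z|lborel. a (fst z) $ j * U z $ i * dx j (dx i \<psi>) z))"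
  unfolding split by (simp add: iUU iaU iaa aa sum_subtractf)
 also have "(\<Sum>i\<in>UNIV. \<Sum>j\<in>UNIV. (LINT z|lborel. a (fst z) $ j * U z $ i * dx j (dx i \<psi>) z)) =
   (\<Sum>j\<in>UNIV. \<Sum>i\<in>UNIV. (LINT z|lborel. a (fst z) $ j * U z $ i * dx i (dx j \<psi>) z))"
  by (subst sum.swap) (simp only: comm)
 finally show ?thesis using UU by (simp add: aU)
qed

end

text \<open>The constants of the duality argument: \<open>c_e\<close> bounds the cube of the average that the parametrix leaves
 over, \<open>c_psi\<close> that of the Laplacian of the potential. The Young parameters \<open>mu0\<close> and \<open>K1\<close> are so large that
 either term costs at most an eighth of \<open>eta_mass\<close> times the cubic norm of the test function.\<close>

definition c_e :: real where "c_e = 48 ^ 3 * unit_ball_vol 3 ^ 3"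
definition c_psi :: real where "c_psi = 8 * c_e + 8 * eta_mass ^ 3"
definition mu0 :: real where "mu0 = 1 + 8 * c_e / eta_mass"
definition K1 :: real where "K1 = 4 * c_psi / eta_mass + 1"
definition K2 :: real where "K2 = (K1 + unit_ball_vol 3) / 2"
definition KP :: real where "KP = 2 * (mu0 ^ 3 + K2) / eta_mass"

lemma constants:
 shows "0 <= c_e" "0 <= c_psi" "1 <= mu0" "c_e / mu0 ^ 6 <= eta_mass / 8" "1 <= K1" "c_psi / (2 * K1) <= eta_mass / 8"
  "0 < K2" "0 < KP"
proof -
 note S = eta_mass_pos
 show ce: "0 <= c_e" by (simp add: c_e_def)
 then show cp: "0 <= c_psi" using S by (simp add: c_psi_def)
 show mu: "1 <= mu0" using ce S by (simp add: mu0_def)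
 have "8 * c_e / eta_mass <= mu0 ^ 1" by (simp add: mu0_def)
 also have "... <= mu0 ^ 6" using mu by (intro power_increasing) auto
 finally show "c_e / mu0 ^ 6 <= eta_mass / 8" using mu S by (simp add: field_simps)
 show k1: "1 <= K1" using cp S by (simp add: K1_def)
 have "4 * c_psi / eta_mass <= K1" by (simp add: K1_def)
 then show "c_psi / (2 * K1) <= eta_mass / 8" using S k1 by (simp add: field_simps)
 have "0 < unit_ball_vol (3::real)" by (rule unit_ball_vol_pos) simp
 then have "0 < K1 + unit_ball_vol 3" using k1 by linarith
 then show k2: "0 < K2" by (simp add: K2_def)
 show "0 < KP" using k2 mu S by (auto simp: KP_def intro!: divide_pos_pos add_nonneg_pos)
qed

lemma abs_power_integrable:
 assumes F: "F \<in> test_fun V"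
 shows "integrable lborel (%z. \<bar>F z\<bar> ^ Suc k)" "integrable lborel (%x. \<bar>F (t::real, x::real^3)\<bar> ^ Suc k)"
proof -
 have [measurable]: "F \<in> borel_measurable borel" by (rule smooth_borel[OF test_funD(1)[OF F]])
 obtain B where B: "0 <= B" "!!z. \<bar>F z\<bar> <= B" using test_fun_bounded[OF F] by metis
 have bd: "\<bar>F z\<bar> ^ Suc k <= B ^ k * \<bar>F z\<bar>" for z
  using mult_right_mono[OF power_mono[OF B(2)[of z], of k], of "\<bar>F z\<bar>"] by (simp add: mult.commute)
 show "integrable lborel (%z. \<bar>F z\<bar> ^ Suc k)"
  by (rule Bochner_Integration.integrable_bound[of _ "%z. B ^ k * \<bar>F z\<bar>"])
   (use bd B test_fun_integrable[OF F] in \<open>auto intro!: AE_I2\<close>)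
 show "integrable lborel (%x. \<bar>F (t, x)\<bar> ^ Suc k)"
  by (rule Bochner_Integration.integrable_bound[of _ "%x. B ^ k * \<bar>F (t, x)\<bar>"])
   (use bd B slice_integrable[OF F] in \<open>auto intro!: AE_I2\<close>)
qed

lemma ball_content: "0 <= s ==> measure lborel (ball (c::real^3) s) = unit_ball_vol 3 * s ^ 3"
 by (simp add: content_ball)

context flow
begin

lemma mean_bound:
 assumes r: "0 < r"
 shows "\<bar>mean c r t $ i\<bar> <= 1 + E0 / (8 * r ^ 3)"
proof -
 let ?f = "%x. U (t, x) $ i"
 have m: "?f \<in> borel_measurable borel" by measurable
 note si = set_integrable_of_square[OF m r comp_square_finite[where A="cube c r" and t=t and i=i]]
 have V: "0 < 8 * r ^ 3" using r by simp
 have "\<bar>cube_mean ?f c r - 0\<bar> <= cube_mean (%x. \<bar>?f x - 0\<bar>) c r"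
  by (rule cube_mean_dev[OF si(1) r])
 also have "... <= cube_mean (%x. 1 + (?f x)^2) c r"
 proof (intro cube_mean_mono set_integrable_dev set_integral_add(1) set_integrable_cube_const si r)
  fix x
  show "\<bar>?f x - 0\<bar> <= 1 + (?f x)^2"
  proof (cases "\<bar>?f x\<bar> <= 1")
   case False
   then have "\<bar>?f x\<bar> * 1 <= \<bar>?f x\<bar> * \<bar>?f x\<bar>" by (intro mult_left_mono) auto
   then show ?thesis by (simp add: power2_eq_square)
  qed (simp add: add_increasing2)
 qed
 also have "... = 1 + cube_mean (%x. (?f x)^2) c r"
  by (simp add: cube_mean_add set_integrable_cube_const[OF r] si(2) cube_mean_const[OF r])
 also have "cube_mean (%x. (?f x)^2) c r <= E0 / (8 * r ^ 3)"
  unfolding cube_mean_def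
 proof (rule divide_right_mono)
  have "ennreal (LINT x:cube c r|lborel. (?f x)^2) = (\<integral>\<^sup>+x\<in>cube c r. ennreal ((?f x)^2) \<partial>lborel)"
   by (rule set_nn_integral_eq_set_integral'[symmetric, OF si(2)]) simp
  also have "... <= (\<integral>\<^sup>+x. ennreal ((norm (U (t, x)))^2) \<partial>lborel)"
  proof (rule nn_integral_mono)
   fix x
   have "(?f x)^2 <= (norm (U (t, x)))^2"
    using component_le_norm_cart[of "U (t, x)" i] by (metis abs_le_square_iff abs_norm_cancel)
   then show "ennreal ((?f x)^2) * indicator (cube c r) x <= ennreal ((norm (U (t, x)))^2)"
    by (cases "x \<in> cube c r") (simp_all add: ennreal_leI)
  qed
  also have "... <= ennreal E0" by (rule energy)
  finally show "(LINT x:cube c r|lborel. (?f x)^2) <= E0" using E0 by (simp add: ennreal_le_iff)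
 qed (use V in simp)
 finally show ?thesis by (simp add: mean_def)
qed

text \<open>The potential \<open>\<psi>\<close> of \<open>h\<close> satisfies \<open>\<Delta>\<psi> = e - S h\<close> with \<open>S = eta_mass\<close> and \<open>e\<close> an average of \<open>h\<close> at scale \<open>r\<close>. Hence
 \<open>S \<integral> p h = \<integral> p e + \<integral> (u - a) \<otimes> (u - a) : \<nabla>\<^sup>2\<psi>\<close>. As \<open>h\<close> lives on the small ball, \<open>e\<close> is small, which yields
 the factor \<open>\<theta>\<^sup>3\<close>. In the other term the Hessian is measured in \<open>L\<^sup>2\<close>, where its norm is that of the Laplacian;
 this replaces the theory of singular integrals and is why the fourth power of the velocity appears.\<close>

lemma pressure_dual:
 assumes r: "0 < r" and \<alpha>: "1 <= \<alpha>" and \<theta>: "0 < \<theta>" "\<theta> <= 1 / 4"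
  and J: "t1 < t2" "0 <= t1" "t2 <= T" and B: "ball x0 (2 * r) \<subseteq> \<Omega>"
  and F: "!!t. t1 < t ==> t < t2 ==>
   (\<integral>\<^sup>+x\<in>cube x0 r. ennreal ((norm (U (t, x) - mean x0 r t)) ^ 4) \<partial>lborel) <= ennreal (Phi r \<alpha> t / r)"
  and Pp: "(\<integral>\<^sup>+z\<in>{t1<..<t2} \<times> ball x0 r. ennreal (\<bar>p z\<bar> powr (3/2)) \<partial>lborel) <= ennreal Pp" "0 <= Pp"
  and Nn: "(\<integral>\<^sup>+t\<in>{t1<..<t2}. ennreal (Nu r \<alpha> t) \<partial>lborel) <= ennreal Nn" "0 <= Nn"
  and h: "h \<in> test_fun ({t1<..<t2} \<times> ball x0 (\<theta> * r))"
 shows "eta_mass * (LINT z|lborel. p z * h z) <=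
  mu0 ^ 3 * \<theta> ^ 3 * Pp + K2 * Nn + eta_mass / 4 * (LINT z|lborel. \<bar>h z\<bar> ^ 3)"
proof -
 define S where "S = eta_mass"
 define ub :: real where "ub = unit_ball_vol 3"
 have S: "0 < S" using eta_mass_pos by (simp add: S_def)
 have ub: "0 < ub" unfolding ub_def by (rule unit_ball_vol_pos) simp
 define J' where "J' = {t1<..<t2}"
 define \<psi> where "\<psi> = parametrix (r / 2) h"
 define e where "e z = laplace \<psi> z + S * h z" for z
 define H where "H t = (LINT x|lborel. \<bar>h (t, x)\<bar> ^ 3)" for t
 have \<psi>: "\<psi> \<in> test_fun (J' \<times> ball x0 r)"
  unfolding \<psi>_def
 proof (rule test_fun_parametrix[OF h])
  fix t and x y :: "real^3" assume a: "(t, x) \<in> {t1<..<t2} \<times> ball x0 (\<theta> * r)" "norm y <= r / 2"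
  have "\<theta> * r <= r / 4" using \<theta> r by (simp add: field_simps)
  then have "dist x0 x < r / 4" using a(1) by auto
  moreover have "dist x (x + y) <= r / 2" using a(2) by (simp add: dist_norm)
  ultimately have "dist x0 (x + y) < r" using dist_triangle[of x0 "x + y" x] r by linarith
  then show "(t, x + y) \<in> J' \<times> ball x0 r" using a(1) by (auto simp: J'_def)
 qed
 have L: "laplace \<psi> \<in> test_fun (J' \<times> ball x0 r)" by (rule test_fun_laplace[OF \<psi>])
 have h': "h \<in> test_fun (J' \<times> ball x0 r)"
 proof (rule test_fun_mono[OF h])
  have "\<theta> * r <= 1 * r" using \<theta> r by (intro mult_right_mono) auto
  then show "{t1<..<t2} \<times> ball x0 (\<theta> * r) \<subseteq> J' \<times> ball x0 r" by (auto simp: J'_def)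
 qed
 have [measurable]: "h \<in> borel_measurable borel" "laplace \<psi> \<in> borel_measurable borel"
  using smooth_borel test_funD(1)[OF h] test_funD(1)[OF L] by auto
 have [measurable]: "e \<in> borel_measurable borel" "J' \<in> sets borel" unfolding e_def J'_def by measurable
 have [measurable]: "(%t. H t) \<in> borel_measurable borel"
  unfolding H_def by (rule slice_integral_measurable[of "%z. \<bar>h z\<bar> ^ 3"]) measurable
 have H0: "0 <= H t" for t by (simp add: H_def)
 have zero: "h z = 0" "laplace \<psi> z = 0" "e z = 0" if "z \<notin> J' \<times> ball x0 r" for z
  using test_funD(4)[OF h' that] test_funD(4)[OF L that] by (auto simp: e_def)
 have ebound: "\<bar>e (t, x)\<bar> ^ 3 <= 48 ^ 3 * ub^2 * \<theta> ^ 6 / r ^ 3 * H t * indicator (ball x0 r) x" for t x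
 proof (cases "x \<in> ball x0 r")
  case True
  have "e (t, x) = (LINT y|lborel. eta y * h (t, x - (r / 2) *\<^sub>R y))"
   using laplace_parametrix[OF h, of "r / 2" t x] r by (simp add: e_def \<psi>_def S_def)
  then have "\<bar>e (t, x)\<bar> <= 6 / (r / 2) ^ 3 * (LINT y|lborel. \<bar>h (t, y)\<bar>)"
   using eta_average_bound[OF h, of "r / 2" t x] r by simp
  also have "6 / (r / 2) ^ 3 = 48 / r ^ 3" by (simp add: field_simps power3_eq_cube)
  finally have "\<bar>e (t, x)\<bar> ^ 3 <= (48 / r ^ 3 * (LINT y|lborel. \<bar>h (t, y)\<bar>)) ^ 3" by (intro power_mono) auto
  also have "... = (48 / r ^ 3) ^ 3 * (LINT y|lborel. \<bar>h (t, y)\<bar>) ^ 3" by (rule power_mult_distrib)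
  also have "(LINT y|lborel. \<bar>h (t, y)\<bar>) ^ 3 <= (measure lborel (ball x0 (\<theta> * r)))^2 * (LINT y|lborel. \<bar>h (t, y)\<bar> ^ 3)"
  proof (rule jensen_cube)
   show "integrable lborel (%y. \<bar>h (t, y)\<bar>)" "integrable lborel (%y. \<bar>h (t, y)\<bar> ^ 3)"
    using abs_power_integrable(2)[OF h, where k=0] abs_power_integrable(2)[OF h, where k=2] by (simp_all add: numeral_3_eq_3)
   show "\<bar>h (t, y)\<bar> = 0" if "y \<notin> ball x0 (\<theta> * r)" for y
    using test_funD(4)[OF h, of "(t, y)"] that by simp
   show "0 < measure lborel (ball x0 (\<theta> * r))" using \<theta> r ub by (simp add: ball_content ub_def)
   show "emeasure lborel (ball x0 (\<theta> * r)) < \<infinity>" using \<theta> r by (simp add: emeasure_ball)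
  qed simp_all
  also have "measure lborel (ball x0 (\<theta> * r)) = ub * \<theta> ^ 3 * r ^ 3"
   using \<theta> r by (simp add: ball_content ub_def power_mult_distrib)
  also have "(48 / r ^ 3) ^ 3 * ((ub * \<theta> ^ 3 * r ^ 3)^2 * (LINT y|lborel. \<bar>h (t, y)\<bar> ^ 3)) = 48 ^ 3 * ub^2 * \<theta> ^ 6 / r ^ 3 * H t"
  proof -
   have "(48 / r ^ 3) ^ 3 * (ub * \<theta> ^ 3 * r ^ 3)^2 = 48 ^ 3 * ub^2 * \<theta> ^ 6 / r ^ 3"
    using r by (simp add: power_divide power_mult_distrib power_mult[symmetric] field_simps power_add[symmetric])
   then show ?thesis by (simp only: H_def mult.assoc[symmetric])
  qed
  finally show ?thesis using True r by (simp add: mult_left_mono)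
 next
  case False
  then show ?thesis using zero(3)[of "(t, x)"] by simp
 qed
 have ice: "c_e = 48 ^ 3 * ub ^ 3" by (simp add: c_e_def ub_def)
 have ball_int: "integrable lborel (indicator (ball x0 r) :: _ => real)"
  using r by (simp add: integrable_indicator_iff emeasure_ball)
 have e3: "integrable lborel (%x. \<bar>e (t, x)\<bar> ^ 3)" "(LINT x|lborel. \<bar>e (t, x)\<bar> ^ 3) <= c_e * \<theta> ^ 6 * H t" for t
 proof -
  define Q where "Q = 48 ^ 3 * ub^2 * \<theta> ^ 6 / r ^ 3 * H t"
  have i: "integrable lborel (%x. Q * indicator (ball x0 r) x)"
   using ball_int by simp
  show *: "integrable lborel (%x. \<bar>e (t, x)\<bar> ^ 3)"
   by (rule Bochner_Integration.integrable_bound[OF i]) (use ebound[of t, folded Q_def] in \<open>auto intro!: AE_I2 order_trans[OF _ abs_ge_self]\<close>)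
  have "(LINT x|lborel. \<bar>e (t, x)\<bar> ^ 3) <= (LINT x|lborel. Q * indicator (ball x0 r) x)"
   by (rule integral_mono[OF * i]) (use ebound[of t, folded Q_def] in simp)
  also have "... = Q * (ub * r ^ 3)" using r by (simp add: ball_content ub_def)
  also have "... = c_e * \<theta> ^ 6 * H t"
   using r by (simp add: Q_def ice power2_eq_square power3_eq_cube)
  finally show "(LINT x|lborel. \<bar>e (t, x)\<bar> ^ 3) <= c_e * \<theta> ^ 6 * H t" .
 qed
 have th1: "\<theta> ^ 6 <= 1" using \<theta> by (intro power_le_one) auto
 define \<mu> where "\<mu> = mu0 * \<theta>"
 have \<mu>: "0 < \<mu>" using constants(3) \<theta> by (simp add: \<mu>_def)
 \<comment> \<open>the far part of the pressure\<close>
 have term1: "(\<integral>\<^sup>+x. ennreal \<bar>p (t, x) * e (t, x)\<bar> \<partial>lborel) <=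
   ennreal (\<mu> ^ 3) * (\<integral>\<^sup>+x\<in>ball x0 r. ennreal (\<bar>p (t, x)\<bar> powr (3/2)) \<partial>lborel) * indicator J' t + ennreal (S / 8 * H t)" for t
 proof (cases "t \<in> J'")
  case True
  have "(\<integral>\<^sup>+x. ennreal \<bar>p (t, x) * e (t, x)\<bar> \<partial>lborel) <=
    (\<integral>\<^sup>+x. ennreal (\<mu> ^ 3) * (ennreal (\<bar>p (t, x)\<bar> powr (3/2)) * indicator (ball x0 r) x) + ennreal (1 / \<mu> ^ 6) * ennreal (\<bar>e (t, x)\<bar> ^ 3) \<partial>lborel)"
  proof (rule nn_integral_mono)
   fix x
   show "ennreal \<bar>p (t, x) * e (t, x)\<bar> <= ennreal (\<mu> ^ 3) * (ennreal (\<bar>p (t, x)\<bar> powr (3/2)) * indicator (ball x0 r) x) + ennreal (1 / \<mu> ^ 6) * ennreal (\<bar>e (t, x)\<bar> ^ 3)"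
   proof (cases "x \<in> ball x0 r")
    case True
    have "\<bar>p (t, x) * e (t, x)\<bar> = (\<mu> * sqrt \<bar>p (t, x)\<bar>)^2 * (\<bar>e (t, x)\<bar> / \<mu>^2)"
     using \<mu> by (simp add: power_mult_distrib abs_mult)
    also have "... <= (\<mu> * sqrt \<bar>p (t, x)\<bar>) ^ 3 + (\<bar>e (t, x)\<bar> / \<mu>^2) ^ 3"
     using \<mu> by (intro young_32) auto
    also have "... = \<mu> ^ 3 * (\<bar>p (t, x)\<bar> powr (3/2)) + 1 / \<mu> ^ 6 * \<bar>e (t, x)\<bar> ^ 3"
     by (simp add: power_mult_distrib sqrt_powr power_divide flip: power_mult)
    finally have "ennreal \<bar>p (t, x) * e (t, x)\<bar> <= ennreal (\<mu> ^ 3 * (\<bar>p (t, x)\<bar> powr (3/2)) + 1 / \<mu> ^ 6 * \<bar>e (t, x)\<bar> ^ 3)"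
     by (rule ennreal_leI)
    also have "... = ennreal (\<mu> ^ 3) * ennreal (\<bar>p (t, x)\<bar> powr (3/2)) + ennreal (1 / \<mu> ^ 6) * ennreal (\<bar>e (t, x)\<bar> ^ 3)"
     using \<mu> by (subst ennreal_plus) (auto simp: ennreal_mult[symmetric])
    finally show ?thesis using True by simp
   next
    case False
    then show ?thesis using zero(3)[of "(t, x)"] by simp
   qed
  qed
  also have "... = ennreal (\<mu> ^ 3) * (\<integral>\<^sup>+x\<in>ball x0 r. ennreal (\<bar>p (t, x)\<bar> powr (3/2)) \<partial>lborel) + ennreal (1 / \<mu> ^ 6) * (\<integral>\<^sup>+x. ennreal (\<bar>e (t, x)\<bar> ^ 3) \<partial>lborel)"
   by (rule nn_integral_lincomb) measurable
  also have "(\<integral>\<^sup>+x. ennreal (\<bar>e (t, x)\<bar> ^ 3) \<partial>lborel) = ennreal (LINT x|lborel. \<bar>e (t, x)\<bar> ^ 3)"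
   by (rule nn_integral_eq_integral[OF e3(1)]) simp
  also have "ennreal (1 / \<mu> ^ 6) * ennreal (LINT x|lborel. \<bar>e (t, x)\<bar> ^ 3) <= ennreal (S / 8 * H t)"
  proof -
   have "1 / \<mu> ^ 6 * (LINT x|lborel. \<bar>e (t, x)\<bar> ^ 3) <= 1 / \<mu> ^ 6 * (c_e * \<theta> ^ 6 * H t)"
    using \<mu> by (intro mult_left_mono e3(2)) auto
   also have "... = c_e / mu0 ^ 6 * H t" using \<theta> by (simp add: \<mu>_def power_mult_distrib)
   also have "... <= S / 8 * H t" using constants(4) H0 by (intro mult_right_mono) (auto simp: S_def)
   finally show ?thesis using \<mu> by (simp add: ennreal_mult[symmetric] ennreal_leI)
  qed
  finally show ?thesis using True by (simp add: add_left_mono)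
 next
  case False
  then show ?thesis using zero(3)[of "(t, x)" for x] by simp
 qed
 define D where "D i j = dx j (dx i \<psi>)" for i j
 have Dt: "D i j \<in> test_fun (J' \<times> ball x0 r)" for i j unfolding D_def by (intro test_fun_partial(1) \<psi> dx_Basis)
 have [measurable]: "D i j \<in> borel_measurable borel" for i j by (rule smooth_borel[OF test_funD(1)[OF Dt]])
 define a where "a t = indicator J' t *\<^sub>R mean x0 r t" for t :: real
 define W where "W z = (\<Sum>i\<in>UNIV. \<Sum>j\<in>UNIV. (U z - a (fst z)) $ i * (U z - a (fst z)) $ j * D i j z)" for z
 have am [measurable]: "a \<in> borel_measurable borel" unfolding a_def by measurable
 have Wm [measurable]: "W \<in> borel_measurable borel" unfolding W_def by measurable
 \<comment> \<open>the near part: the Hessian of the potential is controlled in \<open>L\<^sup>2\<close> by its Laplacian\<close>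
 have term2: "(\<integral>\<^sup>+x. ennreal \<bar>W (t, x)\<bar> \<partial>lborel) <= ennreal (S / 8 * H t) + ennreal K2 * (ennreal (Nu r \<alpha> t) * indicator J' t)" for t
 proof (cases "t \<in> J'")
  case True
  define P where "P = Phi r \<alpha> t"
  have P: "1 <= P" unfolding P_def by (rule Phi_ge_1[OF r \<alpha>])
  define n where "n = Nu r \<alpha> t"
  have n: "n = P powr (3/4)" by (simp add: n_def P_def Nu_def)
  define d where "d x = U (t, x) - mean x0 r t" for x
  have [measurable]: "d \<in> borel_measurable borel" unfolding d_def by measurable
  define q where "q = P powr (1/4) / r"
  have q: "0 < q" using P r by (simp add: q_def)
  define \<nu> where "\<nu> = K1 / q"
  have \<nu>: "0 < \<nu>" using q constants(5) by (simp add: \<nu>_def)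
  define X where "X = (LINT x|lborel. (laplace \<psi> (t, x))^2)"
  have D2: "integrable lborel (%x. (D i j (t, x))^2)" for i j
   using abs_power_integrable(2)[OF Dt, where k=1] by (simp add: numeral_2_eq_2[symmetric])
  have DX: "(\<integral>\<^sup>+x. ennreal (\<Sum>i\<in>UNIV. \<Sum>j\<in>UNIV. (D i j (t, x))^2) \<partial>lborel) = ennreal X"
  proof -
   have "(\<integral>\<^sup>+x. ennreal (\<Sum>i\<in>UNIV. \<Sum>j\<in>UNIV. (D i j (t, x))^2) \<partial>lborel) = ennreal (LINT x|lborel. (\<Sum>i\<in>UNIV. \<Sum>j\<in>UNIV. (D i j (t, x))^2))"
    by (intro nn_integral_eq_integral Bochner_Integration.integrable_sum D2) (auto intro!: sum_nonneg)
   moreover have "(%x. \<Sum>i\<in>UNIV. \<Sum>j\<in>UNIV. (D i j (t, x))^2) = (%x. \<Sum>i\<in>UNIV. \<Sum>j\<in>UNIV. (dx i (dx j \<psi>) (t, x))^2)"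
    unfolding D_def by (rule ext, rule sum.swap)
   ultimately show ?thesis using hessian_L2[OF \<psi>, of t] by (simp only: X_def)
  qed
  have ptw: "ennreal \<bar>W (t, x)\<bar> <= ennreal (\<nu> / 2) * (ennreal ((norm (d x)) ^ 4) * indicator (cube x0 r) x)
    + ennreal (1 / (2 * \<nu>)) * ennreal (\<Sum>i\<in>UNIV. \<Sum>j\<in>UNIV. (D i j (t, x))^2)" for x
  proof (cases "x \<in> ball x0 r")
   case x: True
   have at: "a t = mean x0 r t" using True by (simp add: a_def)
   have yb: "\<bar>u * v\<bar> <= \<nu> / 2 * u^2 + 1 / (2 * \<nu>) * v^2" for u v :: real
   proof -
    have "0 <= (\<nu> * \<bar>u\<bar> - \<bar>v\<bar>)^2" by simp
    then have "2 * (\<nu> * (\<bar>u\<bar> * \<bar>v\<bar>)) <= \<nu> * \<nu> * u^2 + v^2" by (simp add: power2_eq_square algebra_simps)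
    then have "\<bar>u\<bar> * \<bar>v\<bar> <= (\<nu> * \<nu> * u^2 + v^2) / (2 * \<nu>)" using \<nu> by (simp add: field_simps)
    also have "... = \<nu> / 2 * u^2 + 1 / (2 * \<nu>) * v^2" using \<nu> by (simp add: field_simps)
    finally show ?thesis by (simp add: abs_mult)
   qed
   have "\<bar>W (t, x)\<bar> <= (\<Sum>i\<in>UNIV. \<Sum>j\<in>UNIV. \<bar>(d x $ i * d x $ j) * D i j (t, x)\<bar>)"
    unfolding W_def by (auto simp: at d_def intro!: order_trans[OF sum_abs] sum_mono)
   also have "... <= (\<Sum>i\<in>UNIV. \<Sum>j\<in>UNIV. \<nu> / 2 * (d x $ i * d x $ j)^2 + 1 / (2 * \<nu>) * (D i j (t, x))^2)"
    by (intro sum_mono yb)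
   also have "... = \<nu> / 2 * (\<Sum>i\<in>UNIV. \<Sum>j\<in>UNIV. (d x $ i * d x $ j)^2) + 1 / (2 * \<nu>) * (\<Sum>i\<in>UNIV. \<Sum>j\<in>UNIV. (D i j (t, x))^2)"
    by (simp only: sum.distrib sum_distrib_left)
   also have "(\<Sum>i\<in>UNIV. \<Sum>j\<in>UNIV. (d x $ i * d x $ j)^2) = (norm (d x)) ^ 4"
   proof -
    have "(norm (d x))^2 = (\<Sum>i\<in>UNIV. (d x $ i)^2)" by (simp add: norm_vec_def L2_set_def sum_nonneg)
    then have "((norm (d x))^2)^2 = (\<Sum>i\<in>UNIV. \<Sum>j\<in>UNIV. (d x $ i)^2 * (d x $ j)^2)"
     by (simp add: power2_eq_square[of "sum _ _"] sum_product)
    then show ?thesis by (simp add: power_mult_distrib flip: power_mult)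
   qed
   finally have "ennreal \<bar>W (t, x)\<bar> <= ennreal (\<nu> / 2 * (norm (d x)) ^ 4 + 1 / (2 * \<nu>) * (\<Sum>i\<in>UNIV. \<Sum>j\<in>UNIV. (D i j (t, x))^2))"
    by (rule ennreal_leI)
   also have "... = ennreal (\<nu> / 2) * ennreal ((norm (d x)) ^ 4) + ennreal (1 / (2 * \<nu>)) * ennreal (\<Sum>i\<in>UNIV. \<Sum>j\<in>UNIV. (D i j (t, x))^2)"
    using \<nu> by (subst ennreal_plus) (auto simp: ennreal_mult[symmetric] sum_nonneg)
   finally show ?thesis using subsetD[OF ball_subset_cube x] by simp
  next
   case False
   then have "D i j (t, x) = 0" for i j using test_funD(4)[OF Dt, of "(t, x)"] by simp
   then show ?thesis by (simp add: W_def)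
  qed
  have Fd: "(\<integral>\<^sup>+x\<in>cube x0 r. ennreal ((norm (d x)) ^ 4) \<partial>lborel) <= ennreal (P / r)"
   using F[of t] True by (simp add: d_def P_def J'_def)
  have Xq: "X * q <= c_psi * H t + ub * n"
  proof -
   have L2: "integrable lborel (%x. (laplace \<psi> (t, x))^2)" "integrable lborel (%x. \<bar>laplace \<psi> (t, x)\<bar> ^ 3)"
    using abs_power_integrable(2)[OF L, where k=1] abs_power_integrable(2)[OF L, where k=2]
    by (simp_all add: numeral_2_eq_2[symmetric] numeral_3_eq_3[symmetric])
   have h3: "integrable lborel (%x. \<bar>h (t, x)\<bar> ^ 3)"
    using abs_power_integrable(2)[OF h, where k=2] by (simp add: numeral_3_eq_3[symmetric])
   have "X * q = (LINT x|lborel. (laplace \<psi> (t, x))^2 * q)" by (simp add: X_def)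
   also have "... <= (LINT x|lborel. \<bar>laplace \<psi> (t, x)\<bar> ^ 3 + q ^ 3 * indicator (ball x0 r) x)"
   proof (rule integral_mono)
    show "integrable lborel (%x. (laplace \<psi> (t, x))^2 * q)" using L2 by simp
    show "integrable lborel (%x. \<bar>laplace \<psi> (t, x)\<bar> ^ 3 + q ^ 3 * indicator (ball x0 r) x)"
     using L2(2) ball_int by simp
    fix x
    show "(laplace \<psi> (t, x))^2 * q <= \<bar>laplace \<psi> (t, x)\<bar> ^ 3 + q ^ 3 * indicator (ball x0 r) x"
    proof (cases "x \<in> ball x0 r")
     case True
     then show ?thesis using young_32[of "\<bar>laplace \<psi> (t, x)\<bar>" q] q by simp
    next
     case False
     then show ?thesis using zero(2)[of "(t, x)"] by simp
    qed
   qed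
   also have "... = (LINT x|lborel. \<bar>laplace \<psi> (t, x)\<bar> ^ 3) + q ^ 3 * (ub * r ^ 3)"
    using L2(2) ball_int r by (simp add: ball_content ub_def)
   also have "q ^ 3 * (ub * r ^ 3) = ub * n"
    using P r by (simp add: q_def n power_divide powr_power)
   also have "(LINT x|lborel. \<bar>laplace \<psi> (t, x)\<bar> ^ 3) <= (LINT x|lborel. 8 * \<bar>e (t, x)\<bar> ^ 3 + 8 * S ^ 3 * \<bar>h (t, x)\<bar> ^ 3)"
   proof (rule integral_mono[OF L2(2)])
    show "integrable lborel (%x. 8 * \<bar>e (t, x)\<bar> ^ 3 + 8 * S ^ 3 * \<bar>h (t, x)\<bar> ^ 3)"
     using e3(1) h3 by simp
    fix x
    have "\<bar>laplace \<psi> (t, x)\<bar> ^ 3 <= (\<bar>e (t, x)\<bar> + S * \<bar>h (t, x)\<bar>) ^ 3"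
    proof (rule power_mono)
     have "laplace \<psi> (t, x) = e (t, x) - S * h (t, x)" by (simp add: e_def)
     then show "\<bar>laplace \<psi> (t, x)\<bar> <= \<bar>e (t, x)\<bar> + S * \<bar>h (t, x)\<bar>"
      using abs_triangle_ineq4[of "e (t, x)" "S * h (t, x)"] S by (simp add: abs_mult)
    qed simp
    also have "... <= 2 ^ 3 * (\<bar>e (t, x)\<bar> ^ 3 + (S * \<bar>h (t, x)\<bar>) ^ 3)"
     using S by (intro power_add_bound) auto
    finally show "\<bar>laplace \<psi> (t, x)\<bar> ^ 3 <= 8 * \<bar>e (t, x)\<bar> ^ 3 + 8 * S ^ 3 * \<bar>h (t, x)\<bar> ^ 3"
     by (simp add: power_mult_distrib)
   qed
   also have "(LINT x|lborel. 8 * \<bar>e (t, x)\<bar> ^ 3 + 8 * S ^ 3 * \<bar>h (t, x)\<bar> ^ 3) = 8 * (LINT x|lborel. \<bar>e (t, x)\<bar> ^ 3) + 8 * S ^ 3 * H t"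
    using e3(1) h3 by (simp add: H_def)
   also have "(LINT x|lborel. \<bar>e (t, x)\<bar> ^ 3) <= c_e * 1 * H t"
    using e3(2)[of t] mult_right_mono[OF mult_left_mono[OF th1 constants(1)] H0[of t]] by linarith
   finally show ?thesis by (simp add: c_psi_def S_def algebra_simps)
  qed
  have "(\<integral>\<^sup>+x. ennreal \<bar>W (t, x)\<bar> \<partial>lborel) <= (\<integral>\<^sup>+x. ennreal (\<nu> / 2) * (ennreal ((norm (d x)) ^ 4) * indicator (cube x0 r) x)
    + ennreal (1 / (2 * \<nu>)) * ennreal (\<Sum>i\<in>UNIV. \<Sum>j\<in>UNIV. (D i j (t, x))^2) \<partial>lborel)"
   by (intro nn_integral_mono ptw)
  also have "... = ennreal (\<nu> / 2) * (\<integral>\<^sup>+x\<in>cube x0 r. ennreal ((norm (d x)) ^ 4) \<partial>lborel) + ennreal (1 / (2 * \<nu>)) * ennreal X"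
   unfolding DX[symmetric] by (rule nn_integral_lincomb) measurable
  also have "ennreal (\<nu> / 2) * (\<integral>\<^sup>+x\<in>cube x0 r. ennreal ((norm (d x)) ^ 4) \<partial>lborel) + ennreal (1 / (2 * \<nu>)) * ennreal X
    <= ennreal (\<nu> / 2) * ennreal (P / r) + ennreal (1 / (2 * \<nu>)) * ennreal X"
   by (intro add_right_mono mult_left_mono Fd) simp
  also have "... = ennreal (\<nu> / 2 * (P / r) + 1 / (2 * \<nu>) * X)"
   using \<nu> P r by (simp add: ennreal_plus ennreal_mult[symmetric] X_def)
  also have "\<nu> / 2 * (P / r) + 1 / (2 * \<nu>) * X <= S / 8 * H t + K2 * n"
  proof -
   have "P / P powr (1/4) = P powr (3/4)" using P powr_diff[of P 1 "1/4"] by simp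
   then have "K1 * P / P powr (1/4) = K1 * P powr (3/4)" by (simp only: times_divide_eq_right[symmetric])
   then have 1: "\<nu> / 2 * (P / r) = K1 / 2 * n" using r by (simp add: \<nu>_def q_def n)
   have "1 / (2 * \<nu>) * X = (X * q) / (2 * K1)" using q constants(5) by (simp add: \<nu>_def field_simps)
   also have "... <= (c_psi * H t + ub * n) / (2 * K1)"
    using Xq constants(5) by (intro divide_right_mono) auto
   also have "... = c_psi / (2 * K1) * H t + (ub * n) / (2 * K1)" by (simp add: add_divide_distrib)
   also have "c_psi / (2 * K1) * H t <= S / 8 * H t"
    using constants(6) H0 by (intro mult_right_mono) (auto simp: S_def)
   also have "(ub * n) / (2 * K1) <= (ub * n) / 2"
    using constants(5) ub n by (intro divide_left_mono) auto
   finally show ?thesis unfolding 1 by (simp add: K2_def ub_def[symmetric] algebra_simps add_divide_distrib)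
  qed
  finally have "(\<integral>\<^sup>+x. ennreal \<bar>W (t, x)\<bar> \<partial>lborel) <= ennreal (S / 8 * H t + K2 * n)" by (simp add: ennreal_leI)
  also have "... = ennreal (S / 8 * H t) + ennreal K2 * ennreal n"
   using S H0[of t] constants(7) n by (simp add: ennreal_plus ennreal_mult[symmetric])
  finally show ?thesis using True by (simp add: n_def)
 next
  case False
  then have "D i j (t, x) = 0" for i j x using test_funD(4)[OF Dt, of "(t, x)"] by simp
  then show ?thesis by (simp add: W_def)
 qed
 have sub: "J' \<times> ball x0 r \<subseteq> {0<..<T} \<times> \<Omega>"
 proof -
  have "ball x0 r \<subseteq> ball x0 (2 * r)" using r by auto
  then show ?thesis using B J by (auto simp: J'_def)
 qed
 have eq: "(LINT z|lborel. W z) + (LINT z|lborel. p z * laplace \<psi> z) = 0"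
  unfolding W_def D_def
 proof (rule pressure_eq_dev[of \<psi> t1 t2 "ball x0 r" a "1 + E0 / (8 * r ^ 3)"])
  show "\<psi> \<in> test_fun ({t1<..<t2} \<times> ball x0 r)" using \<psi> by (simp add: J'_def)
  show "{t1<..<t2} \<times> ball x0 r \<subseteq> {0<..<T} \<times> \<Omega>" using sub by (simp add: J'_def)
  show "(%t. a t $ i) \<in> borel_measurable borel" for i by measurable
  have "0 <= 1 + E0 / (8 * r ^ 3)" using E0 r by simp
  then show "\<bar>a t $ i\<bar> <= 1 + E0 / (8 * r ^ 3)" for i t
   using mean_bound[OF r, of x0 t i] by (simp add: a_def indicator_def)
 qed (rule J)
 have iL: "integrable lborel (%z. p z * laplace \<psi> z)" and ih: "integrable lborel (%z. p z * h z)"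
  by (rule integrable_test_mult[OF lf_p]; rule L h)+
 have pe: "p z * e z = p z * laplace \<psi> z + S * (p z * h z)" for z by (simp add: e_def algebra_simps)
 have "S * (LINT z|lborel. p z * h z) = (LINT z|lborel. p z * e z) - (LINT z|lborel. p z * laplace \<psi> z)"
  unfolding pe using iL ih by simp
 also have "... = (LINT z|lborel. p z * e z) + (LINT z|lborel. W z)" using eq by simp
 also have "(LINT z|lborel. p z * e z) <= \<mu> ^ 3 * Pp + S / 8 * (LINT z|lborel. \<bar>h z\<bar> ^ 3)"
  and "(LINT z|lborel. W z) <= S / 8 * (LINT z|lborel. \<bar>h z\<bar> ^ 3) + K2 * Nn"
 proof -
  have h3: "integrable lborel (%z. \<bar>h z\<bar> ^ 3)"
   using abs_power_integrable(1)[OF h, where k=2] by (simp add: numeral_3_eq_3[symmetric])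
  define Ht where "Ht = (LINT z|lborel. \<bar>h z\<bar> ^ 3)"
  have Ht0: "0 <= Ht" by (simp add: Ht_def)
  have Ht: "(\<integral>\<^sup>+t. ennreal (H t) \<partial>lborel) = ennreal Ht"
  proof -
   have "ennreal (H t) = (\<integral>\<^sup>+x. ennreal (\<bar>h (t, x)\<bar> ^ 3) \<partial>lborel)" for t
    unfolding H_def using abs_power_integrable(2)[OF h, where k=2, of t]
    by (intro nn_integral_eq_integral[symmetric]) (auto simp: numeral_3_eq_3[symmetric])
   then have "(\<integral>\<^sup>+t. ennreal (H t) \<partial>lborel) = (\<integral>\<^sup>+z. ennreal (\<bar>h z\<bar> ^ 3) \<partial>lborel)"
    using tonelli[of "%z. ennreal (\<bar>h z\<bar> ^ 3)"] by simp
   then show ?thesis unfolding Ht_def using h3 by (simp add: nn_integral_eq_integral)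
  qed
  have SH: "(\<integral>\<^sup>+t. ennreal (S / 8 * H t) \<partial>lborel) = ennreal (S / 8 * Ht)"
  proof -
   have "ennreal (S / 8 * H t) = ennreal (S / 8) * ennreal (H t)" for t
    using S H0 by (intro ennreal_mult) auto
   then have "(\<integral>\<^sup>+t. ennreal (S / 8 * H t) \<partial>lborel) = ennreal (S / 8) * (\<integral>\<^sup>+t. ennreal (H t) \<partial>lborel)"
    by (simp only:) (rule nn_integral_cmult, measurable)
   then show ?thesis unfolding Ht using S Ht0 by (simp add: ennreal_mult[symmetric])
  qed
  have "(\<integral>\<^sup>+z. ennreal \<bar>p z * e z\<bar> \<partial>lborel) = (\<integral>\<^sup>+t. (\<integral>\<^sup>+x. ennreal \<bar>p (t, x) * e (t, x)\<bar> \<partial>lborel) \<partial>lborel)"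
   by (rule tonelli) measurable
  also have "... <= (\<integral>\<^sup>+t. ennreal (\<mu> ^ 3) * (\<integral>\<^sup>+x\<in>ball x0 r. ennreal (\<bar>p (t, x)\<bar> powr (3/2)) \<partial>lborel) * indicator J' t + ennreal (S / 8 * H t) \<partial>lborel)"
   by (intro nn_integral_mono term1)
  also have "... = (\<integral>\<^sup>+t. ennreal (\<mu> ^ 3) * (\<integral>\<^sup>+x. ennreal (\<bar>p (t, x)\<bar> powr (3/2)) * indicator (J' \<times> ball x0 r) (t, x) \<partial>lborel) + ennreal (S / 8 * H t) \<partial>lborel)"
   by (intro nn_integral_cong) (auto simp: indicator_def)
  also have "... = (\<integral>\<^sup>+t. ennreal (\<mu> ^ 3) * (\<integral>\<^sup>+x. ennreal (\<bar>p (t, x)\<bar> powr (3/2)) * indicator (J' \<times> ball x0 r) (t, x) \<partial>lborel) \<partial>lborel) + (\<integral>\<^sup>+t. ennreal (S / 8 * H t) \<partial>lborel)"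
  proof (rule nn_integral_add)
   have [measurable]: "J' \<times> ball x0 r \<in> sets borel"
    unfolding J'_def by (intro borel_open open_Times) auto
   have "(%t. \<integral>\<^sup>+x. ennreal (\<bar>p (t, x)\<bar> powr (3/2)) * indicator (J' \<times> ball x0 r) (t, x) \<partial>lborel) \<in> borel_measurable borel"
    by (rule slice_nn_integral_measurable[of "%z. ennreal (\<bar>p z\<bar> powr (3/2)) * indicator (J' \<times> ball x0 r) z"]) measurable
   then show "(%t. ennreal (\<mu> ^ 3) * (\<integral>\<^sup>+x. ennreal (\<bar>p (t, x)\<bar> powr (3/2)) * indicator (J' \<times> ball x0 r) (t, x) \<partial>lborel)) \<in> borel_measurable lborel" by simp
  qed measurable
  also have "(\<integral>\<^sup>+t. ennreal (\<mu> ^ 3) * (\<integral>\<^sup>+x. ennreal (\<bar>p (t, x)\<bar> powr (3/2)) * indicator (J' \<times> ball x0 r) (t, x) \<partial>lborel) \<partial>lborel) =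
    ennreal (\<mu> ^ 3) * (\<integral>\<^sup>+z\<in>J' \<times> ball x0 r. ennreal (\<bar>p z\<bar> powr (3/2)) \<partial>lborel)"
  proof -
   have [measurable]: "J' \<times> ball x0 r \<in> sets borel"
    unfolding J'_def by (intro borel_open open_Times) auto
   have m: "(%t. \<integral>\<^sup>+x. ennreal (\<bar>p (t, x)\<bar> powr (3/2)) * indicator (J' \<times> ball x0 r) (t, x) \<partial>lborel) \<in> borel_measurable lborel"
    using slice_nn_integral_measurable[of "%z. ennreal (\<bar>p z\<bar> powr (3/2)) * indicator (J' \<times> ball x0 r) z"] by simp
   have "(\<integral>\<^sup>+z\<in>J' \<times> ball x0 r. ennreal (\<bar>p z\<bar> powr (3/2)) \<partial>lborel) =
     (\<integral>\<^sup>+t. (\<integral>\<^sup>+x. ennreal (\<bar>p (t, x)\<bar> powr (3/2)) * indicator (J' \<times> ball x0 r) (t, x) \<partial>lborel) \<partial>lborel)"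
    by (rule tonelli) measurable
   then show ?thesis using nn_integral_cmult[OF m, of "ennreal (\<mu> ^ 3)"] by simp
  qed
  also have "ennreal (\<mu> ^ 3) * (\<integral>\<^sup>+z\<in>J' \<times> ball x0 r. ennreal (\<bar>p z\<bar> powr (3/2)) \<partial>lborel) + (\<integral>\<^sup>+t. ennreal (S / 8 * H t) \<partial>lborel)
    <= ennreal (\<mu> ^ 3) * ennreal Pp + ennreal (S / 8 * Ht)"
   unfolding SH using Pp(1) by (intro add_right_mono mult_left_mono) (auto simp: J'_def)
  also have "... = ennreal (\<mu> ^ 3 * Pp + S / 8 * Ht)"
   using \<mu> Pp S Ht0 by (simp add: ennreal_plus ennreal_mult)
  finally show "(LINT z|lborel. p z * e z) <= \<mu> ^ 3 * Pp + S / 8 * (LINT z|lborel. \<bar>h z\<bar> ^ 3)"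
   unfolding Ht_def[symmetric] using \<mu> Pp S Ht0 by (intro integral_le_of_nn) auto
  have "(\<integral>\<^sup>+z. ennreal \<bar>W z\<bar> \<partial>lborel) = (\<integral>\<^sup>+t. (\<integral>\<^sup>+x. ennreal \<bar>W (t, x)\<bar> \<partial>lborel) \<partial>lborel)"
   by (rule tonelli) measurable
  also have "... <= (\<integral>\<^sup>+t. ennreal (S / 8 * H t) + ennreal K2 * (ennreal (Nu r \<alpha> t) * indicator J' t) \<partial>lborel)"
   by (intro nn_integral_mono term2)
  also have "... = (\<integral>\<^sup>+t. ennreal (S / 8 * H t) \<partial>lborel) + (\<integral>\<^sup>+t. ennreal K2 * (ennreal (Nu r \<alpha> t) * indicator J' t) \<partial>lborel)"
   by (rule nn_integral_add) measurable
  also have "(\<integral>\<^sup>+t. ennreal K2 * (ennreal (Nu r \<alpha> t) * indicator J' t) \<partial>lborel) = ennreal K2 * (\<integral>\<^sup>+t\<in>J'. ennreal (Nu r \<alpha> t) \<partial>lborel)"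
   by (rule nn_integral_cmult) measurable
  also have "(\<integral>\<^sup>+t. ennreal (S / 8 * H t) \<partial>lborel) + ennreal K2 * (\<integral>\<^sup>+t\<in>J'. ennreal (Nu r \<alpha> t) \<partial>lborel) <= ennreal (S / 8 * Ht) + ennreal K2 * ennreal Nn"
   unfolding SH using Nn(1) by (intro add_left_mono mult_left_mono) (auto simp: J'_def)
  also have "... = ennreal (S / 8 * Ht + K2 * Nn)"
   using Nn S Ht0 constants(7) by (simp add: ennreal_plus ennreal_mult)
  finally show "(LINT z|lborel. W z) <= S / 8 * (LINT z|lborel. \<bar>h z\<bar> ^ 3) + K2 * Nn"
   unfolding Ht_def[symmetric] using Nn S Ht0 constants(7) by (intro integral_le_of_nn) auto
 qed
 then show ?thesis
  using calculation by (simp add: S_def[symmetric] \<mu>_def power_mult_distrib)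
qed

text \<open>Duality with the functions \<open>sgn p min(\<bar>p\<bar>\<^sup>1\<^sup>/\<^sup>2, L)\<close>, which are limits of test functions.\<close>

lemma pressure_decay:
 assumes r: "0 < r" and \<alpha>: "1 <= \<alpha>" and \<theta>: "0 < \<theta>" "\<theta> <= 1 / 4"
  and J: "t1 < t2" "0 <= t1" "t2 <= T" and B: "ball x0 (2 * r) \<subseteq> \<Omega>"
  and F: "!!t. t1 < t ==> t < t2 ==>
   (\<integral>\<^sup>+x\<in>cube x0 r. ennreal ((norm (U (t, x) - mean x0 r t)) ^ 4) \<partial>lborel) <= ennreal (Phi r \<alpha> t / r)"
  and Pp: "(\<integral>\<^sup>+z\<in>{t1<..<t2} \<times> ball x0 r. ennreal (\<bar>p z\<bar> powr (3/2)) \<partial>lborel) <= ennreal Pp" "0 <= Pp"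
  and Nn: "(\<integral>\<^sup>+t\<in>{t1<..<t2}. ennreal (Nu r \<alpha> t) \<partial>lborel) <= ennreal Nn" "0 <= Nn"
 shows "(\<integral>\<^sup>+z\<in>{t1<..<t2} \<times> ball x0 (\<theta> * r). ennreal (\<bar>p z\<bar> powr (3/2)) \<partial>lborel) <= ennreal (KP * (\<theta> ^ 3 * Pp + Nn))"
proof -
 define S where "S = eta_mass"
 have S: "0 < S" using eta_mass_pos by (simp add: S_def)
 define G where "G = {t1<..<t2} \<times> ball x0 (\<theta> * r)"
 have Gm [measurable]: "G \<in> sets borel" unfolding G_def by (intro borel_open open_Times) auto
 have Gfin: "emeasure lborel G < \<infinity>"
 proof -
  have "G \<subseteq> {t1..t2} \<times> cball x0 (\<theta> * r)" by (auto simp: G_def)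
  then have "emeasure lborel G <= emeasure lborel ({t1..t2} \<times> cball x0 (\<theta> * r))"
   by (intro emeasure_mono) (auto intro!: borel_closed closed_Times)
  also have "... < \<infinity>" by (intro emeasure_compact_finite compact_Times) auto
  finally show ?thesis .
 qed
 have iG: "integrable lborel (indicator G :: spacetime => real)"
  using Gfin by (simp add: integrable_indicator_iff)
 have ip: "integrable lborel (%z. \<bar>p z\<bar> powr (3/2))"
  by (rule integrableI_bounded) (use p_int in auto)
 have ipG: "integrable lborel (%z. \<bar>p z\<bar> * indicator G z)"
 proof (rule Bochner_Integration.integrable_bound[OF Bochner_Integration.integrable_add[OF iG ip]])
  show "AE z in lborel. norm (\<bar>p z\<bar> * indicator G z) <= norm (indicator G z + \<bar>p z\<bar> powr (3/2))"
  proof (rule AE_I2)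
   fix z show "norm (\<bar>p z\<bar> * indicator G z) <= norm (indicator G z + \<bar>p z\<bar> powr (3/2))"
    using abs_le_one_plus_powr[of "p z"] by (cases "z \<in> G") auto
  qed
 qed measurable
 define A where "A = mu0 ^ 3 * \<theta> ^ 3 * Pp + K2 * Nn"
 have trunc: "(\<integral>\<^sup>+z\<in>G. ennreal ((min (sqrt \<bar>p z\<bar>) (real L)) ^ 3) \<partial>lborel) <= ennreal (KP * (\<theta> ^ 3 * Pp + Nn))" for L :: nat
 proof -
  define h0 where "h0 z = indicator G z * (sgn (p z) * min (sqrt \<bar>p z\<bar>) (real L))" for z
  have [measurable]: "h0 \<in> borel_measurable borel" unfolding h0_def by measurable
  have sg: "\<bar>sgn y * m\<bar> <= m" if "0 <= m" for y m :: real using that by (simp add: abs_mult abs_sgn_eq)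
  have h0b: "\<bar>h0 z\<bar> <= real L" for z
  proof -
   have "\<bar>h0 z\<bar> <= \<bar>sgn (p z) * min (sqrt \<bar>p z\<bar>) (real L)\<bar>" by (simp add: h0_def indicator_def)
   also have "... <= min (sqrt \<bar>p z\<bar>) (real L)" by (rule sg) simp
   finally show ?thesis by simp
  qed
  have tr: "0 < \<theta> * r" using \<theta> r by simp
  have h0m: "h0 \<in> borel_measurable borel" by measurable
  show ?thesis
  proof (rule approx_cylinder[OF J(1) tr h0m h0b])
   fix h :: "nat => spacetime => real"
   assume h: "!!n. h n \<in> test_fun ({t1<..<t2} \<times> ball x0 (\<theta> * r))" "!!n z. \<bar>h n z\<bar> <= real L + 1"
    "AE z in lborel. z \<in> {t1<..<t2} \<times> ball x0 (\<theta> * r) --> (%n. h n z) \<longlonglongrightarrow> h0 z"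
   have [measurable]: "h n \<in> borel_measurable borel" for n by (rule smooth_borel[OF test_funD(1)[OF h(1)]])
   have hz: "h n z = 0" if "z \<notin> G" for n z using test_funD(4)[OF h(1)] that by (simp add: G_def)
   have conv: "AE z in lborel. (%n. h n z) \<longlonglongrightarrow> h0 z"
    using h(3)
   proof eventually_elim
    case (elim z)
    then show ?case by (cases "z \<in> G") (simp_all add: G_def[symmetric] hz, simp add: h0_def)
   qed
   have lim1: "(%n. LINT z|lborel. p z * h n z) \<longlonglongrightarrow> (LINT z|lborel. p z * h0 z)"
    and iph0: "integrable lborel (%z. p z * h0 z)"
   proof -
    have i: "integrable lborel (%z. (real L + 1) * (\<bar>p z\<bar> * indicator G z))" using ipG by simp
    have c: "AE z in lborel. (%n. p z * h n z) \<longlonglongrightarrow> p z * h0 z"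
     using conv by eventually_elim (intro tendsto_intros)
    have b: "AE z in lborel. norm (p z * h n z) <= (real L + 1) * (\<bar>p z\<bar> * indicator G z)" for n
    proof (rule AE_I2)
     fix z show "norm (p z * h n z) <= (real L + 1) * (\<bar>p z\<bar> * indicator G z)"
      using mult_right_mono[OF h(2)[of n z], of "\<bar>p z\<bar>"] hz[of z n] by (cases "z \<in> G") (simp_all add: abs_mult mult.commute)
    qed
    show "(%n. LINT z|lborel. p z * h n z) \<longlonglongrightarrow> (LINT z|lborel. p z * h0 z)"
     by (rule integral_dominated_convergence[OF _ _ i c b]) measurable
    show "integrable lborel (%z. p z * h0 z)"
     by (rule integrable_dominated_convergence[OF _ _ i c b]) measurable
   qed
   have lim2: "(%n. LINT z|lborel. \<bar>h n z\<bar> ^ 3) \<longlonglongrightarrow> (LINT z|lborel. \<bar>h0 z\<bar> ^ 3)"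
    and ih0: "integrable lborel (%z. \<bar>h0 z\<bar> ^ 3)"
   proof -
    have i: "integrable lborel (%z. (real L + 1) ^ 3 * indicator G z)" using iG by simp
    have c: "AE z in lborel. (%n. \<bar>h n z\<bar> ^ 3) \<longlonglongrightarrow> \<bar>h0 z\<bar> ^ 3"
     using conv by eventually_elim (intro tendsto_intros)
    have b: "AE z in lborel. norm (\<bar>h n z\<bar> ^ 3) <= (real L + 1) ^ 3 * indicator G z" for n
    proof (rule AE_I2)
     fix z show "norm (\<bar>h n z\<bar> ^ 3) <= (real L + 1) ^ 3 * indicator G z"
      using power_mono[OF h(2)[of n z], of 3] hz[of z n] by (cases "z \<in> G") simp_all
    qed
    show "(%n. LINT z|lborel. \<bar>h n z\<bar> ^ 3) \<longlonglongrightarrow> (LINT z|lborel. \<bar>h0 z\<bar> ^ 3)"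
     by (rule integral_dominated_convergence[OF _ _ i c b]) measurable
    show "integrable lborel (%z. \<bar>h0 z\<bar> ^ 3)"
     by (rule integrable_dominated_convergence[OF _ _ i c b]) measurable
   qed
   define X where "X = (LINT z|lborel. \<bar>h0 z\<bar> ^ 3)"
   have "S * (LINT z|lborel. p z * h0 z) <= A + S / 4 * X"
   proof (rule LIMSEQ_le)
    show "(%n. S * (LINT z|lborel. p z * h n z)) \<longlonglongrightarrow> S * (LINT z|lborel. p z * h0 z)"
     by (intro tendsto_intros lim1)
    show "(%n. A + S / 4 * (LINT z|lborel. \<bar>h n z\<bar> ^ 3)) \<longlonglongrightarrow> A + S / 4 * X"
     unfolding X_def by (intro tendsto_intros lim2)
    show "\<exists>N. \<forall>n\<ge>N. S * (LINT z|lborel. p z * h n z) <= A + S / 4 * (LINT z|lborel. \<bar>h n z\<bar> ^ 3)"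
     using pressure_dual[OF r \<alpha> \<theta> J B F Pp Nn h(1)] by (simp add: A_def S_def)
   qed
   moreover have "X <= (LINT z|lborel. p z * h0 z)"
    unfolding X_def
   proof (rule integral_mono[OF ih0 iph0])
    fix z
    show "\<bar>h0 z\<bar> ^ 3 <= p z * h0 z"
    proof (cases "z \<in> G \<and> p z ~= 0")
     case True
     define m where "m = min (sqrt \<bar>p z\<bar>) (real L)"
     have m: "0 <= m" "m <= sqrt \<bar>p z\<bar>" by (auto simp: m_def)
     have "m^2 <= (sqrt \<bar>p z\<bar>)^2" using m by (intro power_mono) auto
     then have 1: "m^2 * m <= \<bar>p z\<bar> * m" using m by (intro mult_right_mono) auto
     have h0z: "h0 z = sgn (p z) * m" using True by (simp add: h0_def m_def)
     have 2: "\<bar>h0 z\<bar> = m" using True m(1) by (simp add: h0z abs_mult abs_sgn_eq)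
     have 3: "p z * h0 z = \<bar>p z\<bar> * m" unfolding h0z abs_sgn[of "p z"] by simp
     show ?thesis unfolding 2 3 using 1 by (simp add: power2_eq_square power3_eq_cube)
    qed (auto simp: h0_def)
   qed
   then have "S * X <= S * (LINT z|lborel. p z * h0 z)" using S by (intro mult_left_mono) auto
   ultimately have "3 / 4 * (S * X) <= A" by linarith
   moreover have A0: "0 <= A" using constants(3,7) \<theta> Pp Nn by (simp add: A_def)
   ultimately have "S * X <= 2 * A" by linarith
   then have "X <= 2 * A / S" using S by (simp add: field_simps)
   also have "... <= KP * (\<theta> ^ 3 * Pp + Nn)"
   proof -
    have "0 <= mu0 ^ 3 * Nn + K2 * (\<theta> ^ 3 * Pp)"
     using constants(3,7) \<theta> Pp Nn by simp
    then have "A <= (mu0 ^ 3 + K2) * (\<theta> ^ 3 * Pp + Nn)" by (simp add: A_def algebra_simps)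
    then have "2 * A / S <= 2 * ((mu0 ^ 3 + K2) * (\<theta> ^ 3 * Pp + Nn)) / S"
     using S by (intro divide_right_mono mult_left_mono) auto
    moreover have "KP * y = 2 * ((mu0 ^ 3 + K2) * y) / S" for y
     unfolding KP_def S_def by (simp only: times_divide_eq_left mult.assoc)
    ultimately show ?thesis by simp
   qed
   finally have XX: "X <= KP * (\<theta> ^ 3 * Pp + Nn)" .
   have "(\<integral>\<^sup>+z\<in>G. ennreal ((min (sqrt \<bar>p z\<bar>) (real L)) ^ 3) \<partial>lborel) = (\<integral>\<^sup>+z. ennreal (\<bar>h0 z\<bar> ^ 3) \<partial>lborel)"
   proof (rule nn_integral_cong)
    fix z
    have "\<bar>h0 z\<bar> = indicator G z * min (sqrt \<bar>p z\<bar>) (real L)"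
     by (cases "p z = 0") (auto simp: h0_def abs_mult abs_sgn_eq)
    then show "ennreal ((min (sqrt \<bar>p z\<bar>) (real L)) ^ 3) * indicator G z = ennreal (\<bar>h0 z\<bar> ^ 3)"
     by (cases "z \<in> G") simp_all
   qed
   also have "... = ennreal X" unfolding X_def by (rule nn_integral_eq_integral[OF ih0]) simp
   finally show "(\<integral>\<^sup>+z\<in>G. ennreal ((min (sqrt \<bar>p z\<bar>) (real L)) ^ 3) \<partial>lborel) <= ennreal (KP * (\<theta> ^ 3 * Pp + Nn))"
    using XX by (simp add: ennreal_leI)
  qed
 qed
 have "(\<integral>\<^sup>+z\<in>G. ennreal (\<bar>p z\<bar> powr (3/2)) \<partial>lborel) =
   (\<integral>\<^sup>+z. (SUP L. ennreal ((min (sqrt \<bar>p z\<bar>) (real L)) ^ 3) * indicator G z) \<partial>lborel)"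
 proof (rule nn_integral_cong)
  fix z
  show "ennreal (\<bar>p z\<bar> powr (3/2)) * indicator G z = (SUP L. ennreal ((min (sqrt \<bar>p z\<bar>) (real L)) ^ 3) * indicator G z)"
  proof (rule antisym)
   obtain N where N: "sqrt \<bar>p z\<bar> <= real N" using real_arch_simple by blast
   then have "min (sqrt \<bar>p z\<bar>) (real N) = sqrt \<bar>p z\<bar>" by simp
   then show "ennreal (\<bar>p z\<bar> powr (3/2)) * indicator G z <= (SUP L. ennreal ((min (sqrt \<bar>p z\<bar>) (real L)) ^ 3) * indicator G z)"
    by (intro SUP_upper2[of N]) (simp_all add: sqrt_powr)
   show "(SUP L. ennreal ((min (sqrt \<bar>p z\<bar>) (real L)) ^ 3) * indicator G z) <= ennreal (\<bar>p z\<bar> powr (3/2)) * indicator G z"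
    unfolding sqrt_powr by (intro SUP_least mult_right_mono ennreal_leI power_mono) auto
  qed
 qed
 also have "... = (SUP L. \<integral>\<^sup>+z. ennreal ((min (sqrt \<bar>p z\<bar>) (real L)) ^ 3) * indicator G z \<partial>lborel)"
 proof (rule nn_integral_monotone_convergence_SUP)
  show "incseq (%L z. ennreal ((min (sqrt \<bar>p z\<bar>) (real L)) ^ 3) * indicator G z)"
   by (intro monoI le_funI mult_right_mono ennreal_leI power_mono) auto
 qed measurable
 also have "... <= ennreal (KP * (\<theta> ^ 3 * Pp + Nn))" by (intro SUP_least trunc)
 finally show ?thesis by (simp add: G_def)
qed

end

context flow
begin

definition KD :: real where "KD = (KC + KP) * (1 + KN)"

lemma KD_pos: "0 < KD" and KN_nonneg: "0 <= KN"
proof -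
 show KN: "0 <= KN" using KW_pos by (simp add: KN_def)
 show "0 < KD" using KN KC_pos constants(8) by (simp add: KD_def)
qed

lemma slab_integral:
 assumes [measurable]: "F \<in> borel_measurable borel" and r: "0 <= r"
 shows "(\<integral>\<^sup>+z\<in>{t1<..<t2} \<times> ball x0 r. F z \<partial>lborel) = (\<integral>\<^sup>+t\<in>{t1<..<t2}. (\<integral>\<^sup>+x\<in>ball x0 r. F (t::real, x::real^3) \<partial>lborel) \<partial>lborel)"
proof -
 have [measurable]: "{t1<..<t2} \<times> ball x0 r \<in> sets (borel :: spacetime measure)"
  by (intro borel_open open_Times) auto
 have "(\<integral>\<^sup>+z\<in>{t1<..<t2} \<times> ball x0 r. F z \<partial>lborel) = (\<integral>\<^sup>+t. (\<integral>\<^sup>+x. F (t, x) * indicator ({t1<..<t2} \<times> ball x0 r) (t, x) \<partial>lborel) \<partial>lborel)"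
  by (rule tonelli) measurable
 also have "... = (\<integral>\<^sup>+t\<in>{t1<..<t2}. (\<integral>\<^sup>+x\<in>ball x0 r. F (t, x) \<partial>lborel) \<partial>lborel)"
 proof (rule nn_integral_cong)
  fix t
  show "(\<integral>\<^sup>+x. F (t, x) * indicator ({t1<..<t2} \<times> ball x0 r) (t, x) \<partial>lborel) = (\<integral>\<^sup>+x\<in>ball x0 r. F (t, x) \<partial>lborel) * indicator {t1<..<t2} t"
   by (cases "t \<in> {t1<..<t2}") (simp_all add: indicator_times)
 qed
 finally show ?thesis .
qed

text \<open>The velocity and the pressure estimate in one form: a factor \<open>\<theta>\<^sup>3\<close>, to be compared with the \<open>\<theta>\<^sup>2\<close> of scale
 invariance, and a source term that depends sublinearly on the energy.\<close>

lemma cylinder_decay: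
 assumes r: "0 < r" and \<alpha>: "1 <= \<alpha>" and \<theta>: "0 < \<theta>" "\<theta> <= 1 / 4"
  and t0: "0 <= t0 - r^2" "t0 <= T" and B: "ball x0 (2 * r) \<subseteq> \<Omega>"
  and A: "!!t. t0 - r^2 < t ==> t < t0 ==> (\<integral>\<^sup>+x\<in>ball x0 (2 * r). ennreal ((norm (U (t, x)))^2) \<partial>lborel) <= ennreal (2 * r * \<alpha>)"
  and X: "(\<integral>\<^sup>+z\<in>pcyl (2 * r) (t0, x0). ennreal (norm (U z) ^ 3) \<partial>lborel) <= ennreal X"
   "(\<integral>\<^sup>+z\<in>pcyl (2 * r) (t0, x0). ennreal (\<bar>p z\<bar> powr (3/2)) \<partial>lborel) <= ennreal X" "0 <= X"
 shows "(\<integral>\<^sup>+z\<in>pcyl (\<theta> * r) (t0, x0). ennreal (norm (U z) ^ 3) \<partial>lborel) <= ennreal (KD * (\<theta> ^ 3 * X + (1 + M^2) * \<alpha> powr (9/16) * r^2))"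
  "(\<integral>\<^sup>+z\<in>pcyl (\<theta> * r) (t0, x0). ennreal (\<bar>p z\<bar> powr (3/2)) \<partial>lborel) <= ennreal (KD * (\<theta> ^ 3 * X + (1 + M^2) * \<alpha> powr (9/16) * r^2))"
proof -
 define t1 where "t1 = t0 - (\<theta> * r)^2"
 have \<theta>r: "0 < \<theta> * r" using \<theta> r by simp
 have "(\<theta> * r)^2 <= (1 * r)^2" using \<theta> r by (intro power_mono mult_right_mono) auto
 then have t1: "t0 - r^2 <= t1" "t1 < t0" "0 <= t1" using \<theta>r t0 by (auto simp: t1_def)
 define J where "J = {t1<..<t0}"
 define m where "m = (1 + M^2) * \<alpha> powr (9/16) * r^2"
 have m: "0 <= m" by (simp add: m_def)
 have Js: "J \<subseteq> {0<..<T}" using t1 t0 by (auto simp: J_def)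
 have Jm: "J \<in> sets borel" by (simp add: J_def)
 have [measurable]: "J \<in> sets borel" by (rule Jm)
 have Je: "emeasure lborel J <= ennreal (r^2)" using t1 by (simp add: J_def ennreal_leI)
 have F: "(\<integral>\<^sup>+x\<in>cube x0 r. ennreal ((norm (U (t, x) - mean x0 r t)) ^ 4) \<partial>lborel) <= ennreal (Phi r \<alpha> t / r)"
  if "t1 < t" "t < t0" for t
  using that t1 t0 by (intro fourth_moment r B \<alpha> A) auto
 have Nu: "(\<integral>\<^sup>+t\<in>J. ennreal (Nu r \<alpha> t) \<partial>lborel) <= ennreal (KN * m)"
  using Nu_integral[OF r \<alpha> Js Jm Je] by (simp add: m_def mult.assoc)
 have pc: "pcyl (\<theta> * r) (t0, x0) = {t1<..<t0} \<times> ball x0 (\<theta> * r)" by (simp add: pcyl_def t1_def)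
 have "r^2 <= (2 * r)^2" by (simp add: power_mult_distrib)
 then have sub: "{t1<..<t0} \<times> ball x0 (2 * r) \<subseteq> pcyl (2 * r) (t0, x0)"
  using t1 by (auto simp: pcyl_def)
 have big: "x + y <= KD * (\<theta> ^ 3 * X + m)" if "x <= K * (\<theta> ^ 3 * X)" "y <= K * (KN * m)" "0 <= K" "K <= KC + KP" for x y K
 proof -
  have n: "0 <= \<theta> ^ 3 * X" "0 <= KN * m" using \<theta> X m KN_nonneg by simp_all
  have "K * (\<theta> ^ 3 * X) <= (KC + KP) * (\<theta> ^ 3 * X)" "K * (KN * m) <= (KC + KP) * (KN * m)"
   using that n by (auto intro!: mult_right_mono)
  moreover have "KD * (\<theta> ^ 3 * X + m) = (KC + KP) * (\<theta> ^ 3 * X) + (KC + KP) * (KN * m) + (KC + KP) * (KN * (\<theta> ^ 3 * X) + m)"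
   by (simp add: KD_def algebra_simps)
  moreover have "0 <= (KC + KP) * (KN * (\<theta> ^ 3 * X) + m)"
   using \<theta> X(3) m KN_nonneg KC_pos constants(8) by (intro mult_nonneg_nonneg add_nonneg_nonneg) auto
  ultimately show ?thesis using that by linarith
 qed
 define u3 where "u3 t = (\<integral>\<^sup>+x\<in>ball x0 (2 * r). ennreal (norm (U (t, x)) ^ 3) \<partial>lborel)" for t
 have u3m [measurable]: "u3 \<in> borel_measurable borel"
  unfolding u3_def
  using slice_nn_integral_measurable[of "%z. ennreal (norm (U z) ^ 3) * indicator (ball x0 (2 * r)) (snd z)"] by simp
 have u3X: "(\<integral>\<^sup>+t\<in>J. u3 t \<partial>lborel) <= ennreal X"
 proof -
  have "(\<integral>\<^sup>+t\<in>J. u3 t \<partial>lborel) = (\<integral>\<^sup>+z\<in>{t1<..<t0} \<times> ball x0 (2 * r). ennreal (norm (U z) ^ 3) \<partial>lborel)"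
   unfolding u3_def J_def using r by (intro slab_integral[symmetric]) auto
  also have "... <= (\<integral>\<^sup>+z\<in>pcyl (2 * r) (t0, x0). ennreal (norm (U z) ^ 3) \<partial>lborel)"
   using sub by (intro nn_integral_mono mult_left_mono) (auto simp: indicator_def)
  finally show ?thesis using X(1) by simp
 qed
 have "(\<integral>\<^sup>+z\<in>pcyl (\<theta> * r) (t0, x0). ennreal (norm (U z) ^ 3) \<partial>lborel) = (\<integral>\<^sup>+t\<in>J. (\<integral>\<^sup>+x\<in>ball x0 (\<theta> * r). ennreal (norm (U (t, x)) ^ 3) \<partial>lborel) \<partial>lborel)"
  unfolding pc J_def using \<theta>r by (intro slab_integral) auto
 also have "... <= (\<integral>\<^sup>+t. ennreal (KC * \<theta> ^ 3) * (u3 t * indicator J t) + ennreal KC * (ennreal (Nu r \<alpha> t) * indicator J t) \<partial>lborel)"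
 proof (rule nn_integral_mono)
  fix t
  have th: "\<theta> <= 1" using \<theta> by simp
  show "(\<integral>\<^sup>+x\<in>ball x0 (\<theta> * r). ennreal (norm (U (t, x)) ^ 3) \<partial>lborel) * indicator J t <= ennreal (KC * \<theta> ^ 3) * (u3 t * indicator J t) + ennreal KC * (ennreal (Nu r \<alpha> t) * indicator J t)"
   using cubic_decay[OF r \<alpha> \<theta>(1) th F, of t] by (cases "t \<in> J") (simp_all add: J_def u3_def)
 qed
 also have "... = ennreal (KC * \<theta> ^ 3) * (\<integral>\<^sup>+t\<in>J. u3 t \<partial>lborel) + ennreal KC * (\<integral>\<^sup>+t\<in>J. ennreal (Nu r \<alpha> t) \<partial>lborel)"
  by (rule nn_integral_lincomb) measurable
 also have "ennreal (KC * \<theta> ^ 3) * (\<integral>\<^sup>+t\<in>J. u3 t \<partial>lborel) + ennreal KC * (\<integral>\<^sup>+t\<in>J. ennreal (Nu r \<alpha> t) \<partial>lborel) <=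
   ennreal (KC * \<theta> ^ 3) * ennreal X + ennreal KC * ennreal (KN * m)"
  by (intro add_mono mult_left_mono u3X Nu) auto
 also have "... = ennreal (KC * \<theta> ^ 3 * X + KC * (KN * m))"
  using KC_pos \<theta> X m KN_nonneg by (simp add: ennreal_plus ennreal_mult)
 also have "... <= ennreal (KD * (\<theta> ^ 3 * X + m))"
  using KC_pos constants(8) by (intro ennreal_leI big[of _ KC]) auto
 finally show "(\<integral>\<^sup>+z\<in>pcyl (\<theta> * r) (t0, x0). ennreal (norm (U z) ^ 3) \<partial>lborel) <= ennreal (KD * (\<theta> ^ 3 * X + (1 + M^2) * \<alpha> powr (9/16) * r^2))"
  by (simp add: m_def)
 have "(\<integral>\<^sup>+z\<in>pcyl (\<theta> * r) (t0, x0). ennreal (\<bar>p z\<bar> powr (3/2)) \<partial>lborel) <= ennreal (KP * (\<theta> ^ 3 * X + KN * m))"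
  unfolding pc
 proof (rule pressure_decay[OF r \<alpha> \<theta> t1(2,3) t0(2) B F])
  have "{t1<..<t0} \<times> ball x0 r \<subseteq> pcyl (2 * r) (t0, x0)"
   using sub r by (force intro: order_trans)
  then have "(\<integral>\<^sup>+z\<in>{t1<..<t0} \<times> ball x0 r. ennreal (\<bar>p z\<bar> powr (3/2)) \<partial>lborel) <= (\<integral>\<^sup>+z\<in>pcyl (2 * r) (t0, x0). ennreal (\<bar>p z\<bar> powr (3/2)) \<partial>lborel)"
   by (intro nn_integral_mono mult_left_mono) (auto simp: indicator_def)
  then show "(\<integral>\<^sup>+z\<in>{t1<..<t0} \<times> ball x0 r. ennreal (\<bar>p z\<bar> powr (3/2)) \<partial>lborel) <= ennreal X" using X(2) by simp
  show "(\<integral>\<^sup>+t\<in>{t1<..<t0}. ennreal (Nu r \<alpha> t) \<partial>lborel) <= ennreal (KN * m)" using Nu by (simp add: J_def)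
  show "0 <= KN * m" using KN_nonneg m by simp
 qed (use X in auto)
 also have "... <= ennreal (KD * (\<theta> ^ 3 * X + m))"
  unfolding distrib_left[of KP] using KC_pos constants(8) by (intro ennreal_leI big[of _ KP]) auto
 finally show "(\<integral>\<^sup>+z\<in>pcyl (\<theta> * r) (t0, x0). ennreal (\<bar>p z\<bar> powr (3/2)) \<partial>lborel) <= ennreal (KD * (\<theta> ^ 3 * X + (1 + M^2) * \<alpha> powr (9/16) * r^2))"
  by (simp add: m_def)
qed

text \<open>A bound at a fixed scale in terms of the energy, from which the iteration starts.\<close>

definition crude :: "real => real" where
 "crude r = 72 * (KN * (1 + M^2) * (1 + E0 / (2 * r)) powr (9/16) * r^2) + 8 * (3 * (1 + E0 / (8 * r ^ 3))) ^ 3 * (8 * r ^ 3) * r^2"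

lemma cubic_crude:
 assumes r: "0 < r" and t0: "0 <= t0 - r^2" "t0 <= T" and B: "ball x0 (2 * r) \<subseteq> \<Omega>"
 shows "(\<integral>\<^sup>+z\<in>pcyl r (t0, x0). ennreal (norm (U z) ^ 3) \<partial>lborel) <= ennreal (crude r)" "0 <= crude r"
proof -
 define \<alpha> where "\<alpha> = 1 + E0 / (2 * r)"
 have \<alpha>: "1 <= \<alpha>" using E0 r by (simp add: \<alpha>_def)
 define t1 where "t1 = t0 - r^2"
 define J where "J = {t1<..<t0}"
 define a where "a = 3 * (1 + E0 / (8 * r ^ 3))"
 have a: "0 <= a" using E0 r by (simp add: a_def)
 have Js: "J \<subseteq> {0<..<T}" using t0 by (auto simp: J_def t1_def)
 have Jm: "J \<in> sets borel" by (simp add: J_def)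
 have [measurable]: "J \<in> sets borel" by (rule Jm)
 have Je: "emeasure lborel J = ennreal (r^2)" by (simp add: J_def t1_def)
 define m where "m = KN * (1 + M^2) * \<alpha> powr (9/16) * r^2"
 have m: "0 <= m" using KN_nonneg by (simp add: m_def)
 have Nu: "(\<integral>\<^sup>+t\<in>J. ennreal (Nu r \<alpha> t) \<partial>lborel) <= ennreal m"
  using Nu_integral[OF r \<alpha> Js Jm] Je by (simp add: m_def)
 have ptw: "(\<integral>\<^sup>+x\<in>ball x0 r. ennreal (norm (U (t, x)) ^ 3) \<partial>lborel) <= ennreal (72 * Nu r \<alpha> t) + ennreal (8 * a ^ 3 * (8 * r ^ 3))"
  if t: "t \<in> J" for t
 proof -
  define d where "d x = norm (U (t, x) - mean x0 r t)" for x
  have [measurable]: "d \<in> borel_measurable borel" unfolding d_def by measurable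
  have d0: "0 <= d x" for x by (simp add: d_def)
  have "norm (mean x0 r t) <= (\<Sum>i\<in>UNIV. \<bar>mean x0 r t $ i\<bar>)" by (rule norm_le_l1_cart)
  also have "... <= (\<Sum>i\<in>(UNIV::3 set). 1 + E0 / (8 * r ^ 3))" by (intro sum_mono mean_bound r)
  also have "... = a" by (simp add: a_def)
  finally have na: "norm (mean x0 r t) <= a" .
  have "(\<integral>\<^sup>+x\<in>ball x0 (2 * r). ennreal ((norm (U (t, x)))^2) \<partial>lborel) <= (\<integral>\<^sup>+x. ennreal ((norm (U (t, x)))^2) \<partial>lborel)"
   by (intro nn_integral_mono) (auto simp: indicator_def)
  also have "... <= ennreal E0" by (rule energy)
  also have "... <= ennreal (2 * r * \<alpha>)" using r by (intro ennreal_leI) (simp add: \<alpha>_def field_simps)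
  finally have A: "(\<integral>\<^sup>+x\<in>ball x0 (2 * r). ennreal ((norm (U (t, x)))^2) \<partial>lborel) <= ennreal (2 * r * \<alpha>)" .
  have "0 < t" "t < T" using t Js by auto
  from third_moment[OF r \<alpha> fourth_moment[OF r B this \<alpha> A]]
  have d3: "(\<integral>\<^sup>+x\<in>cube x0 r. ennreal (d x ^ 3) \<partial>lborel) <= ennreal (9 * Nu r \<alpha> t)" by (simp add: d_def)
  have "(\<integral>\<^sup>+x\<in>ball x0 r. ennreal (norm (U (t, x)) ^ 3) \<partial>lborel) <= (\<integral>\<^sup>+x. 8 * (ennreal (d x ^ 3) * indicator (cube x0 r) x) + ennreal (8 * a ^ 3) * indicator (cube x0 r) x \<partial>lborel)"
  proof (rule nn_integral_mono)
   fix x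
   have "norm (U (t, x)) ^ 3 <= (d x + a) ^ 3"
    using norm_triangle_ineq[of "U (t, x) - mean x0 r t" "mean x0 r t"] na by (intro power_mono) (auto simp: d_def)
   also have "... <= 2 ^ 3 * (d x ^ 3 + a ^ 3)" by (rule power_add_bound[OF d0 a])
   finally have "ennreal (norm (U (t, x)) ^ 3) <= ennreal (8 * d x ^ 3 + 8 * a ^ 3)" by (intro ennreal_leI) simp
   also have "... = 8 * ennreal (d x ^ 3) + ennreal (8 * a ^ 3)"
    using d0[of x] a by (subst ennreal_plus) (auto simp: ennreal_mult)
   finally have *: "ennreal (norm (U (t, x)) ^ 3) <= 8 * ennreal (d x ^ 3) + ennreal (8 * a ^ 3)" .
   show "ennreal (norm (U (t, x)) ^ 3) * indicator (ball x0 r) x <= 8 * (ennreal (d x ^ 3) * indicator (cube x0 r) x) + ennreal (8 * a ^ 3) * indicator (cube x0 r) x"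
   proof (cases "x \<in> ball x0 r")
    case True
    then have "x \<in> cube x0 r" using ball_subset_cube by blast
    then show ?thesis using * True by simp
   qed simp
  qed
  also have "... = 8 * (\<integral>\<^sup>+x\<in>cube x0 r. ennreal (d x ^ 3) \<partial>lborel) + ennreal (8 * a ^ 3) * emeasure lborel (cube x0 r)"
   by (rule nn_integral_lincomb_indicator) measurable
  also have "ennreal (8 * a ^ 3) * emeasure lborel (cube x0 r) = ennreal (8 * a ^ 3 * (8 * r ^ 3))" using r a by (simp add: cube_measure ennreal_mult[symmetric])
  also have "8 * (\<integral>\<^sup>+x\<in>cube x0 r. ennreal (d x ^ 3) \<partial>lborel) + ennreal (8 * a ^ 3 * (8 * r ^ 3)) <= 8 * ennreal (9 * Nu r \<alpha> t) + ennreal (8 * a ^ 3 * (8 * r ^ 3))"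
   by (intro add_right_mono mult_left_mono d3) simp
  also have "8 * ennreal (9 * Nu r \<alpha> t) = ennreal (72 * Nu r \<alpha> t)"
   using Nu_nonneg by (simp add: ennreal_mult flip: mult.assoc)
  finally show ?thesis .
 qed
 have "(\<integral>\<^sup>+z\<in>pcyl r (t0, x0). ennreal (norm (U z) ^ 3) \<partial>lborel) = (\<integral>\<^sup>+t\<in>J. (\<integral>\<^sup>+x\<in>ball x0 r. ennreal (norm (U (t, x)) ^ 3) \<partial>lborel) \<partial>lborel)"
  unfolding pcyl_def J_def fst_conv snd_conv t1_def using r by (intro slab_integral) auto
 also have "... <= (\<integral>\<^sup>+t. ennreal 72 * (ennreal (Nu r \<alpha> t) * indicator J t) + ennreal (8 * a ^ 3 * (8 * r ^ 3)) * indicator J t \<partial>lborel)"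
 proof (rule nn_integral_mono)
  fix t
  show "(\<integral>\<^sup>+x\<in>ball x0 r. ennreal (norm (U (t, x)) ^ 3) \<partial>lborel) * indicator J t <= ennreal 72 * (ennreal (Nu r \<alpha> t) * indicator J t) + ennreal (8 * a ^ 3 * (8 * r ^ 3)) * indicator J t"
   using ptw[of t] Nu_nonneg[of r \<alpha> t] by (cases "t \<in> J") (simp_all add: ennreal_mult)
 qed
 also have "... = ennreal 72 * (\<integral>\<^sup>+t\<in>J. ennreal (Nu r \<alpha> t) \<partial>lborel) + ennreal (8 * a ^ 3 * (8 * r ^ 3)) * emeasure lborel J"
  by (rule nn_integral_lincomb_indicator) measurable
 also have "ennreal 72 * (\<integral>\<^sup>+t\<in>J. ennreal (Nu r \<alpha> t) \<partial>lborel) + ennreal (8 * a ^ 3 * (8 * r ^ 3)) * emeasure lborel J <=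
   ennreal 72 * ennreal m + ennreal (8 * a ^ 3 * (8 * r ^ 3)) * ennreal (r^2)"
  unfolding Je by (intro add_right_mono mult_left_mono Nu) auto
 also have "... = ennreal (72 * m + 8 * a ^ 3 * (8 * r ^ 3) * r^2)"
  using m a r by (subst ennreal_plus) (auto simp: ennreal_mult)
 finally show "(\<integral>\<^sup>+z\<in>pcyl r (t0, x0). ennreal (norm (U z) ^ 3) \<partial>lborel) <= ennreal (crude r)"
  by (simp add: crude_def m_def a_def \<alpha>_def)
 have "0 <= 72 * m + 8 * a ^ 3 * (8 * r ^ 3) * r^2" using m a r by simp
 then show "0 <= crude r" by (simp add: crude_def m_def a_def \<alpha>_def)
qed

end

section \<open>Measurability of the BMO norm in time\<close>

definition osc_ball :: "(real^3 => real^3) => real^3 => real => ennreal" where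
 "osc_ball f a r = (\<integral>\<^sup>+x\<in>ball a r. ennreal (norm (f x - average (ball a r) f)) \<partial>lebesgue) / emeasure lebesgue (ball a r)"

lemma bmo_norm_osc: "bmo_norm \<Omega> f = (SUP d\<in>{(a, r). 0 < r \<and> ball a r \<subseteq> \<Omega>}. osc_ball f (fst d) (snd d))"
proof -
 have "{ball a r |a r. 0 < r \<and> ball a r \<subseteq> \<Omega>} = (%d. ball (fst d) (snd d)) ` {(a, r). 0 < r \<and> ball a r \<subseteq> \<Omega>}"
  by force
 then show ?thesis by (simp add: bmo_norm_def osc_ball_def image_image)
qed

lemma ball_emeasure: "0 <= r ==> emeasure lebesgue (ball (a::real^3) r) = ennreal (unit_ball_vol 3 * r ^ 3)"
 by (simp add: emeasure_ball)

lemma average_borel: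
 assumes "f \<in> borel_measurable borel" "0 <= r"
 shows "average (ball a r) f = (LINT x:ball a r|lborel. f x) /\<^sub>R (unit_ball_vol 3 * r ^ 3)"
proof -
 have "(LINT x:ball a r|lebesgue. f x) = (LINT x:ball a r|lborel. f x)"
  unfolding set_lebesgue_integral_def using assms(1) by (intro integral_completion) measurable
 then show ?thesis using assms(2) by (simp add: average_def ball_content)
qed

lemma average_cong:
 assumes f: "f \<in> borel_measurable (lebesgue_on \<Omega>)" and g: "g \<in> borel_measurable borel"
  and ae: "AE x in lborel. x \<in> \<Omega> --> f x = g x" and \<Omega>: "open \<Omega>" and B: "ball a r \<subseteq> \<Omega>"
 shows "average (ball a r) f = average (ball a r) g"
proof -
 have m: "(%x. if x \<in> \<Omega> then f x else 0) \<in> borel_measurable lebesgue"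
  using f \<Omega> by (subst borel_measurable_if) auto
 have "(LINT x:ball a r|lebesgue. f x) = (LINT x:ball a r|lebesgue. if x \<in> \<Omega> then f x else 0)"
  using B by (intro set_lebesgue_integral_cong) auto
 also have "... = (LINT x:ball a r|lebesgue. g x)"
  unfolding set_lebesgue_integral_def
 proof (rule integral_cong_AE)
  show "(%x. indicat_real (ball a r) x *\<^sub>R (if x \<in> \<Omega> then f x else 0)) \<in> borel_measurable lebesgue"
   using m by (intro borel_measurable_scaleR borel_measurable_indicator) auto
  show "(%x. indicat_real (ball a r) x *\<^sub>R g x) \<in> borel_measurable lebesgue"
   using g by (intro borel_measurable_scaleR borel_measurable_indicator measurable_completion) auto
  have "AE x in lebesgue. x \<in> \<Omega> --> f x = g x" using ae by (simp add: AE_completion_iff)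
  then show "AE x in lebesgue. indicat_real (ball a r) x *\<^sub>R (if x \<in> \<Omega> then f x else 0) = indicat_real (ball a r) x *\<^sub>R g x"
   by eventually_elim (use B in \<open>auto simp: indicator_def\<close>)
 qed
 finally show ?thesis by (simp add: average_def)
qed

lemma bmo_norm_cong:
 assumes f: "f \<in> borel_measurable (lebesgue_on \<Omega>)" and g: "g \<in> borel_measurable borel"
  and ae: "AE x in lborel. x \<in> \<Omega> --> f x = g x" and \<Omega>: "open \<Omega>"
 shows "bmo_norm \<Omega> f = bmo_norm \<Omega> g"
 unfolding bmo_norm_osc
proof (rule SUP_cong[OF refl])
 fix d assume "d \<in> {(a, r). 0 < r \<and> ball a r \<subseteq> \<Omega>}"
 then obtain a r where d: "d = (a, r)" "0 < r" "ball a r \<subseteq> \<Omega>" by auto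
 have ae': "AE x in lebesgue. x \<in> \<Omega> --> f x = g x" using ae by (simp add: AE_completion_iff)
 have "(\<integral>\<^sup>+x\<in>ball a r. ennreal (norm (f x - average (ball a r) g)) \<partial>lebesgue) = (\<integral>\<^sup>+x\<in>ball a r. ennreal (norm (g x - average (ball a r) g)) \<partial>lebesgue)"
  by (rule nn_integral_cong_AE) (use ae' in \<open>eventually_elim, use d in \<open>auto simp: indicator_def\<close>\<close>)
 then show "osc_ball f (fst d) (snd d) = osc_ball g (fst d) (snd d)"
  by (simp add: osc_ball_def d average_cong[OF f g ae \<Omega> d(3)])
qed

lemma set_integrable_norm_dev:
 fixes f :: "real^3 => real^3"
 assumes "set_integrable lborel (ball a r) f"
 shows "set_integrable lborel (ball a r) (%x. norm (f x - k))"
proof -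
 have "set_integrable lborel (ball a r) (%x. k)"
 proof (cases "0 <= r")
  case True
  then have "emeasure lborel (ball a r) < \<infinity>" by (simp add: emeasure_ball)
  then show ?thesis unfolding set_integrable_def
   by (intro integrable_scaleR_left) (simp add: integrable_indicator_iff)
 next
  case False
  then have e: "ball a r = {}" by simp
  show ?thesis unfolding e set_integrable_def by simp
 qed
 from set_integrable_norm[OF set_integral_diff(1)[OF assms this]] show ?thesis .
qed

lemma osc_ball_eq:
 fixes f :: "real^3 => real^3"
 assumes "f \<in> borel_measurable borel" "set_integrable lborel (ball a r) f" "0 < r"
 shows "osc_ball f a r = ennreal ((LINT x:ball a r|lborel. norm (f x - average (ball a r) f)) / (unit_ball_vol 3 * r ^ 3))"
proof -
 have "(\<integral>\<^sup>+x\<in>ball a r. ennreal (norm (f x - average (ball a r) f)) \<partial>lebesgue) = ennreal (LINT x:ball a r|lborel. norm (f x - average (ball a r) f))"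
  unfolding nn_integral_completion
  by (rule set_nn_integral_eq_set_integral'[OF set_integrable_norm_dev[OF assms(2)]]) simp
 moreover have "0 < unit_ball_vol (3::real)" by (rule unit_ball_vol_pos) simp
 moreover have "0 <= (LINT x:ball a r|lborel. norm (f x - average (ball a r) f))"
  by (simp add: set_lebesgue_integral_def)
 ultimately show ?thesis
  using assms(3) by (simp only: osc_ball_def ball_emeasure[OF less_imp_le[OF assms(3)]]) (intro divide_ennreal, auto)
qed

text \<open>The oscillation over a ball is the limit of those over slightly smaller balls with centers and
 radii in a countable dense set, because the indicator functions converge everywhere.\<close>

lemma bmo_norm_countable:
 fixes \<Omega> :: "(real^3) set"
 obtains D where "countable D" "D \<subseteq> {(a, r). 0 < r \<and> ball a r \<subseteq> \<Omega>}"
  "!!f. f \<in> borel_measurable borel ==> (!!a r. ball a r \<subseteq> \<Omega> ==> set_integrable lborel (ball a r) f) ==>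
    bmo_norm \<Omega> f = (SUP d\<in>D. osc_ball f (fst d) (snd d))"
proof -
 obtain D0 :: "((real^3) \<times> real) set" where D0: "countable D0" "!!X. open X ==> X ~= {} ==> \<exists>d\<in>D0. d \<in> X"
  using countable_dense_setE by blast
 let ?G = "{(a, r). 0 < r \<and> ball a r \<subseteq> \<Omega>}"
 show ?thesis
 proof (rule that[of "D0 \<inter> ?G"])
  show "countable (D0 \<inter> ?G)" using D0(1) by auto
  show "D0 \<inter> ?G \<subseteq> ?G" by blast
  fix f :: "real^3 => real^3"
  assume f [measurable]: "f \<in> borel_measurable borel" and fi: "!!a r. ball a r \<subseteq> \<Omega> ==> set_integrable lborel (ball a r) f"
  show "bmo_norm \<Omega> f = (SUP d\<in>D0 \<inter> ?G. osc_ball f (fst d) (snd d))"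
   unfolding bmo_norm_osc
  proof (rule antisym)
   show "(SUP d\<in>D0 \<inter> ?G. osc_ball f (fst d) (snd d)) <= (SUP d\<in>?G. osc_ball f (fst d) (snd d))"
    by (rule SUP_subset_mono) auto
   show "(SUP d\<in>?G. osc_ball f (fst d) (snd d)) <= (SUP d\<in>D0 \<inter> ?G. osc_ball f (fst d) (snd d))"
   proof (rule SUP_least)
    fix d assume "d \<in> ?G"
    then obtain a r where d: "d = (a, r)" "0 < r" "ball a r \<subseteq> \<Omega>" by auto
    define \<delta> where "\<delta> n = r / 4 * inverse (real (Suc n))" for n
    have \<delta>: "0 < \<delta> n" "\<delta> n <= r / 4" for n
    proof -
     show "0 < \<delta> n" using d by (simp add: \<delta>_def)
     have "inverse (real (Suc n)) <= 1" by (simp add: field_simps)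
     then have "r / 4 * inverse (real (Suc n)) <= r / 4 * 1" using d by (intro mult_left_mono) auto
     then show "\<delta> n <= r / 4" by (simp add: \<delta>_def)
    qed
    have \<delta>lim: "\<delta> \<longlonglongrightarrow> 0"
     unfolding \<delta>_def using tendsto_mult_left[OF LIMSEQ_inverse_real_of_nat, of "r / 4"] by simp
    have "\<exists>e\<in>D0. dist a (fst e) < \<delta> n \<and> r - 3 * \<delta> n < snd e \<and> snd e < r - \<delta> n" for n
    proof -
     have "open {e :: (real^3) \<times> real. dist a (fst e) < \<delta> n \<and> r - 3 * \<delta> n < snd e \<and> snd e < r - \<delta> n}"
      by (intro open_Collect_conj open_Collect_less continuous_intros)
     moreover have "(a, r - 2 * \<delta> n) \<in> {e. dist a (fst e) < \<delta> n \<and> r - 3 * \<delta> n < snd e \<and> snd e < r - \<delta> n}"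
      using \<delta>[of n] by simp
     ultimately show ?thesis using D0(2)[of "{e. dist a (fst e) < \<delta> n \<and> r - 3 * \<delta> n < snd e \<and> snd e < r - \<delta> n}"] by blast
    qed
    then obtain e where e: "!!n. e n \<in> D0" "!!n. dist a (fst (e n)) < \<delta> n" "!!n. r - 3 * \<delta> n < snd (e n)" "!!n. snd (e n) < r - \<delta> n"
     by metis
    define an rn where "an n = fst (e n)" and "rn n = snd (e n)" for n
    have rn: "0 < rn n" for n using e(3)[of n] \<delta>[of n] d by (simp add: rn_def)
    have sub: "ball (an n) (rn n) \<subseteq> ball a r" for n
    proof
     fix x assume "x \<in> ball (an n) (rn n)"
     then show "x \<in> ball a r" using dist_triangle[of a x "an n"] e(2)[of n] e(4)[of n] by (simp add: an_def rn_def)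
    qed
    then have "ball (fst (e n)) (snd (e n)) \<subseteq> \<Omega>" for n using d(3) unfolding an_def rn_def by blast
    then have "e n \<in> D0 \<inter> ?G" for n using e(1)[of n] rn[of n] unfolding rn_def by (auto simp: split_beta)
    then have le: "osc_ball f (an n) (rn n) <= (SUP d\<in>D0 \<inter> ?G. osc_ball f (fst d) (snd d))" for n
     unfolding an_def rn_def by (rule SUP_upper)
    have ind: "(%n. indicator (ball (an n) (rn n)) x :: real) \<longlonglongrightarrow> indicator (ball a r) x" for x
    proof (cases "x \<in> ball a r")
     case True
     then have "\<forall>\<^sub>F n in sequentially. \<delta> n < (r - dist a x) / 4"
      using \<delta>lim by (intro order_tendstoD(2)) auto
     then have "\<forall>\<^sub>F n in sequentially. indicator (ball (an n) (rn n)) x = (indicator (ball a r) x :: real)"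
     proof eventually_elim
      case (elim n)
      have "dist (an n) x <= dist a (an n) + dist a x" using dist_triangle[of "an n" x a] by (simp add: dist_commute)
      then have "dist (an n) x < rn n" using elim e(2)[of n] e(3)[of n] by (simp add: an_def rn_def)
      then show ?case using True by simp
     qed
     then show ?thesis by (rule tendsto_eventually)
    next
     case False
     then have "x \<notin> ball (an n) (rn n)" for n using sub[of n] by blast
     then show ?thesis using False by simp
    qed
    have rlim: "rn \<longlonglongrightarrow> r"
    proof (rule tendsto_sandwich)
     show "\<forall>\<^sub>F n in sequentially. r - 3 * \<delta> n <= rn n" using e(3) by (auto simp: rn_def less_imp_le)
     show "\<forall>\<^sub>F n in sequentially. rn n <= r" using e(4) \<delta>(1) by (intro always_eventually allI) (unfold rn_def, smt (verit, best))
     show "(%n. r - 3 * \<delta> n) \<longlonglongrightarrow> r" using tendsto_diff[OF tendsto_const tendsto_mult_left[OF \<delta>lim, of 3], of r] by simp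
    qed simp
    define V where "V s = unit_ball_vol 3 * s ^ 3" for s :: real
    have "0 < unit_ball_vol (3::real)" by (rule unit_ball_vol_pos) simp
    then have V3: "unit_ball_vol (3::real) ~= 0" by linarith
    have V: "0 < V r" using d \<open>0 < unit_ball_vol 3\<close> by (simp add: V_def)
    have Vlim: "(%n. V (rn n)) \<longlonglongrightarrow> V r" unfolding V_def by (intro tendsto_intros rlim)
    have fB: "integrable lborel (%x. indicator (ball a r) x *\<^sub>R f x)"
     using fi[OF d(3)] by (simp add: set_integrable_def)
    have nfB: "integrable lborel (%x. indicator (ball a r) x * norm (f x))"
     using set_integrable_norm[OF fi[OF d(3)]] by (simp add: set_integrable_def)
    have "(%n. LINT x|lborel. indicator (ball (an n) (rn n)) x *\<^sub>R f x) \<longlonglongrightarrow> (LINT x|lborel. indicator (ball a r) x *\<^sub>R f x)"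
    proof (rule integral_dominated_convergence[OF _ _ nfB])
     show "AE x in lborel. (%n. indicat_real (ball (an n) (rn n)) x *\<^sub>R f x) \<longlonglongrightarrow> indicat_real (ball a r) x *\<^sub>R f x"
      by (intro AE_I2 tendsto_intros ind)
     show "AE x in lborel. norm (indicat_real (ball (an n) (rn n)) x *\<^sub>R f x) <= indicat_real (ball a r) x * norm (f x)" for n
      using sub[of n] by (intro AE_I2) (auto simp: indicator_def)
    qed measurable
    then have alim: "(%n. average (ball (an n) (rn n)) f) \<longlonglongrightarrow> average (ball a r) f"
     using V rn d(2) unfolding average_borel[OF f less_imp_le[OF rn]] average_borel[OF f less_imp_le[OF d(2)]] set_lebesgue_integral_def
     by (intro tendsto_scaleR tendsto_inverse) (use Vlim V3 in \<open>auto simp: V_def\<close>)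
    then have "Bseq (%n. average (ball (an n) (rn n)) f)" by (intro convergent_imp_Bseq convergentI)
    then obtain C where C: "!!n. norm (average (ball (an n) (rn n)) f) <= C" by (auto simp: Bseq_def)
    have dom: "integrable lborel (%x. indicator (ball a r) x * norm (f x) + C * indicator (ball a r) x)"
     using nfB d(2) by (intro Bochner_Integration.integrable_add) (auto simp: integrable_indicator_iff emeasure_ball)
    have "(%n. LINT x|lborel. indicator (ball (an n) (rn n)) x *\<^sub>R norm (f x - average (ball (an n) (rn n)) f))
      \<longlonglongrightarrow> (LINT x|lborel. indicator (ball a r) x *\<^sub>R norm (f x - average (ball a r) f))"
    proof (rule integral_dominated_convergence[OF _ _ dom])
     show "AE x in lborel. (%n. indicat_real (ball (an n) (rn n)) x *\<^sub>R norm (f x - average (ball (an n) (rn n)) f)) \<longlonglongrightarrow> indicat_real (ball a r) x *\<^sub>R norm (f x - average (ball a r) f)"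
      by (intro AE_I2 tendsto_intros ind alim)
     show "AE x in lborel. norm (indicat_real (ball (an n) (rn n)) x *\<^sub>R norm (f x - average (ball (an n) (rn n)) f)) <= indicat_real (ball a r) x * norm (f x) + C * indicat_real (ball a r) x" for n
     proof (rule AE_I2)
      fix x
      have "norm (f x - average (ball (an n) (rn n)) f) <= norm (f x) + C"
       using norm_triangle_ineq4[of "f x" "average (ball (an n) (rn n)) f"] C[of n] by linarith
      moreover have "0 <= C" using C[of n] norm_ge_zero order_trans by blast
      ultimately show "norm (indicat_real (ball (an n) (rn n)) x *\<^sub>R norm (f x - average (ball (an n) (rn n)) f)) <= indicat_real (ball a r) x * norm (f x) + C * indicat_real (ball a r) x"
       using subsetD[OF sub[of n], of x] by (cases "x \<in> ball (an n) (rn n)"; cases "x \<in> ball a r") auto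
     qed
    qed measurable
    then have "(%n. (LINT x:ball (an n) (rn n)|lborel. norm (f x - average (ball (an n) (rn n)) f)) / V (rn n)) \<longlonglongrightarrow>
      (LINT x:ball a r|lborel. norm (f x - average (ball a r) f)) / V r"
     unfolding set_lebesgue_integral_def using V by (intro tendsto_divide Vlim) auto
    from tendsto_ennrealI[OF this]
    have "(%n. osc_ball f (an n) (rn n)) \<longlonglongrightarrow> osc_ball f a r"
     using osc_ball_eq[OF f fi rn] osc_ball_eq[OF f fi[OF d(3)] d(2)] sub d(3)
     by (simp add: V_def subset_trans[OF sub d(3)])
    then show "osc_ball f (fst d) (snd d) <= (SUP d\<in>D0 \<inter> ?G. osc_ball f (fst d) (snd d))"
     unfolding d(1) fst_conv snd_conv using le by (intro LIMSEQ_le_const2) auto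
   qed
  qed
 qed
qed

lemma osc_ball_measurable:
 fixes F :: "spacetime => real^3"
 assumes F [measurable]: "F \<in> borel_measurable borel" and r: "0 <= r"
 shows "(%t. osc_ball (%x. F (t, x)) a r) \<in> borel_measurable borel"
proof -
 define A where "A t = average (ball a r) (%x. F (t, x))" for t
 have Fs: "(%x. F (t, x)) \<in> borel_measurable borel" for t by measurable
 have "(%t. LINT x|lborel. indicator (ball a r) x *\<^sub>R F (t, x)) \<in> borel_measurable borel"
  using slice_integral_measurable[of "%z. indicator (ball a r) (snd z) *\<^sub>R F z"] by simp
 then have A [measurable]: "A \<in> borel_measurable borel"
  unfolding A_def average_borel[OF Fs r] set_lebesgue_integral_def by measurable
 have "(%t. \<integral>\<^sup>+x. ennreal (norm (F (t, x) - A t)) * indicator (ball a r) x \<partial>lborel) \<in> borel_measurable borel"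
  using slice_nn_integral_measurable[of "%z. ennreal (norm (F z - A (fst z))) * indicator (ball a r) (snd z)"] by simp
 then show ?thesis
  unfolding osc_ball_def A_def[symmetric] nn_integral_completion by measurable
qed

section \<open>Borel versions of a suitable weak solution\<close>

lemma lebesgue_eq_lborel_integral:
 fixes f g :: "'a::euclidean_space => real"
 assumes g: "g \<in> borel_measurable borel" and ae: "AE x in lborel. f x = g x"
 shows "(LINT x|lebesgue. f x) = (LINT x|lborel. g x)" "integrable lebesgue f \<longleftrightarrow> integrable lborel g"
proof -
 have ae': "AE x in lebesgue. f x = g x" using ae by (simp add: AE_completion_iff)
 have gl: "g \<in> borel_measurable lebesgue" using g by (intro measurable_completion) simp
 have fm: "f \<in> borel_measurable lebesgue"
 proof (rule measurableI)
  fix A :: "real set" assume A: "A \<in> sets borel"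
  show "f -` A \<inter> space lebesgue \<in> sets lebesgue"
  proof (rule completion.in_sets_AE)
   show "AE x in lebesgue. x \<in> g -` A \<inter> space lebesgue \<longleftrightarrow> x \<in> f -` A \<inter> space lebesgue"
    using ae' by eventually_elim simp
   show "g -` A \<inter> space lebesgue \<in> sets lebesgue" using gl A by (rule measurable_sets)
  qed simp
 qed simp
 show "(LINT x|lebesgue. f x) = (LINT x|lborel. g x)"
  using integral_cong_AE[OF fm gl ae'] integral_completion[of g lborel] g by simp
 show "integrable lebesgue f \<longleftrightarrow> integrable lborel g"
  using integrable_cong_AE[OF fm gl ae'] integrable_completion[of g lborel] g by simp
qed

lemma borel_version:
 fixes f :: "'a::euclidean_space => 'b::euclidean_space"
 assumes f: "f \<in> borel_measurable (lebesgue_on S)" and S: "S \<in> sets lebesgue"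
 obtains g where "g \<in> borel_measurable borel" "AE x in lborel. x \<in> S --> f x = g x"
proof -
 define f0 where "f0 x = (if x \<in> S then f x else 0)" for x
 have "f0 \<in> borel_measurable lebesgue" unfolding f0_def by (rule borel_measurable_if_I[OF f S])
 then have "\<exists>g\<in>borel_measurable lborel. AE x in lborel. f0 x \<bullet> i = g x" for i
  by (intro completion_ex_borel_measurable_real borel_measurable_inner borel_measurable_const)
 then obtain G where G: "!!i. G i \<in> borel_measurable lborel" "!!i. AE x in lborel. f0 x \<bullet> i = G i x"
  by metis
 show thesis
 proof (rule that[of "%x. \<Sum>i\<in>Basis. G i x *\<^sub>R i"])
  show "(%x. \<Sum>i\<in>Basis. G i x *\<^sub>R i) \<in> borel_measurable borel"
   using G(1) by (intro borel_measurable_sum borel_measurable_scaleR) auto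
  have "AE x in lborel. \<forall>i\<in>Basis. f0 x \<bullet> i = G i x"
   using G(2) by (intro AE_finite_allI) auto
  then show "AE x in lborel. x \<in> S --> f x = (\<Sum>i\<in>Basis. G i x *\<^sub>R i)"
  proof eventually_elim
   case (elim x)
   have "(\<Sum>i\<in>Basis. G i x *\<^sub>R i) = (\<Sum>i\<in>Basis. (f0 x \<bullet> i) *\<^sub>R i)" using elim by simp
   also have "... = f0 x" by (rule euclidean_representation)
   finally show ?case by (simp add: f0_def)
  qed
 qed
qed

lemma set_integrable_ball_of_square:
 fixes f :: "real^3 => real^3"
 assumes [measurable]: "f \<in> borel_measurable borel" and fin: "(\<integral>\<^sup>+x\<in>ball a r. ennreal ((norm (f x))^2) \<partial>lborel) < \<infinity>"
 shows "set_integrable lborel (ball a r) f"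
 unfolding set_integrable_def
proof (rule integrableI_bounded)
 have "(\<integral>\<^sup>+x. ennreal (norm (indicat_real (ball a r) x *\<^sub>R f x)) \<partial>lborel)
   <= (\<integral>\<^sup>+x. indicator (ball a r) x + ennreal ((norm (f x))^2) * indicator (ball a r) x \<partial>lborel)"
 proof (rule nn_integral_mono)
  fix x
  have "norm (f x) <= 1 + (norm (f x))^2" using sum_power2_ge_zero[of "norm (f x) - 1" "norm (f x)"] by (simp add: power2_eq_square algebra_simps)
  then have "ennreal (norm (f x)) <= ennreal (1 + (norm (f x))^2)" by (rule ennreal_leI)
  then show "ennreal (norm (indicat_real (ball a r) x *\<^sub>R f x)) <= indicator (ball a r) x + ennreal ((norm (f x))^2) * indicator (ball a r) x"
   by (simp add: indicator_def)
 qed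
 also have "... = emeasure lborel (ball a r) + (\<integral>\<^sup>+x\<in>ball a r. ennreal ((norm (f x))^2) \<partial>lborel)"
  by (subst nn_integral_add) auto
 also have "... < \<infinity>" using fin emeasure_bounded_finite[OF bounded_ball[of a r]] by simp
 finally show "(\<integral>\<^sup>+x. ennreal (norm (indicat_real (ball a r) x *\<^sub>R f x)) \<partial>lborel) < \<infinity>" .
qed measurable

text \<open>The hypotheses of the theorem on \<open>(u, P)\<close>.\<close>

locale solution =
 fixes T M :: real and \<Omega> :: "(real^3) set" and u :: "real => real^3 => real^3" and P :: "real => real^3 => real"
 assumes domain: "domain3 \<Omega>" and T: "0 < T" and sws: "suitable_weak_solution T \<Omega> u P"
  and M: "0 <= M" and weak_bmo: "weakL2_bmo_norm T \<Omega> u = ennreal M"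
begin

lemma open_Omega: "open \<Omega>" using domain by (simp add: domain3_def)

lemma Omega_borel [measurable]: "\<Omega> \<in> sets borel" using open_Omega by (rule borel_open)

lemma Z_borel [measurable]: "{0..T} \<times> \<Omega> \<in> sets borel"
 using open_Omega by (intro borel_Times borel_closed borel_open) auto

lemma initial_energy: "sq_norm \<Omega> (u 0) < \<infinity>"
proof -
 have "0 \<in> {0..T}" using T by simp
 then show ?thesis
  using sws unfolding suitable_weak_solution_def leray_hopf_def energy_class_def by blast
qed

lemma energy_bound: "t \<in> {0..T} ==> sq_norm \<Omega> (u t) <= ennreal (enn2real (sq_norm \<Omega> (u 0)))"
proof -
 assume t: "t \<in> {0..T}"
 have "sq_norm \<Omega> (u t) <= sq_norm \<Omega> (u t) + 2 * sq_norm ({0..t} \<times> \<Omega>) (%z. grad T \<Omega> u (fst z) (snd z))"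
  by simp
 also have "... <= sq_norm \<Omega> (u 0)"
  using sws t unfolding suitable_weak_solution_def leray_hopf_def energy_inequality_def by blast
 also have "... = ennreal (enn2real (sq_norm \<Omega> (u 0)))"
  using initial_energy by (simp add: less_top)
 finally show ?thesis .
qed

text \<open>The superlevel sets of the BMO norm are measurable because the norm agrees with a Borel function off
 a null set; without measurability their measure would be a meaningless default.\<close>

lemma level_set_bound:
 assumes B: "B \<in> borel_measurable borel" and N: "N \<in> null_sets lborel"
  and eq: "!!t. t \<in> {0..T} - N ==> bmo_norm \<Omega> (u t) = B t" and \<sigma>: "0 < \<sigma>"
 shows "emeasure lborel {t\<in>{0..T}. ennreal \<sigma> < B t} <= ennreal (M^2 / \<sigma>^2)"
proof -
 let ?S = "{t\<in>{0..T}. ennreal \<sigma> < bmo_norm \<Omega> (u t)}" and ?S' = "{t\<in>{0..T}. ennreal \<sigma> < B t}"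
 have [measurable]: "B \<in> borel_measurable borel" by (rule B)
 have S': "?S' \<in> sets borel" by measurable
 have "AE t in lborel. t \<notin> N" by (rule AE_not_in[OF N])
 then have ae: "AE t in lebesgue. t \<in> ?S' \<longleftrightarrow> t \<in> ?S"
  unfolding AE_completion_iff by eventually_elim (use eq in auto)
 have S: "?S \<in> sets lebesgue"
  by (rule completion.in_sets_AE[OF ae]) (use S' in auto)
 have "measure lebesgue ?S = measure lebesgue ?S'"
  using ae S S' by (intro measure_eq_AE) auto
 also have "... = measure lborel ?S'" using S' by simp
 finally have m: "measure lebesgue ?S = measure lborel ?S'" .
 have le: "ennreal (\<sigma> * sqrt (measure lebesgue ?S)) <= weakL2_bmo_norm T \<Omega> u"
  unfolding weakL2_bmo_norm_def using \<sigma> by (intro SUP_upper) auto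
 have "\<sigma> * sqrt (measure lborel ?S') <= M" using le M unfolding weak_bmo m by (simp only: ennreal_le_iff)
 then have "(\<sigma> * sqrt (measure lborel ?S'))^2 <= M^2" using \<sigma> by (intro power_mono) auto
 then have "measure lborel ?S' <= M^2 / \<sigma>^2"
  using \<sigma> by (simp add: power_mult_distrib field_simps)
 moreover have "emeasure lborel ?S' = ennreal (measure lborel ?S')"
 proof (rule emeasure_eq_ennreal_measure)
  have "emeasure lborel ?S' <= emeasure lborel {0..T}" by (intro emeasure_mono) auto
  also have "... < \<infinity>" using T by simp
  finally show "emeasure lborel ?S' ~= top" by simp
 qed
 ultimately show ?thesis by (simp add: ennreal_leI)
qed

lemma infinite_level_null:
 assumes "B \<in> borel_measurable borel" "N \<in> null_sets lborel"
  and eq: "!!t. t \<in> {0..T} - N ==> bmo_norm \<Omega> (u t) = B t"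
 shows "{t\<in>{0..T}. B t = \<infinity>} \<in> null_sets lborel"
proof -
 have [measurable]: "B \<in> borel_measurable borel" by (rule assms)
 let ?S = "{t\<in>{0..T}. B t = \<infinity>}"
 have S: "?S \<in> sets borel" by measurable
 have small: "emeasure lborel ?S <= ennreal e" if e: "0 < e" for e
 proof -
  let ?\<sigma> = "(M + 1) / sqrt e"
  have \<sigma>: "0 < ?\<sigma>" using e M by simp
  have "emeasure lborel ?S <= emeasure lborel {t\<in>{0..T}. ennreal ?\<sigma> < B t}"
   by (intro emeasure_mono) auto
  also have "... <= ennreal (M^2 / ?\<sigma>^2)" by (rule level_set_bound[OF assms \<sigma>])
  also have "M^2 / ?\<sigma>^2 <= e"
  proof -
   have "M^2 / ?\<sigma>^2 = e * (M^2 / (M + 1)^2)" using e by (simp add: power_divide)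
   also have "M^2 / (M + 1)^2 <= 1" using M by (simp add: divide_le_eq power_mono)
   then have "e * (M^2 / (M + 1)^2) <= e" using e mult_left_mono[of "M^2 / (M + 1)^2" 1 e] by simp
   finally show ?thesis .
  qed
  finally show ?thesis by (simp add: ennreal_leI)
 qed
 have "emeasure lborel ?S <= 0" by (rule ennreal_le_epsilon) (simp only: add_0 small)
 then show ?thesis using S by (simp add: null_sets_def)
qed

text \<open>The velocity is modified on a null set of times so that every slice is square integrable and
 of bounded mean oscillation, and the BMO norms of the slices are measurable in time.\<close>

lemma velocity_version:
 obtains U b where "U \<in> borel_measurable borel" "b \<in> borel_measurable borel"
  "!!t A. t \<in> {0..T} ==> A \<in> sets borel ==> A \<subseteq> \<Omega> ==> (\<integral>\<^sup>+x\<in>A. ennreal ((norm (U (t, x)))^2) \<partial>lborel) <= sq_norm A (u t)"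
  "!!t x. (t, x) \<notin> {0..T} \<times> \<Omega> ==> U (t, x) = 0"
  "AE z in lborel. z \<in> {0..T} \<times> \<Omega> --> U z = u (fst z) (snd z)"
  "!!t. 0 <= b t"
  "!!t a r. 0 < r ==> ball a r \<subseteq> \<Omega> ==>
   \<exists>k. (\<integral>\<^sup>+x\<in>ball a r. ennreal (norm (U (t, x) - k)) \<partial>lborel) <= ennreal (b t * (unit_ball_vol 3 * r ^ 3))"
  "!!\<sigma>. 0 < \<sigma> ==> emeasure lborel {t\<in>{0..T}. \<sigma> < b t} <= ennreal (M^2 / \<sigma>^2)"
proof -
 let ?Z = "{0..T} \<times> \<Omega>"
 have Zl: "?Z \<in> sets lebesgue" using Z_borel by (intro sets_completionI_sets) simp
 have "(%z. u (fst z) (snd z)) \<in> borel_measurable (lebesgue_on ?Z)"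
  using sws unfolding suitable_weak_solution_def leray_hopf_def energy_class_def by blast
 then obtain U1 :: "spacetime => real^3" where U1 [measurable]: "U1 \<in> borel_measurable borel"
  and U1ae: "AE z in lborel. z \<in> ?Z --> u (fst z) (snd z) = U1 z"
  by (rule borel_version[OF _ Zl])
 obtain N where N: "N \<in> null_sets lborel" "{t. \<not> (AE x in lborel. (t, x) \<in> ?Z --> u t x = U1 (t, x))} \<subseteq> N"
  using AE_slices[OF U1ae] by (auto elim!: AE_E simp: null_sets_def)
 have [measurable]: "N \<in> sets borel" using N(1) by auto
 define U0 where "U0 z = (if fst z \<in> {0..T} - N \<and> snd z \<in> \<Omega> then U1 z else 0)" for z
 have U0 [measurable]: "U0 \<in> borel_measurable borel" unfolding U0_def by measurable
 have U0s: "(%x. U0 (t, x)) \<in> borel_measurable borel" for t by (rule slice_measurable[OF U0])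
 have good: "AE x in lborel. x \<in> \<Omega> --> u t x = U0 (t, x)" if "t \<in> {0..T} - N" for t
 proof -
  have "AE x in lborel. (t, x) \<in> ?Z --> u t x = U1 (t, x)" using that N(2) by blast
  then show ?thesis by eventually_elim (use that in \<open>auto simp: U0_def\<close>)
 qed
 have sq0: "(\<integral>\<^sup>+x\<in>A. ennreal ((norm (U0 (t, x)))^2) \<partial>lborel) <= sq_norm A (u t)"
  if "t \<in> {0..T}" "A \<subseteq> \<Omega>" for t A
 proof (cases "t \<in> N")
  case True then show ?thesis by (simp add: U0_def)
 next
  case False
  then have "AE x in lborel. x \<in> \<Omega> --> u t x = U0 (t, x)" using that by (intro good) auto
  then have "AE x in lborel. ennreal ((norm (U0 (t, x)))^2) * indicator A x <= ennreal ((norm (u t x))^2) * indicator A x"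
   by eventually_elim (use that in \<open>auto simp: indicator_def\<close>)
  then show ?thesis unfolding sq_norm_def nn_integral_completion by (rule nn_integral_mono_AE)
 qed
 have fin: "(\<integral>\<^sup>+x\<in>A. ennreal ((norm (U0 (t, x)))^2) \<partial>lborel) < \<infinity>" if "A \<subseteq> \<Omega>" for t A
 proof (cases "t \<in> {0..T}")
  case True
  have "(\<integral>\<^sup>+x\<in>A. ennreal ((norm (U0 (t, x)))^2) \<partial>lborel) <= (\<integral>\<^sup>+x\<in>\<Omega>. ennreal ((norm (U0 (t, x)))^2) \<partial>lborel)"
   using that by (intro nn_integral_mono mult_left_mono) (auto simp: indicator_def)
  also have "... <= sq_norm \<Omega> (u t)" by (rule sq0[OF True]) simp
  also have "... < \<infinity>" using energy_bound[OF True] by (auto simp: less_top[symmetric] top_unique)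
  finally show ?thesis .
 qed (auto simp: U0_def)
 have int0: "set_integrable lborel (ball a r) (%x. U0 (t, x))" if "ball a r \<subseteq> \<Omega>" for a r t
  by (rule set_integrable_ball_of_square[OF U0s fin[OF that]])
 have "\<exists>D. countable D \<and> D \<subseteq> {(a, r). 0 < r \<and> ball a r \<subseteq> \<Omega>} \<and>
   (\<forall>f. f \<in> borel_measurable borel --> (\<forall>a r. ball a r \<subseteq> \<Omega> --> set_integrable lborel (ball a r) f) -->
    bmo_norm \<Omega> f = (SUP d\<in>D. osc_ball f (fst d) (snd d)))" (is "\<exists>D. ?Q D")
 proof (rule bmo_norm_countable[of \<Omega>])
  fix D
  assume "countable D" "D \<subseteq> {(a, r). 0 < r \<and> ball a r \<subseteq> \<Omega>}"
   and "!!f. f \<in> borel_measurable borel ==> (!!a r. ball a r \<subseteq> \<Omega> ==> set_integrable lborel (ball a r) f) ==>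
    bmo_norm \<Omega> f = (SUP d\<in>D. osc_ball f (fst d) (snd d))"
  then show "\<exists>D. ?Q D" by (intro exI[of _ D] conjI allI impI) simp_all
 qed
 then obtain D where D: "?Q D" ..
 note Dc = D[THEN conjunct1] D[THEN conjunct2, THEN conjunct1]
 define B where "B t = bmo_norm \<Omega> (%x. U0 (t, x))" for t
 have B_eq: "B = (%t. SUP d\<in>D. osc_ball (%x. U0 (t, x)) (fst d) (snd d))"
 proof
  show "B t = (SUP d\<in>D. osc_ball (%x. U0 (t, x)) (fst d) (snd d))" for t
   unfolding B_def
   by (rule D[THEN conjunct2, THEN conjunct2, rule_format]) (simp_all add: U0s int0)
 qed
 have B [measurable]: "B \<in> borel_measurable borel"
  unfolding B_eq using Dc(2) by (intro borel_measurable_SUP Dc(1) osc_ball_measurable U0) auto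
 have uB: "bmo_norm \<Omega> (u t) = B t" if "t \<in> {0..T} - N" for t
  unfolding B_def
 proof (rule bmo_norm_cong[OF _ U0s good[OF that] open_Omega])
  show "u t \<in> borel_measurable (lebesgue_on \<Omega>)"
   using sws that unfolding suitable_weak_solution_def leray_hopf_def energy_class_def by blast
 qed
 have N2: "{t\<in>{0..T}. B t = \<infinity>} \<in> null_sets lborel" by (rule infinite_level_null[OF B N(1) uB])
 define b where "b t = (if B t = \<infinity> then 0 else enn2real (B t))" for t
 define U where "U z = (if B (fst z) = \<infinity> then 0 else U0 z)" for z
 show thesis
 proof (rule that[of U b])
  show "U \<in> borel_measurable borel" unfolding U_def by measurable
  show "b \<in> borel_measurable borel" unfolding b_def by measurable
  show "0 <= b t" for t by (simp add: b_def)
  show "U (t, x) = 0" if "(t, x) \<notin> ?Z" for t x using that by (auto simp: U_def U0_def)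
  show "(\<integral>\<^sup>+x\<in>A. ennreal ((norm (U (t, x)))^2) \<partial>lborel) <= sq_norm A (u t)" if "t \<in> {0..T}" "A \<subseteq> \<Omega>" for t A
   using sq0[OF that] by (cases "B t = \<infinity>") (simp_all add: U_def)
  have "AE t in lborel. t \<notin> N \<and> t \<notin> {t\<in>{0..T}. B t = \<infinity>}"
   using AE_not_in[OF N(1)] AE_not_in[OF N2] by eventually_elim blast
  then have "AE z in (lborel :: spacetime measure). fst z \<notin> N \<and> fst z \<notin> {t\<in>{0..T}. B t = \<infinity>}" by (rule AE_fst)
  then show "AE z in lborel. z \<in> ?Z --> U z = u (fst z) (snd z)"
   using U1ae by eventually_elim (auto simp: U_def U0_def)
  show "\<exists>k. (\<integral>\<^sup>+x\<in>ball a r. ennreal (norm (U (t, x) - k)) \<partial>lborel) <= ennreal (b t * (unit_ball_vol 3 * r ^ 3))"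
   if ar: "0 < r" "ball a r \<subseteq> \<Omega>" for t a r
  proof (cases "B t = \<infinity>")
   case True
   then show ?thesis by (intro exI[of _ 0]) (simp add: U_def)
  next
   case False
   let ?f = "%x. U0 (t, x)"
   let ?I = "\<integral>\<^sup>+x\<in>ball a r. ennreal (norm (?f x - average (ball a r) ?f)) \<partial>lborel"
   have v: "0 < unit_ball_vol 3 * r ^ 3" using ar by simp
   have "osc_ball ?f a r <= B t"
    unfolding B_def bmo_norm_osc using ar by (intro SUP_upper2[of "(a, r)"]) auto
   then have le: "?I / ennreal (unit_ball_vol 3 * r ^ 3) <= B t"
    using ar by (simp add: osc_ball_def nn_integral_completion emeasure_ball)
   have "?I = ?I / ennreal (unit_ball_vol 3 * r ^ 3) * ennreal (unit_ball_vol 3 * r ^ 3)"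
   proof -
    have "ennreal (unit_ball_vol 3 * r ^ 3) / ennreal (unit_ball_vol 3 * r ^ 3) = 1"
     using v by (intro ennreal_divide_self) auto
    then show ?thesis by (simp only: ennreal_divide_times mult_1_right)
   qed
   also have "... <= B t * ennreal (unit_ball_vol 3 * r ^ 3)" using le by (rule mult_right_mono) simp
   also have "B t = ennreal (b t)" using False by (simp add: b_def less_top)
   also have "ennreal (b t) * ennreal (unit_ball_vol 3 * r ^ 3) = ennreal (b t * (unit_ball_vol 3 * r ^ 3))"
    using v by (intro ennreal_mult[symmetric]) (auto simp: b_def)
   finally show ?thesis using False by (intro exI[of _ "average (ball a r) ?f"]) (simp add: U_def)
  qed
  show "emeasure lborel {t\<in>{0..T}. \<sigma> < b t} <= ennreal (M^2 / \<sigma>^2)" if \<sigma>: "0 < \<sigma>" for \<sigma>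
  proof -
   have "{t\<in>{0..T}. \<sigma> < b t} \<subseteq> {t\<in>{0..T}. ennreal \<sigma> < B t}"
   proof (clarsimp)
    fix t assume "\<sigma> < b t"
    then have "B t ~= \<infinity>" using \<sigma> by (auto simp: b_def split: if_splits)
    then have "B t = ennreal (b t)" by (simp add: b_def less_top)
    then show "ennreal \<sigma> < B t" using \<open>\<sigma> < b t\<close> \<sigma> by (simp add: ennreal_less_iff)
   qed
   then have "emeasure lborel {t\<in>{0..T}. \<sigma> < b t} <= emeasure lborel {t\<in>{0..T}. ennreal \<sigma> < B t}"
    by (intro emeasure_mono) measurable
   also have "... <= ennreal (M^2 / \<sigma>^2)" by (rule level_set_bound[OF B N(1) uB \<sigma>])
   finally show ?thesis .
  qed
 qed
qed

text \<open>Testing the momentum equations with the gradient of a scalar test function removes the time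
 derivative and the viscous term, because the velocity is divergence free.\<close>

lemma flow_exists:
 obtains U p b where "flow (enn2real (sq_norm \<Omega> (u 0))) U p T M \<Omega> b"
  "!!t A. t \<in> {0..T} ==> A \<in> sets borel ==> A \<subseteq> \<Omega> ==> (\<integral>\<^sup>+x\<in>A. ennreal ((norm (U (t, x)))^2) \<partial>lborel) <= sq_norm A (u t)"
  "AE z in lborel. z \<in> {0..T} \<times> \<Omega> --> U z = u (fst z) (snd z) \<and> p z = P (fst z) (snd z)"
proof -
 let ?Z = "{0..T} \<times> \<Omega>"
 have Zl: "?Z \<in> sets lebesgue" using Z_borel by (intro sets_completionI_sets) simp
 have nse: "solves_NSE T \<Omega> u (%\<phi>. LINT z:?Z|lebesgue. P (fst z) (snd z) * \<phi> z)"
  using sws unfolding suitable_weak_solution_def leray_hopf_def by blast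
 have Pm: "(%z. P (fst z) (snd z)) \<in> borel_measurable (lebesgue_on ?Z)"
  and Pint: "(\<integral>\<^sup>+z\<in>?Z. ennreal (\<bar>P (fst z) (snd z)\<bar> powr (3/2)) \<partial>lebesgue) < \<infinity>"
  using sws unfolding suitable_weak_solution_def by blast+
 obtain p1 :: "spacetime => real" where p1 [measurable]: "p1 \<in> borel_measurable borel"
  and p1ae: "AE z in lborel. z \<in> ?Z --> P (fst z) (snd z) = p1 z"
  by (rule borel_version[OF Pm Zl])
 define p where "p z = (if z \<in> ?Z then p1 z else 0)" for z
 have p [measurable]: "p \<in> borel_measurable borel" unfolding p_def by measurable
 show thesis
 proof (rule velocity_version)
  fix U b
  assume U [measurable]: "U \<in> borel_measurable borel" and b [measurable]: "b \<in> borel_measurable borel"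
   and sq: "!!t A. t \<in> {0..T} ==> A \<in> sets borel ==> A \<subseteq> \<Omega> ==> (\<integral>\<^sup>+x\<in>A. ennreal ((norm (U (t, x)))^2) \<partial>lborel) <= sq_norm A (u t)"
   and U0: "!!t x. (t, x) \<notin> ?Z ==> U (t, x) = 0"
   and Uae: "AE z in lborel. z \<in> ?Z --> U z = u (fst z) (snd z)"
   and b0: "!!t. 0 <= b t"
   and bmo: "!!t a r. 0 < r ==> ball a r \<subseteq> \<Omega> ==>
    \<exists>k. (\<integral>\<^sup>+x\<in>ball a r. ennreal (norm (U (t, x) - k)) \<partial>lborel) <= ennreal (b t * (unit_ball_vol 3 * r ^ 3))"
   and wk: "!!\<sigma>. 0 < \<sigma> ==> emeasure lborel {t\<in>{0..T}. \<sigma> < b t} <= ennreal (M^2 / \<sigma>^2)"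
  have ae: "AE z in lborel. z \<in> ?Z --> U z = u (fst z) (snd z) \<and> p z = P (fst z) (snd z)"
   using Uae p1ae by eventually_elim (simp add: p_def)
  interpret flow_base "enn2real (sq_norm \<Omega> (u 0))" U p
  proof unfold_locales
   show "(\<integral>\<^sup>+x. ennreal ((norm (U (t, x)))^2) \<partial>lborel) <= ennreal (enn2real (sq_norm \<Omega> (u 0)))" for t
   proof (cases "t \<in> {0..T}")
    case True
    have "(\<integral>\<^sup>+x. ennreal ((norm (U (t, x)))^2) \<partial>lborel) = (\<integral>\<^sup>+x\<in>\<Omega>. ennreal ((norm (U (t, x)))^2) \<partial>lborel)"
     by (intro nn_integral_cong) (use U0[of t] in \<open>auto simp: indicator_def\<close>)
    also have "... <= sq_norm \<Omega> (u t)" by (intro sq True Omega_borel subset_refl)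
    also note energy_bound[OF True]
    finally show ?thesis .
   next
    case False
    then have "U (t, x) = 0" for x by (intro U0) auto
    then show ?thesis by simp
   qed
   have "(\<integral>\<^sup>+z. ennreal (\<bar>p z\<bar> powr (3/2)) \<partial>lborel) = (\<integral>\<^sup>+z\<in>?Z. ennreal (\<bar>P (fst z) (snd z)\<bar> powr (3/2)) \<partial>lebesgue)"
    unfolding nn_integral_completion
    by (rule nn_integral_cong_AE) (use ae in \<open>eventually_elim, auto simp: indicator_def p_def\<close>)
   then show "(\<integral>\<^sup>+z. ennreal (\<bar>p z\<bar> powr (3/2)) \<partial>lborel) < \<infinity>" using Pint by simp
  qed (simp_all add: U p)
  have nul: "partial v \<phi> z = 0" if "\<phi> \<in> test_fun ({0<..<T} \<times> \<Omega>)" "z \<notin> ?Z" for v \<phi> z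
  proof (rule partial_outside_support)
   show "z \<notin> support \<phi>" using test_funD(3)[OF that(1)] that(2) by auto
  qed
  have nul': "laplace \<phi> z = 0" if "\<phi> \<in> test_fun ({0<..<T} \<times> \<Omega>)" "z \<notin> ?Z" for \<phi> z
  proof (rule laplace_outside_support)
   show "z \<notin> support \<phi>" using test_funD(3)[OF that(1)] that(2) by auto
  qed
  have lfU: "locally_finite_int (%z. U z $ j)" for j
   using lf_aU[of "%_. 1" 1 j] by simp
  have div: "(LINT z|lborel. (\<Sum>j\<in>UNIV. U z $ j * dx j \<psi> z)) = 0"
   if \<psi>: "\<psi> \<in> test_fun ({0<..<T} \<times> \<Omega>)" for \<psi>
  proof -
   have m: "dx j \<psi> \<in> borel_measurable borel" for j
    by (intro smooth_borel smooth_partial test_funD(1)[OF \<psi>] dx_Basis)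
   have "(LINT z|lborel. (\<Sum>j\<in>UNIV. U z $ j * dx j \<psi> z)) = (LINT z:?Z|lebesgue. (\<Sum>j\<in>UNIV. u (fst z) (snd z) $ j * dx j \<psi> z))"
    unfolding set_lebesgue_integral_def
   proof (rule lebesgue_eq_lborel_integral(1)[symmetric])
    show "(%z. \<Sum>j\<in>UNIV. U z $ j * dx j \<psi> z) \<in> borel_measurable borel" using m by measurable
    show "AE z in lborel. indicat_real ?Z z *\<^sub>R (\<Sum>j\<in>UNIV. u (fst z) (snd z) $ j * dx j \<psi> z) = (\<Sum>j\<in>UNIV. U z $ j * dx j \<psi> z)"
     using Uae by eventually_elim (use nul[OF \<psi>] in \<open>auto simp: indicator_def\<close>)
   qed
   also have "... = 0" using nse \<psi> unfolding solves_NSE_def by blast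
   finally show ?thesis .
  qed
  have mom: "(LINT z|lborel. U z $ i * dt \<phi> z + U z $ i * laplace \<phi> z + (\<Sum>j\<in>UNIV. U z $ i * U z $ j * dx j \<phi> z))
    + (LINT z|lborel. p z * dx i \<phi> z) = 0"
   if \<phi>: "\<phi> \<in> test_fun ({0<..<T} \<times> \<Omega>)" for \<phi> i
  proof -
   have [measurable]: "dx j \<phi> \<in> borel_measurable borel" "dt \<phi> \<in> borel_measurable borel" "laplace \<phi> \<in> borel_measurable borel" for j
    by (intro smooth_borel smooth_partial smooth_laplace test_funD(1)[OF \<phi>] dx_Basis dt_Basis)+
   have "(LINT z|lborel. U z $ i * dt \<phi> z + U z $ i * laplace \<phi> z + (\<Sum>j\<in>UNIV. U z $ i * U z $ j * dx j \<phi> z)) = (LINT z:?Z|lebesgue. momentum_integrand u i \<phi> z)"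
    unfolding set_lebesgue_integral_def
   proof (rule lebesgue_eq_lborel_integral(1)[symmetric])
    show "AE z in lborel. indicat_real ?Z z *\<^sub>R momentum_integrand u i \<phi> z = U z $ i * dt \<phi> z + U z $ i * laplace \<phi> z + (\<Sum>j\<in>UNIV. U z $ i * U z $ j * dx j \<phi> z)"
     using Uae by eventually_elim (use nul[OF \<phi>] nul'[OF \<phi>] in \<open>auto simp: indicator_def momentum_integrand_def Let_def\<close>)
   qed measurable
   moreover have "(LINT z|lborel. p z * dx i \<phi> z) = (LINT z:?Z|lebesgue. P (fst z) (snd z) * dx i \<phi> z)"
    unfolding set_lebesgue_integral_def
   proof (rule lebesgue_eq_lborel_integral(1)[symmetric])
    show "AE z in lborel. indicat_real ?Z z *\<^sub>R (P (fst z) (snd z) * dx i \<phi> z) = p z * dx i \<phi> z"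
     using ae by eventually_elim (use nul[OF \<phi>] in \<open>auto simp: indicator_def\<close>)
   qed measurable
   ultimately show ?thesis using nse \<phi> unfolding solves_NSE_def by simp
  qed
  have "flow (enn2real (sq_norm \<Omega> (u 0))) U p T M \<Omega> b"
  proof unfold_locales
   fix \<psi> assume \<psi>: "\<psi> \<in> test_fun ({0<..<T} \<times> \<Omega>)"
   show "(LINT z|lborel. (\<Sum>j\<in>UNIV. U z $ j * dx j \<psi> z)) = 0" by (rule div[OF \<psi>])
   let ?T = "test_fun ({0<..<T} \<times> \<Omega>)"
   have sm: "smooth \<psi>" by (rule test_funD(1)[OF \<psi>])
   have D: "dx i \<psi> \<in> ?T" for i by (intro test_fun_partial(1) \<psi> dx_Basis)
   have D2: "dx j (dx i \<psi>) \<in> ?T" for i j by (intro test_fun_partial(1) D dx_Basis)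
   have t\<psi>: "dt \<psi> \<in> ?T" by (rule test_fun_partial(1)[OF \<psi> dt_Basis])
   have l\<psi>: "laplace \<psi> \<in> ?T" by (rule test_fun_laplace[OF \<psi>])
   have ct: "dt (dx i \<psi>) = dx i (dt \<psi>)" for i
    by (rule ext) (rule partial_commute[OF sm dx_Basis dt_Basis])
   have cl: "laplace (dx i \<psi>) z = dx i (laplace \<psi>) z" for i z
   proof -
    have "dx i (laplace \<psi>) z = (\<Sum>j\<in>UNIV. dx i (dx j (dx j \<psi>)) z)"
     unfolding laplace_def[abs_def]
     by (intro partial_sum smooth_differentiable smooth_partial sm dx_Basis)
    also have "... = (\<Sum>j\<in>UNIV. dx j (dx j (dx i \<psi>)) z)"
    proof (rule sum.cong[OF refl])
     fix j
     have "dx i (dx j (dx j \<psi>)) z = dx j (dx i (dx j \<psi>)) z"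
      by (intro partial_commute smooth_partial sm dx_Basis)
     moreover have "dx i (dx j \<psi>) = dx j (dx i \<psi>)" using partial_commute[OF sm] by auto
     ultimately show "dx i (dx j (dx j \<psi>)) z = dx j (dx j (dx i \<psi>)) z" by simp
    qed
    finally show ?thesis by (simp add: laplace_def)
   qed
   have it: "integrable lborel (%z. U z $ i * dx i (dt \<psi>) z)" for i
    by (rule integrable_test_mult[OF lfU test_fun_partial(1)[OF t\<psi> dx_Basis]])
   have il: "integrable lborel (%z. U z $ i * dx i (laplace \<psi>) z)" for i
    by (rule integrable_test_mult[OF lfU test_fun_partial(1)[OF l\<psi> dx_Basis]])
   have iu: "integrable lborel (%z. U z $ i * U z $ j * dx j (dx i \<psi>) z)" for i j
    by (rule integrable_test_mult[OF lf_UU D2])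
   have ip: "integrable lborel (%z. p z * dx i (dx i \<psi>) z)" for i
    by (rule integrable_test_mult[OF lf_p D2])
   have "(\<Sum>i\<in>UNIV. (LINT z|lborel. U z $ i * dx i (dt \<psi>) z)) = 0" "(\<Sum>i\<in>UNIV. (LINT z|lborel. U z $ i * dx i (laplace \<psi>) z)) = 0"
    using div[OF t\<psi>] div[OF l\<psi>] by (simp_all add: it il)
   moreover have "(\<Sum>i\<in>UNIV. (LINT z|lborel. U z $ i * dx i (dt \<psi>) z) + (LINT z|lborel. U z $ i * dx i (laplace \<psi>) z)
     + (\<Sum>j\<in>UNIV. (LINT z|lborel. U z $ i * U z $ j * dx j (dx i \<psi>) z)) + (LINT z|lborel. p z * dx i (dx i \<psi>) z)) = 0"
   proof (rule sum.neutral, rule ballI)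
    fix i :: 3
    show "(LINT z|lborel. U z $ i * dx i (dt \<psi>) z) + (LINT z|lborel. U z $ i * dx i (laplace \<psi>) z)
     + (\<Sum>j\<in>UNIV. (LINT z|lborel. U z $ i * U z $ j * dx j (dx i \<psi>) z)) + (LINT z|lborel. p z * dx i (dx i \<psi>) z) = 0"
     using mom[OF D, of i i] unfolding ct cl
     by (simp add: it il iu Bochner_Integration.integrable_sum)
   qed
   ultimately have "(\<Sum>i\<in>UNIV. (\<Sum>j\<in>UNIV. (LINT z|lborel. U z $ i * U z $ j * dx j (dx i \<psi>) z))) + (\<Sum>i\<in>UNIV. (LINT z|lborel. p z * dx i (dx i \<psi>) z)) = 0"
    by (simp add: sum.distrib)
   then show "(LINT z|lborel. (\<Sum>i\<in>UNIV. \<Sum>j\<in>UNIV. U z $ i * U z $ j * dx j (dx i \<psi>) z) + p z * laplace \<psi> z) = 0"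
    by (simp add: laplace_def sum_distrib_left iu ip Bochner_Integration.integrable_sum)
  next
   fix \<sigma> :: real assume \<sigma>: "0 < \<sigma>"
   have "emeasure lborel {t. 0 < t \<and> t < T \<and> \<sigma> < b t} <= emeasure lborel {t\<in>{0..T}. \<sigma> < b t}"
    by (intro emeasure_mono) auto
   also note wk[OF \<sigma>]
   finally show "emeasure lborel {t. 0 < t \<and> t < T \<and> \<sigma> < b t} <= ennreal (M^2 / \<sigma>^2)" .
  qed (use b b0 bmo in auto)
  from that[OF this sq ae] show thesis .
 qed
qed

end

section \<open>The local energy inequality\<close>

subsection \<open>A rescaled cutoff function\<close>

definition rescale :: "real => spacetime => spacetime => spacetime" where
 "rescale R w z = ((fst z - fst w) / R^2, (snd z - snd w) /\<^sub>R R)"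

lemma rescale_derivative:
 "(rescale R w has_derivative (%v. (fst v / R^2, snd v /\<^sub>R R))) (at z)"
 unfolding rescale_def[abs_def] by (auto intro!: derivative_eq_intros simp: divide_inverse)

lemma partial_rescale:
 assumes "smooth f"
 shows "dt (%z. f (rescale R w z)) z = dt f (rescale R w z) / R^2"
  "dx j (%z. f (rescale R w z)) z = dx j f (rescale R w z) / R"
proof -
 note d = smooth_differentiable[OF assms, of "rescale R w z"]
 note c = partial_chain(2)[OF rescale_derivative d]
 show "dt (%z. f (rescale R w z)) z = dt f (rescale R w z) / R^2"
  using c[of "(1, 0)"] partial_scaleR[OF d, of "1 / R^2" "(1, 0)"] by simp
 show "dx j (%z. f (rescale R w z)) z = dx j f (rescale R w z) / R"
  using c[of "(0, axis j 1)"] partial_scaleR[OF d, of "1 / R" "(0, axis j 1)"] by (simp add: divide_inverse)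
qed

lemma smooth_rescale:
 assumes "smooth f" shows "smooth (%z. f (rescale R w z))"
proof (rule smooth_coinduct[of _ "{%z. c * f (rescale R w z) | c f. smooth f}"])
 show "(%z. f (rescale R w z)) \<in> {%z. c * f (rescale R w z) | c f. smooth f}"
  using assms by (auto intro!: exI[of _ 1] exI[of _ f])
next
 fix g assume "g \<in> {%z. c * f (rescale R w z) | c f. smooth f}"
 then obtain c f where g: "g = (%z. c * f (rescale R w z))" "smooth f" by auto
 have dif: "(%z. f (rescale R w z)) differentiable (at z)" for z
  by (rule partial_chain(1)[OF rescale_derivative smooth_differentiable[OF g(2)]])
 then show "g differentiable (at z)" for z unfolding g(1) by (intro derivative_intros)
 fix b :: spacetime assume b: "b \<in> Basis"
 have e: "partial b g = (%z. c * partial b (%z. f (rescale R w z)) z)"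
  unfolding g(1) by (rule ext, rule partial_cmult, rule dif)
 have "\<exists>c'. \<forall>z. partial b (%z. f (rescale R w z)) z = c' * partial b f (rescale R w z)"
 proof (cases "b = (1, 0)")
  case True
  then show ?thesis using partial_rescale(1)[OF g(2)] by (intro exI[of _ "1 / R^2"]) auto
 next
  case False
  then obtain j where "b = (0, axis j 1)" using b by (auto simp: Basis_prod_def Basis_vec_def)
  then show ?thesis using partial_rescale(2)[OF g(2)] by (intro exI[of _ "1 / R"]) auto
 qed
 then obtain c' where c': "!!z. partial b (%z. f (rescale R w z)) z = c' * partial b f (rescale R w z)" by blast
 show "partial b g \<in> {%z. c * f (rescale R w z) | c f. smooth f}"
  unfolding e using smooth_partial[OF g(2) b]
  by (auto intro!: exI[of _ "c * c'"] exI[of _ "partial b f"] simp: c')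
qed

definition unit_cutoff :: "spacetime => real" where
 "unit_cutoff z = bump (fst z + 3 / 4) * bump (1 - fst z) * bump (1 / 2 - (\<Sum>i\<in>UNIV. (snd z $ i)^2))"

lemma norm_sq_sum: "(norm (x :: real^3))^2 = (\<Sum>i\<in>UNIV. (x $ i)^2)"
 by (simp add: norm_vec_def L2_set_def sum_nonneg)

lemma unit_cutoff_smooth: "smooth unit_cutoff"
proof -
 have f: "smooth (fst :: spacetime => real)" by (intro smooth_linear bounded_linear_fst)
 have s: "smooth (%z :: spacetime. snd z $ i)" for i
  by (intro smooth_linear bounded_linear_compose[OF bounded_linear_vec_nth bounded_linear_snd])
 show ?thesis
  unfolding unit_cutoff_def[abs_def]
  by (intro smooth_mult smooth_compose[OF smooth_bump] smooth_add smooth_diff smooth_sum smooth_power f s smooth_const)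
qed

lemma unit_cutoff_support:
 assumes "unit_cutoff z ~= 0"
 shows "- (3 / 4) <= fst z" "fst z <= 1" "norm (snd z) <= 3 / 4"
proof -
 have "0 < fst z + 3 / 4" "0 < 1 - fst z" and n: "0 < 1 / 2 - (norm (snd z))^2"
  using assms bump_eq_0 unfolding unit_cutoff_def norm_sq_sum[symmetric]
  by (metis mult_eq_0_iff not_le)+
 then show "- (3 / 4) <= fst z" "fst z <= 1" by auto
 have "(norm (snd z))^2 <= (3 / 4)^2" using n by (simp add: power2_eq_square)
 then show "norm (snd z) <= 3 / 4" by (rule power2_le_imp_le) simp
qed

lemma unit_cutoff_test_fun: "unit_cutoff \<in> test_fun UNIV"
proof (rule test_funI(1)[OF unit_cutoff_smooth, of "{-(3/4)..1} \<times> cball 0 (3/4)"])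
 show "compact ({- (3 / 4)..1::real} \<times> cball (0 :: real^3) (3 / 4))" by (intro compact_Times) auto
 fix z :: spacetime assume "z \<notin> {- (3 / 4)..1} \<times> cball 0 (3 / 4)"
 then show "unit_cutoff z = 0" using unit_cutoff_support[of z] by (cases z) auto
qed simp

text \<open>One cutoff function is rescaled to all cylinders, so its bounds scale. The cutoff is positive up to
 and beyond the final time of the cylinder: the local energy inequality is stated at a time slice and
 needs compact support only towards the past and the spatial boundary.\<close>

lemma cutoff_exists:
 obtains c B :: real where "0 < c" "0 < B"
  "!!R w V. 0 < R ==> {fst w - R^2<..fst w + R^2} \<times> ball (snd w) R \<subseteq> V ==>
   \<exists>\<phi>\<in>test_fun V. (\<forall>z. 0 <= \<phi> z \<and> \<phi> z <= B \<and> \<bar>dt \<phi> z\<bar> <= B / R^2 \<and> \<bar>laplace \<phi> z\<bar> <= B / R^2 \<and> (\<forall>j. \<bar>dx j \<phi> z\<bar> <= B / R)) \<and>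
    (\<forall>z. fst w - R^2 / 4 <= fst z \<and> fst z <= fst w \<and> snd z \<in> ball (snd w) (R / 2) --> c <= \<phi> z) \<and>
    (\<forall>z. z \<notin> {fst w - R^2<..} \<times> ball (snd w) R --> z \<notin> support \<phi>)"
proof -
 have "\<exists>B. \<forall>z. \<bar>f z\<bar> <= B" if "f \<in> test_fun UNIV" for f :: "spacetime => real"
  using test_fun_bounded[OF that] by metis
 then have "\<forall>f \<in> test_fun (UNIV :: spacetime set). \<exists>B. \<forall>z. \<bar>f z\<bar> <= B" by blast
 then obtain b where b: "!!f z. f \<in> test_fun (UNIV :: spacetime set) ==> \<bar>f z\<bar> <= b f" by metis
 note t = unit_cutoff_test_fun
 define B where "B = \<bar>b unit_cutoff\<bar> + \<bar>b (dt unit_cutoff)\<bar> + \<bar>b (laplace unit_cutoff)\<bar> + (\<Sum>j\<in>UNIV. \<bar>b (dx j unit_cutoff)\<bar>) + 1"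
 have s0: "0 <= (\<Sum>j\<in>UNIV. \<bar>b (dx j unit_cutoff)\<bar>)" by (simp add: sum_nonneg)
 have Bb: "\<bar>unit_cutoff z\<bar> <= B" "\<bar>dt unit_cutoff z\<bar> <= B" "\<bar>laplace unit_cutoff z\<bar> <= B" "\<bar>dx j unit_cutoff z\<bar> <= B" for z j
 proof -
  have "\<bar>b (dx j unit_cutoff)\<bar> <= (\<Sum>j\<in>UNIV. \<bar>b (dx j unit_cutoff)\<bar>)" by (rule member_le_sum) auto
  then show "\<bar>dx j unit_cutoff z\<bar> <= B"
   using b[OF test_fun_partial(1)[OF t dx_Basis], of j z] unfolding B_def by linarith
  show "\<bar>unit_cutoff z\<bar> <= B" "\<bar>dt unit_cutoff z\<bar> <= B" "\<bar>laplace unit_cutoff z\<bar> <= B"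
   using b[OF t, of z] b[OF test_fun_partial(1)[OF t dt_Basis], of z] b[OF test_fun_laplace[OF t], of z] s0
   unfolding B_def by linarith+
 qed
 have B: "0 < B" using s0 unfolding B_def by linarith
 define c where "c = bump (1 / 2) * bump 1 * bump (1 / 4)"
 have c: "0 < c" by (simp add: c_def)
 show thesis
 proof (rule that[OF c B])
  fix R :: real and w :: spacetime and V
  assume R: "0 < R" and V: "{fst w - R^2<..fst w + R^2} \<times> ball (snd w) R \<subseteq> V"
  define \<phi> where "\<phi> z = unit_cutoff (rescale R w z)" for z
  note pr = partial_rescale[OF unit_cutoff_smooth, where R = R and w = w, folded \<phi>_def[abs_def]]
  let ?K = "{fst w - 3 / 4 * R^2..fst w + R^2} \<times> cball (snd w) (3 / 4 * R)"
  have sm: "smooth \<phi>" unfolding \<phi>_def by (rule smooth_rescale[OF unit_cutoff_smooth])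
  have out: "\<phi> z = 0" if "z \<notin> ?K" for z
  proof (rule ccontr)
   assume "\<phi> z ~= 0"
   then have k: "- (3 / 4) <= (fst z - fst w) / R^2" "(fst z - fst w) / R^2 <= 1" "norm ((snd z - snd w) /\<^sub>R R) <= 3 / 4"
    using unit_cutoff_support[of "rescale R w z"] unfolding \<phi>_def by (auto simp: rescale_def)
   have e: "norm ((snd z - snd w) /\<^sub>R R) = norm (snd z - snd w) / R" using R by (simp add: divide_inverse)
   have "fst w - 3 / 4 * R^2 <= fst z" "fst z <= fst w + R^2" "norm (snd z - snd w) <= 3 / 4 * R"
    using k(1,2) k(3)[unfolded e] R by (simp_all add: field_simps)
   then have "z \<in> ?K" by (cases z) (auto simp: dist_norm norm_minus_commute)
   then show False using that by simp
  qed
  have K: "compact ?K" by (intro compact_Times) auto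
  have R2: "0 < R^2" using R by simp
  have KV: "?K \<subseteq> {fst w - R^2<..fst w + R^2} \<times> ball (snd w) R"
  proof -
   have "x \<in> ball (snd w) R" if "x \<in> cball (snd w) (3 / 4 * R)" for x using that R by simp
   moreover have "fst w - R^2 < t" if "fst w - 3 / 4 * R^2 <= t" for t using R2 that by linarith
   then have "{fst w - 3 / 4 * R^2..fst w + R^2} \<subseteq> {fst w - R^2<..fst w + R^2}" by fastforce
   ultimately show ?thesis by blast
  qed
  have KV': "?K \<subseteq> V" using KV V by (rule subset_trans)
  have sup: "support \<phi> \<subseteq> ?K" and tf: "\<phi> \<in> test_fun V"
   by (rule test_funI(2)[OF sm K KV' out], assumption) (rule test_funI(1)[OF sm K KV' out])
  have dd: "dx j (dx j \<phi>) z = dx j (dx j unit_cutoff) (rescale R w z) / R^2" for j z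
  proof -
   have e: "dx j \<phi> = (%z. 1 / R * dx j unit_cutoff (rescale R w z))" using pr(2) by auto
   have "dx j (dx j \<phi>) z = 1 / R * dx j (%z. dx j unit_cutoff (rescale R w z)) z"
    unfolding e
    by (intro partial_cmult smooth_differentiable smooth_rescale smooth_partial unit_cutoff_smooth dx_Basis)
   also have "... = dx j (dx j unit_cutoff) (rescale R w z) / R^2"
    by (simp add: partial_rescale(2)[OF smooth_partial[OF unit_cutoff_smooth dx_Basis]] power2_eq_square)
   finally show ?thesis .
  qed
  have lap: "laplace \<phi> z = laplace unit_cutoff (rescale R w z) / R^2" for z
   by (simp add: laplace_def dd sum_divide_distrib)
  show "\<exists>\<phi>\<in>test_fun V. (\<forall>z. 0 <= \<phi> z \<and> \<phi> z <= B \<and> \<bar>dt \<phi> z\<bar> <= B / R^2 \<and> \<bar>laplace \<phi> z\<bar> <= B / R^2 \<and> (\<forall>j. \<bar>dx j \<phi> z\<bar> <= B / R)) \<and>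
    (\<forall>z. fst w - R^2 / 4 <= fst z \<and> fst z <= fst w \<and> snd z \<in> ball (snd w) (R / 2) --> c <= \<phi> z) \<and>
    (\<forall>z. z \<notin> {fst w - R^2<..} \<times> ball (snd w) R --> z \<notin> support \<phi>)"
  proof (intro bexI[OF _ tf] conjI allI impI)
   fix z j
   show "0 <= \<phi> z" by (simp add: \<phi>_def unit_cutoff_def)
   show "\<phi> z <= B" using Bb(1)[of "rescale R w z"] by (simp add: \<phi>_def)
   show "\<bar>dt \<phi> z\<bar> <= B / R^2" unfolding pr(1) abs_divide using Bb(2) R2 by (simp add: divide_right_mono)
   show "\<bar>laplace \<phi> z\<bar> <= B / R^2" unfolding lap abs_divide using Bb(3) R2 by (simp add: divide_right_mono)
   show "\<bar>dx j \<phi> z\<bar> <= B / R" unfolding pr(2) abs_divide using Bb(4) R by (simp add: divide_right_mono)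
  next
   fix z assume "fst w - R^2 / 4 <= fst z \<and> fst z <= fst w \<and> snd z \<in> ball (snd w) (R / 2)"
   then have z: "fst w - R^2 / 4 <= fst z" "fst z <= fst w" "norm (snd z - snd w) <= R / 2"
    by (auto simp: dist_norm norm_minus_commute)
   have "- (1 / 4) <= fst (rescale R w z)" "fst (rescale R w z) <= 0"
    using z R2 by (auto simp: rescale_def field_simps)
   moreover have "(norm (snd (rescale R w z)))^2 <= (1 / 2)^2"
   proof (intro power_mono)
    have e: "norm ((snd z - snd w) /\<^sub>R R) = norm (snd z - snd w) / R" using R by (simp add: divide_inverse)
    show "norm (snd (rescale R w z)) <= 1 / 2"
     unfolding rescale_def snd_conv e using z(3) R by (simp add: field_simps)
   qed simp
   ultimately show "c <= \<phi> z"
    unfolding c_def \<phi>_def unit_cutoff_def norm_sq_sum[symmetric]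
    by (intro mult_mono bump_mono mult_nonneg_nonneg) (auto simp: power2_eq_square)
  next
   fix z assume "z \<notin> {fst w - R^2<..} \<times> ball (snd w) R"
   then have "z \<notin> {fst w - R^2<..fst w + R^2} \<times> ball (snd w) R" by auto
   then show "z \<notin> support \<phi>" using sup KV by (meson subsetD)
  qed
 qed
qed

subsection \<open>Control of the energy by the cubic terms\<close>

lemma nn_integral_le_of_integral:
 fixes f :: "'a => real"
 assumes "f \<in> borel_measurable N" "!!x. 0 <= f x" "(\<integral>\<^sup>+x. ennreal (f x) \<partial>N) < \<infinity>" "(LINT x|N. f x) <= X"
 shows "(\<integral>\<^sup>+x. ennreal (f x) \<partial>N) <= ennreal X"
proof -
 have "integrable N f" using assms by (intro integrableI_bounded) auto
 then have "(\<integral>\<^sup>+x. ennreal (f x) \<partial>N) = ennreal (LINT x|N. f x)" using assms(2) by (intro nn_integral_eq_integral) auto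
 then show ?thesis using assms(4) by (simp add: ennreal_leI)
qed

lemma energy_young:
 fixes a q R :: real assumes a: "0 <= a" and R: "0 < R"
 shows "a^2 / R^2 <= a ^ 3 / R + 1 / R ^ 4" "\<bar>q\<bar> * a <= a ^ 3 + \<bar>q\<bar> powr (3/2)"
proof -
 show "a^2 / R^2 <= a ^ 3 / R + 1 / R ^ 4"
 proof (cases "R * a <= 1")
  case True
  then have "a <= 1 / R" using R by (simp add: field_simps)
  then have "a^2 <= (1 / R)^2" using a by (rule power_mono)
  then have "a^2 / R^2 <= (1 / R)^2 / R^2" by (intro divide_right_mono) auto
  also have "... = 1 / R ^ 4" by (simp add: power_divide eval_nat_numeral)
  finally have "a^2 / R^2 <= 1 / R ^ 4" .
  moreover have "0 <= a ^ 3 / R" using a R by simp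
  ultimately show ?thesis by linarith
 next
  case False
  then have "a^2 * 1 <= a^2 * (R * a)" by (intro mult_left_mono) auto
  then have "a^2 / R^2 <= a^2 * (R * a) / R^2" by (intro divide_right_mono) auto
  also have "... = a ^ 3 / R" using R by (simp add: eval_nat_numeral)
  finally show ?thesis using R by (smt (verit) divide_nonneg_pos zero_less_power)
 qed
 show "\<bar>q\<bar> * a <= a ^ 3 + \<bar>q\<bar> powr (3/2)"
 proof (cases "\<bar>q\<bar> <= a^2")
  case True
  then have "\<bar>q\<bar> * a <= a^2 * a" using a by (intro mult_right_mono)
  then show ?thesis by (simp add: power3_eq_cube power2_eq_square add_increasing2)
 next
  case False
  then have "a^2 <= (sqrt \<bar>q\<bar>)^2" by simp
  then have "a <= sqrt \<bar>q\<bar>" by (rule power2_le_imp_le) simp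
  then have "\<bar>q\<bar> * a <= \<bar>q\<bar> * sqrt \<bar>q\<bar>" by (intro mult_left_mono) auto
  also have "... = \<bar>q\<bar> powr 1 * \<bar>q\<bar> powr (1/2)" by (simp add: powr_half_sqrt)
  also have "... = \<bar>q\<bar> powr (3/2)" by (simp only: powr_add[symmetric]) simp
  finally show ?thesis using a by (simp add: add_increasing)
 qed
qed

lemma energy_integrand_bound:
 fixes v g :: "real^3" and q R B :: real
 assumes R: "0 < R" and B: "0 < B" and d: "\<bar>d\<bar> <= B / R^2" "\<bar>l\<bar> <= B / R^2" and g: "!!j. \<bar>g $ j\<bar> <= B / R"
 shows "\<bar>(norm v)^2 * (d + l) + ((norm v)^2 + 2 * q) * (\<Sum>j\<in>UNIV. v $ j * g $ j)\<bar>
  <= 11 * B / R * norm v ^ 3 + 6 * B / R * \<bar>q\<bar> powr (3/2) + 2 * B / R ^ 4"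
proof -
 let ?a = "norm v"
 have "\<bar>\<Sum>j\<in>UNIV. v $ j * g $ j\<bar> <= (\<Sum>j\<in>(UNIV::3 set). ?a * (B / R))"
 proof (rule order_trans[OF sum_abs], rule sum_mono)
  fix j
  show "\<bar>v $ j * g $ j\<bar> <= ?a * (B / R)"
   unfolding abs_mult using component_le_norm_cart[of v j] g[of j] by (intro mult_mono) auto
 qed
 then have s: "\<bar>\<Sum>j\<in>UNIV. v $ j * g $ j\<bar> <= 3 * ?a * (B / R)" by simp
 have "\<bar>?a^2 * (d + l)\<bar> <= ?a^2 * (2 * B / R^2)"
  unfolding abs_mult using d by (intro mult_mono) (auto simp: abs_le_iff)
 also have "... = 2 * B * (?a^2 / R^2)" by simp
 also have "... <= 2 * B * (?a ^ 3 / R + 1 / R ^ 4)"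
  using B energy_young(1)[OF norm_ge_zero R, of v] by (intro mult_left_mono) auto
 finally have 1: "\<bar>?a^2 * (d + l)\<bar> <= 2 * B / R * ?a ^ 3 + 2 * B / R ^ 4" by (simp add: algebra_simps)
 have "\<bar>(?a^2 + 2 * q) * (\<Sum>j\<in>UNIV. v $ j * g $ j)\<bar> <= (?a^2 + 2 * \<bar>q\<bar>) * (3 * ?a * (B / R))"
  unfolding abs_mult using s by (intro mult_mono) (auto intro!: order_trans[OF abs_triangle_ineq])
 also have "... = 3 * B / R * ?a ^ 3 + 6 * B / R * (\<bar>q\<bar> * ?a)"
  by (simp add: algebra_simps power2_eq_square power3_eq_cube)
 also have "... <= 3 * B / R * ?a ^ 3 + 6 * B / R * (?a ^ 3 + \<bar>q\<bar> powr (3/2))"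
  using energy_young(2)[OF norm_ge_zero R, of q v] B R by (intro add_mono mult_left_mono) auto
 finally have 2: "\<bar>(?a^2 + 2 * q) * (\<Sum>j\<in>UNIV. v $ j * g $ j)\<bar> <= 9 * B / R * ?a ^ 3 + 6 * B / R * \<bar>q\<bar> powr (3/2)"
  by (simp add: algebra_simps)
 show ?thesis
  by (rule order_trans[OF abs_triangle_ineq], rule order_trans[OF add_mono[OF 1 2]]) (simp add: algebra_simps)
qed

lemma (in solution) pcyl_time:
 assumes R: "0 < R" and Q: "pcyl R w \<subseteq> {0<..T} \<times> \<Omega>"
 shows "0 <= fst w - R^2" "fst w <= T" "ball (snd w) R \<subseteq> \<Omega>"
proof -
 have R2: "0 < R^2" using R by simp
 have t: "0 < s \<and> s <= T" if "fst w - R^2 < s" "s < fst w" for s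
  using Q that R by (auto simp: pcyl_def subset_iff dest: spec2[of _ s "snd w"])
 show "0 <= fst w - R^2"
 proof (rule dense_ge_bounded[OF _])
  show "fst w - R^2 < fst w" using R2 by simp
  show "0 <= s" if "fst w - R^2 < s" "s < fst w" for s using t[OF that] by simp
 qed
 show "fst w <= T"
 proof (rule dense_le_bounded)
  show "fst w - R^2 < fst w" using R2 by simp
  show "s <= T" if "fst w - R^2 < s" "s < fst w" for s using t[OF that] by simp
 qed
 show "ball (snd w) R \<subseteq> \<Omega>"
 proof
  fix x assume "x \<in> ball (snd w) R"
  then have "(fst w - R^2 / 2, x) \<in> pcyl R w" using R2 by (simp add: pcyl_def)
  then show "x \<in> \<Omega>" using Q by auto
 qed
qed

lemma (in solution) lebesgue_parts:
 assumes [measurable]: "A \<in> sets borel" and A: "A \<subseteq> {0..T} \<times> \<Omega>"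
 shows "(%z. ennreal (norm (u (fst z) (snd z)) ^ 3) * indicator A z) \<in> borel_measurable lebesgue"
  "(%z. ennreal (\<bar>P (fst z) (snd z)\<bar> powr (3/2)) * indicator A z) \<in> borel_measurable lebesgue"
proof -
 let ?Z = "{0..T} \<times> \<Omega>"
 have Al [measurable]: "A \<in> sets lebesgue" using assms by (intro sets_completionI_sets) simp
 have Zl: "?Z \<in> sets lebesgue" using Z_borel by (intro sets_completionI_sets) simp
 have [measurable]: "(%z. if z \<in> ?Z then u (fst z) (snd z) else 0) \<in> borel_measurable lebesgue"
  "(%z. if z \<in> ?Z then P (fst z) (snd z) else 0) \<in> borel_measurable lebesgue"
  using sws Zl unfolding suitable_weak_solution_def leray_hopf_def energy_class_def
  by (auto intro!: borel_measurable_if_I)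
 have 1: "(%z. ennreal (norm (if z \<in> ?Z then u (fst z) (snd z) else 0) ^ 3) * indicator A z) \<in> borel_measurable lebesgue"
  and 2: "(%z. ennreal (\<bar>if z \<in> ?Z then P (fst z) (snd z) else 0\<bar> powr (3/2)) * indicator A z) \<in> borel_measurable lebesgue"
  by measurable
 have "z \<in> ?Z" if "z \<in> A" for z using that A by blast
 then have e: "(%z. ennreal (norm (u (fst z) (snd z)) ^ 3) * indicator A z) = (%z. ennreal (norm (if z \<in> ?Z then u (fst z) (snd z) else 0) ^ 3) * indicator A z)"
  "(%z. ennreal (\<bar>P (fst z) (snd z)\<bar> powr (3/2)) * indicator A z) = (%z. ennreal (\<bar>if z \<in> ?Z then P (fst z) (snd z) else 0\<bar> powr (3/2)) * indicator A z)"
  by (auto simp: indicator_def fun_eq_iff)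
 show "(%z. ennreal (norm (u (fst z) (snd z)) ^ 3) * indicator A z) \<in> borel_measurable lebesgue"
  "(%z. ennreal (\<bar>P (fst z) (snd z)\<bar> powr (3/2)) * indicator A z) \<in> borel_measurable lebesgue"
  unfolding e by (rule 1, rule 2)
qed

lemma ennreal_le_divide_left:
 assumes "ennreal c * a <= ennreal X" "0 < c" "0 <= X"
 shows "a <= ennreal (X / c)"
proof -
 have "ennreal (1 / c) * (ennreal c * a) <= ennreal (1 / c) * ennreal X" by (intro mult_left_mono assms) simp
 moreover have "ennreal (1 / c) * (ennreal c * a) = a"
  using assms(2) by (simp add: mult.assoc[symmetric] ennreal_mult[symmetric])
 moreover have "ennreal (1 / c) * ennreal X = ennreal (X / c)"
  using assms by (simp add: ennreal_mult[symmetric])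
 ultimately show ?thesis by simp
qed

text \<open>Chebyshev's inequality for a weight. The finiteness assumption makes the Bochner integral in the
 hypothesis a true integral instead of its default value.\<close>

lemma weighted_bound:
 fixes h \<phi> :: "'a::euclidean_space => real"
 assumes h: "(%z. indicat_real D z * h z) \<in> borel_measurable lebesgue" "!!z. 0 <= h z"
  and fin: "(\<integral>\<^sup>+z\<in>D. ennreal (h z) \<partial>lebesgue) < \<infinity>"
  and \<phi>: "\<phi> \<in> borel_measurable borel" "!!z. 0 <= \<phi> z" "!!z. \<phi> z <= B"
  and A: "A \<subseteq> D" "A \<in> sets borel" "!!z. z \<in> A ==> c <= \<phi> z"
  and c: "0 < c" and X: "0 <= X" "(LINT z:D|lebesgue. h z * \<phi> z) <= X"
 shows "(\<integral>\<^sup>+z\<in>A. ennreal (h z) \<partial>lebesgue) <= ennreal (X / c)"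
proof (rule ennreal_le_divide_left[OF _ c X(1)])
 define f where "f z = indicat_real D z * h z" for z
 have [measurable]: "f \<in> borel_measurable lebesgue" using h(1) by (simp add: f_def[abs_def])
 have [measurable]: "\<phi> \<in> borel_measurable lebesgue" "A \<in> sets lebesgue"
  using \<phi>(1) A(2) by (auto intro!: measurable_completion sets_completionI_sets)
 have f0: "0 <= f z" for z using h(2) by (simp add: f_def)
 have B: "0 <= B" using order_trans[OF \<phi>(2) \<phi>(3)] .
 have "(\<integral>\<^sup>+z. ennreal (f z * \<phi> z) \<partial>lebesgue) <= (\<integral>\<^sup>+z. ennreal B * ennreal (f z) \<partial>lebesgue)"
 proof (rule nn_integral_mono)
  fix z
  show "ennreal (f z * \<phi> z) <= ennreal B * ennreal (f z)"
   using mult_left_mono[OF \<phi>(3) f0, of z z] f0 B by (simp add: ennreal_mult[symmetric] mult.commute ennreal_leI)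
 qed
 also have "... = ennreal B * (\<integral>\<^sup>+z. ennreal (f z) \<partial>lebesgue)" by (rule nn_integral_cmult) measurable
 also have "(\<integral>\<^sup>+z. ennreal (f z) \<partial>lebesgue) = (\<integral>\<^sup>+z\<in>D. ennreal (h z) \<partial>lebesgue)"
  by (intro nn_integral_cong) (simp add: f_def indicator_def)
 finally have fin': "(\<integral>\<^sup>+z. ennreal (f z * \<phi> z) \<partial>lebesgue) < \<infinity>"
  using fin by (auto simp: ennreal_mult_less_top intro: le_less_trans)
 have "(\<integral>\<^sup>+z. ennreal (f z * \<phi> z) \<partial>lebesgue) <= ennreal X"
 proof (rule nn_integral_le_of_integral[OF _ _ fin'])
  show "(LINT z|lebesgue. f z * \<phi> z) <= X" using X(2) by (simp add: set_lebesgue_integral_def f_def mult.assoc)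
 qed (use f0 \<phi>(2) in auto)
 moreover have "ennreal c * (\<integral>\<^sup>+z\<in>A. ennreal (h z) \<partial>lebesgue) = (\<integral>\<^sup>+z. ennreal c * (ennreal (f z) * indicator A z) \<partial>lebesgue)"
  by (subst nn_integral_cmult, measurable, intro arg_cong[where f = "(*) (ennreal c)"] nn_integral_cong)
   (use A(1) in \<open>auto simp: f_def indicator_def\<close>)
 moreover have "(\<integral>\<^sup>+z. ennreal c * (ennreal (f z) * indicator A z) \<partial>lebesgue) <= (\<integral>\<^sup>+z. ennreal (f z * \<phi> z) \<partial>lebesgue)"
 proof (rule nn_integral_mono)
  fix z
  show "ennreal c * (ennreal (f z) * indicator A z) <= ennreal (f z * \<phi> z)"
   using mult_left_mono[OF A(3) f0, of z z] f0 c
   by (cases "z \<in> A") (simp_all add: ennreal_mult[symmetric] mult.commute ennreal_leI)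
 qed
 ultimately show "ennreal c * (\<integral>\<^sup>+z\<in>A. ennreal (h z) \<partial>lebesgue) <= ennreal X" by simp
qed

context solution
begin

lemma energy_at_cutoff:
 assumes R: "0 < R" and Q: "pcyl R w \<subseteq> {0<..T} \<times> \<Omega>" and B: "0 < B" and c: "0 < c"
  and \<phi>: "\<phi> \<in> test_fun ({0<..} \<times> \<Omega>)"
  and \<phi>B: "!!z. 0 <= \<phi> z" "!!z. \<phi> z <= B" "!!z. \<bar>dt \<phi> z\<bar> <= B / R^2" "!!z. \<bar>laplace \<phi> z\<bar> <= B / R^2" "!!z j. \<bar>dx j \<phi> z\<bar> <= B / R"
  and \<phi>c: "!!z. fst w - R^2 / 4 <= fst z ==> fst z <= fst w ==> snd z \<in> ball (snd w) (R / 2) ==> c <= \<phi> z"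
  and \<phi>s: "!!z. z \<notin> {fst w - R^2<..} \<times> ball (snd w) R ==> z \<notin> support \<phi>"
  and y: "0 <= y"
  and uy: "(\<integral>\<^sup>+z\<in>pcyl R w. ennreal (norm (u (fst z) (snd z)) ^ 3) \<partial>lebesgue) <= ennreal (R^2 * y)"
  and Py: "(\<integral>\<^sup>+z\<in>pcyl R w. ennreal (\<bar>P (fst z) (snd z)\<bar> powr (3/2)) \<partial>lebesgue) <= ennreal (R^2 * y)"
 shows "!!s. s \<in> {fst w - R^2 / 4..<fst w} ==> sq_norm (ball (snd w) (R / 2)) (u s) <= ennreal (B * (17 + 2 * unit_ball_vol 3) * R * (1 + y) / c)"
  and "sq_norm (pcyl (R / 2) w) (%z. grad T \<Omega> u (fst z) (snd z)) <= ennreal (B * (17 + 2 * unit_ball_vol 3) * R * (1 + y) / c)"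
proof -
 note tm = pcyl_time[OF R Q]
 have R2: "0 < R^2" using R by simp
 let ?v = "unit_ball_vol 3"
 let ?X = "B * (17 + 2 * ?v) * R * (1 + y)"
 have v: "0 <= ?v" by simp
 have X: "0 <= ?X" using B R y v by (intro mult_nonneg_nonneg) auto
 have Qb [measurable]: "pcyl R w \<in> sets borel"
  unfolding pcyl_def by (intro borel_open open_Times) auto
 then have [measurable]: "pcyl R w \<in> sets lebesgue" by (intro sets_completionI_sets) simp
 have QZ: "pcyl R w \<subseteq> {0..T} \<times> \<Omega>" using Q by auto
 note [measurable] = lebesgue_parts[OF Qb QZ]
 define H where "H z = (norm (u (fst z) (snd z)))^2 * (dt \<phi> z + laplace \<phi> z) + ((norm (u (fst z) (snd z)))^2 + 2 * P (fst z) (snd z)) * (\<Sum>j\<in>UNIV. u (fst z) (snd z) $ j * dx j \<phi> z)" for z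
 let ?F = "%z. ennreal (norm (u (fst z) (snd z)) ^ 3) * indicator (pcyl R w) z"
 let ?G = "%z. ennreal (\<bar>P (fst z) (snd z)\<bar> powr (3/2)) * indicator (pcyl R w) z"
 have Hle: "ennreal \<bar>H z\<bar> <= ennreal (11 * B / R) * ?F z + ennreal (6 * B / R) * ?G z + ennreal (2 * B / R ^ 4) * indicator (pcyl R w) z"
  if "fst z < fst w" for z
 proof (cases "z \<in> pcyl R w")
  case True
  have "\<bar>H z\<bar> <= 11 * B / R * norm (u (fst z) (snd z)) ^ 3 + 6 * B / R * \<bar>P (fst z) (snd z)\<bar> powr (3/2) + 2 * B / R ^ 4"
   unfolding H_def
   using energy_integrand_bound[OF R B \<phi>B(3)[of z] \<phi>B(4)[of z], of "\<chi> j. dx j \<phi> z" "u (fst z) (snd z)" "P (fst z) (snd z)"] \<phi>B(5)[of _ z]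
   by simp
  then have "ennreal \<bar>H z\<bar> <= ennreal (11 * B / R * norm (u (fst z) (snd z)) ^ 3 + 6 * B / R * \<bar>P (fst z) (snd z)\<bar> powr (3/2) + 2 * B / R ^ 4)"
   by (rule ennreal_leI)
  also have "... = ennreal (11 * B / R) * ennreal (norm (u (fst z) (snd z)) ^ 3) + ennreal (6 * B / R) * ennreal (\<bar>P (fst z) (snd z)\<bar> powr (3/2)) + ennreal (2 * B / R ^ 4)"
   using B R by (simp only: ennreal_plus[symmetric] ennreal_mult[symmetric] divide_nonneg_pos mult_nonneg_nonneg add_nonneg_nonneg zero_le_power norm_ge_zero powr_ge_zero zero_less_power less_imp_le zero_le_numeral)
  finally show ?thesis using True by simp
 next
  case False
  then have "z \<notin> {fst w - R^2<..} \<times> ball (snd w) R" using that by (cases z) (auto simp: pcyl_def)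
  then have "z \<notin> support \<phi>" by (rule \<phi>s)
  then have "H z = 0" by (simp add: H_def partial_outside_support laplace_outside_support)
  then show ?thesis by simp
 qed
 \<comment> \<open>At the final time the cutoff need not vanish off the cylinder, which excludes that time.\<close>
 have ne: "AE z :: spacetime in lebesgue. fst z ~= fst w"
  unfolding AE_completion_iff by (rule AE_fst[of "%t. t ~= fst w"]) (rule AE_lborel_singleton)
 have RHS: "(LINT z:{0..s} \<times> \<Omega>|lebesgue. H z) <= ?X" if s: "s <= fst w" for s
  unfolding set_lebesgue_integral_def
 proof (rule integral_le_of_nn[OF _ X])
  have "(\<integral>\<^sup>+z. ennreal \<bar>indicat_real ({0..s} \<times> \<Omega>) z *\<^sub>R H z\<bar> \<partial>lebesgue)
    <= (\<integral>\<^sup>+z. ennreal (11 * B / R) * ?F z + ennreal (6 * B / R) * ?G z + ennreal (2 * B / R ^ 4) * indicator (pcyl R w) z \<partial>lebesgue)"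
  proof (rule nn_integral_mono_AE)
   show "AE z in lebesgue. ennreal \<bar>indicat_real ({0..s} \<times> \<Omega>) z *\<^sub>R H z\<bar> <= ennreal (11 * B / R) * ?F z + ennreal (6 * B / R) * ?G z + ennreal (2 * B / R ^ 4) * indicator (pcyl R w) z"
    using ne
   proof eventually_elim
    case (elim z)
    show ?case
    proof (cases "z \<in> {0..s} \<times> \<Omega>")
     case True
     then have "fst z < fst w" using elim s by auto
     then show ?thesis using Hle[of z] True by simp
    qed simp
   qed
  qed
  also have "... = (\<integral>\<^sup>+z. ennreal (11 * B / R) * ?F z + ennreal (6 * B / R) * ?G z \<partial>lebesgue) + (\<integral>\<^sup>+z. ennreal (2 * B / R ^ 4) * indicator (pcyl R w) z \<partial>lebesgue)"
   by (rule nn_integral_add) measurable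
  also have "(\<integral>\<^sup>+z. ennreal (11 * B / R) * ?F z + ennreal (6 * B / R) * ?G z \<partial>lebesgue) = ennreal (11 * B / R) * (\<integral>\<^sup>+z. ?F z \<partial>lebesgue) + ennreal (6 * B / R) * (\<integral>\<^sup>+z. ?G z \<partial>lebesgue)"
   by (rule nn_integral_lincomb) measurable
  also have "(\<integral>\<^sup>+z. ennreal (2 * B / R ^ 4) * indicator (pcyl R w) z \<partial>lebesgue) = ennreal (2 * B / R ^ 4) * emeasure lebesgue (pcyl R w)"
   by (rule nn_integral_cmult_indicator) measurable
  also have "emeasure lebesgue (pcyl R w) = ennreal (R^2 * (?v * R ^ 3))"
  proof -
   have "emeasure lebesgue (pcyl R w) = emeasure (lborel \<Otimes>\<^sub>M lborel) (pcyl R w)"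
    using Qb by (simp add: lborel_prod)
   also have "... = emeasure lborel {fst w - R^2<..<fst w} * emeasure lborel (ball (snd w) R)"
    unfolding pcyl_def by (intro lborel.emeasure_pair_measure_Times) auto
   also have "... = ennreal (R^2 * (?v * R ^ 3))" using R by (simp add: emeasure_ball ennreal_mult)
   finally show ?thesis .
  qed
  also have "ennreal (11 * B / R) * (\<integral>\<^sup>+z. ?F z \<partial>lebesgue) + ennreal (6 * B / R) * (\<integral>\<^sup>+z. ?G z \<partial>lebesgue) + ennreal (2 * B / R ^ 4) * ennreal (R^2 * (?v * R ^ 3))
    <= ennreal (11 * B / R) * ennreal (R^2 * y) + ennreal (6 * B / R) * ennreal (R^2 * y) + ennreal (2 * B / R ^ 4) * ennreal (R^2 * (?v * R ^ 3))"
   by (intro add_mono mult_left_mono uy Py order_refl) auto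
  also have "... = ennreal (11 * B / R * (R^2 * y) + 6 * B / R * (R^2 * y) + 2 * B / R ^ 4 * (R^2 * (?v * R ^ 3)))"
   using B R y v by (simp only: ennreal_plus[symmetric] ennreal_mult[symmetric] divide_nonneg_pos mult_nonneg_nonneg add_nonneg_nonneg zero_le_power zero_less_power less_imp_le zero_le_numeral zero_le_power2)
  also have "... <= ennreal ?X"
  proof (rule ennreal_leI)
   have "11 * B / R * (R^2 * y) + 6 * B / R * (R^2 * y) + 2 * B / R ^ 4 * (R^2 * (?v * R ^ 3)) = B * R * (17 * y + 2 * ?v)"
    using R by (simp add: field_simps eval_nat_numeral)
   also have "... <= B * R * ((17 + 2 * ?v) * (1 + y))"
    using B R y v by (intro mult_left_mono) (auto simp: algebra_simps)
   finally show "11 * B / R * (R^2 * y) + 6 * B / R * (R^2 * y) + 2 * B / R ^ 4 * (R^2 * (?v * R ^ 3)) <= ?X" by (simp add: mult_ac)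
  qed
  finally show "(\<integral>\<^sup>+z. ennreal \<bar>indicat_real ({0..s} \<times> \<Omega>) z *\<^sub>R H z\<bar> \<partial>lebesgue) <= ennreal ?X" .
 qed
 let ?g = "%z. (norm (grad T \<Omega> u (fst z) (snd z)))^2"
 have lei: "(LINT x:\<Omega>|lebesgue. (norm (u s x))^2 * \<phi> (s, x)) + 2 * (LINT z:{0..s} \<times> \<Omega>|lebesgue. ?g z * \<phi> z) <= (LINT z:{0..s} \<times> \<Omega>|lebesgue. H z)"
  if "s \<in> {0..T}" for s
  using sws \<phi> \<phi>B(1) that unfolding suitable_weak_solution_def local_energy_inequality_def H_def by blast
 have n1: "0 <= (LINT x:\<Omega>|lebesgue. (norm (u s x))^2 * \<phi> (s, x))" for s
  unfolding set_lebesgue_integral_def using \<phi>B(1) by (intro Bochner_Integration.integral_nonneg) (auto simp: indicator_def)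
 have n2: "0 <= (LINT z:{0..s} \<times> \<Omega>|lebesgue. ?g z * \<phi> z)" for s
  unfolding set_lebesgue_integral_def using \<phi>B(1) by (intro Bochner_Integration.integral_nonneg) (auto simp: indicator_def)
 have b1: "(LINT x:\<Omega>|lebesgue. (norm (u s x))^2 * \<phi> (s, x)) <= ?X" "(LINT z:{0..s} \<times> \<Omega>|lebesgue. ?g z * \<phi> z) <= ?X"
  if "s \<in> {0..T}" "s <= fst w" for s
  using lei[OF that(1)] RHS[OF that(2)] n1[of s] n2[of s] by linarith+
 have \<phi>b [measurable]: "\<phi> \<in> borel_measurable borel" by (rule smooth_borel[OF test_funD(1)[OF \<phi>]])
 show "sq_norm (ball (snd w) (R / 2)) (u s) <= ennreal (?X / c)" if s: "s \<in> {fst w - R^2 / 4..<fst w}" for s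
  unfolding sq_norm_def
 proof (rule weighted_bound[of \<Omega> _ "%x. \<phi> (s, x)" B])
  have "0 <= s" "s <= T" using s tm(1,2) R2 by (simp_all only: atLeastLessThan_iff) linarith+
  then have sT: "s \<in> {0..T}" by simp
  have "\<Omega> \<in> sets lebesgue" by (intro sets_completionI_sets) simp
  then have [measurable]: "(%x. if x \<in> \<Omega> then u s x else 0) \<in> borel_measurable lebesgue"
   using sws sT unfolding suitable_weak_solution_def leray_hopf_def energy_class_def
   by (intro borel_measurable_if_I) auto
  have e: "(%x. indicat_real \<Omega> x * (norm (u s x))^2) = (%x. (norm (if x \<in> \<Omega> then u s x else 0))^2)" by auto
  show "(%x. indicat_real \<Omega> x * (norm (u s x))^2) \<in> borel_measurable lebesgue" unfolding e by measurable
  show "(\<integral>\<^sup>+x\<in>\<Omega>. ennreal ((norm (u s x))^2) \<partial>lebesgue) < \<infinity>"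
   using order_le_less_trans[OF energy_bound[OF sT] ennreal_less_top] by (simp add: sq_norm_def)
  show "(%x. \<phi> (s, x)) \<in> borel_measurable borel" by (rule slice_measurable[OF \<phi>b])
  show "ball (snd w) (R / 2) \<subseteq> \<Omega>" using tm(3) R by (auto simp: subset_iff)
  show "c <= \<phi> (s, x)" if "x \<in> ball (snd w) (R / 2)" for x using s that by (intro \<phi>c) auto
  show "(LINT x:\<Omega>|lebesgue. (norm (u s x))^2 * \<phi> (s, x)) <= ?X" using b1(1)[OF sT] s by simp
 qed (use \<phi>B(1,2) c X in auto)
 show "sq_norm (pcyl (R / 2) w) (%z. grad T \<Omega> u (fst z) (snd z)) <= ennreal (?X / c)"
  unfolding sq_norm_def
 proof (rule weighted_bound[of "{0..fst w} \<times> \<Omega>" _ \<phi> B])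
  let ?D = "{0..fst w} \<times> \<Omega>" and ?Z = "{0..T} \<times> \<Omega>"
  have "0 <= fst w" using tm(1) R2 by linarith
  then have wT: "fst w \<in> {0..T}" using tm(2) by simp
  have Zl: "?Z \<in> sets lebesgue" using Z_borel by (intro sets_completionI_sets) simp
  have "?D \<in> sets borel" using open_Omega by (intro borel_Times borel_closed borel_open) auto
  then have [measurable]: "?D \<in> sets lebesgue" by (intro sets_completionI_sets) simp
  have ec: "energy_class T \<Omega> u" using sws unfolding suitable_weak_solution_def leray_hopf_def by blast
  then have "\<exists>g. spatial_gradient T \<Omega> u g" unfolding energy_class_def by blast
  then have "spatial_gradient T \<Omega> u (grad T \<Omega> u)" unfolding grad_def by (rule someI_ex)
  then have [measurable]: "(%z. if z \<in> ?Z then grad T \<Omega> u (fst z) (snd z) else 0) \<in> borel_measurable lebesgue"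
   unfolding spatial_gradient_def using Zl by (intro borel_measurable_if_I) auto
  have e: "(%z. indicat_real ?D z * ?g z) = (%z. indicat_real ?D z * (norm (if z \<in> ?Z then grad T \<Omega> u (fst z) (snd z) else 0))^2)"
   using wT by (auto simp: fun_eq_iff indicator_def)
  show "(%z. indicat_real ?D z * ?g z) \<in> borel_measurable lebesgue" unfolding e by measurable
  have "(\<integral>\<^sup>+z\<in>?D. ennreal (?g z) \<partial>lebesgue) <= (\<integral>\<^sup>+z\<in>?Z. ennreal (?g z) \<partial>lebesgue)"
   using wT by (intro nn_integral_mono mult_left_mono) (auto simp: indicator_def)
  also have "... < \<infinity>" using ec by (simp add: energy_class_def sq_norm_def)
  finally show "(\<integral>\<^sup>+z\<in>?D. ennreal (?g z) \<partial>lebesgue) < \<infinity>" .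
  show "pcyl (R / 2) w \<subseteq> ?D" using tm R R2 by (auto simp: pcyl_def power_divide subset_iff)
  show "pcyl (R / 2) w \<in> sets borel" unfolding pcyl_def by (intro borel_open open_Times) auto
  show "c <= \<phi> z" if "z \<in> pcyl (R / 2) w" for z using that by (intro \<phi>c) (auto simp: pcyl_def power_divide)
  show "(LINT z:?D|lebesgue. ?g z * \<phi> z) <= ?X" using b1(2)[OF wT] by simp
 qed (use \<phi>B(1,2) c X \<phi>b in auto)
qed

end

text \<open>The number \<open>y\<close> is dimensionless: the cubic integrals scale like \<open>R\<^sup>2\<close>.\<close>

definition cyl_bound ::
  "(real => real^3 => real^3) => (real => real^3 => real) => real => spacetime => real => bool" where
 "cyl_bound u P R w y \<longleftrightarrow>
   (\<integral>\<^sup>+z\<in>pcyl R w. ennreal (norm (u (fst z) (snd z)) ^ 3) \<partial>lebesgue) <= ennreal (R^2 * y) \<and>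
   (\<integral>\<^sup>+z\<in>pcyl R w. ennreal (\<bar>P (fst z) (snd z)\<bar> powr (3/2)) \<partial>lebesgue) <= ennreal (R^2 * y)"

definition energy_constant :: "real => bool" where
 "energy_constant K \<longleftrightarrow> 1 <= K \<and> (\<forall>T M \<Omega> u P R w y.
   solution T M \<Omega> u P \<and> 0 < R \<and> pcyl R w \<subseteq> {0<..T} \<times> \<Omega> \<and> 0 <= y \<and> cyl_bound u P R w y -->
   (\<forall>s\<in>{fst w - R^2 / 4..<fst w}. sq_norm (ball (snd w) (R / 2)) (u s) <= ennreal (K * R * (1 + y))) \<and>
   sq_norm (pcyl (R / 2) w) (%z. grad T \<Omega> u (fst z) (snd z)) <= ennreal (K * R * (1 + y)))"

lemma energy_constant_exists: "\<exists>K. energy_constant K"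
proof (rule cutoff_exists)
 fix c B :: real
 assume c: "0 < c" and B: "0 < B"
  and cut: "!!R w V. 0 < R ==> {fst w - R^2<..fst w + R^2} \<times> ball (snd w) R \<subseteq> V ==>
   \<exists>\<phi>\<in>test_fun V. (\<forall>z. 0 <= \<phi> z \<and> \<phi> z <= B \<and> \<bar>dt \<phi> z\<bar> <= B / R^2 \<and> \<bar>laplace \<phi> z\<bar> <= B / R^2 \<and> (\<forall>j. \<bar>dx j \<phi> z\<bar> <= B / R)) \<and>
    (\<forall>z. fst w - R^2 / 4 <= fst z \<and> fst z <= fst w \<and> snd z \<in> ball (snd w) (R / 2) --> c <= \<phi> z) \<and>
    (\<forall>z. z \<notin> {fst w - R^2<..} \<times> ball (snd w) R --> z \<notin> support \<phi>)"
 let ?K = "max 1 (B * (17 + 2 * unit_ball_vol 3) / c)"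
 have "energy_constant ?K"
  unfolding energy_constant_def
 proof (intro conjI allI impI ballI; (elim conjE)?)
  show "1 <= ?K" by simp
 next
  fix T M \<Omega> u P R y and w :: spacetime
  assume sol: "solution T M \<Omega> u P" and R: "0 < R" and Q: "pcyl R w \<subseteq> {0<..T} \<times> \<Omega>" and y: "0 <= y"
   and cb: "cyl_bound u P R w y"
  interpret solution T M \<Omega> u P by (rule sol)
  have "{fst w - R^2<..fst w + R^2} \<times> ball (snd w) R \<subseteq> {0<..} \<times> \<Omega>"
   using pcyl_time[OF R Q] by auto
  from cut[OF R this] obtain \<phi> where \<phi>: "\<phi> \<in> test_fun ({0<..} \<times> \<Omega>)"
   "\<forall>z. 0 <= \<phi> z \<and> \<phi> z <= B \<and> \<bar>dt \<phi> z\<bar> <= B / R^2 \<and> \<bar>laplace \<phi> z\<bar> <= B / R^2 \<and> (\<forall>j. \<bar>dx j \<phi> z\<bar> <= B / R)"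
   "\<forall>z. fst w - R^2 / 4 <= fst z \<and> fst z <= fst w \<and> snd z \<in> ball (snd w) (R / 2) --> c <= \<phi> z"
   "\<forall>z. z \<notin> {fst w - R^2<..} \<times> ball (snd w) R --> z \<notin> support \<phi>" by blast
  have "B * (17 + 2 * unit_ball_vol 3) / c * (R * (1 + y)) <= ?K * (R * (1 + y))"
   using R y by (intro mult_right_mono) auto
  then have le: "ennreal (B * (17 + 2 * unit_ball_vol 3) * R * (1 + y) / c) <= ennreal (?K * R * (1 + y))"
   by (intro ennreal_leI) (simp add: mult_ac)
  note en = energy_at_cutoff[OF R Q B c \<phi>(1) _ _ _ _ _ _ _ y cb[unfolded cyl_bound_def, THEN conjunct1] cb[unfolded cyl_bound_def, THEN conjunct2]]
  show "sq_norm (ball (snd w) (R / 2)) (u s) <= ennreal (?K * R * (1 + y))"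
   if "s \<in> {fst w - R^2 / 4..<fst w}" for s
   by (rule order_trans[OF en(1) le]) (use \<phi>(2-4) that in blast)+
  show "sq_norm (pcyl (R / 2) w) (%z. grad T \<Omega> u (fst z) (snd z)) <= ennreal (?K * R * (1 + y))"
   by (rule order_trans[OF en(2) le]) (use \<phi>(2-4) in blast)+
 qed
 then show ?thesis ..
qed

definition KE :: real where "KE = (SOME K. energy_constant K)"

lemma energy_constant_KE: "energy_constant KE"
 unfolding KE_def by (rule someI_ex[OF energy_constant_exists])

lemma KE_ge_1: "1 <= KE" using energy_constant_KE by (simp add: energy_constant_def)

lemma (in solution) local_energy:
 assumes "0 < R" "pcyl R w \<subseteq> {0<..T} \<times> \<Omega>" "0 <= y" "cyl_bound u P R w y"
 shows "!!s. fst w - R^2 / 4 <= s ==> s < fst w ==> sq_norm (ball (snd w) (R / 2)) (u s) <= ennreal (KE * R * (1 + y))"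
  "sq_norm (pcyl (R / 2) w) (%z. grad T \<Omega> u (fst z) (snd z)) <= ennreal (KE * R * (1 + y))"
proof -
 have "solution T M \<Omega> u P" by unfold_locales
 then show "!!s. fst w - R^2 / 4 <= s ==> s < fst w ==> sq_norm (ball (snd w) (R / 2)) (u s) <= ennreal (KE * R * (1 + y))"
  "sq_norm (pcyl (R / 2) w) (%z. grad T \<Omega> u (fst z) (snd z)) <= ennreal (KE * R * (1 + y))"
  using energy_constant_KE[unfolded energy_constant_def, THEN conjunct2, rule_format, of T M \<Omega> u P R w y] assms by auto
qed

section \<open>Iteration over scales\<close>

text \<open>The ratio of scales makes the coefficient of the old bound at most \<open>1/4\<close>; the remaining \<open>1/4\<close> of the
 contraction factor \<open>1/2\<close> is spent on absorbing the energy.\<close>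

definition theta0 :: real where "theta0 = min (1 / 4) (1 / (64 * flow.KD))"

definition absorb :: "real => real" where
 "absorb M = flow.KD * (1 + M^2) * (2 * KE) powr (9/16) / theta0^2"

definition step_const :: "real => real" where
 "step_const M = 1 / 4 + absorb M * (4 * absorb M) powr (9/7)"

text \<open>Either \<open>s\<close> is so large that \<open>L s\<^sup>9\<^sup>/\<^sup>1\<^sup>6 <= s/4\<close>, or it is bounded by a power of \<open>L\<close>.\<close>

lemma absorb_power:
 fixes L s :: real
 assumes L: "0 <= L" and s: "1 <= s"
 shows "L * s powr (9/16) <= s / 4 + L * (4 * L) powr (9/7)"
proof (cases "4 * L <= s powr (7/16)")
 case True
 then have "4 * L * s powr (9/16) <= s powr (7/16) * s powr (9/16)" by (intro mult_right_mono) auto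
 also have "... = s" using s by (simp add: powr_add[symmetric])
 finally show ?thesis using L by (simp add: add_increasing2)
next
 case False
 then have "(s powr (7/16)) powr (9/7) <= (4 * L) powr (9/7)" by (intro powr_mono2) auto
 then have "s powr (9/16) <= (4 * L) powr (9/7)" by (simp add: powr_powr)
 then have "L * s powr (9/16) <= L * (4 * L) powr (9/7)" using L by (intro mult_left_mono)
 then show ?thesis using s by simp
qed

lemma pcyl_mono: assumes "0 <= r" "r <= R" shows "pcyl r w \<subseteq> pcyl R w"
proof -
 have "r^2 <= R^2" using assms by (intro power_mono) auto
 then have "{fst w - r^2<..<fst w} \<subseteq> {fst w - R^2<..<fst w}" by (intro greaterThanLessThan_subseteq_greaterThanLessThan[THEN iffD2]) linarith
 then show ?thesis using assms unfolding pcyl_def by (intro Sigma_mono subset_ball)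
qed

lemma cyl_bound_mono:
 assumes b: "cyl_bound u P R w y" and r: "0 < r" "r <= R" and y: "R^2 * y <= r^2 * y'"
 shows "cyl_bound u P r w y'"
proof -
 have sub: "pcyl r w \<subseteq> pcyl R w" using r by (intro pcyl_mono) auto
 have m: "(\<integral>\<^sup>+z\<in>pcyl r w. f z \<partial>lebesgue) <= (\<integral>\<^sup>+z\<in>pcyl R w. f z \<partial>lebesgue)" for f
  using sub by (intro nn_integral_mono mult_left_mono) (auto simp: indicator_def)
 show ?thesis
  unfolding cyl_bound_def
  by (intro conjI order_trans[OF m order_trans[OF _ ennreal_leI[OF y]]]) (use b in \<open>simp_all add: cyl_bound_def\<close>)
qed

lemma flow_mono_energy: "flow E U p T M \<Omega> b ==> E <= E' ==> flow E' U p T M \<Omega> b"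
 unfolding flow_def flow_base_def by (meson ennreal_leI order_trans)

lemma KD_pos': "0 < flow.KD"
proof -
 have "flow 0 (%z. 0) (%z. 0) 1 0 {} (%t. 0)"
  by unfold_locales auto
 then show ?thesis by (rule flow.KD_pos)
qed

lemma theta0: "0 < theta0" "theta0 <= 1 / 4" "16 * flow.KD * theta0 <= 1 / 4"
proof -
 show "0 < theta0" "theta0 <= 1 / 4" using KD_pos' by (auto simp: theta0_def)
 have "theta0 <= 1 / (64 * flow.KD)" by (simp add: theta0_def)
 then show "16 * flow.KD * theta0 <= 1 / 4" using KD_pos' by (simp add: field_simps)
qed

lemma absorb_nonneg: "0 <= absorb M" and step_const_pos: "0 < step_const M"
proof -
 show "0 <= absorb M" using KD_pos' KE_ge_1 by (simp add: absorb_def)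
 then show "0 < step_const M" unfolding step_const_def by (intro add_pos_nonneg mult_nonneg_nonneg) auto
qed

context solution
begin

lemma flow_transfer:
 assumes ae: "AE z in lborel. z \<in> {0..T} \<times> \<Omega> --> U z = u (fst z) (snd z) \<and> p z = P (fst z) (snd z)"
  and A: "A \<subseteq> {0..T} \<times> \<Omega>"
 shows "(\<integral>\<^sup>+z\<in>A. ennreal (norm (u (fst z) (snd z)) ^ 3) \<partial>lebesgue) = (\<integral>\<^sup>+z\<in>A. ennreal (norm (U z) ^ 3) \<partial>lborel)"
  "(\<integral>\<^sup>+z\<in>A. ennreal (\<bar>P (fst z) (snd z)\<bar> powr (3/2)) \<partial>lebesgue) = (\<integral>\<^sup>+z\<in>A. ennreal (\<bar>p z\<bar> powr (3/2)) \<partial>lborel)"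
 unfolding nn_integral_completion
 by (intro nn_integral_cong_AE, use ae in \<open>eventually_elim, use A in \<open>auto simp: indicator_def\<close>\<close>)+

text \<open>One step: the local energy inequality bounds the energy on half the cylinder, and the decay
 estimate turns this into a bound on a much smaller cylinder, in which \<open>y\<close> is halved and a constant is
 added that depends only on \<open>M\<close>.\<close>

lemma scale_step:
 assumes R: "0 < R" and Q: "pcyl R w \<subseteq> {0<..T} \<times> \<Omega>" and y: "0 <= y" and cb: "cyl_bound u P R w y"
 shows "cyl_bound u P (theta0 / 4 * R) w (y / 2 + step_const M)"
proof (rule flow_exists)
 fix U p b
 assume fl: "flow (enn2real (sq_norm \<Omega> (u 0))) U p T M \<Omega> b"
  and sq: "!!t A. t \<in> {0..T} ==> A \<in> sets borel ==> A \<subseteq> \<Omega> ==> (\<integral>\<^sup>+x\<in>A. ennreal ((norm (U (t, x)))^2) \<partial>lborel) <= sq_norm A (u t)"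
  and ae: "AE z in lborel. z \<in> {0..T} \<times> \<Omega> --> U z = u (fst z) (snd z) \<and> p z = P (fst z) (snd z)"
 interpret flow "enn2real (sq_norm \<Omega> (u 0))" U p T M \<Omega> b by (rule fl)
 note tm = pcyl_time[OF R Q]
 define r where "r = R / 4"
 define \<alpha> where "\<alpha> = 2 * KE * (1 + y)"
 define Y where "Y = R^2 * y"
 have r: "0 < r" "2 * r = R / 2" using R by (simp_all add: r_def)
 have "1 * 1 <= (2 * KE) * (1 + y)" using KE_ge_1 y by (intro mult_mono) auto
 then have \<alpha>: "1 <= \<alpha>" by (simp add: \<alpha>_def)
 have r2: "r^2 <= R^2 / 4" "0 < R^2" using R by (simp_all add: r_def power_divide)
 have t0: "0 <= fst w - r^2" using r2 tm(1) by linarith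
 have B: "ball (snd w) (2 * r) \<subseteq> \<Omega>" unfolding r(2) using tm(3) R by (auto simp: subset_iff)
 have Q2: "pcyl (2 * r) w \<subseteq> pcyl R w" unfolding r(2) using R by (intro pcyl_mono) auto
 have QZ: "pcyl R w \<subseteq> {0..T} \<times> \<Omega>" using Q by auto
 have w: "(fst w, snd w) = w" by simp
 have A: "(\<integral>\<^sup>+x\<in>ball (snd w) (2 * r). ennreal ((norm (U (t, x)))^2) \<partial>lborel) <= ennreal (2 * r * \<alpha>)"
  if "fst w - r^2 < t" "t < fst w" for t
 proof -
  have "fst w - R^2 / 4 <= t" "0 <= t" "t <= T" using that r2 t0 tm by linarith+
  then have "(\<integral>\<^sup>+x\<in>ball (snd w) (2 * r). ennreal ((norm (U (t, x)))^2) \<partial>lborel) <= sq_norm (ball (snd w) (R / 2)) (u t)"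
   unfolding r(2)[symmetric] by (intro sq B) auto
  also have "... <= ennreal (KE * R * (1 + y))"
   using \<open>fst w - R\<^sup>2 / 4 <= t\<close> that by (intro local_energy(1)[OF R Q y cb]) auto
  also have "KE * R * (1 + y) = 2 * r * \<alpha>" by (simp add: r \<alpha>_def)
  finally show ?thesis .
 qed
 have X: "(\<integral>\<^sup>+z\<in>pcyl (2 * r) (fst w, snd w). ennreal (norm (U z) ^ 3) \<partial>lborel) <= ennreal Y"
  "(\<integral>\<^sup>+z\<in>pcyl (2 * r) (fst w, snd w). ennreal (\<bar>p z\<bar> powr (3/2)) \<partial>lborel) <= ennreal Y"
 proof -
  have m: "(\<integral>\<^sup>+z\<in>pcyl (2 * r) w. f z \<partial>lborel) <= (\<integral>\<^sup>+z\<in>pcyl R w. f z \<partial>lborel)" for f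
   using Q2 by (intro nn_integral_mono mult_left_mono) (auto simp: indicator_def)
  note c = cb[unfolded cyl_bound_def flow_transfer[OF ae QZ], folded Y_def]
  show "(\<integral>\<^sup>+z\<in>pcyl (2 * r) (fst w, snd w). ennreal (norm (U z) ^ 3) \<partial>lborel) <= ennreal Y"
   "(\<integral>\<^sup>+z\<in>pcyl (2 * r) (fst w, snd w). ennreal (\<bar>p z\<bar> powr (3/2)) \<partial>lborel) <= ennreal Y"
   unfolding w by (rule order_trans[OF m c[THEN conjunct1]], rule order_trans[OF m c[THEN conjunct2]])
 qed
 have Y: "0 <= Y" using y by (simp add: Y_def)
 have s: "theta0 / 4 * R = theta0 * r" by (simp add: r_def)
 have le: "KD * (theta0 ^ 3 * Y + (1 + M^2) * \<alpha> powr (9/16) * r^2) <= (theta0 * r)^2 * (y / 2 + step_const M)"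
 proof -
  have "KD * (theta0 ^ 3 * Y + (1 + M^2) * \<alpha> powr (9/16) * r^2)
    = (theta0 * r)^2 * (16 * KD * theta0 * y + KD * (1 + M^2) * \<alpha> powr (9/16) / theta0^2)"
   using theta0(1) by (simp add: Y_def r_def field_simps power2_eq_square power3_eq_cube)
  also have "KD * (1 + M^2) * \<alpha> powr (9/16) / theta0^2 = absorb M * (1 + y) powr (9/16)"
   using KE_ge_1 y by (simp add: absorb_def \<alpha>_def powr_mult)
  also have "16 * KD * theta0 * y + absorb M * (1 + y) powr (9/16) <= 1 / 4 * y + ((1 + y) / 4 + absorb M * (4 * absorb M) powr (9/7))"
   using y theta0(3) by (intro add_mono mult_right_mono absorb_power absorb_nonneg) auto
  also have "... = y / 2 + step_const M" by (simp add: step_const_def add_divide_distrib)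
  finally show ?thesis by (simp add: mult_left_mono)
 qed
 have sub: "pcyl (theta0 * r) w \<subseteq> {0..T} \<times> \<Omega>"
  using pcyl_mono[of "theta0 * r" R w] theta0 R QZ mult_mono[of theta0 1 r R] by (auto simp: r_def)
 have d: "(\<integral>\<^sup>+z\<in>pcyl (theta0 * r) (fst w, snd w). ennreal (norm (U z) ^ 3) \<partial>lborel) <= ennreal (KD * (theta0 ^ 3 * Y + (1 + M^2) * \<alpha> powr (9/16) * r^2))"
  "(\<integral>\<^sup>+z\<in>pcyl (theta0 * r) (fst w, snd w). ennreal (\<bar>p z\<bar> powr (3/2)) \<partial>lborel) <= ennreal (KD * (theta0 ^ 3 * Y + (1 + M^2) * \<alpha> powr (9/16) * r^2))"
  by (rule cylinder_decay[OF r(1) \<alpha> theta0(1,2) t0 tm(2) B A X Y]; simp)+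
 show ?thesis
  unfolding cyl_bound_def s flow_transfer[OF ae sub]
  by (rule conjI[OF order_trans[OF d(1)[unfolded w] ennreal_leI[OF le]] order_trans[OF d(2)[unfolded w] ennreal_leI[OF le]]])
qed

lemma scale_iterate:
 assumes R: "0 < R" and Q: "pcyl R w \<subseteq> {0<..T} \<times> \<Omega>" and y: "0 <= y" and cb: "cyl_bound u P R w y"
 shows "cyl_bound u P ((theta0 / 4) ^ n * R) w (y / 2 ^ n + 2 * step_const M)"
proof (induction n)
 case 0
 show ?case by (rule cyl_bound_mono[OF cb]) (use R step_const_pos[of M] in \<open>auto intro!: mult_left_mono\<close>)
next
 case (Suc n)
 have t: "0 < theta0 / 4" "theta0 / 4 <= 1" using theta0 by auto
 have p: "0 < (theta0 / 4) ^ n * R" "(theta0 / 4) ^ n * R <= R"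
  using t R power_le_one[of "theta0 / 4" n] by (auto simp: mult_left_le_one_le)
 have "cyl_bound u P (theta0 / 4 * ((theta0 / 4) ^ n * R)) w ((y / 2 ^ n + 2 * step_const M) / 2 + step_const M)"
  by (rule scale_step[OF p(1) _ _ Suc]) (use pcyl_mono[of "(theta0 / 4) ^ n * R" R w] p Q y step_const_pos[of M] in auto)
 moreover have "(y / 2 ^ n + 2 * step_const M) / 2 + step_const M = y / 2 ^ Suc n + 2 * step_const M" by (simp add: field_simps)
 ultimately show ?case by (simp add: mult.assoc)
qed

text \<open>Scales between two steps of the iteration cost a constant. The initial bound \<open>y\<close> is forgotten
 geometrically: this separates the constants that depend on the data from those that do not.\<close>

lemma scale_interpolate:
 assumes R: "0 < R" and Q: "pcyl R w \<subseteq> {0<..T} \<times> \<Omega>" and y: "0 <= y" and cb: "cyl_bound u P R w y"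
  and r: "0 < r" "r <= (theta0 / 4) ^ N * R"
 shows "cyl_bound u P r w ((4 / theta0)^2 * (y / 2 ^ N + 2 * step_const M))"
proof -
 let ?t = "theta0 / 4"
 have t: "0 < ?t" "?t < 1" using theta0 by auto
 have "\<exists>k. ?t ^ k < r / R" using r R t real_arch_pow_inv[of "r / R" ?t] by auto
 then obtain k where k: "?t ^ k * R < r" using R by (auto simp: field_simps)
 define m where "m = (LEAST m. ?t ^ (N + Suc m) * R < r)"
 have "?t ^ (N + Suc k) * R <= ?t ^ k * R"
  using t R by (intro mult_right_mono power_decreasing) auto
 then have "?t ^ (N + Suc k) * R < r" using k by linarith
 then have m: "?t ^ (N + Suc m) * R < r" unfolding m_def by (rule LeastI)
 have m': "r <= ?t ^ (N + m) * R"
 proof (cases m)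
  case 0 then show ?thesis using r by simp
 next
  case (Suc j)
  then have "\<not> ?t ^ (N + Suc j) * R < r" unfolding m_def by (intro not_less_Least) simp
  then show ?thesis using Suc by simp
 qed
 let ?y = "y / 2 ^ (N + m) + 2 * step_const M" and ?y' = "y / 2 ^ N + 2 * step_const M"
 have yy: "?y <= ?y'" using y by (intro add_right_mono divide_left_mono power_increasing) auto
 have y0: "0 <= ?y" using y step_const_pos[of M] by simp
 have "?t ^ (N + m) * R <= 4 / theta0 * r" using m t R theta0(1) by (simp add: field_simps)
 then have "(?t ^ (N + m) * R)^2 <= (4 / theta0 * r)^2" using t R by (intro power_mono) auto
 then have "(?t ^ (N + m) * R)^2 * ?y <= (4 / theta0 * r)^2 * ?y'" using yy y0 by (intro mult_mono) auto
 then have "(?t ^ (N + m) * R)^2 * ?y <= r^2 * ((4 / theta0)^2 * ?y')"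
  unfolding power_mult_distrib[of "4 / theta0" r] by (simp only: mult_ac)
 then show ?thesis by (rule cyl_bound_mono[OF scale_iterate[OF R Q y cb] r(1) m'])
qed

lemma G_bound:
 assumes r: "0 < r" and Q: "pcyl (2 * r) w \<subseteq> {0<..T} \<times> \<Omega>" and y: "0 <= y" and cb: "cyl_bound u P (2 * r) w y"
 shows "G_quant T \<Omega> u P r w <= ennreal (4 * KE * (1 + y) + 8 * y)"
proof -
 have r2: "0 < 2 * r" using r by simp
 note le = local_energy[OF r2 Q y cb, simplified]
 have cb': "cyl_bound u P r w (4 * y)" by (rule cyl_bound_mono[OF cb r]) (use r in \<open>auto simp: power_mult_distrib\<close>)
 have nn: "0 <= KE" using KE_ge_1 by simp
 have e: "ennreal (1 / r) * ennreal (KE * (2 * r) * (1 + y)) = ennreal (2 * KE * (1 + y))"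
  using r y nn by (simp add: ennreal_mult[symmetric])
 have 1: "(SUP s\<in>{fst w - r^2..<fst w}. ennreal (1 / r) * sq_norm (ball (snd w) r) (u s)) <= ennreal (2 * KE * (1 + y))"
 proof (rule SUP_least)
  fix s assume "s \<in> {fst w - r^2..<fst w}"
  then have "sq_norm (ball (snd w) r) (u s) <= ennreal (KE * (2 * r) * (1 + y))" using le(1)[of s] by (simp add: power_mult_distrib)
  then have "ennreal (1 / r) * sq_norm (ball (snd w) r) (u s) <= ennreal (1 / r) * ennreal (KE * (2 * r) * (1 + y))" by (rule mult_left_mono) simp
  then show "ennreal (1 / r) * sq_norm (ball (snd w) r) (u s) <= ennreal (2 * KE * (1 + y))" unfolding e .
 qed
 have "ennreal (1 / r) * sq_norm (pcyl r w) (%w. grad T \<Omega> u (fst w) (snd w)) <= ennreal (1 / r) * ennreal (KE * (2 * r) * (1 + y))"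
  using le(2) by (intro mult_left_mono) (auto simp: mult_ac)
 then have 2: "ennreal (1 / r) * sq_norm (pcyl r w) (%w. grad T \<Omega> u (fst w) (snd w)) <= ennreal (2 * KE * (1 + y))" unfolding e .
 have e2: "ennreal (1 / r^2) * ennreal (r^2 * (4 * y)) = ennreal (4 * y)"
  using r y by (simp add: ennreal_mult[symmetric])
 have 3: "ennreal (1 / r^2) * (\<integral>\<^sup>+w\<in>pcyl r w. ennreal (norm (u (fst w) (snd w)) ^ 3) \<partial>lebesgue) <= ennreal (4 * y)"
  "ennreal (1 / r^2) * (\<integral>\<^sup>+w\<in>pcyl r w. ennreal (\<bar>P (fst w) (snd w)\<bar> powr (3/2)) \<partial>lebesgue) <= ennreal (4 * y)"
  unfolding e2[symmetric] using cb' by (auto simp: cyl_bound_def intro!: mult_left_mono)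
 have "G_quant T \<Omega> u P r w <= ennreal (2 * KE * (1 + y)) + ennreal (2 * KE * (1 + y)) + ennreal (4 * y) + ennreal (4 * y)"
  unfolding G_quant_def by (intro add_mono 1 2 3)
 also have "... = ennreal (4 * KE * (1 + y) + 8 * y)"
  using y nn by (simp add: ennreal_plus[symmetric] del: ennreal_plus)
 finally show ?thesis .
qed

end

section \<open>Bounds at positive scales\<close>

text \<open>The constants of the theorem, as functions of the size \<open>K\<close> of the data. Absolute values keep them positive
 for arguments that do not arise from a solution.\<close>

definition start :: "real => real => real => real" where
 "start K \<rho> M = (\<bar>flow.crude K M (\<rho> / 2)\<bar> + \<bar>K\<bar>) / (\<rho> / 2)^2"

definition level :: "real => real => real" where
 "level M a = (4 / theta0)^2 * (a + 2 * step_const M)"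

definition bound_G :: "real => real" where "bound_G y = 4 * KE * (1 + y) + 8 * y"

definition bound1 :: "real => real => real => real" where
 "bound1 K \<rho> M = bound_G (level M (start K \<rho> M)) + 8 / \<bar>\<rho>\<bar> * \<bar>K\<bar> + 16 / \<rho>^2 * (\<bar>flow.crude K M (\<rho> / 2)\<bar> + \<bar>K\<bar>)"

lemma start_nonneg: "0 <= start K \<rho> M" by (simp add: start_def)

lemma level_nonneg: "0 <= a ==> 0 <= level M a"
 using step_const_pos[of M] by (simp add: level_def)

lemma bound_G_pos: "0 <= y ==> 0 < bound_G y"
 using KE_ge_1 by (simp add: bound_G_def add_pos_nonneg)

lemma bound1_pos: "0 < bound1 K \<rho> M"
 unfolding bound1_def by (intro add_pos_nonneg bound_G_pos level_nonneg start_nonneg) auto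

context solution
begin

abbreviation data where "data \<equiv> data_size T \<Omega> u P"

lemma data_bounds:
 shows "0 <= data" "sq_norm \<Omega> (u 0) <= ennreal data"
  "(\<integral>\<^sup>+z\<in>{0..T}\<times>\<Omega>. ennreal (\<bar>P (fst z) (snd z)\<bar> powr (3/2)) \<partial>lebesgue) <= ennreal data"
proof -
 let ?b = "\<integral>\<^sup>+z\<in>{0..T}\<times>\<Omega>. ennreal (\<bar>P (fst z) (snd z)\<bar> powr (3/2)) \<partial>lebesgue"
 have "?b < \<infinity>" using sws unfolding suitable_weak_solution_def by blast
 then have "ennreal data = sq_norm \<Omega> (u 0) + ?b"
  using initial_energy by (simp add: data_size_def ennreal_enn2real)
 then show "0 <= data" "sq_norm \<Omega> (u 0) <= ennreal data" "?b <= ennreal data"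
  by (simp_all add: data_size_def)
qed

lemma initial_scale:
 assumes \<rho>: "0 < \<rho>" and Q: "pcyl \<rho> w \<subseteq> {0<..T} \<times> \<Omega>"
 shows "(\<integral>\<^sup>+z\<in>pcyl (\<rho> / 2) w. ennreal (norm (u (fst z) (snd z)) ^ 3) \<partial>lebesgue) <= ennreal \<bar>flow.crude data M (\<rho> / 2)\<bar>"
  and "cyl_bound u P (\<rho> / 2) w (start data \<rho> M)"
proof -
 note tm = pcyl_time[OF \<rho> Q]
 have sub: "pcyl (\<rho> / 2) w \<subseteq> pcyl \<rho> w" using \<rho> by (intro pcyl_mono) auto
 have sub0: "pcyl (\<rho> / 2) w \<subseteq> {0..T} \<times> \<Omega>" using sub Q by auto
 show 1: "(\<integral>\<^sup>+z\<in>pcyl (\<rho> / 2) w. ennreal (norm (u (fst z) (snd z)) ^ 3) \<partial>lebesgue) <= ennreal \<bar>flow.crude data M (\<rho> / 2)\<bar>"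
 proof (rule flow_exists)
  fix U p b
  assume fl: "flow (enn2real (sq_norm \<Omega> (u 0))) U p T M \<Omega> b"
   and ae: "AE z in lborel. z \<in> {0..T} \<times> \<Omega> --> U z = u (fst z) (snd z) \<and> p z = P (fst z) (snd z)"
  have "ennreal (enn2real (sq_norm \<Omega> (u 0))) <= ennreal data"
   using data_bounds(2) initial_energy by (simp add: ennreal_enn2real)
  then have "enn2real (sq_norm \<Omega> (u 0)) <= data" using data_bounds(1) by (simp only: ennreal_le_iff)
  from flow_mono_energy[OF fl this] interpret flow data U p T M \<Omega> b .
  have h: "0 < \<rho> / 2" using \<rho> by simp
  have t0: "0 <= fst w - (\<rho> / 2)^2" using tm(1) by (simp add: power_divide) (smt (verit) zero_le_power2)
  have B: "ball (snd w) (2 * (\<rho> / 2)) \<subseteq> \<Omega>" using tm(3) by simp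
  show ?thesis
   using cubic_crude[OF h t0 tm(2) B] unfolding flow_transfer(1)[OF ae sub0] by (simp add: abs_of_nonneg)
 qed
 have 2: "(\<integral>\<^sup>+z\<in>pcyl (\<rho> / 2) w. ennreal (\<bar>P (fst z) (snd z)\<bar> powr (3/2)) \<partial>lebesgue) <= ennreal data"
 proof (rule order_trans[OF _ data_bounds(3)])
  show "(\<integral>\<^sup>+z\<in>pcyl (\<rho> / 2) w. ennreal (\<bar>P (fst z) (snd z)\<bar> powr (3/2)) \<partial>lebesgue) <= (\<integral>\<^sup>+z\<in>{0..T}\<times>\<Omega>. ennreal (\<bar>P (fst z) (snd z)\<bar> powr (3/2)) \<partial>lebesgue)"
   using sub0 by (intro nn_integral_mono mult_left_mono) (auto simp: indicator_def)
 qed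
 have e: "(\<rho> / 2)^2 * start data \<rho> M = \<bar>flow.crude data M (\<rho> / 2)\<bar> + \<bar>data\<bar>" using \<rho> by (simp add: start_def)
 show "cyl_bound u P (\<rho> / 2) w (start data \<rho> M)"
  unfolding cyl_bound_def e
  by (intro conjI order_trans[OF 1] order_trans[OF 2] ennreal_leI) auto
qed

text \<open>With \<open>N = 0\<close> the bound holds up to the scale \<open>\<rho>/4\<close>; for large \<open>N\<close> the data disappear from it.\<close>

lemma G_small:
 assumes \<rho>: "0 < \<rho>" and Q: "pcyl \<rho> w \<subseteq> {0<..T} \<times> \<Omega>" and r: "0 < r" "2 * r <= (theta0 / 4) ^ N * (\<rho> / 2)"
 shows "G_quant T \<Omega> u P r w <= ennreal (bound_G (level M (start data \<rho> M / 2 ^ N)))"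
proof -
 have h: "0 < \<rho> / 2" "0 < 2 * r" using \<rho> r by simp_all
 have Qh: "pcyl (\<rho> / 2) w \<subseteq> {0<..T} \<times> \<Omega>" using pcyl_mono[of "\<rho> / 2" \<rho> w] \<rho> Q by auto
 have "(theta0 / 4) ^ N <= 1" using theta0 by (intro power_le_one) auto
 then have "(theta0 / 4) ^ N * (\<rho> / 2) <= \<rho> / 2" using h by (simp add: mult_left_le_one_le theta0(1) less_imp_le)
 then have "2 * r <= \<rho> / 2" using r by linarith
 then have Qr: "pcyl (2 * r) w \<subseteq> {0<..T} \<times> \<Omega>" using pcyl_mono[of "2 * r" "\<rho> / 2" w] h Qh by auto
 have n: "0 <= level M (start data \<rho> M / 2 ^ N)" by (intro level_nonneg divide_nonneg_nonneg start_nonneg) simp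
 show ?thesis
  unfolding bound_G_def
  by (rule G_bound[OF r(1) Qr n])
   (unfold level_def, rule scale_interpolate[OF h(1) Qh start_nonneg initial_scale(2)[OF \<rho> Q] h(2) r(2)])
qed

text \<open>The cubic integrals are under control only up to the scale \<open>\<rho>/2\<close>, but the local energy inequality needs them
 at twice the radius. For \<open>r > \<rho>/4\<close> the powers of \<open>1/r\<close> are harmless and the global inequality suffices.\<close>

lemma G_large:
 assumes \<rho>: "0 < \<rho>" and Q: "pcyl \<rho> w \<subseteq> {0<..T} \<times> \<Omega>" and r: "\<rho> / 4 < r" "r <= \<rho> / 2"
 shows "G_quant T \<Omega> u P r w <= ennreal (8 / \<rho> * data + 16 / \<rho>^2 * (\<bar>flow.crude data M (\<rho> / 2)\<bar> + data))"
proof -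
 let ?c = "\<bar>flow.crude data M (\<rho> / 2)\<bar>"
 note tm = pcyl_time[OF \<rho> Q]
 have r0: "0 < r" using \<rho> r by linarith
 have sub: "pcyl r w \<subseteq> pcyl (\<rho> / 2) w" "pcyl r w \<subseteq> pcyl \<rho> w" using r0 r \<rho> by (intro pcyl_mono; linarith)+
 have sZ: "pcyl r w \<subseteq> {0..T} \<times> \<Omega>" using sub(2) Q by auto
 have r1: "1 / r <= 4 / \<rho>" using r \<rho> r0 by (simp add: field_simps)
 have "(\<rho> / 4)^2 <= r^2" using r \<rho> by (intro power_mono) auto
 then have r2: "1 / r^2 <= 16 / \<rho>^2" using r0 \<rho> by (simp add: field_simps)
 have rr: "r^2 <= \<rho>^2" using r r0 by (intro power_mono) auto
 have m: "(\<integral>\<^sup>+z\<in>A. f z \<partial>lebesgue) <= (\<integral>\<^sup>+z\<in>B. f z \<partial>lebesgue)" if "A \<subseteq> B" for A B :: "'x::euclidean_space set" and f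
  using that by (intro nn_integral_mono mult_left_mono) (auto simp: indicator_def)
 have s1: "ennreal (1 / r) * x <= ennreal (4 / \<rho> * data)" if "x <= ennreal data" for x
 proof -
  have "ennreal (1 / r) * x <= ennreal (4 / \<rho>) * ennreal data" using that r1 by (intro mult_mono ennreal_leI) auto
  then show ?thesis using \<rho> data_bounds(1) by (simp add: ennreal_mult[symmetric])
 qed
 have s2: "ennreal (1 / r^2) * x <= ennreal (16 / \<rho>^2 * c)" if "x <= ennreal c" "0 <= c" for x c
 proof -
  have "ennreal (1 / r^2) * x <= ennreal (16 / \<rho>^2) * ennreal c" using that r2 by (intro mult_mono ennreal_leI) auto
  then show ?thesis using \<rho> that(2) by (simp add: ennreal_mult[symmetric])
 qed
 have 1: "(SUP s\<in>{fst w - r^2..<fst w}. ennreal (1 / r) * sq_norm (ball (snd w) r) (u s)) <= ennreal (4 / \<rho> * data)"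
 proof (rule SUP_least, rule s1)
  fix s assume "s \<in> {fst w - r^2..<fst w}"
  then have s: "s \<in> {0..T}" using tm rr by auto
  have "sq_norm (ball (snd w) r) (u s) <= sq_norm \<Omega> (u s)"
   unfolding sq_norm_def using tm(3) r \<rho> by (intro m) (auto simp: subset_iff)
  also have "... <= ennreal (enn2real (sq_norm \<Omega> (u 0)))" by (rule energy_bound[OF s])
  also have "... <= ennreal data" using data_bounds(2) initial_energy by (simp add: ennreal_enn2real)
  finally show "sq_norm (ball (snd w) r) (u s) <= ennreal data" .
 qed
 have 2: "ennreal (1 / r) * sq_norm (pcyl r w) (%w. grad T \<Omega> u (fst w) (snd w)) <= ennreal (4 / \<rho> * data)"
 proof (rule s1)
  let ?g = "%z. grad T \<Omega> u (fst z) (snd z)"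
  have T': "T \<in> {0..T}" using T by simp
  have "sq_norm (pcyl r w) ?g <= sq_norm ({0..T} \<times> \<Omega>) ?g"
   unfolding sq_norm_def by (rule m[OF sZ])
  also have "... <= 2 * sq_norm ({0..T} \<times> \<Omega>) ?g" by (simp add: mult_2)
  also have "... <= sq_norm \<Omega> (u T) + 2 * sq_norm ({0..T} \<times> \<Omega>) ?g" by simp
  also have "... <= sq_norm \<Omega> (u 0)"
   using sws T' unfolding suitable_weak_solution_def leray_hopf_def energy_inequality_def by blast
  also note data_bounds(2)
  finally show "sq_norm (pcyl r w) (%w. grad T \<Omega> u (fst w) (snd w)) <= ennreal data" .
 qed
 have 3: "ennreal (1 / r^2) * (\<integral>\<^sup>+w\<in>pcyl r w. ennreal (norm (u (fst w) (snd w)) ^ 3) \<partial>lebesgue) <= ennreal (16 / \<rho>^2 * ?c)"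
  by (rule s2[OF order_trans[OF m[OF sub(1)] initial_scale(1)[OF \<rho> Q]]]) simp
 have 4: "ennreal (1 / r^2) * (\<integral>\<^sup>+w\<in>pcyl r w. ennreal (\<bar>P (fst w) (snd w)\<bar> powr (3/2)) \<partial>lebesgue) <= ennreal (16 / \<rho>^2 * data)"
  by (rule s2[OF order_trans[OF m[OF sZ] data_bounds(3)] data_bounds(1)])
 have "G_quant T \<Omega> u P r w <= ennreal (4 / \<rho> * data) + ennreal (4 / \<rho> * data) + ennreal (16 / \<rho>^2 * ?c) + ennreal (16 / \<rho>^2 * data)"
  unfolding G_quant_def by (intro add_mono 1 2 3 4)
 also have "... = ennreal (8 / \<rho> * data + 16 / \<rho>^2 * (?c + data))"
 proof -
  have "0 <= 4 / \<rho> * data" "0 <= 16 / \<rho>^2 * ?c" "0 <= 16 / \<rho>^2 * data" using \<rho> data_bounds(1) by simp_all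
  then have "ennreal (4 / \<rho> * data) + ennreal (4 / \<rho> * data) + ennreal (16 / \<rho>^2 * ?c) + ennreal (16 / \<rho>^2 * data)
    = ennreal (4 / \<rho> * data + 4 / \<rho> * data + 16 / \<rho>^2 * ?c + 16 / \<rho>^2 * data)"
   by (simp only: ennreal_plus[symmetric] add_nonneg_nonneg)
  also have "4 / \<rho> * data + 4 / \<rho> * data + 16 / \<rho>^2 * ?c + 16 / \<rho>^2 * data = 8 / \<rho> * data + 16 / \<rho>^2 * (?c + data)"
   by (simp add: algebra_simps)
  finally show ?thesis .
 qed
 finally show ?thesis .
qed

lemma pcyl_subset_radius:
 assumes "0 < r" "pcyl r w \<subseteq> pcyl \<rho> w" "0 < \<rho>"
 shows "r <= \<rho>"
proof (rule ccontr)
 assume "\<not> r <= \<rho>"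
 then have "\<rho>^2 < r^2" "0 < \<rho>^2" using assms by (auto intro: power_strict_mono)
 then have "(fst w - \<rho>^2, snd w) \<in> pcyl r w" using assms by (simp add: pcyl_def)
 then have "(fst w - \<rho>^2, snd w) \<in> pcyl \<rho> w" using assms(2) by blast
 then show False by (simp add: pcyl_def)
qed

theorem G_bound_interior:
 assumes \<rho>: "0 < \<rho>" and r: "0 < r" and sub: "pcyl (2 * r) w \<subseteq> pcyl \<rho> w" and Q: "pcyl \<rho> w \<subseteq> {0<..T} \<times> \<Omega>"
 shows "G_quant T \<Omega> u P r w <= ennreal (bound1 data \<rho> M)"
proof (cases "r <= \<rho> / 4")
 case True
 have "G_quant T \<Omega> u P r w <= ennreal (bound_G (level M (start data \<rho> M)))"
  using G_small[OF \<rho> Q r, of 0] True by simp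
 also have "... <= ennreal (bound1 data \<rho> M)" unfolding bound1_def by (intro ennreal_leI) (simp add: add_increasing2)
 finally show ?thesis .
next
 case False
 have "2 * r <= \<rho>" using pcyl_subset_radius[OF _ sub \<rho>] r by simp
 then have "G_quant T \<Omega> u P r w <= ennreal (8 / \<rho> * data + 16 / \<rho>^2 * (\<bar>flow.crude data M (\<rho> / 2)\<bar> + data))"
  using False by (intro G_large[OF \<rho> Q]) auto
 also have "... <= ennreal (bound1 data \<rho> M)"
  using data_bounds(1) \<rho> bound_G_pos[OF level_nonneg[OF start_nonneg[of data \<rho> M]], of M]
  by (intro ennreal_leI) (simp add: bound1_def)
 finally show ?thesis .
qed

end

section \<open>Small scales\<close>

text \<open>The radius \<open>\<rho>\<close> of a cylinder inside the domain and the number of steps after which the data no longer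
 matter. At distance 0 the radius is 0, which makes the claim empty there.\<close>

definition small_radius :: "real => real => real => real" where
 "small_radius K M d = (if 0 < d then
   (let \<rho> = min (d / 2) (sqrt (d / 2)); N = (LEAST N. start K \<rho> M / 2 ^ N <= 1)
   in (theta0 / 4) ^ N * \<rho> / 4) else 0)"

lemma small_radius_pos: "0 < d ==> 0 < small_radius K M d"
 using theta0(1) by (simp add: small_radius_def Let_def)

text \<open>Both \<open>(0, x)\<close> and the points \<open>(t, y)\<close> with \<open>y\<close> on the boundary of \<open>\<Omega>\<close> are boundary points of the cylinder; a
 ball that leaves \<open>\<Omega>\<close> meets its boundary by connectedness.\<close>

lemma (in solution) bdist_interior:
 assumes z: "z \<in> {0<..T} \<times> \<Omega>"
 shows "bdist T \<Omega> z <= fst z" "ball (snd z) (bdist T \<Omega> z) \<subseteq> \<Omega>"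
proof -
 let ?S = "{..T} \<times> (UNIV :: (real^3) set)" and ?A = "{0..T} \<times> \<Omega>"
 let ?F = "top_of_set ?S frontier_of ?A"
 obtain t x where zx: "z = (t, x)" "0 < t" "t <= T" "x \<in> \<Omega>" using z by auto
 have AS: "?A \<subseteq> ?S" by auto
 have cl: "top_of_set ?S closure_of ?A = ?S \<inter> closure ?A"
  using AS by (simp add: closure_of_subtopology inf_absorb2)
 have int: "top_of_set ?S interior_of ?A \<subseteq> ?A" by (rule interior_of_subset)
 have F: "w \<in> ?F" if "w \<in> closure ?A" "w \<in> ?S" "w \<notin> top_of_set ?S interior_of ?A" for w
  unfolding frontier_of_def cl using that by blast
 have d: "bdist T \<Omega> z <= dist z w" if "w \<in> ?F" for w
  unfolding bdist_def by (rule infdist_le[OF that])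
 have "(0, x) \<notin> top_of_set ?S interior_of ?A"
 proof
  assume "(0, x) \<in> top_of_set ?S interior_of ?A"
  moreover have "openin (top_of_set ?S) (top_of_set ?S interior_of ?A)" by (rule openin_interior_of)
  ultimately obtain e where e: "0 < e" "!!w. w \<in> ?S ==> dist w (0, x) < e ==> w \<in> top_of_set ?S interior_of ?A"
   unfolding openin_euclidean_subtopology_iff by blast
  have "(- e / 2, x) \<in> top_of_set ?S interior_of ?A"
   using e(1) T by (intro e(2)) (auto simp: dist_Pair_Pair)
  then show False using int e(1) by auto
 qed
 moreover have "(0, x) \<in> closure ?A" using zx T closure_subset[of ?A] by auto
 ultimately have "(0, x) \<in> ?F" using T by (intro F) auto
 from d[OF this] show "bdist T \<Omega> z <= fst z" using zx by (simp add: dist_Pair_Pair)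
 show "ball (snd z) (bdist T \<Omega> z) \<subseteq> \<Omega>"
 proof (rule ccontr)
  assume "\<not> ball (snd z) (bdist T \<Omega> z) \<subseteq> \<Omega>"
  then obtain y' where y': "y' \<in> ball (snd z) (bdist T \<Omega> z)" "y' \<notin> \<Omega>" by blast
  have x: "snd z = x" by (simp add: zx(1))
  note y' = y'[unfolded x]
  then have "0 < bdist T \<Omega> z" using order_le_less_trans[OF zero_le_dist[of x y']] by simp
  then have "x \<in> ball x (bdist T \<Omega> z) \<inter> \<Omega>" using zx(4) by (simp only: centre_in_ball Int_iff)
  then have "ball x (bdist T \<Omega> z) - \<Omega> ~= {}" "ball x (bdist T \<Omega> z) \<inter> \<Omega> ~= {}"
   using y' by blast+
  then obtain y where y: "y \<in> ball x (bdist T \<Omega> z)" "y \<in> frontier \<Omega>"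
   using connected_Int_frontier[OF connected_ball] by blast
  have "y \<notin> \<Omega>" using y(2) open_Omega by (auto simp: frontier_def interior_open)
  then have "(t, y) \<notin> top_of_set ?S interior_of ?A" using int by auto
  moreover have "(t, y) \<in> closure ?A"
   using y(2) zx by (auto simp: closure_Times frontier_def)
  ultimately have "(t, y) \<in> ?F" using zx by (intro F) auto
  from d[OF this] show False using y(1) zx by (simp add: dist_Pair_Pair)
 qed
qed

theorem (in solution) G_bound_small:
 assumes z: "z \<in> {0<..T} \<times> \<Omega>" and r: "0 < r" "r < small_radius data M (bdist T \<Omega> z)"
 shows "G_quant T \<Omega> u P r z <= ennreal (bound_G (level M 1))"
proof -
 define d where "d = bdist T \<Omega> z"
 have d: "0 < d" using r unfolding d_def small_radius_def by (auto split: if_splits)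
 define \<rho> where "\<rho> = min (d / 2) (sqrt (d / 2))"
 define N where "N = (LEAST N. start data \<rho> M / 2 ^ N <= 1)"
 have \<rho>: "0 < \<rho>" "\<rho> <= d / 2" using d by (auto simp: \<rho>_def)
 have "\<rho>^2 <= (sqrt (d / 2))^2" using \<rho>(1) by (intro power_mono) (auto simp: \<rho>_def)
 then have \<rho>2: "\<rho>^2 <= d / 2" using d by simp
 have rN: "r < (theta0 / 4) ^ N * \<rho> / 4" using r d unfolding small_radius_def d_def[symmetric] by (simp add: Let_def \<rho>_def N_def)
 obtain n where "start data \<rho> M < 2 ^ n" using real_arch_pow[of 2 "start data \<rho> M"] by auto
 then have "start data \<rho> M / 2 ^ n <= 1" by simp
 then have N1: "start data \<rho> M / 2 ^ N <= 1" unfolding N_def by (rule LeastI)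
 have b: "d <= fst z" "ball (snd z) d \<subseteq> \<Omega>" using bdist_interior[OF z] by (simp_all add: d_def)
 have Q: "pcyl \<rho> z \<subseteq> {0<..T} \<times> \<Omega>"
 proof
  fix w assume "w \<in> pcyl \<rho> z"
  then have "fst z - \<rho>^2 < fst w" "fst w < fst z" "dist (snd z) (snd w) < \<rho>" by (auto simp: pcyl_def)
  then have "0 < fst w" "fst w <= T" "snd w \<in> ball (snd z) d" using b(1) \<rho>(2) \<rho>2 d z by auto
  then show "w \<in> {0<..T} \<times> \<Omega>" using b(2) by (cases w) auto
 qed
 have "G_quant T \<Omega> u P r z <= ennreal (bound_G (level M (start data \<rho> M / 2 ^ N)))"
  by (rule G_small[OF \<rho>(1) Q r(1)]) (use rN in simp)
 also have "... <= ennreal (bound_G (level M 1))"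
 proof -
  have "level M (start data \<rho> M / 2 ^ N) <= level M 1"
   unfolding level_def using N1 by (intro mult_left_mono) auto
  then show ?thesis
   unfolding bound_G_def using KE_ge_1 by (intro ennreal_leI add_mono mult_left_mono) auto
 qed
 finally show ?thesis .
qed

section \<open>The energy measure\<close>

lemma energy_measureD:
 assumes "energy_measure T \<Omega> u \<E>" "open \<Omega>"
 shows "space \<E> = \<Omega>" "!!A. A \<in> sets borel ==> A \<subseteq> \<Omega> ==> A \<in> sets \<E>"
  "!!K. compact K ==> K \<subseteq> \<Omega> ==> emeasure \<E> K < \<infinity>"
  "!!f :: real^3 => real. continuous_on UNIV f ==> f \<in> borel_measurable \<E>"
proof -
 have s: "sets \<E> = sets (restrict_space borel \<Omega>)"
  using assms(1) by (simp add: energy_measure_def radon_measure_on_def)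
 show "space \<E> = \<Omega>" using assms(1) by (simp add: energy_measure_def radon_measure_on_def)
 show "A \<in> sets \<E>" if "A \<in> sets borel" "A \<subseteq> \<Omega>" for A
  unfolding s sets_restrict_space using that by (auto intro!: image_eqI[of _ _ A])
 show "emeasure \<E> K < \<infinity>" if "compact K" "K \<subseteq> \<Omega>" for K
  using assms(1) that unfolding energy_measure_def radon_measure_on_def by blast
 show "f \<in> borel_measurable \<E>" if "continuous_on UNIV f" for f :: "real^3 => real"
  using measurable_restrict_space1[OF borel_measurable_continuous_onI[OF that], of \<Omega>] by (simp add: measurable_cong_sets[OF s refl])
qed

context solution
begin

text \<open>By part (i) the energy in a ball at times close to \<open>T\<close> is at most a multiple of the radius;
 this bound passes to the weak limit through a cutoff function.\<close>

lemma energy_measure_ball: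
 assumes em: "energy_measure T \<Omega> u \<E>" and \<rho>: "0 < \<rho>" "\<rho>^2 <= T" "ball x \<rho> \<subseteq> \<Omega>" and r: "0 < r" "r <= \<rho> / 4"
 shows "emeasure \<E> (ball x r) <= ennreal (2 * bound1 data \<rho> M * r)"
proof -
 note E = energy_measureD[OF em open_Omega]
 define R where "R = 2 * r"
 have R: "0 < R" "R <= \<rho> / 2" using r by (simp_all add: R_def)
 have Q: "pcyl \<rho> (T, x) \<subseteq> {0<..T} \<times> \<Omega>" using \<rho> by (auto simp: pcyl_def)
 have sub: "pcyl (2 * R) (T, x) \<subseteq> pcyl \<rho> (T, x)" using R by (intro pcyl_mono) auto
 have G: "G_quant T \<Omega> u P R (T, x) <= ennreal (bound1 data \<rho> M)"
  by (rule G_bound_interior[OF \<rho>(1) R(1) sub Q])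
 have b: "0 <= bound1 data \<rho> M" using bound1_pos[of data \<rho> M] by simp
 have bR: "0 <= bound1 data \<rho> M * R" using b R by simp
 have sq: "sq_norm (ball x R) (u s) <= ennreal (bound1 data \<rho> M * R)" if s: "T - R^2 <= s" "s < T" for s
 proof -
  have "ennreal (1 / R) * sq_norm (ball x R) (u s) <= (SUP s\<in>{T - R^2..<T}. ennreal (1 / R) * sq_norm (ball x R) (u s))"
   using s by (intro SUP_upper) auto
  also have "... <= G_quant T \<Omega> u P R (T, x)" unfolding G_quant_def fst_conv snd_conv add.assoc by simp
  also note G
  finally have "sq_norm (ball x R) (u s) <= ennreal (bound1 data \<rho> M / (1 / R))"
   using R b by (intro ennreal_le_divide_left) auto
  then show ?thesis by simp
 qed
 define f where "f y = max 0 (min 1 (3 - 4 * dist x y / R))" for y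
 have fc: "continuous_on UNIV f" unfolding f_def using R by (intro continuous_intros) auto
 have f01: "0 <= f y" "f y <= 1" for y by (simp_all add: f_def)
 have fout: "f y = 0" if "y \<notin> cball x (3 / 4 * R)" for y
  using that R by (simp add: f_def field_simps max_def min_def)
 have fin: "f y = 1" if "y \<in> ball x r" for y
  using that R by (simp add: f_def R_def field_simps min_def)
 have supp: "support f \<subseteq> cball x (3 / 4 * R)"
  unfolding support_def using fout by (intro closure_minimal) (blast, simp)
 have cb: "cball x (3 / 4 * R) \<subseteq> ball x R" "ball x R \<subseteq> \<Omega>" using R \<rho>(3) by (auto simp: subset_iff)
 have cs: "compact (support f)"
  using bounded_subset[OF bounded_cball supp] by (simp add: compact_eq_bounded_closed) (simp add: support_def)
 obtain t where t: "\<forall>k. t k \<in> {0..<T}" "t \<longlonglongrightarrow> T"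
  and lim: "\<forall>f :: real^3 => real. continuous_on UNIV f \<and> compact (support f) \<and> support f \<subseteq> \<Omega> -->
   (%k. LINT y:\<Omega>|lebesgue. f y * (norm (u (t k) y))^2) \<longlonglongrightarrow> (LINT y|\<E>. f y)"
  using em[unfolded energy_measure_def, THEN conjunct2] by (elim exE conjE)
 have "(LINT y|\<E>. f y) <= bound1 data \<rho> M * R"
 proof (rule tendsto_upperbound)
  show "(%k. LINT y:\<Omega>|lebesgue. f y * (norm (u (t k) y))^2) \<longlonglongrightarrow> (LINT y|\<E>. f y)"
   by (intro lim[rule_format] conjI fc cs order_trans[OF supp] order_trans[OF cb])
  have "0 < R^2" using R by simp
  then have "T - R^2 < T" by linarith
  then have "\<forall>\<^sub>F k in sequentially. T - R^2 < t k" by (rule order_tendstoD(1)[OF t(2)])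
  then show "\<forall>\<^sub>F k in sequentially. (LINT y:\<Omega>|lebesgue. f y * (norm (u (t k) y))^2) <= bound1 data \<rho> M * R"
  proof eventually_elim
   case (elim k)
   have tk: "t k < T" using t(1) by simp
   show ?case
    unfolding set_lebesgue_integral_def
   proof (rule integral_le_of_nn[OF order_trans[OF nn_integral_mono sq[OF less_imp_le[OF elim] tk, unfolded sq_norm_def]] bR])
    fix y
    have "f y * (norm (u (t k) y))^2 <= 1 * (norm (u (t k) y))^2" using f01 by (intro mult_right_mono) auto
    moreover have "f y = 0" if "y \<notin> ball x R" using fout cb(1) that by blast
    ultimately show "ennreal \<bar>indicat_real \<Omega> y *\<^sub>R (f y * (norm (u (t k) y))^2)\<bar> <= ennreal ((norm (u (t k) y))^2) * indicator (ball x R) y"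
     using f01(1)[of y] by (cases "y \<in> ball x R") (auto simp: indicator_def abs_mult intro: ennreal_leI)
   qed
  qed
 qed simp
 moreover have "emeasure \<E> (ball x r) <= ennreal (LINT y|\<E>. f y)"
 proof -
  have fm: "f \<in> borel_measurable \<E>" by (rule E(4)[OF fc])
  have cE: "cball x (3 / 4 * R) \<in> sets \<E>" "ball x r \<in> sets \<E>"
   using cb r by (auto intro!: E(2) simp: R_def subset_iff)
  have "(\<integral>\<^sup>+y. ennreal (f y) \<partial>\<E>) <= (\<integral>\<^sup>+y. indicator (cball x (3 / 4 * R)) y \<partial>\<E>)"
  proof (rule nn_integral_mono)
   fix y
   show "ennreal (f y) <= indicator (cball x (3 / 4 * R)) y"
    using fout[of y] f01(2)[of y] by (cases "y \<in> cball x (3 / 4 * R)") (simp_all add: ennreal_le_1)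
  qed
  also have "... = emeasure \<E> (cball x (3 / 4 * R))" using cE by simp
  also have "... < \<infinity>" using cb by (intro E(3)) auto
  finally have "integrable \<E> f" using fm f01 by (intro integrableI_bounded) auto
  then have e: "(\<integral>\<^sup>+y. ennreal (f y) \<partial>\<E>) = ennreal (LINT y|\<E>. f y)" using f01 by (intro nn_integral_eq_integral) auto
  have "emeasure \<E> (ball x r) = (\<integral>\<^sup>+y. indicator (ball x r) y \<partial>\<E>)" using cE by simp
  also have "... <= (\<integral>\<^sup>+y. ennreal (f y) \<partial>\<E>)"
  proof (rule nn_integral_mono)
   fix y show "indicator (ball x r) y <= ennreal (f y)" using fin[of y] by (cases "y \<in> ball x r") auto
  qed
  finally show ?thesis unfolding e .
 qed
 ultimately show ?thesis
  by (auto simp: R_def mult_ac elim!: order_trans intro!: ennreal_leI)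
qed

text \<open>From \<open>\<E>(B\<^sub>r) <= C r\<close>, dividing logarithms by \<open>ln r < 0\<close>; the constant contributes \<open>ln C / ln r\<close>, which tends to 0.\<close>

lemma lower_local_dim_ge_1:
 assumes em: "energy_measure T \<Omega> u \<E>" and x: "x \<in> \<Omega>"
 shows "1 <= lower_local_dim \<E> x"
proof -
 obtain e where e: "0 < e" "ball x e \<subseteq> \<Omega>" using open_Omega x open_contains_ball by blast
 define \<rho> where "\<rho> = min e (sqrt T)"
 have \<rho>: "0 < \<rho>" "ball x \<rho> \<subseteq> \<Omega>" using e T by (auto simp: \<rho>_def)
 have "\<rho>^2 <= (sqrt T)^2" using \<rho>(1) by (intro power_mono) (auto simp: \<rho>_def)
 then have \<rho>T: "\<rho>^2 <= T" using T by simp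
 define C where "C = 2 * bound1 data \<rho> M"
 have C: "0 < C" using bound1_pos by (simp add: C_def)
 have le: "ereal (1 + ln C / ln r) <= eln (emeasure \<E> (ball x r)) / ereal (ln r)" if r: "0 < r" "r < min 1 (\<rho> / 4)" for r
 proof -
  have E: "emeasure \<E> (ball x r) <= ennreal (C * r)"
   using energy_measure_ball[OF em \<rho>(1) \<rho>T \<rho>(2), of r] r by (simp add: C_def)
  have l: "ln r < 0" using r by simp
  show ?thesis
  proof (cases "emeasure \<E> (ball x r) = 0")
   case True
   have "(-\<infinity>) / ereal (ln r) = \<infinity>" using l by (simp add: divide_ereal_def)
   then show ?thesis using True by (simp add: eln_def)
  next
   case False
   have fin: "emeasure \<E> (ball x r) ~= \<infinity>" using E by (auto simp: top_unique)
   define m where "m = enn2real (emeasure \<E> (ball x r))"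
   have em': "emeasure \<E> (ball x r) = ennreal m" using fin by (simp add: m_def less_top)
   have m: "0 < m" using False fin by (simp add: m_def enn2real_positive_iff zero_less_iff_neq_zero less_top)
   have "m <= C * r" using E C r unfolding em' by (simp add: ennreal_le_iff)
   then have "ln m <= ln (C * r)" using m by simp
   also have "... = ln C + ln r" using C r by (simp add: ln_mult)
   finally have "(ln C + ln r) / ln r <= ln m / ln r" using l by (simp add: divide_right_mono_neg)
   moreover have "(ln C + ln r) / ln r = 1 + ln C / ln r" using l by (simp add: add_divide_distrib)
   ultimately have "1 + ln C / ln r <= ln m / ln r" by (simp only:)
   then show ?thesis using False fin l by (simp add: eln_def m_def)
  qed
 qed
 have "((%r. 1 + ln C / ln r) \<longlongrightarrow> 1 + 0) (at_right 0)"
  by (intro tendsto_add tendsto_const tendsto_divide_0[OF tendsto_const] filterlim_at_bot_imp_at_infinity ln_at_0)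
 then have "((%r. ereal (1 + ln C / ln r)) \<longlongrightarrow> 1) (at_right 0)" by (simp add: one_ereal_def)
 then have "1 = Liminf (at_right 0) (%r. ereal (1 + ln C / ln r))"
  by (intro lim_imp_Liminf[symmetric]) auto
 also have "... <= lower_local_dim \<E> x"
  unfolding lower_local_dim_def
 proof (rule Liminf_mono)
  have "0 < min 1 (\<rho> / 4)" using \<rho> by simp
  then show "\<forall>\<^sub>F r in at_right 0. ereal (1 + ln C / ln r) <= eln (emeasure \<E> (ball x r)) / ereal (ln r)"
   using le unfolding eventually_at_right_field by blast
 qed
 finally show ?thesis .
qed

text \<open>The mass distribution principle: a set of small diameter \<open>d\<close> has measure at most a multiple of
 \<open>d\<close>, hence of \<open>d\<^sup>s\<close>, so the sums of \<open>d\<^sup>s\<close> over the covers of a set of positive measure are bounded below.\<close>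

lemma hausdorff_measure_pos:
 assumes em: "energy_measure T \<Omega> u \<E>" and S: "compact S" "S \<subseteq> \<Omega>" "0 < emeasure \<E> S" and s: "0 < s" "s < 1"
 shows "0 < hausdorff_measure s S"
proof -
 note E = energy_measureD[OF em open_Omega]
 obtain e where e: "0 < e" "(\<Union>x\<in>S. ball x e) \<subseteq> \<Omega>"
  by (rule compact_subset_open_imp_ball_epsilon_subset[OF S(1) open_Omega S(2)])
 define \<rho> where "\<rho> = min e (sqrt T)"
 have \<rho>: "0 < \<rho>" "\<rho> <= e" using e T by (auto simp: \<rho>_def)
 have "\<rho>^2 <= (sqrt T)^2" using \<rho>(1) by (intro power_mono) (auto simp: \<rho>_def)
 then have \<rho>T: "\<rho>^2 <= T" using T by simp
 define C where "C = 2 * bound1 data \<rho> M"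
 have C: "0 < C" using bound1_pos by (simp add: C_def)
 have \<rho>\<Omega>: "ball x \<rho> \<subseteq> \<Omega>" if "x \<in> S" for x using e(2) that subset_ball[OF \<rho>(2), of x] by blast
 have EB: "emeasure \<E> (ball x r) <= ennreal (C * r)" if "x \<in> S" "0 < r" "r <= \<rho> / 4" for x r
  using energy_measure_ball[OF em \<rho>(1) \<rho>T \<rho>\<Omega>[OF that(1)] that(2,3)] by (simp add: C_def)
 have Bm: "ball x r \<in> sets \<E>" if "x \<in> S" "r <= \<rho>" for x r
  using \<rho>\<Omega>[OF that(1)] subset_ball[OF that(2), of x] by (intro E(2)) auto
 have point: "emeasure \<E> {x} = 0" if x: "x \<in> S" for x
 proof -
  have small: "emeasure \<E> {x} <= 0 + ennreal q" if "0 < q" for q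
  proof -
   define r where "r = min (q / C) (\<rho> / 4)"
   have r: "0 < r" "r <= \<rho> / 4" "C * r <= q" using that C \<rho> by (auto simp: r_def min_def field_simps)
   have "emeasure \<E> {x} <= emeasure \<E> (ball x r)" using r \<rho> by (intro emeasure_mono Bm x) auto
   also have "... <= ennreal (C * r)" by (rule EB[OF x r(1,2)])
   also have "... <= ennreal q" by (rule ennreal_leI[OF r(3)])
   finally show ?thesis by simp
  qed
  have "emeasure \<E> {x} <= 0" by (rule ennreal_le_epsilon) (rule small)
  then show ?thesis by simp
 qed
 define \<delta> where "\<delta> = min 1 (\<rho> / 8)"
 have \<delta>: "0 < \<delta>" "\<delta> <= 1" "\<delta> <= \<rho> / 8" using \<rho> by (auto simp: \<delta>_def)
 have cover: "ennreal (1 / (2 * C)) * emeasure \<E> S <= (\<Sum>i. ennreal (diameter (V i) powr s))"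
  if V: "S \<subseteq> (\<Union>i. V i)" "!!i. bounded (V i) \<and> diameter (V i) <= \<delta>" for V :: "nat => (real^3) set"
 proof -
  define d where "d i = diameter (V i)" for i
  have d: "0 <= d i" "d i <= \<delta>" for i using V(2)[of i] diameter_ge_0[of "V i"] by (auto simp: d_def)
  define c where "c i = (SOME x. x \<in> V i \<inter> S)" for i
  have c: "c i \<in> V i" "c i \<in> S" if "V i \<inter> S ~= {}" for i
   using someI_ex[of "%x. x \<in> V i \<inter> S"] that by (auto simp: c_def)
  define W where "W i = (if V i \<inter> S = {} then {} else if d i = 0 then {c i} else ball (c i) (2 * d i))" for i
  have Wm: "W i \<in> sets \<E>" for i
  proof -
   have "2 * d i <= \<rho>" using d[of i] \<delta>(3) \<rho>(1) by linarith
   then show ?thesis using Bm c[of i] S(2) by (auto simp: W_def intro!: E(2))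
  qed
  have SW: "S \<subseteq> (\<Union>i. W i)"
  proof
   fix y assume y: "y \<in> S"
   then obtain i where i: "y \<in> V i" using V(1) by auto
   then have ne: "V i \<inter> S ~= {}" using y by auto
   have "dist (c i) y <= d i" unfolding d_def using V(2)[of i] c(1)[OF ne] i by (intro diameter_bounded_bound) auto
   then have "y \<in> W i" using ne d(1)[of i] by (auto simp: W_def)
   then show "y \<in> (\<Union>i. W i)" by blast
  qed
  have EW: "emeasure \<E> (W i) <= ennreal (2 * C) * ennreal (d i powr s)" for i
  proof (cases "V i \<inter> S = {} \<or> d i = 0")
   case True
   then show ?thesis using point c(2)[of i] by (auto simp: W_def)
  next
   case False
   then have di: "0 < d i" "V i \<inter> S ~= {}" using d(1)[of i] by auto
   have "emeasure \<E> (W i) <= ennreal (C * (2 * d i))"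
    using False di d(2)[of i] \<delta>(3) by (simp add: W_def) (intro EB c(2), auto)
   also have "C * (2 * d i) <= 2 * C * d i powr s"
   proof -
    have "d i powr 1 <= d i powr s" using di d(2)[of i] \<delta>(2) s by (intro powr_mono') auto
    then show ?thesis using C di by simp
   qed
   then have "ennreal (C * (2 * d i)) <= ennreal (2 * C) * ennreal (d i powr s)"
    using C by (simp add: ennreal_mult[symmetric] ennreal_leI)
   finally show ?thesis .
  qed
  have Sm: "S \<in> sets \<E>" using S by (intro E(2)) (auto intro: borel_compact)
  have "emeasure \<E> S <= emeasure \<E> (\<Union>i. W i)" using SW Wm by (intro emeasure_mono) auto
  also have "... <= (\<Sum>i. emeasure \<E> (W i))" using Wm by (intro emeasure_subadditive_countably) auto
  also have "... <= (\<Sum>i. ennreal (2 * C) * ennreal (d i powr s))" by (intro suminf_le EW summableI)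
  also have "... = ennreal (2 * C) * (\<Sum>i. ennreal (d i powr s))" by simp
  finally have "ennreal (1 / (2 * C)) * emeasure \<E> S <= ennreal (1 / (2 * C)) * (ennreal (2 * C) * (\<Sum>i. ennreal (d i powr s)))"
   by (rule mult_left_mono) simp
  also have "... = (\<Sum>i. ennreal (d i powr s))" using C by (simp add: mult.assoc[symmetric] ennreal_mult[symmetric])
  finally show ?thesis by (simp add: d_def)
 qed
 have "0 < ennreal (1 / (2 * C)) * emeasure \<E> S" using C S(3) by (simp add: ennreal_zero_less_mult_iff)
 also have "... <= hausdorff_premeasure s \<delta> S"
  unfolding hausdorff_premeasure_def using cover by (intro INF_greatest) auto
 also have "... <= hausdorff_measure s S" unfolding hausdorff_measure_def using \<delta>(1) by (intro SUP_upper) auto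
 finally show ?thesis .
qed

lemma concentration_dim_ge_1:
 assumes em: "energy_measure T \<Omega> u \<E>"
 shows "1 <= concentration_dim \<Omega> \<E>"
proof -
 have "1 <= hausdorff_dim S" if S: "compact S" "S \<subseteq> \<Omega>" "0 < emeasure \<E> S" for S
  unfolding hausdorff_dim_def
 proof (rule INF_greatest)
  fix s assume "s \<in> {s. 0 < s \<and> hausdorff_measure s S = 0}"
  then have "0 < s" "\<not> s < 1" using hausdorff_measure_pos[OF em S, of s] by auto
  then show "1 <= ereal s" by (simp add: one_ereal_def)
 qed
 then show ?thesis unfolding concentration_dim_def Let_def by (auto intro!: INF_greatest)
qed

end

theorem theorem1p1:
  shows "\<exists>(C1 :: real \<Rightarrow> real \<Rightarrow> real \<Rightarrow> real) (C2 :: real \<Rightarrow> real) (r0 :: real \<Rightarrow> real \<Rightarrow> real \<Rightarrow> real).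
    (\<forall>K \<rho> M. 0 < C1 K \<rho> M) \<and> (\<forall>M. 0 < C2 M) \<and> (\<forall>K M d. 0 < d \<longrightarrow> 0 < r0 K M d) \<and>
    (\<forall>(\<Omega> :: (real^3) set) (T :: real) (u :: real \<Rightarrow> real^3 \<Rightarrow> real^3) (P :: real \<Rightarrow> real^3 \<Rightarrow> real)
       (M :: real).
       domain3 \<Omega> \<and> 0 < T \<and> suitable_weak_solution T \<Omega> u P \<and>
       0 \<le> M \<and> weakL2_bmo_norm T \<Omega> u = ennreal M \<longrightarrow>
         (\<forall>\<rho> r z. 0 < \<rho> \<and> 0 < r \<and> pcyl (2 * r) z \<subseteq> pcyl \<rho> z \<and> pcyl \<rho> z \<subseteq> {0<..T} \<times> \<Omega> \<longrightarrow>
            G_quant T \<Omega> u P r z \<le> ennreal (C1 (data_size T \<Omega> u P) \<rho> M)) \<and>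
         (\<forall>z\<in>{0<..T} \<times> \<Omega>. \<forall>r. 0 < r \<and> r < r0 (data_size T \<Omega> u P) M (bdist T \<Omega> z) \<longrightarrow>
            G_quant T \<Omega> u P r z \<le> ennreal (C2 M)) \<and>
         (\<forall>\<E>. energy_measure T \<Omega> u \<E> \<longrightarrow>
            (\<forall>x\<in>\<Omega>. 1 \<le> lower_local_dim \<E> x) \<and> 1 \<le> concentration_dim \<Omega> \<E>))"
proof (rule exI[of _ bound1], rule exI[of _ "%M. bound_G (level M 1)"], rule exI[of _ small_radius],
  intro conjI allI impI ballI; (elim conjE)?)
 show "0 < bound1 K \<rho> M" for K \<rho> M by (rule bound1_pos)
 show "0 < bound_G (level M 1)" for M by (intro bound_G_pos level_nonneg) simp
 show "0 < small_radius K M d" if "0 < d" for K M d using that by (rule small_radius_pos)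
next
 fix \<Omega> :: "(real^3) set" and T u P M
 assume "domain3 \<Omega>" "0 < T" "suitable_weak_solution T \<Omega> u P" "0 <= M" "weakL2_bmo_norm T \<Omega> u = ennreal M"
 then interpret solution T M \<Omega> u P by unfold_locales
 show "G_quant T \<Omega> u P r z <= ennreal (bound1 (data_size T \<Omega> u P) \<rho> M)"
  if "0 < \<rho>" "0 < r" "pcyl (2 * r) z \<subseteq> pcyl \<rho> z" "pcyl \<rho> z \<subseteq> {0<..T} \<times> \<Omega>" for \<rho> r z
  using that by (rule G_bound_interior)
 show "G_quant T \<Omega> u P r z <= ennreal (bound_G (level M 1))"
  if "z \<in> {0<..T} \<times> \<Omega>" "0 < r" "r < small_radius (data_size T \<Omega> u P) M (bdist T \<Omega> z)" for z r
  using that by (rule G_bound_small)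
 show "1 <= lower_local_dim \<E> x" if "energy_measure T \<Omega> u \<E>" "x \<in> \<Omega>" for \<E> x
  using that by (rule lower_local_dim_ge_1)
 show "1 <= concentration_dim \<Omega> \<E>" if "energy_measure T \<Omega> u \<E>" for \<E>
  using that by (rule concentration_dim_ge_1)
qed

end
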